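(* Let $f\colon X\to Y$ be a continuous map between finite topological spaces. The following conditions are equivalent: (1) $f$ is h-open (homologically open). (2) $f$ satisfies the base change theorem for homology: for any abelian data $F$ on $X$, any $y\in Y$ and any $i\ge 0$, the base change morphism $$H_i(f^{-1}(y),F_{\vert f^{-1}(y)})\to (L_if_!F)_y$$ is an isomorphism.
   Context: A finite topological space $X$ is regarded as a preordered set: $p\le q$ iff $\overline{\{p\}}\subseteq\overline{\{q\}}$. Put $U_p=\{q: q\ge p\}$ (smallest open set containing $p$) and $C_p=\{q: q\le p\}$ (closure of $p$). Continuous maps are the monotone maps. An abelian data $F$ on $X$ is a functor from the preorder $X$ to abelian groups: groups $F_p$ and homomorphisms $r_{pq}\colon F_p\to F_q$ for $p\le q$. For a subspace $S\subseteq X$, $F_{\vert S}$ is the restricted functor, $\Gamma(S,F)=\varprojlim_{s\in S}F_s$ and $L(S,F)=\varinjlim_{s\in S}F_s$ (colimit over the preorder $S$). $H^i(S,-)$ are the right derived functors of $\Gamma(S,-)$ and $H_i(S,-)$ are the left derived functors of $L(S,-)$, on abelian data on $S$. For $f\colon X\to Y$ continuous, $f_!F$ is the abelian data on $Y$ with $(f_!F)_y=L(f^{-1}(C_y),F)$, $L_if_!$ are the left derived functors of $f_!$, and $(L_if_!F)_y=H_i(f^{-1}(C_y),F)$. The base change morphism is the map $H_i(f^{-1}(y),F_{\vert f^{-1}(y)})\to H_i(f^{-1}(C_y),F_{\vert f^{-1}(C_y)})$ induced by the inclusion $f^{-1}(y)\subseteq f^{-1}(C_y)$. A finite space $X$ is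 homologically trivial if $H_i(X,\mathbb{Z})=0$ for $i>0$ and $H_0(X,\mathbb{Z})=\mathbb{Z}$ (constant coefficients); equivalently $H^i(X,\mathbb{Z})=0$ for $i>0$ and $H^0(X,\mathbb{Z})=\mathbb{Z}$. $f\colon X\to Y$ is h-open if $f$ is open and, for any $x\in X$, the induced map $f_{\vert U_x}\colon U_x\to U_{f(x)}$ has homologically trivial fibers: for every $y\in U_{f(x)}$ the space $U_x\cap f^{-1}(y)$ is homologically trivial. *)

theory Defs
  imports "HOL-Analysis.Abstract_Topology" "HOL-Algebra.Product_Groups"
begin

text \<open>
  With this orientation the open sets are the up-sets and \<open>down_set X p\<close> is the closure of \<open>p\<close>.
\<close>

definition spec_le :: "'a topology \<Rightarrow> 'a \<Rightarrow> 'a \<Rightarrow> bool" where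
  "spec_le X p q \<longleftrightarrow>
     p \<in> topspace X \<and> q \<in> topspace X \<and> X closure_of {p} \<subseteq> X closure_of {q}"

definition up_set :: "'a topology \<Rightarrow> 'a \<Rightarrow> 'a set" where
  "up_set X p = {q. spec_le X p q}"

definition down_set :: "'a topology \<Rightarrow> 'a \<Rightarrow> 'a set" where
  "down_set X p = {q. spec_le X q p}"

abbreviation preimage_space :: "'a topology \<Rightarrow> ('a \<Rightarrow> 'b) \<Rightarrow> 'b set \<Rightarrow> 'a topology" where
  "preimage_space X f B \<equiv> subtopology X {x \<in> topspace X. f x \<in> B}"

text \<open>
  Only the values at points of the space (and on comparable pairs) are relevant, so the restriction
  of an abelian data \<open>F\<close> on \<open>X\<close> to a subspace is \<open>F\<close> itself, regarded as data on
  \<^term>\<open>subtopology X S\<close>.  Groups are written multiplicatively, as in HOL-Algebra.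
\<close>

record ('a, 'g) ab_data =
  stalk :: "'a \<Rightarrow> 'g monoid"
  trans_map :: "'a \<Rightarrow> 'a \<Rightarrow> 'g \<Rightarrow> 'g"

definition abelian_data :: "'a topology \<Rightarrow> ('a, 'g) ab_data \<Rightarrow> bool" where
  "abelian_data X F \<longleftrightarrow>
     (\<forall>p \<in> topspace X. comm_group (stalk F p)) \<and>
     (\<forall>p q. spec_le X p q \<longrightarrow> trans_map F p q \<in> hom (stalk F p) (stalk F q)) \<and>
     (\<forall>p \<in> topspace X. \<forall>a \<in> carrier (stalk F p). trans_map F p p a = a) \<and>
     (\<forall>p q r. spec_le X p q \<longrightarrow> spec_le X q r \<longrightarrow>
        (\<forall>a \<in> carrier (stalk F p). trans_map F q r (trans_map F p q a) = trans_map F p r a))"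

definition data_hom ::
  "'a topology \<Rightarrow> ('a, 'g) ab_data \<Rightarrow> ('a, 'h) ab_data \<Rightarrow> ('a \<Rightarrow> 'g \<Rightarrow> 'h) set" where
  "data_hom X F G =
     {\<phi>. (\<forall>p \<in> topspace X. \<phi> p \<in> hom (stalk F p) (stalk G p)) \<and>
         (\<forall>p q. spec_le X p q \<longrightarrow>
            (\<forall>a \<in> carrier (stalk F p). \<phi> q (trans_map F p q a) = trans_map G p q (\<phi> p a)))}"

text \<open>Epimorphisms of abelian data are exactly the pointwise surjective morphisms.\<close>

definition data_epi ::
  "'a topology \<Rightarrow> ('a, 'g) ab_data \<Rightarrow> ('a, 'h) ab_data \<Rightarrow> ('a \<Rightarrow> 'g \<Rightarrow> 'h) \<Rightarrow> bool" where
  "data_epi X F G \<phi> \<longleftrightarrow>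
     \<phi> \<in> data_hom X F G \<and>
     (\<forall>p \<in> topspace X. \<phi> p ` carrier (stalk F p) = carrier (stalk G p))"

definition const_int_data :: "('a, int) ab_data" where
  "const_int_data = \<lparr>stalk = (\<lambda>_. integer_group), trans_map = (\<lambda>_ _ a. a)\<rparr>"

text \<open>
  A homomorphism \<open>h\<close> into \<open>H\<close> acts on cosets by sending the coset of \<open>x\<close> to the coset \<open>N h(x)\<close>.
\<close>

definition coset_map :: "('h, 'm) monoid_scheme \<Rightarrow> 'h set \<Rightarrow> ('g \<Rightarrow> 'h) \<Rightarrow> 'g set \<Rightarrow> 'h set" where
  "coset_map H N h c = N <#>\<^bsub>H\<^esub> (h ` c)"

definition sum_incl :: "'a topology \<Rightarrow> ('a, 'g) ab_data \<Rightarrow> 'a \<Rightarrow> 'g \<Rightarrow> ('a \<Rightarrow> 'g)" where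
  "sum_incl X F p a = (\<lambda>i \<in> topspace X. if i = p then a else \<one>\<^bsub>stalk F i\<^esub>)"

abbreviation data_sum :: "'a topology \<Rightarrow> ('a, 'g) ab_data \<Rightarrow> ('a \<Rightarrow> 'g) monoid" where
  "data_sum X F \<equiv> sum_group (topspace X) (stalk F)"

definition colim_relations :: "'a topology \<Rightarrow> ('a, 'g) ab_data \<Rightarrow> ('a \<Rightarrow> 'g) set" where
  "colim_relations X F =
     generate (data_sum X F)
       {sum_incl X F q (trans_map F p q a)
          \<otimes>\<^bsub>data_sum X F\<^esub> inv\<^bsub>data_sum X F\<^esub> (sum_incl X F p a) | p q a.
          spec_le X p q \<and> a \<in> carrier (stalk F p)}"

definition colim :: "'a topology \<Rightarrow> ('a, 'g) ab_data \<Rightarrow> ('a \<Rightarrow> 'g) set monoid" where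
  "colim X F = data_sum X F Mod colim_relations X F"

text \<open>
  The map \<open>L(S, F) \<rightarrow> L(T, G)\<close> induced by a morphism from \<open>F\<close> to the restriction of \<open>G\<close> to \<open>S\<close>,
  where \<open>S\<close> is a subspace of \<open>T\<close>.
\<close>

definition colim_map ::
  "'a topology \<Rightarrow> ('a, 'g) ab_data \<Rightarrow> 'a topology \<Rightarrow> ('a, 'h) ab_data \<Rightarrow> ('a \<Rightarrow> 'g \<Rightarrow> 'h)
     \<Rightarrow> ('a \<Rightarrow> 'g) set \<Rightarrow> ('a \<Rightarrow> 'h) set" where
  "colim_map S F T G \<phi> =
     coset_map (data_sum T G) (colim_relations T G)
       (\<lambda>x. \<lambda>i \<in> topspace T. if i \<in> topspace S then \<phi> i (x i) else \<one>\<^bsub>stalk G i\<^esub>)"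

text \<open>Complexes are indexed by \<open>n \<ge> 0\<close>, with \<open>d n\<close> going from \<open>C (n + 1)\<close> to \<open>C n\<close>.\<close>

definition cycles :: "(nat \<Rightarrow> 'g monoid) \<Rightarrow> (nat \<Rightarrow> 'g \<Rightarrow> 'g) \<Rightarrow> nat \<Rightarrow> 'g set" where
  "cycles C d n =
     (case n of 0 \<Rightarrow> carrier (C 0) | Suc m \<Rightarrow> kernel (C (Suc m)) (C m) (d m))"

definition boundaries :: "(nat \<Rightarrow> 'g monoid) \<Rightarrow> (nat \<Rightarrow> 'g \<Rightarrow> 'g) \<Rightarrow> nat \<Rightarrow> 'g set" where
  "boundaries C d n = d n ` carrier (C (Suc n))"

definition chain_homology ::
  "(nat \<Rightarrow> 'g monoid) \<Rightarrow> (nat \<Rightarrow> 'g \<Rightarrow> 'g) \<Rightarrow> nat \<Rightarrow> 'g set monoid" where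
  "chain_homology C d n = (C n)\<lparr>carrier := cycles C d n\<rparr> Mod boundaries C d n"

definition chain_homology_map ::
  "(nat \<Rightarrow> 'h monoid) \<Rightarrow> (nat \<Rightarrow> 'h \<Rightarrow> 'h) \<Rightarrow> (nat \<Rightarrow> 'g \<Rightarrow> 'h) \<Rightarrow> nat \<Rightarrow> 'g set \<Rightarrow> 'h set" where
  "chain_homology_map D d h n = coset_map (D n) (boundaries D d n) (h n)"

text \<open>
  Everything takes place in the category of abelian data whose groups have carriers in a fixed type
  \<open>'g\<close>.  When \<open>'g\<close> is infinite and the space is finite, this abelian category has enough projectives,
  and they are the projectives of the category of all abelian data (direct summands of free ones).
  Hence left derived functors computed in it are the usual ones; for finite \<open>'g\<close> the definitions
  below are not meaningful.
\<close>

definition projective_data :: "'a topology \<Rightarrow> ('a, 'g) ab_data \<Rightarrow> bool" where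
  "projective_data X P \<longleftrightarrow>
     abelian_data X P \<and>
     (\<forall>(G :: ('a, 'g) ab_data) (H :: ('a, 'g) ab_data) \<pi> \<phi>.
        abelian_data X G \<and> abelian_data X H \<and> data_epi X G H \<pi> \<and> \<phi> \<in> data_hom X P H \<longrightarrow>
        (\<exists>\<psi> \<in> data_hom X P G.
           \<forall>p \<in> topspace X. \<forall>a \<in> carrier (stalk P p). \<pi> p (\<psi> p a) = \<phi> p a))"

record ('a, 'g) resolution =
  res_obj :: "nat \<Rightarrow> ('a, 'g) ab_data"
  res_diff :: "nat \<Rightarrow> 'a \<Rightarrow> 'g \<Rightarrow> 'g"
  res_aug :: "'a \<Rightarrow> 'g \<Rightarrow> 'g"

definition projective_resolution ::
  "'a topology \<Rightarrow> ('a, 'g) ab_data \<Rightarrow> ('a, 'g) resolution \<Rightarrow> bool" where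
  "projective_resolution X F R \<longleftrightarrow>
     (\<forall>n. projective_data X (res_obj R n)) \<and>
     (\<forall>n. res_diff R n \<in> data_hom X (res_obj R (Suc n)) (res_obj R n)) \<and>
     data_epi X (res_obj R 0) F (res_aug R) \<and>
     (\<forall>p \<in> topspace X.
        res_diff R 0 p ` carrier (stalk (res_obj R 1) p)
          = kernel (stalk (res_obj R 0) p) (stalk F p) (res_aug R p)) \<and>
     (\<forall>n. \<forall>p \<in> topspace X.
        res_diff R (Suc n) p ` carrier (stalk (res_obj R (Suc (Suc n))) p)
          = kernel (stalk (res_obj R (Suc n)) p) (stalk (res_obj R n) p) (res_diff R n p))"

definition proj_res :: "'a topology \<Rightarrow> ('a, 'g) ab_data \<Rightarrow> ('a, 'g) resolution" where
  "proj_res X F = (SOME R. projective_resolution X F R)"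

text \<open>
  Here \<open>R\<close> resolves the restriction to \<open>S\<close> of the data resolved by \<open>R'\<close> on a larger space; \<open>\<phi>\<close> is a
  chain map from \<open>R\<close> to the restriction of \<open>R'\<close> over the identity of the resolved data.  It exists
  and is unique up to homotopy.
\<close>

definition comparison_map ::
  "'a topology \<Rightarrow> ('a, 'g) resolution \<Rightarrow> ('a, 'g) resolution \<Rightarrow> (nat \<Rightarrow> 'a \<Rightarrow> 'g \<Rightarrow> 'g) \<Rightarrow> bool" where
  "comparison_map S R R' \<phi> \<longleftrightarrow>
     (\<forall>n. \<phi> n \<in> data_hom S (res_obj R n) (res_obj R' n)) \<and>
     (\<forall>p \<in> topspace S. \<forall>a \<in> carrier (stalk (res_obj R 0) p).
        res_aug R' p (\<phi> 0 p a) = res_aug R p a) \<and>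
     (\<forall>n. \<forall>p \<in> topspace S. \<forall>a \<in> carrier (stalk (res_obj R (Suc n)) p).
        res_diff R' n p (\<phi> (Suc n) p a) = \<phi> n p (res_diff R n p a))"

definition colim_cplx :: "'a topology \<Rightarrow> ('a, 'g) resolution \<Rightarrow> nat \<Rightarrow> ('a \<Rightarrow> 'g) set monoid" where
  "colim_cplx S R n = colim S (res_obj R n)"

definition colim_diff ::
  "'a topology \<Rightarrow> ('a, 'g) resolution \<Rightarrow> nat \<Rightarrow> ('a \<Rightarrow> 'g) set \<Rightarrow> ('a \<Rightarrow> 'g) set" where
  "colim_diff S R n = colim_map S (res_obj R (Suc n)) S (res_obj R n) (res_diff R n)"

definition homology ::
  "nat \<Rightarrow> 'a topology \<Rightarrow> ('a, 'g) ab_data \<Rightarrow> ('a \<Rightarrow> 'g) set set monoid" where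
  "homology n S F = chain_homology (colim_cplx S (proj_res S F)) (colim_diff S (proj_res S F)) n"

text \<open>
  For \<open>S\<close> a subspace of \<open>T\<close>, \<open>R\<close> a resolution on \<open>S\<close> and \<open>R'\<close> a resolution of the same data on \<open>T\<close>
  or on a larger space: the map from the homology of \<open>L(S, R)\<close> to the homology of \<open>L(T, R')\<close>.
\<close>

definition resolution_homology_map ::
  "nat \<Rightarrow> 'a topology \<Rightarrow> ('a, 'g) resolution \<Rightarrow> 'a topology \<Rightarrow> ('a, 'g) resolution
     \<Rightarrow> ('a \<Rightarrow> 'g) set set \<Rightarrow> ('a \<Rightarrow> 'g) set set" where
  "resolution_homology_map n S R T R' =
     (let \<phi> = (SOME \<phi>. comparison_map S R R' \<phi>)
      in chain_homology_map (colim_cplx T R') (colim_diff T R')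
           (\<lambda>k. colim_map S (res_obj R k) T (res_obj R' k) (\<phi> k)) n)"

definition homology_incl_map ::
  "nat \<Rightarrow> 'a topology \<Rightarrow> 'a topology \<Rightarrow> ('a, 'g) ab_data
     \<Rightarrow> ('a \<Rightarrow> 'g) set set \<Rightarrow> ('a \<Rightarrow> 'g) set set" where
  "homology_incl_map n S T F = resolution_homology_map n S (proj_res S F) T (proj_res T F)"

definition homologically_trivial :: "'a topology \<Rightarrow> bool" where
  "homologically_trivial X \<longleftrightarrow>
     (\<forall>i > 0. trivial_group (homology i X const_int_data)) \<and>
     homology 0 X const_int_data \<cong> integer_group"

definition h_open :: "'a topology \<Rightarrow> 'b topology \<Rightarrow> ('a \<Rightarrow> 'b) \<Rightarrow> bool" where
  "h_open X Y f \<longleftrightarrow>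
     open_map X Y f \<and>
     (\<forall>x \<in> topspace X. \<forall>y \<in> up_set Y (f x).
        homologically_trivial (preimage_space (subtopology X (up_set X x)) f {y}))"

definition shriek ::
  "'a topology \<Rightarrow> 'b topology \<Rightarrow> ('a \<Rightarrow> 'b) \<Rightarrow> ('a, 'g) ab_data \<Rightarrow> ('b, ('a \<Rightarrow> 'g) set) ab_data" where
  "shriek X Y f F =
     \<lparr>stalk = (\<lambda>y. colim (preimage_space X f (down_set Y y)) F),
      trans_map = (\<lambda>y y'. colim_map (preimage_space X f (down_set Y y)) F
                             (preimage_space X f (down_set Y y')) F (\<lambda>_ a. a))\<rparr>"

definition shriek_map ::
  "'a topology \<Rightarrow> 'b topology \<Rightarrow> ('a \<Rightarrow> 'b) \<Rightarrow> ('a, 'g) ab_data \<Rightarrow> ('a, 'g) ab_data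
     \<Rightarrow> ('a \<Rightarrow> 'g \<Rightarrow> 'g) \<Rightarrow> 'b \<Rightarrow> ('a \<Rightarrow> 'g) set \<Rightarrow> ('a \<Rightarrow> 'g) set" where
  "shriek_map X Y f F G \<phi> =
     (\<lambda>y. colim_map (preimage_space X f (down_set Y y)) F
            (preimage_space X f (down_set Y y)) G \<phi>)"

text \<open>
  The homology of \<open>f\<^sub>!\<close> applied to a projective resolution of \<open>F\<close> on all of \<open>X\<close>, computed pointwise
  on \<open>Y\<close>.
\<close>

definition derived_shriek ::
  "nat \<Rightarrow> 'a topology \<Rightarrow> 'b topology \<Rightarrow> ('a \<Rightarrow> 'b) \<Rightarrow> ('a, 'g) ab_data
     \<Rightarrow> ('b, ('a \<Rightarrow> 'g) set set) ab_data" where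
  "derived_shriek n X Y f F =
     (let R = proj_res X F;
          C = (\<lambda>y k. stalk (shriek X Y f (res_obj R k)) y);
          d = (\<lambda>y k. shriek_map X Y f (res_obj R (Suc k)) (res_obj R k) (res_diff R k) y)
      in \<lparr>stalk = (\<lambda>y. chain_homology (C y) (d y) n),
          trans_map = (\<lambda>y y'. chain_homology_map (C y') (d y')
             (\<lambda>k. trans_map (shriek X Y f (res_obj R k)) y y') n)\<rparr>)"

text \<open>
  The canonical identification of \<open>H\<^sub>n(f\<inverse>(C\<^sub>y), F)\<close> with the stalk of \<open>L\<^sub>nf\<^sub>!F\<close> at \<open>y\<close>: the restriction of a
  projective resolution of \<open>F\<close> to the closed subspace \<open>f\<inverse>(C\<^sub>y)\<close> is again a projective resolution.
\<close>

definition derived_shriek_stalk_map ::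
  "nat \<Rightarrow> 'a topology \<Rightarrow> 'b topology \<Rightarrow> ('a \<Rightarrow> 'b) \<Rightarrow> ('a, 'g) ab_data \<Rightarrow> 'b
     \<Rightarrow> ('a \<Rightarrow> 'g) set set \<Rightarrow> ('a \<Rightarrow> 'g) set set" where
  "derived_shriek_stalk_map n X Y f F y =
     (let T = preimage_space X f (down_set Y y)
      in resolution_homology_map n T (proj_res T F) T (proj_res X F))"

definition base_change_map ::
  "nat \<Rightarrow> 'a topology \<Rightarrow> 'b topology \<Rightarrow> ('a \<Rightarrow> 'b) \<Rightarrow> ('a, 'g) ab_data \<Rightarrow> 'b
     \<Rightarrow> ('a \<Rightarrow> 'g) set set \<Rightarrow> ('a \<Rightarrow> 'g) set set" where
  "base_change_map n X Y f F y =
     derived_shriek_stalk_map n X Y f F y \<circ>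
     homology_incl_map n (preimage_space X f {y}) (preimage_space X f (down_set Y y)) F"

end

(*
  Colimits over a finite space S are computed on representatives: a family of stalk elements dies in
  the colimit iff it is a boundary in the bar complex, whose chains are weakly increasing sequences
  of points.  A datum is acyclic on S if its bar complex is exact in positive degrees.  Dimension
  shifting shows that the colimits of an exact sequence of acyclic data are exact, and conversely
  that a datum with an acyclic resolution whose colimits are exact is acyclic.  So vanishing of
  homology is acyclicity, without comparing different resolutions.

  Projective data are retracts of sums of the data Z_x (the integers on the up-set U_x, zero
  elsewhere), so everything can be tested on the Z_x.  On f^-1(C_y) the support of Z_x is empty or has
  the least element x, hence Z_x is acyclic there with colimit Z or 0.  On f^-1(y), acyclicity of Z_x
  with colimit Z says exactly that U_x \<inter> f^-1(y) is homologically trivial.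

  If f is h-open, then a projective resolution of F on X restricts to an acyclic resolution on
  f^-1(y), and its colimits over f^-1(y) and f^-1(C_y) agree; the mapping cone of the comparison of
  resolutions is exact and acyclic, which gives base change.  Conversely, base change for Z_x, with
  the integers coded in the infinite type of group elements, yields the triviality of the fibres,
  and nonempty fibres over all y >= f(x) make f open.
*)
theory Submission
  imports Defs "HOL-Algebra.Free_Abelian_Groups"
begin

text \<open>These global rules make \<open>blast\<close> and \<open>auto\<close> diverge on goals with function application.\<close>

declare funcsetI [rule del] funcset_mem [rule del]

text \<open>The chosen resolutions live in one fixed type \<open>'g\<close>, while the argument
  needs data in several types: integers for constant coefficients, free abelian groups on pairs, and
  \<open>'g \<times> 'g\<close> for the mapping cone. Acyclicity therefore has to be a notion that
  chooses no resolution and makes sense in every type; the bar complex supplies it. Infinity of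
  \<open>'g\<close> enters where free data covering a given datum are coded back into
  \<open>'g\<close>. A projective datum restricted to a fibre need not stay projective, so
  projective resolutions cannot simply be compared there, and exact sequences of acyclic data take
  their place. For the integers on an up-set the colimit is controlled by one number, the sum of all
  entries; extending a family by zero preserves it, and this compares the colimits over the two
  spaces. The converse extracts from base change an abstract isomorphism of groups and works with
  that: a colimit isomorphic to the integers already forces the sum to be injective and the support
  to be nonempty.\<close>

lemma spec_le_iff:
  "spec_le X p q \<longleftrightarrow> p \<in> topspace X \<and> q \<in> topspace X \<and> p \<in> X closure_of {q}"
proof -
  have "X closure_of {p} \<subseteq> X closure_of {q} \<longleftrightarrow> p \<in> X closure_of {q}" if "p \<in> topspace X"
  proof
    assume "X closure_of {p} \<subseteq> X closure_of {q}"
    moreover have "p \<in> X closure_of {p}"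
      using that closure_of_subset[of "{p}" X] by auto
    ultimately show "p \<in> X closure_of {q}" by auto
  next
    assume "p \<in> X closure_of {q}"
    then show "X closure_of {p} \<subseteq> X closure_of {q}"
      by (intro closure_of_minimal) auto
  qed
  then show ?thesis unfolding spec_le_def by auto
qed

lemma spec_le_refl: "p \<in> topspace X \<Longrightarrow> spec_le X p p"
  and spec_le_trans: "spec_le X p q \<Longrightarrow> spec_le X q r \<Longrightarrow> spec_le X p r"
  and spec_le_topspace: "spec_le X p q \<Longrightarrow> p \<in> topspace X" "spec_le X p q \<Longrightarrow> q \<in> topspace X"
  unfolding spec_le_def by auto

lemma spec_le_subtopology:
  "spec_le (subtopology X S) p q \<longleftrightarrow> p \<in> S \<and> q \<in> S \<and> spec_le X p q"
  unfolding spec_le_iff closure_of_subtopology by (auto simp: Int_absorb1)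

subsection \<open>Chain complexes of abelian groups\<close>

text \<open>Multiplying the image of the coset by \<open>M\<close> absorbs \<open>h(N)\<close> and
  fills up a whole coset. This is where \<open>coset_map\<close> is seen to be the map induced on
  quotients.\<close>

lemma coset_map_rcoset:
  assumes "comm_group G" "comm_group H" "subgroup N G" "subgroup M H"
    "h \<in> hom G H" "h ` N \<subseteq> M" "x \<in> carrier G"
  shows "coset_map H M h (N #>\<^bsub>G\<^esub> x) = M #>\<^bsub>H\<^esub> h x"
proof -
  interpret G: comm_group G by fact
  interpret H: comm_group H by fact
  interpret N: subgroup N G by fact
  interpret M: subgroup M H by fact
  have hx: "h x \<in> carrier H" using assms hom_in_carrier by metis
  show ?thesis
  proof (intro equalityI subsetI)
    fix z assume "z \<in> coset_map H M h (N #>\<^bsub>G\<^esub> x)"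
    then obtain m n where mn: "m \<in> M" "n \<in> N" "z = m \<otimes>\<^bsub>H\<^esub> h (n \<otimes>\<^bsub>G\<^esub> x)"
      unfolding coset_map_def set_mult_def r_coset_def by auto
    have "h n \<in> M" using mn assms by auto
    have "z = (m \<otimes>\<^bsub>H\<^esub> h n) \<otimes>\<^bsub>H\<^esub> h x"
      using mn assms \<open>h n \<in> M\<close> hx by (simp add: hom_mult H.m_assoc)
    then show "z \<in> M #>\<^bsub>H\<^esub> h x"
      unfolding r_coset_def using \<open>h n \<in> M\<close> mn by auto
  next
    fix z assume "z \<in> M #>\<^bsub>H\<^esub> h x"
    then obtain m where "m \<in> M" "z = m \<otimes>\<^bsub>H\<^esub> h x" unfolding r_coset_def by auto
    moreover have "x = \<one>\<^bsub>G\<^esub> \<otimes>\<^bsub>G\<^esub> x" using assms by simp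
    ultimately show "z \<in> coset_map H M h (N #>\<^bsub>G\<^esub> x)"
      unfolding coset_map_def set_mult_def r_coset_def using N.one_closed by blast
  qed
qed

text \<open>Products of cosets see only the multiplication, so cycles may be treated as elements of
  the whole chain group when homology maps are computed.\<close>

lemma coset_map_carrier_update: "coset_map (H\<lparr>carrier := Z\<rparr>) N h = coset_map H N h"
  by (simp add: fun_eq_iff coset_map_def set_mult_def)

lemma r_coset_carrier_update: "N #>\<^bsub>H\<lparr>carrier := Z\<rparr>\<^esub> x = N #>\<^bsub>H\<^esub> x"
  by (simp add: r_coset_def)

lemma rcoset_eq_iff:
  assumes "comm_group G" "subgroup N G" "x \<in> carrier G" "y \<in> carrier G"
  shows "N #>\<^bsub>G\<^esub> x = N #>\<^bsub>G\<^esub> y \<longleftrightarrow> x \<otimes>\<^bsub>G\<^esub> inv\<^bsub>G\<^esub> y \<in> N"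
proof -
  interpret G: comm_group G by fact
  interpret N: subgroup N G by fact
  show ?thesis
    using assms N.rcos_module[OF G.is_group, of y x] G.rcos_self[of x N] G.repr_independence[of x N y]
    by auto
qed

lemma rcoset_mult:
  assumes "comm_group G" "subgroup N G" "x \<in> carrier G" "y \<in> carrier G"
  shows "(N #>\<^bsub>G\<^esub> x) \<otimes>\<^bsub>G Mod N\<^esub> (N #>\<^bsub>G\<^esub> y) = N #>\<^bsub>G\<^esub> (x \<otimes>\<^bsub>G\<^esub> y)"
proof -
  interpret normal N G using assms comm_group.subgroup_imp_normal by blast
  show ?thesis using assms rcos_sum by (simp add: FactGroup_def)
qed

lemma rcoset_eq_one_iff:
  assumes "comm_group G" "subgroup N G" "x \<in> carrier G"
  shows "N #>\<^bsub>G\<^esub> x = N \<longleftrightarrow> x \<in> N"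
proof -
  interpret G: comm_group G by fact
  show ?thesis
    using assms rcoset_eq_iff[of G N x "\<one>\<^bsub>G\<^esub>"] by (simp add: G.coset_mult_one subgroup.subset)
qed

lemma coset_map_hom:
  assumes "comm_group G" "comm_group H" "subgroup N G" "subgroup M H" "h \<in> hom G H" "h ` N \<subseteq> M"
  shows "coset_map H M h \<in> hom (G Mod N) (H Mod M)"
proof (rule homI)
  note * = coset_map_rcoset[OF assms]
  interpret G: comm_group G by fact
  fix x assume x: "x \<in> carrier (G Mod N)"
  obtain a where a: "a \<in> carrier G" "x = N #>\<^bsub>G\<^esub> a"
    using x unfolding carrier_FactGroup by blast
  show "coset_map H M h x \<in> carrier (H Mod M)"
    unfolding a(2) *[OF a(1)] carrier_FactGroup using hom_in_carrier[OF assms(5) a(1)] by (rule imageI)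
  fix y assume y: "y \<in> carrier (G Mod N)"
  obtain b where b: "b \<in> carrier G" "y = N #>\<^bsub>G\<^esub> b"
    using y unfolding carrier_FactGroup by blast
  note ha = hom_in_carrier[OF assms(5) a(1)] and hb = hom_in_carrier[OF assms(5) b(1)]
  show "coset_map H M h (x \<otimes>\<^bsub>G Mod N\<^esub> y) = coset_map H M h x \<otimes>\<^bsub>H Mod M\<^esub> coset_map H M h y"
    unfolding a(2) b(2) rcoset_mult[OF assms(1,3) a(1) b(1)] *[OF a(1)] *[OF b(1)]
      *[OF G.m_closed[OF a(1) b(1)]] hom_mult[OF assms(5) a(1) b(1)] rcoset_mult[OF assms(2,4) ha hb] ..
qed

definition chain_complex :: "(nat \<Rightarrow> 'g monoid) \<Rightarrow> (nat \<Rightarrow> 'g \<Rightarrow> 'g) \<Rightarrow> bool" where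
  "chain_complex C d \<longleftrightarrow>
     (\<forall>n. comm_group (C n)) \<and> (\<forall>n. d n \<in> hom (C (Suc n)) (C n)) \<and>
     (\<forall>n. \<forall>x \<in> carrier (C (Suc (Suc n))). d n (d (Suc n) x) = \<one>\<^bsub>C n\<^esub>)"

definition chain_map ::
  "(nat \<Rightarrow> 'g monoid) \<Rightarrow> (nat \<Rightarrow> 'g \<Rightarrow> 'g) \<Rightarrow> (nat \<Rightarrow> 'h monoid) \<Rightarrow> (nat \<Rightarrow> 'h \<Rightarrow> 'h) \<Rightarrow>
    (nat \<Rightarrow> 'g \<Rightarrow> 'h) \<Rightarrow> bool" where
  "chain_map C d D e h \<longleftrightarrow>
     (\<forall>n. h n \<in> hom (C n) (D n)) \<and>
     (\<forall>n. \<forall>x \<in> carrier (C (Suc n)). e n (h (Suc n) x) = h n (d n x))"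

lemma cycles_0: "cycles C d 0 = carrier (C 0)"
  and cycles_Suc: "cycles C d (Suc n) = {x \<in> carrier (C (Suc n)). d n x = \<one>\<^bsub>C n\<^esub>}"
  by (auto simp: cycles_def kernel_def)

lemma hom_group_homI: "comm_group G \<Longrightarrow> comm_group H \<Longrightarrow> h \<in> hom G H \<Longrightarrow> group_hom G H h"
  by (simp add: group_hom_def group_hom_axioms_def comm_group_def)

lemma comm_group_subgroup: 
  assumes "comm_group G" "subgroup H G"
  shows "comm_group (G\<lparr>carrier := H\<rparr>)"
proof -
  interpret comm_group G by fact
  interpret H: subgroup H G by fact
  show ?thesis
    using H.subgroup_is_group[OF is_group] H.subset
    by (intro group.group_comm_groupI) (auto simp: m_comm subset_iff)
qed

lemma subgroup_cycles:
  assumes "chain_complex C d"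
  shows "subgroup (cycles C d n) (C n)"
proof (cases n)
  case 0
  then show ?thesis using assms
    by (simp add: cycles_0 chain_complex_def comm_group_def group.subgroup_self)
next
  case (Suc m)
  then have "group_hom (C (Suc m)) (C m) (d m)"
    using assms by (auto simp: chain_complex_def intro: hom_group_homI)
  then show ?thesis using Suc by (simp add: cycles_def group_hom.subgroup_kernel)
qed

lemma boundaries_subset_cycles:
  assumes "chain_complex C d"
  shows "boundaries C d n \<subseteq> cycles C d n"
proof -
  have "d n \<in> hom (C (Suc n)) (C n)" using assms by (simp add: chain_complex_def)
  then have "d n x \<in> carrier (C n)" if "x \<in> carrier (C (Suc n))" for x
    using that by (rule hom_in_carrier)
  then show ?thesis using assms
    by (cases n) (auto simp: boundaries_def cycles_0 cycles_Suc chain_complex_def)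
qed

lemma cycles_group:
  assumes "chain_complex C d"
  shows "comm_group ((C n)\<lparr>carrier := cycles C d n\<rparr>)"
    "subgroup (boundaries C d n) ((C n)\<lparr>carrier := cycles C d n\<rparr>)"
proof -
  interpret comm_group "C n" using assms by (simp add: chain_complex_def)
  show "comm_group ((C n)\<lparr>carrier := cycles C d n\<rparr>)"
    using comm_group_subgroup subgroup_cycles[OF assms] comm_group_axioms by blast
  have "group_hom (C (Suc n)) (C n) (d n)"
    using assms by (auto simp: chain_complex_def intro: hom_group_homI)
  then have "subgroup (boundaries C d n) (C n)"
    unfolding boundaries_def by (rule group_hom.img_is_subgroup)
  then show "subgroup (boundaries C d n) ((C n)\<lparr>carrier := cycles C d n\<rparr>)"
    using subgroup_incl subgroup_cycles[OF assms] boundaries_subset_cycles[OF assms] by blast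
qed

lemma comm_group_chain_homology:
  "chain_complex C d \<Longrightarrow> comm_group (chain_homology C d n)"
  unfolding chain_homology_def by (intro comm_group.abelian_FactGroup cycles_group)

text \<open>The coset is formed in \<open>C n\<close>; inside the group of cycles it would be the
  same set, since both have the same multiplication.\<close>

definition hclass :: "(nat \<Rightarrow> 'g monoid) \<Rightarrow> (nat \<Rightarrow> 'g \<Rightarrow> 'g) \<Rightarrow> nat \<Rightarrow> 'g \<Rightarrow> 'g set" where
  "hclass C d n x = boundaries C d n #>\<^bsub>C n\<^esub> x"

lemma carrier_chain_homology:
  "carrier (chain_homology C d n) = hclass C d n ` cycles C d n"
  unfolding chain_homology_def hclass_def by (simp add: carrier_FactGroup r_coset_def)

lemma hclass_eq_iff:
  assumes "chain_complex C d" "x \<in> cycles C d n" "y \<in> cycles C d n"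
  shows "hclass C d n x = hclass C d n y \<longleftrightarrow> x \<otimes>\<^bsub>C n\<^esub> inv\<^bsub>C n\<^esub> y \<in> boundaries C d n"
proof -
  interpret comm_group "C n" using assms by (simp add: chain_complex_def)
  have "inv\<^bsub>(C n)\<lparr>carrier := cycles C d n\<rparr>\<^esub> y = inv\<^bsub>C n\<^esub> y"
    using m_inv_consistent subgroup_cycles assms by blast
  then show ?thesis
    using rcoset_eq_iff[OF cycles_group[OF assms(1), of n], of x y] assms
    by (simp add: hclass_def r_coset_def)
qed

lemma hclass_one_iff:
  assumes "chain_complex C d" "x \<in> cycles C d n"
  shows "hclass C d n x = \<one>\<^bsub>chain_homology C d n\<^esub> \<longleftrightarrow> x \<in> boundaries C d n"
  using rcoset_eq_one_iff[OF cycles_group[OF assms(1), of n], of x] assms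
  by (simp add: hclass_def r_coset_def chain_homology_def)

lemma chain_map_hom: "chain_map C d D e h \<Longrightarrow> h n \<in> hom (C n) (D n)"
  and chain_map_commute:
    "chain_map C d D e h \<Longrightarrow> x \<in> carrier (C (Suc n)) \<Longrightarrow> e n (h (Suc n) x) = h n (d n x)"
  by (simp_all add: chain_map_def)

lemma chain_map_cycles:
  assumes "chain_complex C d" "chain_complex D e" "chain_map C d D e h" "x \<in> cycles C d n"
  shows "h n x \<in> cycles D e n"
proof (cases n)
  case 0
  then show ?thesis
    using assms(4) hom_in_carrier[OF chain_map_hom[OF assms(3), of 0]] by (simp add: cycles_0)
next
  case (Suc m)
  then have x: "x \<in> carrier (C (Suc m))" "d m x = \<one>\<^bsub>C m\<^esub>"
    using assms(4) by (auto simp: cycles_Suc)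
  have "group (C m)" "group (D m)"
    using assms(1,2) by (auto simp: chain_complex_def comm_group_def)
  then have "h m \<one>\<^bsub>C m\<^esub> = \<one>\<^bsub>D m\<^esub>"
    using hom_one[OF chain_map_hom[OF assms(3), of m]] by blast
  then have "e m (h (Suc m) x) = \<one>\<^bsub>D m\<^esub>"
    using chain_map_commute[OF assms(3) x(1)] x(2) by simp
  then show ?thesis
    using Suc x(1) hom_in_carrier[OF chain_map_hom[OF assms(3), of "Suc m"]] by (simp add: cycles_Suc)
qed

lemma chain_map_boundaries:
  assumes "chain_complex C d" "chain_complex D e" "chain_map C d D e h" "x \<in> boundaries C d n"
  shows "h n x \<in> boundaries D e n"
proof -
  obtain z where z: "z \<in> carrier (C (Suc n))" "x = d n z" using assms(4) by (auto simp: boundaries_def)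
  have "h (Suc n) z \<in> carrier (D (Suc n))"
    using hom_in_carrier[OF chain_map_hom[OF assms(3), of "Suc n"] z(1)] .
  then show ?thesis
    using chain_map_commute[OF assms(3) z(1)] z(2) unfolding boundaries_def by (metis image_eqI)
qed

lemma chain_map_cycles_hom:
  assumes "chain_complex C d" "chain_complex D e" "chain_map C d D e h"
  shows "h n \<in> hom ((C n)\<lparr>carrier := cycles C d n\<rparr>) ((D n)\<lparr>carrier := cycles D e n\<rparr>)"
proof (rule homI)
  show "h n x \<in> carrier ((D n)\<lparr>carrier := cycles D e n\<rparr>)"
    if "x \<in> carrier ((C n)\<lparr>carrier := cycles C d n\<rparr>)" for x
    using that chain_map_cycles[OF assms] by simp
  have sub: "cycles C d n \<subseteq> carrier (C n)"
    using subgroup.subset subgroup_cycles assms(1) by blast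
  have mult: "h n (x \<otimes>\<^bsub>C n\<^esub> y) = h n x \<otimes>\<^bsub>D n\<^esub> h n y"
    if "x \<in> carrier (C n)" "y \<in> carrier (C n)" for x y
    using hom_mult[OF chain_map_hom[OF assms(3)] that] .
  show "h n (x \<otimes>\<^bsub>(C n)\<lparr>carrier := cycles C d n\<rparr>\<^esub> y) =
      h n x \<otimes>\<^bsub>(D n)\<lparr>carrier := cycles D e n\<rparr>\<^esub> h n y"
    if "x \<in> carrier ((C n)\<lparr>carrier := cycles C d n\<rparr>)" "y \<in> carrier ((C n)\<lparr>carrier := cycles C d n\<rparr>)"
    for x y
    using that sub by (simp add: mult subset_iff)
qed

lemma chain_homology_map_class:
  assumes "chain_complex C d" "chain_complex D e" "chain_map C d D e h" "x \<in> cycles C d n"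
  shows "chain_homology_map D e h n (hclass C d n x) = hclass D e n (h n x)"
proof -
  have "h n ` boundaries C d n \<subseteq> boundaries D e n"
    using chain_map_boundaries[OF assms(1-3)] by auto
  from coset_map_rcoset[OF cycles_group(1)[OF assms(1)] cycles_group(1)[OF assms(2)]
      cycles_group(2)[OF assms(1)] cycles_group(2)[OF assms(2)]
      chain_map_cycles_hom[OF assms(1-3)] this, of x] assms(4)
  show ?thesis
    unfolding chain_homology_map_def hclass_def coset_map_carrier_update r_coset_carrier_update by simp
qed

lemma chain_homology_map_hom:
  assumes "chain_complex C d" "chain_complex D e" "chain_map C d D e h"
  shows "chain_homology_map D e h n \<in> hom (chain_homology C d n) (chain_homology D e n)"
proof -
  have sub: "h n ` boundaries C d n \<subseteq> boundaries D e n"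
    using chain_map_boundaries[OF assms(1-3)] by auto
  have "coset_map ((D n)\<lparr>carrier := cycles D e n\<rparr>) (boundaries D e n) (h n)
    \<in> hom ((C n)\<lparr>carrier := cycles C d n\<rparr> Mod boundaries C d n)
        ((D n)\<lparr>carrier := cycles D e n\<rparr> Mod boundaries D e n)"
    by (rule coset_map_hom[OF cycles_group(1)[OF assms(1)] cycles_group(1)[OF assms(2)]
      cycles_group(2)[OF assms(1)] cycles_group(2)[OF assms(2)]
      chain_map_cycles_hom[OF assms(1-3)] sub])
  then show ?thesis
    by (simp only: chain_homology_map_def chain_homology_def coset_map_carrier_update)
qed

text \<open>Trivial kernel and surjectivity are phrased on cycles and boundaries, so that later
  arguments handle representatives instead of classes.\<close>

lemma chain_homology_map_iso:
  assumes C: "chain_complex C d" and D: "chain_complex D e" and h: "chain_map C d D e h"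
    and inj: "\<And>x. x \<in> cycles C d n \<Longrightarrow> h n x \<in> boundaries D e n \<Longrightarrow> x \<in> boundaries C d n"
    and surj: "\<And>y. y \<in> cycles D e n \<Longrightarrow>
      \<exists>x \<in> cycles C d n. y \<otimes>\<^bsub>D n\<^esub> inv\<^bsub>D n\<^esub> h n x \<in> boundaries D e n"
  shows "chain_homology_map D e h n \<in> iso (chain_homology C d n) (chain_homology D e n)"
proof -
  interpret group_hom "chain_homology C d n" "chain_homology D e n" "chain_homology_map D e h n"
    by (rule hom_group_homI[OF comm_group_chain_homology[OF C] comm_group_chain_homology[OF D]
          chain_homology_map_hom[OF C D h]])
  note cls = chain_homology_map_class[OF C D h]
  have "\<forall>z \<in> carrier (chain_homology C d n).
      chain_homology_map D e h n z = \<one>\<^bsub>chain_homology D e n\<^esub> \<longrightarrow> z = \<one>\<^bsub>chain_homology C d n\<^esub>"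
  proof (intro ballI impI)
    fix z assume z: "z \<in> carrier (chain_homology C d n)"
      and one: "chain_homology_map D e h n z = \<one>\<^bsub>chain_homology D e n\<^esub>"
    obtain x where x: "x \<in> cycles C d n" "z = hclass C d n x"
      using z unfolding carrier_chain_homology by blast
    have "hclass D e n (h n x) = \<one>\<^bsub>chain_homology D e n\<^esub>"
      using one unfolding x(2) cls[OF x(1)] .
    then have "h n x \<in> boundaries D e n"
      using hclass_one_iff[OF D chain_map_cycles[OF C D h x(1)]] by blast
    then show "z = \<one>\<^bsub>chain_homology C d n\<^esub>"
      using x inj hclass_one_iff[OF C x(1)] by blast
  qed
  moreover have "carrier (chain_homology D e n)
      \<subseteq> chain_homology_map D e h n ` carrier (chain_homology C d n)"
  proof
    fix z assume "z \<in> carrier (chain_homology D e n)"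
    then obtain y where y: "y \<in> cycles D e n" "z = hclass D e n y"
      unfolding carrier_chain_homology by blast
    obtain x where x: "x \<in> cycles C d n" "y \<otimes>\<^bsub>D n\<^esub> inv\<^bsub>D n\<^esub> h n x \<in> boundaries D e n"
      using surj[OF y(1)] by blast
    have "z = hclass D e n (h n x)"
      using hclass_eq_iff[OF D y(1) chain_map_cycles[OF C D h x(1)]] y(2) x(2) by blast
    then have "z = chain_homology_map D e h n (hclass C d n x)"
      unfolding cls[OF x(1)] .
    moreover have "hclass C d n x \<in> carrier (chain_homology C d n)"
      unfolding carrier_chain_homology using x(1) by (rule imageI)
    ultimately show "z \<in> chain_homology_map D e h n ` carrier (chain_homology C d n)"
      by (rule image_eqI)
  qed
  ultimately show ?thesis by (intro iso_iff[THEN iffD2] conjI)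
qed

lemma trivial_chain_homology_iff:
  assumes "chain_complex C d"
  shows "trivial_group (chain_homology C d n) \<longleftrightarrow> cycles C d n \<subseteq> boundaries C d n"
proof -
  interpret comm_group "chain_homology C d n" using assms by (rule comm_group_chain_homology)
  have "trivial_group (chain_homology C d n) \<longleftrightarrow>
      (\<forall>z \<in> carrier (chain_homology C d n). z = \<one>\<^bsub>chain_homology C d n\<^esub>)"
    unfolding trivial_group_def using one_closed is_group by blast
  also have "\<dots> \<longleftrightarrow> (\<forall>x \<in> cycles C d n. hclass C d n x = \<one>\<^bsub>chain_homology C d n\<^esub>)"
    unfolding carrier_chain_homology by blast
  also have "\<dots> \<longleftrightarrow> cycles C d n \<subseteq> boundaries C d n"
    using hclass_one_iff[OF assms] by blast
  finally show ?thesis .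
qed

subsection \<open>Abelian data and colimits\<close>

text \<open>Asks only that the inclusion be monotone. This is transitive by unfolding, which suits
  the tower of fibre, preimage of a closure and whole space; data and morphisms restrict along it
  unchanged.\<close>

definition subspace_of :: "'a topology \<Rightarrow> 'a topology \<Rightarrow> bool" where
  "subspace_of S T \<longleftrightarrow> topspace S \<subseteq> topspace T \<and> (\<forall>p q. spec_le S p q \<longrightarrow> spec_le T p q)"

lemma subspace_of_subtopology: "subspace_of (subtopology X S) X"
  by (auto simp: subspace_of_def spec_le_subtopology)

lemma subspace_of_refl: "subspace_of X X"
  by (simp add: subspace_of_def)

lemma data_comm_group:
  assumes "abelian_data X F" "p \<in> topspace X"
  shows "comm_group (stalk F p)"
proof -
  have "\<forall>p \<in> topspace X. comm_group (stalk F p)"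
    using assms(1) unfolding abelian_data_def by (elim conjE)
  then show ?thesis using assms(2) by (rule bspec)
qed

lemma data_trans_hom:
  assumes "abelian_data X F" "spec_le X p q"
  shows "trans_map F p q \<in> hom (stalk F p) (stalk F q)"
proof -
  have "\<forall>p q. spec_le X p q \<longrightarrow> trans_map F p q \<in> hom (stalk F p) (stalk F q)"
    using assms(1) unfolding abelian_data_def by (elim conjE)
  then show ?thesis using assms(2) by (elim allE impE)
qed

lemma data_trans_id:
  assumes "abelian_data X F" "p \<in> topspace X" "a \<in> carrier (stalk F p)"
  shows "trans_map F p p a = a"
proof -
  have "\<forall>p \<in> topspace X. \<forall>a \<in> carrier (stalk F p). trans_map F p p a = a"
    using assms(1) unfolding abelian_data_def by (elim conjE)
  from bspec[OF bspec[OF this assms(2)] assms(3)] show ?thesis .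
qed

lemma data_trans_comp:
  assumes "abelian_data X F" "spec_le X p q" "spec_le X q r" "a \<in> carrier (stalk F p)"
  shows "trans_map F q r (trans_map F p q a) = trans_map F p r a"
proof -
  have "\<forall>p q r. spec_le X p q \<longrightarrow> spec_le X q r \<longrightarrow>
      (\<forall>a \<in> carrier (stalk F p). trans_map F q r (trans_map F p q a) = trans_map F p r a)"
    using assms(1) unfolding abelian_data_def by (elim conjE)
  from this[rule_format, OF assms(2-4)] show ?thesis .
qed

lemma data_group: "abelian_data X F \<Longrightarrow> p \<in> topspace X \<Longrightarrow> group (stalk F p)"
  by (rule comm_group.axioms(2)[OF data_comm_group])

lemma abelian_dataI:
  assumes "\<And>p. p \<in> topspace X \<Longrightarrow> comm_group (stalk F p)"
    and "\<And>p q. spec_le X p q \<Longrightarrow> trans_map F p q \<in> hom (stalk F p) (stalk F q)"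
    and "\<And>p a. p \<in> topspace X \<Longrightarrow> a \<in> carrier (stalk F p) \<Longrightarrow> trans_map F p p a = a"
    and "\<And>p q r a. spec_le X p q \<Longrightarrow> spec_le X q r \<Longrightarrow> a \<in> carrier (stalk F p) \<Longrightarrow>
      trans_map F q r (trans_map F p q a) = trans_map F p r a"
  shows "abelian_data X F"
  unfolding abelian_data_def by (intro conjI allI ballI impI; rule assms)

lemma data_homI:
  assumes "\<And>p. p \<in> topspace X \<Longrightarrow> \<phi> p \<in> hom (stalk F p) (stalk G p)"
    and "\<And>p q a. spec_le X p q \<Longrightarrow> a \<in> carrier (stalk F p) \<Longrightarrow>
      \<phi> q (trans_map F p q a) = trans_map G p q (\<phi> p a)"
  shows "\<phi> \<in> data_hom X F G"
  unfolding data_hom_def by (intro CollectI conjI allI ballI impI; rule assms)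

lemma subspace_ofD:
  assumes "subspace_of S T"
  shows "p \<in> topspace S \<Longrightarrow> p \<in> topspace T" "spec_le S p q \<Longrightarrow> spec_le T p q"
  using assms unfolding subspace_of_def by auto

lemma data_trans_closed:
  "abelian_data X F \<Longrightarrow> spec_le X p q \<Longrightarrow> a \<in> carrier (stalk F p) \<Longrightarrow> trans_map F p q a \<in> carrier (stalk F q)"
  by (rule hom_in_carrier[OF data_trans_hom])

lemma data_hom_hom:
  assumes "\<phi> \<in> data_hom X F G" "p \<in> topspace X"
  shows "\<phi> p \<in> hom (stalk F p) (stalk G p)"
proof -
  have "\<forall>p \<in> topspace X. \<phi> p \<in> hom (stalk F p) (stalk G p)"
    using assms(1) unfolding data_hom_def by (elim CollectE conjE)
  then show ?thesis using assms(2) by (rule bspec)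
qed

lemma data_hom_natural:
  assumes "\<phi> \<in> data_hom X F G" "spec_le X p q" "a \<in> carrier (stalk F p)"
  shows "\<phi> q (trans_map F p q a) = trans_map G p q (\<phi> p a)"
proof -
  have "\<forall>p q. spec_le X p q \<longrightarrow>
      (\<forall>a \<in> carrier (stalk F p). \<phi> q (trans_map F p q a) = trans_map G p q (\<phi> p a))"
    using assms(1) unfolding data_hom_def by (elim CollectE conjE)
  from this[rule_format, OF assms(2-3)] show ?thesis .
qed

lemma data_hom_closed:
  "\<phi> \<in> data_hom X F G \<Longrightarrow> p \<in> topspace X \<Longrightarrow> a \<in> carrier (stalk F p) \<Longrightarrow> \<phi> p a \<in> carrier (stalk G p)"
  by (rule hom_in_carrier[OF data_hom_hom])

lemma data_hom_one:
  assumes "abelian_data X F" "abelian_data X G" "\<phi> \<in> data_hom X F G" "p \<in> topspace X"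
  shows "\<phi> p \<one>\<^bsub>stalk F p\<^esub> = \<one>\<^bsub>stalk G p\<^esub>"
  by (rule hom_one[OF data_hom_hom[OF assms(3,4)] data_group[OF assms(1,4)] data_group[OF assms(2,4)]])

lemma data_hom_group_hom:
  assumes "abelian_data X F" "abelian_data X G" "\<phi> \<in> data_hom X F G" "p \<in> topspace X"
  shows "group_hom (stalk F p) (stalk G p) (\<phi> p)"
  using assms by (intro hom_group_homI data_comm_group data_hom_hom)

lemma data_hom_comp:
  assumes "\<phi> \<in> data_hom X F G" "\<psi> \<in> data_hom X G H"
  shows "(\<lambda>p a. \<psi> p (\<phi> p a)) \<in> data_hom X F H"
proof (rule data_homI)
  fix p assume "p \<in> topspace X"
  then show "(\<lambda>a. \<psi> p (\<phi> p a)) \<in> hom (stalk F p) (stalk H p)"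
    using hom_compose[OF data_hom_hom[OF assms(1)] data_hom_hom[OF assms(2)], of p] by (simp add: comp_def)
next
  fix p q a assume "spec_le X p q" "a \<in> carrier (stalk F p)"
  then show "\<psi> q (\<phi> q (trans_map F p q a)) = trans_map H p q (\<psi> p (\<phi> p a))"
    using assms by (simp add: data_hom_natural data_hom_closed spec_le_topspace)
qed

lemma data_hom_id: "abelian_data X F \<Longrightarrow> (\<lambda>p a. a) \<in> data_hom X F F"
  by (rule data_homI) (auto simp: hom_def)

lemma abelian_data_subspace: "abelian_data X F \<Longrightarrow> subspace_of S X \<Longrightarrow> abelian_data S F"
  by (rule abelian_dataI)
    (simp_all add: data_comm_group data_trans_hom data_trans_id data_trans_comp[where X = X] subspace_ofD)

lemma data_hom_subspace: "\<phi> \<in> data_hom X F G \<Longrightarrow> subspace_of S X \<Longrightarrow> \<phi> \<in> data_hom S F G"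
  by (rule data_homI) (simp_all add: data_hom_hom data_hom_natural subspace_ofD)

lemma data_epi_subspace: "data_epi X F G \<phi> \<Longrightarrow> subspace_of S X \<Longrightarrow> data_epi S F G \<phi>"
  unfolding data_epi_def using data_hom_subspace[of \<phi> X F G S] subspace_ofD(1)[of S X] by simp

section \<open>Finite sums of stalks, and colimits computed on representatives\<close>

definition psingle :: "'i set \<Rightarrow> ('i \<Rightarrow> ('g, 'm) monoid_scheme) \<Rightarrow> 'i \<Rightarrow> 'g \<Rightarrow> 'i \<Rightarrow> 'g" where
  "psingle I G i a = (\<lambda>j\<in>I. if j = i then a else \<one>\<^bsub>G j\<^esub>)"

text \<open>A finite family is the product of its entries placed one at a time; the inner induction
  enlarges the set \<open>J\<close> of positions at which \<open>x\<close> is kept and not replaced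
  by the unit.\<close>

lemma product_group_induct:
  assumes "finite I" and G: "\<And>i. i \<in> I \<Longrightarrow> group (G i)" and x: "x \<in> (\<Pi>\<^sub>E i\<in>I. carrier (G i))"
    and one: "P (\<lambda>i\<in>I. \<one>\<^bsub>G i\<^esub>)"
    and mult: "\<And>x y. x \<in> (\<Pi>\<^sub>E i\<in>I. carrier (G i)) \<Longrightarrow> y \<in> (\<Pi>\<^sub>E i\<in>I. carrier (G i)) \<Longrightarrow>
      P x \<Longrightarrow> P y \<Longrightarrow> P (\<lambda>i\<in>I. x i \<otimes>\<^bsub>G i\<^esub> y i)"
    and single: "\<And>i a. i \<in> I \<Longrightarrow> a \<in> carrier (G i) \<Longrightarrow> P (psingle I G i a)"
  shows "P x"
proof -
  have G1: "\<one>\<^bsub>G i\<^esub> \<in> carrier (G i)" if "i \<in> I" for i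
    using G[OF that] group.is_monoid monoid.one_closed by blast
  have "P (\<lambda>i\<in>I. if i \<in> J then x i else \<one>\<^bsub>G i\<^esub>)" if "finite J" "J \<subseteq> I" for J
    using that
  proof (induction J)
    case empty
    show ?case using one by (simp add: restrict_def)
  next
    case (insert k J)
    let ?u = "\<lambda>i\<in>I. if i \<in> J then x i else \<one>\<^bsub>G i\<^esub>"
    have k: "k \<in> I" "x k \<in> carrier (G k)" using insert x by auto
    have "(\<lambda>i\<in>I. if i \<in> insert k J then x i else \<one>\<^bsub>G i\<^esub>) = (\<lambda>i\<in>I. psingle I G k (x k) i \<otimes>\<^bsub>G i\<^esub> ?u i)"
    proof (rule restrict_ext)
      fix i assume i: "i \<in> I"
      interpret group "G i" using G i .
      have "x i \<in> carrier (G i)" using x i by auto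
      then have "x i \<otimes>\<^bsub>G i\<^esub> \<one>\<^bsub>G i\<^esub> = x i" "\<one>\<^bsub>G i\<^esub> \<otimes>\<^bsub>G i\<^esub> x i = x i" "\<one>\<^bsub>G i\<^esub> \<otimes>\<^bsub>G i\<^esub> \<one>\<^bsub>G i\<^esub> = \<one>\<^bsub>G i\<^esub>"
        by simp_all
      then show "(if i \<in> insert k J then x i else \<one>\<^bsub>G i\<^esub>) = psingle I G k (x k) i \<otimes>\<^bsub>G i\<^esub> ?u i"
        using insert.hyps i by (auto simp: psingle_def)
    qed
    moreover have "P (\<lambda>i\<in>I. psingle I G k (x k) i \<otimes>\<^bsub>G i\<^esub> ?u i)"
      using insert k x G1 by (intro mult single) (auto simp: psingle_def)
    ultimately show ?case by (simp only:)
  qed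
  from this[OF \<open>finite I\<close> order_refl] have "P (\<lambda>i\<in>I. if i \<in> I then x i else \<one>\<^bsub>G i\<^esub>)" .
  also have "(\<lambda>i\<in>I. if i \<in> I then x i else \<one>\<^bsub>G i\<^esub>) = x"
    using x by (auto simp: fun_eq_iff PiE_iff extensional_def)
  finally show ?thesis .
qed

lemma comm_group_product_group:
  assumes "\<And>i. i \<in> I \<Longrightarrow> comm_group (G i)"
  shows "comm_group (product_group I G)"
proof (rule group.group_comm_groupI)
  show "group (product_group I G)" using assms by (simp add: comm_group_def)
  fix x y assume "x \<in> carrier (product_group I G)" "y \<in> carrier (product_group I G)"
  then show "x \<otimes>\<^bsub>product_group I G\<^esub> y = y \<otimes>\<^bsub>product_group I G\<^esub> x"
    using assms by (auto intro!: restrict_ext comm_monoid.m_comm simp: comm_group_def)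
qed

lemma data_sum_carrier:
  assumes "finite (topspace X)" "abelian_data X F"
  shows "carrier (data_sum X F) = (\<Pi>\<^sub>E p\<in>topspace X. carrier (stalk F p))"
proof -
  have "finite {i \<in> topspace X. x i \<noteq> \<one>\<^bsub>stalk F i\<^esub>}" for x using assms(1) by simp
  then show ?thesis using carrier_sum_group[of "topspace X" "stalk F"] data_group[OF assms(2)] by simp
qed

lemma data_sum_eq_product:
  assumes "finite (topspace X)" "abelian_data X F"
  shows "data_sum X F = product_group (topspace X) (stalk F)"
  by (rule monoid.equality) (simp_all add: data_sum_carrier[OF assms])

lemma comm_group_data_sum:
  assumes "finite (topspace X)" "abelian_data X F"
  shows "comm_group (data_sum X F)"
  unfolding data_sum_eq_product[OF assms] by (intro comm_group_product_group data_comm_group[OF assms(2)])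

lemma data_sum_mult: "(x \<otimes>\<^bsub>data_sum X F\<^esub> y) = (\<lambda>p\<in>topspace X. x p \<otimes>\<^bsub>stalk F p\<^esub> y p)"
  and data_sum_one: "\<one>\<^bsub>data_sum X F\<^esub> = (\<lambda>p\<in>topspace X. \<one>\<^bsub>stalk F p\<^esub>)"
  by simp_all

lemma data_sum_inv:
  assumes "abelian_data X F" "x \<in> carrier (data_sum X F)"
  shows "inv\<^bsub>data_sum X F\<^esub> x = (\<lambda>p\<in>topspace X. inv\<^bsub>stalk F p\<^esub> x p)"
  using assms data_group by (intro inv_sum_group)

lemma sum_incl_psingle: "sum_incl X F p a = psingle (topspace X) (stalk F) p a"
  by (simp add: sum_incl_def psingle_def)

lemma psingle_in_PiE:
  assumes "\<And>i. i \<in> I \<Longrightarrow> group (G i)" "i \<in> I \<Longrightarrow> a \<in> carrier (G i)"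
  shows "psingle I G i a \<in> (\<Pi>\<^sub>E i\<in>I. carrier (G i))"
proof -
  have "\<one>\<^bsub>G j\<^esub> \<in> carrier (G j)" if "j \<in> I" for j
    using assms(1)[OF that] group.is_monoid monoid.one_closed by blast
  then show ?thesis using assms(2) by (auto simp: psingle_def)
qed

lemma sum_incl_closed:
  assumes "finite (topspace X)" "abelian_data X F" "p \<in> topspace X" "a \<in> carrier (stalk F p)"
  shows "sum_incl X F p a \<in> carrier (data_sum X F)"
  unfolding data_sum_carrier[OF assms(1,2)] sum_incl_psingle
  by (rule psingle_in_PiE) (use assms data_group in auto)

text \<open>The map of \<open>colim_map\<close> before passing to cosets: apply the morphism
  pointwise and extend by units. Statements on colimits become statements on \<open>push\<close>
  modulo \<open>colim_relations\<close>.\<close>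

definition push :: "'a topology \<Rightarrow> 'a topology \<Rightarrow> ('a, 'h) ab_data \<Rightarrow> ('a \<Rightarrow> 'g \<Rightarrow> 'h) \<Rightarrow> ('a \<Rightarrow> 'g) \<Rightarrow> 'a \<Rightarrow> 'h" where
  "push S T G \<phi> x = (\<lambda>i \<in> topspace T. if i \<in> topspace S then \<phi> i (x i) else \<one>\<^bsub>stalk G i\<^esub>)"

lemma colim_map_push: "colim_map S F T G \<phi> = coset_map (data_sum T G) (colim_relations T G) (push S T G \<phi>)"
  by (simp add: colim_map_def push_def[abs_def])

lemma push_hom:
  assumes "finite (topspace S)" "finite (topspace T)" "subspace_of S T" "abelian_data S F" "abelian_data T G"
    "\<phi> \<in> data_hom S F G"
  shows "push S T G \<phi> \<in> hom (data_sum S F) (data_sum T G)"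
proof (rule homI)
  fix x assume x: "x \<in> carrier (data_sum S F)"
  have one: "\<one>\<^bsub>stalk G i\<^esub> \<in> carrier (stalk G i)" if "i \<in> topspace T" for i
    using data_group[OF assms(5) that] group.is_monoid monoid.one_closed by blast
  show "push S T G \<phi> x \<in> carrier (data_sum T G)"
    using x one data_hom_closed[OF assms(6)] unfolding data_sum_carrier[OF assms(1,4)] data_sum_carrier[OF assms(2,5)]
    by (auto simp: push_def PiE_iff)
  fix y assume y: "y \<in> carrier (data_sum S F)"
  show "push S T G \<phi> (x \<otimes>\<^bsub>data_sum S F\<^esub> y) = push S T G \<phi> x \<otimes>\<^bsub>data_sum T G\<^esub> push S T G \<phi> y"
    unfolding push_def data_sum_mult
  proof (rule restrict_ext)
    fix i assume i: "i \<in> topspace T"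
    show "(if i \<in> topspace S then \<phi> i ((\<lambda>p\<in>topspace S. x p \<otimes>\<^bsub>stalk F p\<^esub> y p) i) else \<one>\<^bsub>stalk G i\<^esub>) =
        (\<lambda>i\<in>topspace T. if i \<in> topspace S then \<phi> i (x i) else \<one>\<^bsub>stalk G i\<^esub>) i \<otimes>\<^bsub>stalk G i\<^esub>
        (\<lambda>i\<in>topspace T. if i \<in> topspace S then \<phi> i (y i) else \<one>\<^bsub>stalk G i\<^esub>) i"
    proof (cases "i \<in> topspace S")
      case True
      then have "x i \<in> carrier (stalk F i)" "y i \<in> carrier (stalk F i)"
        using x y unfolding data_sum_carrier[OF assms(1,4)] by auto
      then show ?thesis using i True by (simp add: hom_mult[OF data_hom_hom[OF assms(6)]])
    next
      case False
      interpret group "stalk G i" using data_group[OF assms(5) i] .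
      show ?thesis using i False by simp
    qed
  qed
qed

lemma generate_hom_in:
  assumes "group G" "group H" "h \<in> hom G H" "subgroup M H" "S \<subseteq> carrier G"
    "\<And>s. s \<in> S \<Longrightarrow> h s \<in> M" "x \<in> generate G S"
  shows "h x \<in> M"
proof -
  interpret group_hom G H h using assms by (simp add: group_hom_def group_hom_axioms_def)
  interpret M: subgroup M H by fact
  show ?thesis using assms(7)
  proof (induction x rule: generate.induct)
    case one
    then show ?case by simp
  next
    case (incl s)
    then show ?case using assms(6) by simp
  next
    case (inv s)
    then show ?case using assms(5,6) by (simp add: subset_iff)
  next
    case (eng x y)
    then have "x \<in> carrier G" "y \<in> carrier G" using G.generate_in_carrier assms(5) by auto
    then show ?case using eng by simp
  qed
qed

definition relator :: "'a topology \<Rightarrow> ('a, 'g) ab_data \<Rightarrow> 'a \<Rightarrow> 'a \<Rightarrow> 'g \<Rightarrow> 'a \<Rightarrow> 'g" where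
  "relator X F p q a = sum_incl X F q (trans_map F p q a)
     \<otimes>\<^bsub>data_sum X F\<^esub> inv\<^bsub>data_sum X F\<^esub> (sum_incl X F p a)"

lemma colim_relations_relator:
  "colim_relations X F = generate (data_sum X F)
     {relator X F p q a | p q a. spec_le X p q \<and> a \<in> carrier (stalk F p)}"
  by (simp add: colim_relations_def relator_def)

lemma relator_closed:
  assumes "finite (topspace X)" "abelian_data X F" "spec_le X p q" "a \<in> carrier (stalk F p)"
  shows "relator X F p q a \<in> carrier (data_sum X F)"
proof -
  interpret comm_group "data_sum X F" using assms(1,2) by (rule comm_group_data_sum)
  show ?thesis unfolding relator_def
    using assms by (intro m_closed inv_closed sum_incl_closed data_trans_closed) (auto simp: spec_le_topspace)
qed

lemma subgroup_colim_relations: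
  assumes "finite (topspace X)" "abelian_data X F"
  shows "subgroup (colim_relations X F) (data_sum X F)"
proof -
  interpret comm_group "data_sum X F" using assms by (rule comm_group_data_sum)
  show ?thesis unfolding colim_relations_relator
    using relator_closed[OF assms] by (intro generate_is_subgroup) auto
qed

lemma relator_in_relations:
  assumes "spec_le X p q" "a \<in> carrier (stalk F p)"
  shows "relator X F p q a \<in> colim_relations X F"
  unfolding colim_relations_relator using assms by (intro generate.incl) auto

text \<open>Replaces the universal property of the colimit: a homomorphism out of the sum has to be
  tested on relators only.\<close>

lemma relations_hom_in:
  assumes "finite (topspace X)" "abelian_data X F" "group H" "h \<in> hom (data_sum X F) H" "subgroup M H"
    "\<And>p q a. spec_le X p q \<Longrightarrow> a \<in> carrier (stalk F p) \<Longrightarrow> h (relator X F p q a) \<in> M"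
    "x \<in> colim_relations X F"
  shows "h x \<in> M"
proof (rule generate_hom_in[OF _ assms(3,4,5)])
  show "group (data_sum X F)" using comm_group_data_sum[OF assms(1,2)] by (simp add: comm_group_def)
  show "x \<in> generate (data_sum X F) {relator X F p q a | p q a. spec_le X p q \<and> a \<in> carrier (stalk F p)}"
    using assms(7) by (simp add: colim_relations_relator)
qed (use assms(6) relator_closed[OF assms(1,2)] in auto)

lemma hom_inv: "group G \<Longrightarrow> group H \<Longrightarrow> h \<in> hom G H \<Longrightarrow> x \<in> carrier G \<Longrightarrow> h (inv\<^bsub>G\<^esub> x) = inv\<^bsub>H\<^esub> h x"
  by (simp add: group_hom.hom_inv group_hom_def group_hom_axioms_def)

lemma push_sum_incl:
  assumes "subspace_of S T" "abelian_data S F" "abelian_data T G" "\<phi> \<in> data_hom S F G" "p \<in> topspace S"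
  shows "push S T G \<phi> (sum_incl S F p a) = sum_incl T G p (\<phi> p a)"
proof -
  have "abelian_data S G" using abelian_data_subspace assms by blast
  then show ?thesis unfolding push_def sum_incl_def
    using assms data_hom_one[OF assms(2) _ assms(4)] by (intro restrict_ext) auto
qed

text \<open>Naturality of the morphism carries each relator to the relator of the image
  element.\<close>

lemma push_relations:
  assumes "finite (topspace S)" "finite (topspace T)" "subspace_of S T" "abelian_data S F" "abelian_data T G"
    "\<phi> \<in> data_hom S F G" "x \<in> colim_relations S F"
  shows "push S T G \<phi> x \<in> colim_relations T G"
proof (rule relations_hom_in[OF assms(1,4) _ push_hom[OF assms(1-6)] subgroup_colim_relations[OF assms(2,5)] _ assms(7)])
  show gT: "group (data_sum T G)" using comm_group_data_sum[OF assms(2,5)] by (simp add: comm_group_def)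
  have gS: "group (data_sum S F)" using comm_group_data_sum[OF assms(1,4)] by (simp add: comm_group_def)
  fix p q a assume pq: "spec_le S p q" and a: "a \<in> carrier (stalk F p)"
  then have p: "p \<in> topspace S" and q: "q \<in> topspace S" by (auto simp: spec_le_topspace)
  note ia = sum_incl_closed[OF assms(1,4) p a]
  note ib = sum_incl_closed[OF assms(1,4) q data_trans_closed[OF assms(4) pq a]]
  have iv: "inv\<^bsub>data_sum S F\<^esub> sum_incl S F p a \<in> carrier (data_sum S F)"
    using gS ia by (rule group.inv_closed)
  have "push S T G \<phi> (relator S F p q a) = relator T G p q (\<phi> p a)"
    unfolding relator_def hom_mult[OF push_hom[OF assms(1-6)] ib iv] hom_inv[OF gS gT push_hom[OF assms(1-6)] ia]
      push_sum_incl[OF assms(3-6) p] push_sum_incl[OF assms(3-6) q] data_hom_natural[OF assms(6) pq a] ..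
  moreover have "spec_le T p q" using assms(3) pq by (simp add: subspace_of_def)
  ultimately show "push S T G \<phi> (relator S F p q a) \<in> colim_relations T G"
    using relator_in_relations data_hom_closed[OF assms(6) p a] by metis
qed

definition cls :: "'a topology \<Rightarrow> ('a, 'g) ab_data \<Rightarrow> ('a \<Rightarrow> 'g) \<Rightarrow> ('a \<Rightarrow> 'g) set" where
  "cls X F x = colim_relations X F #>\<^bsub>data_sum X F\<^esub> x"

lemma comm_group_colim:
  assumes "finite (topspace X)" "abelian_data X F"
  shows "comm_group (colim X F)"
  unfolding colim_def
  by (rule comm_group.abelian_FactGroup[OF comm_group_data_sum[OF assms] subgroup_colim_relations[OF assms]])

lemma carrier_colim: "carrier (colim X F) = cls X F ` carrier (data_sum X F)"
  unfolding colim_def carrier_FactGroup cls_def[abs_def] ..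

lemma cls_eq_iff:
  assumes "finite (topspace X)" "abelian_data X F" "x \<in> carrier (data_sum X F)" "y \<in> carrier (data_sum X F)"
  shows "cls X F x = cls X F y \<longleftrightarrow> x \<otimes>\<^bsub>data_sum X F\<^esub> inv\<^bsub>data_sum X F\<^esub> y \<in> colim_relations X F"
  unfolding cls_def
  by (rule rcoset_eq_iff[OF comm_group_data_sum[OF assms(1,2)] subgroup_colim_relations[OF assms(1,2)] assms(3,4)])

lemma cls_one_iff:
  assumes "finite (topspace X)" "abelian_data X F" "x \<in> carrier (data_sum X F)"
  shows "cls X F x = \<one>\<^bsub>colim X F\<^esub> \<longleftrightarrow> x \<in> colim_relations X F"
  unfolding cls_def colim_def one_FactGroup
  by (rule rcoset_eq_one_iff[OF comm_group_data_sum[OF assms(1,2)] subgroup_colim_relations[OF assms(1,2)] assms(3)])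

lemma cls_mult:
  assumes "finite (topspace X)" "abelian_data X F" "x \<in> carrier (data_sum X F)" "y \<in> carrier (data_sum X F)"
  shows "cls X F x \<otimes>\<^bsub>colim X F\<^esub> cls X F y = cls X F (x \<otimes>\<^bsub>data_sum X F\<^esub> y)"
  unfolding cls_def colim_def
  by (rule rcoset_mult[OF comm_group_data_sum[OF assms(1,2)] subgroup_colim_relations[OF assms(1,2)] assms(3,4)])

lemma cls_hom:
  assumes "finite (topspace X)" "abelian_data X F"
  shows "cls X F \<in> hom (data_sum X F) (colim X F)"
  using carrier_colim by (intro homI) (auto simp: cls_mult[OF assms] simp del: mult_sum_group)

lemma colim_map_cls:
  assumes "finite (topspace S)" "finite (topspace T)" "subspace_of S T" "abelian_data S F" "abelian_data T G"
    "\<phi> \<in> data_hom S F G" "x \<in> carrier (data_sum S F)"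
  shows "colim_map S F T G \<phi> (cls S F x) = cls T G (push S T G \<phi> x)"
  unfolding colim_map_push cls_def
  by (rule coset_map_rcoset[OF comm_group_data_sum[OF assms(1,4)] comm_group_data_sum[OF assms(2,5)]
        subgroup_colim_relations[OF assms(1,4)] subgroup_colim_relations[OF assms(2,5)] push_hom[OF assms(1-6)] _ assms(7)])
    (use push_relations[OF assms(1-6)] in blast)

lemma colim_map_hom:
  assumes "finite (topspace S)" "finite (topspace T)" "subspace_of S T" "abelian_data S F" "abelian_data T G"
    "\<phi> \<in> data_hom S F G"
  shows "colim_map S F T G \<phi> \<in> hom (colim S F) (colim T G)"
  unfolding colim_map_push colim_def
  by (rule coset_map_hom[OF comm_group_data_sum[OF assms(1,4)] comm_group_data_sum[OF assms(2,5)]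
        subgroup_colim_relations[OF assms(1,4)] subgroup_colim_relations[OF assms(2,5)] push_hom[OF assms(1-6)]])
    (use push_relations[OF assms(1-6)] in blast)

section \<open>Finite products in an abelian group\<close>

context comm_group
begin

lemma finprod_int_pow:
  assumes "finite A" "f \<in> A \<rightarrow> carrier G"
  shows "finprod G f A [^] (k::int) = finprod G (\<lambda>a. f a [^] k) A"
  using assms
proof (induction A)
  case (insert a A)
  then have "f a \<in> carrier G" "f \<in> A \<rightarrow> carrier G" by auto
  then show ?case using insert by (simp add: int_pow_distrib Pi_iff)
qed simp

lemma finprod_hom:
  assumes "comm_group H" "h \<in> hom G H" "finite A" "f \<in> A \<rightarrow> carrier G"
  shows "h (finprod G f A) = finprod H (\<lambda>a. h (f a)) A"
proof -
  interpret H: comm_group H by fact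
  show ?thesis
    using assms(3,4)
  proof (induction A)
    case empty
    show ?case using hom_one[OF assms(2) is_group H.is_group] by simp
  next
    case (insert a A)
    then have "f a \<in> carrier G" "f \<in> A \<rightarrow> carrier G" by auto
    moreover from this have "h (f a) \<in> carrier H" "(\<lambda>a. h (f a)) \<in> A \<rightarrow> carrier H"
      using hom_in_carrier[OF assms(2)] by auto
    ultimately show ?case using insert hom_mult[OF assms(2)] by simp
  qed
qed

lemma finprod_swap:
  assumes "finite A" "finite B" "\<And>a b. a \<in> A \<Longrightarrow> b \<in> B \<Longrightarrow> f a b \<in> carrier G"
  shows "finprod G (\<lambda>a. finprod G (f a) B) A = finprod G (\<lambda>b. finprod G (\<lambda>a. f a b) A) B"
  using assms(1,3)
proof (induction A)
  case (insert a A)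
  have "finprod G (f a) B \<in> carrier G" "(\<lambda>a. finprod G (f a) B) \<in> A \<rightarrow> carrier G"
    "f a \<in> B \<rightarrow> carrier G" "(\<lambda>b. finprod G (\<lambda>a. f a b) A) \<in> B \<rightarrow> carrier G"
    using insert by (auto intro!: finprod_closed)
  then have "finprod G (\<lambda>a. finprod G (f a) B) (insert a A)
      = finprod G (\<lambda>b. f a b \<otimes> finprod G (\<lambda>a. f a b) A) B"
    using insert by simp
  also have "\<dots> = finprod G (\<lambda>b. finprod G (\<lambda>a. f a b) (insert a A)) B"
    using insert by (intro finprod_cong') (auto simp: Pi_iff)
  finally show ?case .
qed simp

lemma finprod_pow_sum:
  assumes "finite B" "a \<in> carrier G"
  shows "finprod G (\<lambda>b. a [^] (k b :: int)) B = a [^] (\<Sum>b\<in>B. k b)"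
  using assms(1) by (induction B) (simp_all add: assms(2) int_pow_mult Pi_iff)

end

subsection \<open>The bar complex\<close>

definition chains :: "'a topology \<Rightarrow> nat \<Rightarrow> 'a list set" where
  "chains S n = {xs. length xs = Suc n \<and> set xs \<subseteq> topspace S \<and> sorted_wrt (spec_le S) xs}"

definition del :: "nat \<Rightarrow> 'a list \<Rightarrow> 'a list" where
  "del i xs = take i xs @ drop (Suc i) xs"

text \<open>
  Degenerate chains are kept and the coefficients sit at the least point of a chain.  The
  differential is written through the integer incidence matrix \<open>inc\<close>, so that \<open>d d = 0\<close> is an identity
  of integer sums.  The value of \<open>ztr\<close> on incomparable points is irrelevant: the incidence is then 0.
\<close>

definition inc :: "'a list \<Rightarrow> 'a list \<Rightarrow> int" where
  "inc xs ys = (\<Sum>i<length xs. if del i xs = ys then (-1) ^ i else 0)"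

definition bar :: "'a topology \<Rightarrow> ('a, 'g) ab_data \<Rightarrow> nat \<Rightarrow> ('a list \<Rightarrow> 'g) monoid" where
  "bar S M n = product_group (chains S n) (\<lambda>xs. stalk M (hd xs))"

definition ztr :: "'a topology \<Rightarrow> ('a, 'g) ab_data \<Rightarrow> 'a \<Rightarrow> 'a \<Rightarrow> 'g \<Rightarrow> 'g" where
  "ztr S M p q a = (if spec_le S p q then trans_map M p q a else \<one>\<^bsub>stalk M q\<^esub>)"

definition bard :: "'a topology \<Rightarrow> ('a, 'g) ab_data \<Rightarrow> nat \<Rightarrow> ('a list \<Rightarrow> 'g) \<Rightarrow> 'a list \<Rightarrow> 'g" where
  "bard S M n c = (\<lambda>ys \<in> chains S n. finprod (stalk M (hd ys))
     (\<lambda>xs. ztr S M (hd xs) (hd ys) (c xs) [^]\<^bsub>stalk M (hd ys)\<^esub> inc xs ys) (chains S (Suc n)))"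

lemma finite_chains:
  assumes "finite (topspace S)"
  shows "finite (chains S n)"
  by (rule finite_subset[OF _ finite_lists_length_eq[OF assms, of "Suc n"]]) (auto simp: chains_def)

lemma chains_hd: "xs \<in> chains S n \<Longrightarrow> hd xs \<in> topspace S"
  by (cases xs) (auto simp: chains_def)

lemma chains_hd_le:
  assumes "xs \<in> chains S n" "x \<in> set xs"
  shows "spec_le S (hd xs) x"
  using assms by (cases xs) (auto simp: chains_def spec_le_refl)

lemma set_del: "set (del i xs) \<subseteq> set xs"
  unfolding del_def using set_take_subset[of i xs] set_drop_subset[of "Suc i" xs] by auto

lemma length_del: "i < length xs \<Longrightarrow> length (del i xs) = length xs - 1"
  by (simp add: del_def)

lemma del_in_chains:
  assumes "xs \<in> chains S (Suc n)" "i < length xs"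
  shows "del i xs \<in> chains S n"
proof -
  have "sorted_wrt (spec_le S) (take i xs @ drop i xs)"
    using assms by (simp add: chains_def)
  then have 1: "sorted_wrt (spec_le S) (take i xs)" "sorted_wrt (spec_le S) (drop i xs)"
    "\<forall>x\<in>set (take i xs). \<forall>y\<in>set (drop i xs). spec_le S x y"
    unfolding sorted_wrt_append by auto
  have "drop i xs = xs ! i # drop (Suc i) xs" using assms(2) by (simp add: Cons_nth_drop_Suc)
  then have "sorted_wrt (spec_le S) (del i xs)"
    using 1 unfolding del_def sorted_wrt_append by auto
  then show ?thesis using assms set_del[of i xs] by (auto simp: chains_def length_del)
qed

lemma inc_nonzero:
  assumes "inc xs ys \<noteq> 0"
  obtains i where "i < length xs" "del i xs = ys"
proof -
  have "\<exists>i<length xs. del i xs = ys"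
  proof (rule ccontr)
    assume "\<not> (\<exists>i<length xs. del i xs = ys)"
    then have "inc xs ys = 0" unfolding inc_def by (intro sum.neutral) auto
    with assms show False by simp
  qed
  then show ?thesis using that by blast
qed

text \<open>A face is a subsequence, so its first point is not below the first point of the chain.
  Wherever the incidence is nonzero, the map in \<open>ztr\<close> is thus a genuine transition
  map.\<close>

lemma inc_nonzero_le:
  assumes "xs \<in> chains S (Suc n)" "ys \<in> chains S n" "inc xs ys \<noteq> 0"
  shows "spec_le S (hd xs) (hd ys)"
proof -
  obtain i where "i < length xs" "del i xs = ys" using inc_nonzero assms(3) by blast
  moreover have "hd ys \<in> set ys" using assms(2) by (cases ys) (auto simp: chains_def)
  ultimately have "hd ys \<in> set xs" using set_del by fastforce
  then show ?thesis by (rule chains_hd_le[OF assms(1)])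
qed

text \<open>The simplicial identity: after a deletion at the smaller index \<open>j\<close>, the
  entry at \<open>i\<close> has moved to \<open>i - 1\<close>.\<close>

lemma del_del:
  assumes "j < i" "i < length xs"
  shows "del j (del i xs) = del (i - 1) (del j xs)"
proof (rule nth_equalityI)
  show "length (del j (del i xs)) = length (del (i - 1) (del j xs))"
    using assms by (simp add: length_del)
  fix k assume "k < length (del j (del i xs))"
  then have "k < length xs - 2" using assms by (simp add: length_del)
  moreover have nth: "del i ys ! k = (if k < i then ys ! k else ys ! Suc k)"
    if "i < length ys" "k < length ys - 1" for i k and ys :: "'a list"
    using that by (auto simp: del_def nth_append)
  ultimately show "del j (del i xs) ! k = del (i - 1) (del j xs) ! k"
    using assms by (auto simp: nth length_del)
qed

text \<open>The bijection from \<open>(i, j)\<close> to \<open>(j, i - 1)\<close> takes the region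
  \<open>j < i\<close> to the region \<open>i \<le> j\<close>, preserves \<open>f\<close> and lowers
  the exponent by one, so the two halves cancel.\<close>

lemma alternating_double_sum:
  fixes f :: "nat \<Rightarrow> nat \<Rightarrow> int"
  assumes "\<And>i j. j < i \<Longrightarrow> i \<le> Suc m \<Longrightarrow> f i j = f j (i - 1)"
  shows "(\<Sum>i\<le>Suc m. \<Sum>j\<le>m. (-1) ^ (i + j) * f i j) = 0"
proof -
  let ?g = "\<lambda>(i, j). (-1) ^ (i + j) * f i j"
  let ?A = "{(i, j). j < i \<and> i \<le> Suc m}" and ?B = "{(i, j). i \<le> j \<and> j \<le> m}"
  have AB: "{..Suc m} \<times> {..m} = ?A \<union> ?B" by auto
  have fin: "finite ?A" "finite ?B"
    by (rule finite_subset[of _ "{..Suc m} \<times> {..m}"]; auto)+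
  have "(\<Sum>i\<le>Suc m. \<Sum>j\<le>m. (-1) ^ (i + j) * f i j) = sum ?g ({..Suc m} \<times> {..m})"
    by (simp add: sum.cartesian_product)
  also have "\<dots> = sum ?g ?A + sum ?g ?B"
  proof -
    have "?A \<inter> ?B = {}" by auto
    then show ?thesis unfolding AB by (rule sum.union_disjoint[OF fin])
  qed
  also have "sum ?g ?A = sum (\<lambda>x. - ?g x) ?B"
  proof (rule sum.reindex_bij_witness[where i = "\<lambda>(i, j). (Suc j, i)" and j = "\<lambda>(i, j). (j, i - 1)"])
    fix x assume "x \<in> ?A"
    then obtain i j where "x = (i, j)" "j < i" "i \<le> Suc m" by auto
    moreover from this have "(-1 :: int) ^ (j + (i - 1)) = - ((-1) ^ (i + j))"
      by (cases i) (auto simp: add.commute)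
    ultimately show "- (case case x of (i, j) \<Rightarrow> (j, i - 1) of (i, j) \<Rightarrow> (- 1) ^ (i + j) * f i j)
        = (case x of (i, j) \<Rightarrow> (- 1) ^ (i + j) * f i j)"
      using assms[of j i] by simp
  qed auto
  finally show ?thesis by (simp add: sum_negf)
qed

text \<open>Summing over \<open>ys\<close> selects the faces of \<open>xs\<close> and leaves a
  signed double sum over two successive deletions; by \<open>del_del\<close> these cancel in
  pairs.\<close>

lemma inc_inc:
  assumes "finite (topspace S)" "xs \<in> chains S (Suc (Suc n))"
  shows "(\<Sum>ys\<in>chains S (Suc n). inc xs ys * inc ys ws) = 0"
proof -
  have len: "length xs = Suc (Suc (Suc n))" using assms by (simp add: chains_def)
  have "(\<Sum>ys\<in>chains S (Suc n). inc xs ys * inc ys ws) =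
      (\<Sum>ys\<in>chains S (Suc n). \<Sum>i<length xs. (if del i xs = ys then (-1) ^ i * inc ys ws else 0))"
    unfolding inc_def[of xs] sum_distrib_right by (intro sum.cong) auto
  also have "\<dots> = (\<Sum>i<length xs. \<Sum>ys\<in>chains S (Suc n). (if del i xs = ys then (-1) ^ i * inc ys ws else 0))"
    by (rule sum.swap)
  also have "\<dots> = (\<Sum>i<length xs. (-1) ^ i * inc (del i xs) ws)"
    using del_in_chains[OF assms(2)] finite_chains[OF assms(1)] by (intro sum.cong) (auto simp: sum.delta')
  also have "\<dots> = (\<Sum>i\<le>Suc (Suc n). \<Sum>j\<le>Suc n. (-1) ^ (i + j) * (if del j (del i xs) = ws then 1 else 0))"
    unfolding len lessThan_Suc_atMost
  proof (rule sum.cong)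
    fix i assume "i \<in> {..Suc (Suc n)}"
    then have "length (del i xs) = Suc (Suc n)" using len by (simp add: length_del)
    then show "(-1) ^ i * inc (del i xs) ws =
        (\<Sum>j\<le>Suc n. (-1) ^ (i + j) * (if del j (del i xs) = ws then 1 else 0))"
      unfolding inc_def sum_distrib_left by (intro sum.cong) (auto simp: power_add)
  qed simp
  also have "\<dots> = 0"
  proof (rule alternating_double_sum)
    fix i j :: nat assume "j < i" "i \<le> Suc (Suc n)"
    then have "del j (del i xs) = del (i - 1) (del j xs)" using len by (intro del_del) auto
    then show "(if del j (del i xs) = ws then 1 else 0 :: int) = (if del (i - 1) (del j xs) = ws then 1 else 0)"
      by simp
  qed
  finally show ?thesis .
qed

lemma ztr_hom:
  assumes "abelian_data S M" "p \<in> topspace S" "q \<in> topspace S"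
  shows "ztr S M p q \<in> hom (stalk M p) (stalk M q)"
proof (cases "spec_le S p q")
  case True
  then have "ztr S M p q = trans_map M p q" by (simp add: ztr_def fun_eq_iff)
  then show ?thesis using data_trans_hom[OF assms(1) True] by simp
next
  case False
  interpret group "stalk M q" using data_group[OF assms(1,3)] .
  show ?thesis using False by (intro homI) (simp_all add: ztr_def)
qed

lemma ztr_closed:
  assumes "abelian_data S M" "p \<in> topspace S" "q \<in> topspace S" "a \<in> carrier (stalk M p)"
  shows "ztr S M p q a \<in> carrier (stalk M q)"
  by (rule hom_in_carrier[OF ztr_hom[OF assms(1-3)] assms(4)])

context
  fixes S :: "'a topology" and M :: "('a, 'g) ab_data"
  assumes M: "abelian_data S M"
begin

lemma comm_group_bar: "comm_group (bar S M n)"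
  unfolding bar_def by (intro comm_group_product_group data_comm_group[OF M] chains_hd)

lemma carrier_bar: "carrier (bar S M n) = (\<Pi>\<^sub>E xs\<in>chains S n. carrier (stalk M (hd xs)))"
  by (simp add: bar_def)

lemma bar_mult: "x \<otimes>\<^bsub>bar S M n\<^esub> y = (\<lambda>xs\<in>chains S n. x xs \<otimes>\<^bsub>stalk M (hd xs)\<^esub> y xs)"
  by (simp add: bar_def)

lemma bar_one: "\<one>\<^bsub>bar S M n\<^esub> = (\<lambda>xs\<in>chains S n. \<one>\<^bsub>stalk M (hd xs)\<^esub>)"
  by (simp add: bar_def)

lemma bar_inv: "x \<in> carrier (bar S M n) \<Longrightarrow> inv\<^bsub>bar S M n\<^esub> x = (\<lambda>xs\<in>chains S n. inv\<^bsub>stalk M (hd xs)\<^esub> x xs)"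
  unfolding bar_def by (rule inv_product_group) (simp_all add: data_group[OF M] chains_hd)

lemma bar_closed: "c \<in> carrier (bar S M n) \<Longrightarrow> xs \<in> chains S n \<Longrightarrow> c xs \<in> carrier (stalk M (hd xs))"
  by (auto simp: carrier_bar)

lemma bard_term_closed:
  assumes "c \<in> carrier (bar S M n)" "xs \<in> chains S n" "q \<in> topspace S"
  shows "ztr S M (hd xs) q (c xs) [^]\<^bsub>stalk M q\<^esub> (k::int) \<in> carrier (stalk M q)"
  by (rule group.int_pow_closed[OF data_group[OF M assms(3)] ztr_closed[OF M chains_hd[OF assms(2)] assms(3)]])
    (rule bar_closed[OF assms(1,2)])

lemma bard_apply: "ys \<in> chains S n \<Longrightarrow> bard S M n c ys = finprod (stalk M (hd ys))
     (\<lambda>xs. ztr S M (hd xs) (hd ys) (c xs) [^]\<^bsub>stalk M (hd ys)\<^esub> inc xs ys) (chains S (Suc n))"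
  by (simp add: bard_def)

lemma bard_closed:
  assumes c: "c \<in> carrier (bar S M (Suc n))"
  shows "bard S M n c \<in> carrier (bar S M n)"
  unfolding carrier_bar
proof (rule PiE_I)
  fix ys assume ys: "ys \<in> chains S n"
  interpret comm_group "stalk M (hd ys)" using data_comm_group[OF M chains_hd[OF ys]] .
  show "bard S M n c ys \<in> carrier (stalk M (hd ys))"
    unfolding bard_apply[OF ys]
    by (rule finprod_closed) (auto intro: bard_term_closed[OF c _ chains_hd[OF ys]])
qed (simp add: bard_def)

lemma bard_hom: "bard S M n \<in> hom (bar S M (Suc n)) (bar S M n)"
proof (rule homI)
  fix x assume x: "x \<in> carrier (bar S M (Suc n))"
  show "bard S M n x \<in> carrier (bar S M n)" using bard_closed[OF x] .
  fix y assume y: "y \<in> carrier (bar S M (Suc n))"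
  show "bard S M n (x \<otimes>\<^bsub>bar S M (Suc n)\<^esub> y) = bard S M n x \<otimes>\<^bsub>bar S M n\<^esub> bard S M n y"
    unfolding bar_mult[of n] bard_def[of _ _ _ "x \<otimes>\<^bsub>bar S M (Suc n)\<^esub> y"]
  proof (rule restrict_ext)
    fix ys assume ys: "ys \<in> chains S n"
    interpret comm_group "stalk M (hd ys)" using data_comm_group[OF M chains_hd[OF ys]] .
    let ?t = "\<lambda>z xs. ztr S M (hd xs) (hd ys) (z xs) [^]\<^bsub>stalk M (hd ys)\<^esub> inc xs ys"
    have "finprod (stalk M (hd ys)) (?t (x \<otimes>\<^bsub>bar S M (Suc n)\<^esub> y)) (chains S (Suc n)) =
        finprod (stalk M (hd ys)) (\<lambda>xs. ?t x xs \<otimes>\<^bsub>stalk M (hd ys)\<^esub> ?t y xs) (chains S (Suc n))"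
    proof (rule finprod_cong')
      fix xs assume xs: "xs \<in> chains S (Suc n)"
      note h = ztr_hom[OF M chains_hd[OF xs] chains_hd[OF ys]]
      show "?t (x \<otimes>\<^bsub>bar S M (Suc n)\<^esub> y) xs = ?t x xs \<otimes>\<^bsub>stalk M (hd ys)\<^esub> ?t y xs"
        using xs hom_mult[OF h bar_closed[OF x xs] bar_closed[OF y xs]] hom_in_carrier[OF h]
          bar_closed[OF x xs] bar_closed[OF y xs]
        by (simp add: bar_mult int_pow_distrib)
    qed (auto intro!: m_closed bard_term_closed x y chains_hd ys)
    also have "\<dots> = finprod (stalk M (hd ys)) (?t x) (chains S (Suc n)) \<otimes>\<^bsub>stalk M (hd ys)\<^esub>
        finprod (stalk M (hd ys)) (?t y) (chains S (Suc n))"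
      by (rule finprod_multf) (auto intro!: bard_term_closed x y chains_hd ys)
    finally show "finprod (stalk M (hd ys)) (?t (x \<otimes>\<^bsub>bar S M (Suc n)\<^esub> y)) (chains S (Suc n)) =
        bard S M n x ys \<otimes>\<^bsub>stalk M (hd ys)\<^esub> bard S M n y ys"
      unfolding bard_apply[OF ys] .
  qed
qed

text \<open>Exchanging the two products collects, for every chain \<open>xs\<close>, the powers of
  one and the same transported entry; its total exponent is the sum in \<open>inc_inc\<close>, which
  is zero.\<close>

lemma bard_bard:
  assumes fin: "finite (topspace S)" and c: "c \<in> carrier (bar S M (Suc (Suc n)))"
  shows "bard S M n (bard S M (Suc n) c) = \<one>\<^bsub>bar S M n\<^esub>"
  unfolding bar_one bard_def[of _ _ n]
proof (rule restrict_ext)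
  fix ws assume ws: "ws \<in> chains S n"
  let ?G = "stalk M (hd ws)"
  interpret comm_group ?G using data_comm_group[OF M chains_hd[OF ws]] .
  let ?a = "\<lambda>xs. ztr S M (hd xs) (hd ws) (c xs)"
  have a: "?a xs \<in> carrier ?G" if "xs \<in> chains S (Suc (Suc n))" for xs
    using ztr_closed[OF M chains_hd[OF that] chains_hd[OF ws] bar_closed[OF c that]] .
  have "finprod ?G (\<lambda>ys. ztr S M (hd ys) (hd ws) (bard S M (Suc n) c ys) [^]\<^bsub>?G\<^esub> inc ys ws) (chains S (Suc n))
      = finprod ?G (\<lambda>ys. finprod ?G (\<lambda>xs. ?a xs [^]\<^bsub>?G\<^esub> (inc xs ys * inc ys ws)) (chains S (Suc (Suc n))))
          (chains S (Suc n))"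
  proof (rule finprod_cong')
    fix ys assume ys: "ys \<in> chains S (Suc n)"
    let ?H = "stalk M (hd ys)"
    interpret H: comm_group ?H using data_comm_group[OF M chains_hd[OF ys]] .
    note h = ztr_hom[OF M chains_hd[OF ys] chains_hd[OF ws]]
    let ?t = "\<lambda>xs. ztr S M (hd xs) (hd ys) (c xs) [^]\<^bsub>?H\<^esub> inc xs ys"
    have t: "?t xs \<in> carrier ?H" if "xs \<in> chains S (Suc (Suc n))" for xs
      by (rule bard_term_closed[OF c that chains_hd[OF ys]])
    have "ztr S M (hd ys) (hd ws) (bard S M (Suc n) c ys) [^]\<^bsub>?G\<^esub> inc ys ws =
        finprod ?G (\<lambda>xs. ztr S M (hd ys) (hd ws) (?t xs)) (chains S (Suc (Suc n))) [^]\<^bsub>?G\<^esub> inc ys ws"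
      unfolding bard_apply[OF ys] using H.finprod_hom[OF comm_group_axioms h finite_chains[OF fin]] t by auto
    also have "\<dots> = finprod ?G (\<lambda>xs. ztr S M (hd ys) (hd ws) (?t xs) [^]\<^bsub>?G\<^esub> inc ys ws) (chains S (Suc (Suc n)))"
      using hom_in_carrier[OF h] t by (intro finprod_int_pow finite_chains[OF fin]) auto
    also have "\<dots> = finprod ?G (\<lambda>xs. ?a xs [^]\<^bsub>?G\<^esub> (inc xs ys * inc ys ws)) (chains S (Suc (Suc n)))"
    proof (rule finprod_cong')
      fix xs assume xs: "xs \<in> chains S (Suc (Suc n))"
      note z = ztr_closed[OF M chains_hd[OF xs] chains_hd[OF ys] bar_closed[OF c xs]]
      interpret h: group_hom ?H ?G "ztr S M (hd ys) (hd ws)"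
        by (intro hom_group_homI H.comm_group_axioms comm_group_axioms h)
      have "ztr S M (hd ys) (hd ws) (?t xs) [^]\<^bsub>?G\<^esub> inc ys ws =
          ztr S M (hd ys) (hd ws) (ztr S M (hd xs) (hd ys) (c xs)) [^]\<^bsub>?G\<^esub> (inc xs ys * inc ys ws)"
        using z by (simp add: h.hom_int_pow int_pow_pow)
      also have "\<dots> = ?a xs [^]\<^bsub>?G\<^esub> (inc xs ys * inc ys ws)"
      \<comment> \<open>For a zero exponent both powers are the unit, whatever \<open>ztr\<close>
        does; otherwise the three least points are comparable and functoriality of the transition
        maps applies.\<close>
      proof (cases "inc xs ys * inc ys ws = 0")
        case True
        show ?thesis unfolding True int_pow_0 ..
      next
        case False
        then have le: "spec_le S (hd xs) (hd ys)" "spec_le S (hd ys) (hd ws)"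
          using inc_nonzero_le[OF xs ys] inc_nonzero_le[OF ys ws] by auto
        then show ?thesis
          using data_trans_comp[OF M le bar_closed[OF c xs]] spec_le_trans[OF le] by (simp add: ztr_def)
      qed
      finally show "ztr S M (hd ys) (hd ws) (?t xs) [^]\<^bsub>?G\<^esub> inc ys ws = ?a xs [^]\<^bsub>?G\<^esub> (inc xs ys * inc ys ws)" .
    qed (auto intro!: int_pow_closed a)
    finally show "ztr S M (hd ys) (hd ws) (bard S M (Suc n) c ys) [^]\<^bsub>?G\<^esub> inc ys ws =
        finprod ?G (\<lambda>xs. ?a xs [^]\<^bsub>?G\<^esub> (inc xs ys * inc ys ws)) (chains S (Suc (Suc n)))" .
  qed (auto intro!: finprod_closed int_pow_closed a)
  also have "\<dots> = finprod ?G (\<lambda>xs. finprod ?G (\<lambda>ys. ?a xs [^]\<^bsub>?G\<^esub> (inc xs ys * inc ys ws)) (chains S (Suc n)))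
          (chains S (Suc (Suc n)))"
    by (intro finprod_swap finite_chains[OF fin] int_pow_closed a)
  also have "\<dots> = \<one>\<^bsub>?G\<^esub>"
    by (rule finprod_one_eqI) (simp add: finprod_pow_sum[OF finite_chains[OF fin] a] inc_inc[OF fin])
  finally show "finprod ?G (\<lambda>ys. ztr S M (hd ys) (hd ws) (bard S M (Suc n) c ys) [^]\<^bsub>?G\<^esub> inc ys ws) (chains S (Suc n))
      = \<one>\<^bsub>?G\<^esub>" .
qed

end

section \<open>Functoriality of the bar complex, and kernels of morphisms\<close>

definition barm :: "'a topology \<Rightarrow> ('a \<Rightarrow> 'g \<Rightarrow> 'h) \<Rightarrow> nat \<Rightarrow> ('a list \<Rightarrow> 'g) \<Rightarrow> 'a list \<Rightarrow> 'h" where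
  "barm S \<phi> n c = (\<lambda>xs\<in>chains S n. \<phi> (hd xs) (c xs))"

lemma barm_closed:
  assumes "abelian_data S M" "abelian_data S N" "\<phi> \<in> data_hom S M N" "c \<in> carrier (bar S M n)"
  shows "barm S \<phi> n c \<in> carrier (bar S N n)"
  unfolding carrier_bar[OF assms(2)] barm_def
  by (rule restrict_PiE_iff[THEN iffD2]) (auto intro!: data_hom_closed[OF assms(3)] chains_hd bar_closed[OF assms(1,4)])

lemma barm_hom:
  assumes "abelian_data S M" "abelian_data S N" "\<phi> \<in> data_hom S M N"
  shows "barm S \<phi> n \<in> hom (bar S M n) (bar S N n)"
proof (rule homI)
  fix x assume x: "x \<in> carrier (bar S M n)"
  show "barm S \<phi> n x \<in> carrier (bar S N n)" by (rule barm_closed[OF assms x])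
  fix y assume y: "y \<in> carrier (bar S M n)"
  show "barm S \<phi> n (x \<otimes>\<^bsub>bar S M n\<^esub> y) = barm S \<phi> n x \<otimes>\<^bsub>bar S N n\<^esub> barm S \<phi> n y"
    unfolding bar_mult[OF assms(2)] bar_mult[OF assms(1)] barm_def
  proof (rule restrict_ext)
    fix xs assume xs: "xs \<in> chains S n"
    show "\<phi> (hd xs) ((\<lambda>xs\<in>chains S n. x xs \<otimes>\<^bsub>stalk M (hd xs)\<^esub> y xs) xs) =
        (\<lambda>xs\<in>chains S n. \<phi> (hd xs) (x xs)) xs \<otimes>\<^bsub>stalk N (hd xs)\<^esub> (\<lambda>xs\<in>chains S n. \<phi> (hd xs) (y xs)) xs"
      using xs hom_mult[OF data_hom_hom[OF assms(3) chains_hd[OF xs]] bar_closed[OF assms(1) x xs] bar_closed[OF assms(1) y xs]]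
      by simp
  qed
qed

lemma ztr_natural:
  assumes "abelian_data S M" "abelian_data S N" "\<phi> \<in> data_hom S M N" "p \<in> topspace S" "q \<in> topspace S"
    "a \<in> carrier (stalk M p)"
  shows "\<phi> q (ztr S M p q a) = ztr S N p q (\<phi> p a)"
  using data_hom_natural[OF assms(3) _ assms(6)] data_hom_one[OF assms(1-3,5)] by (simp add: ztr_def)

text \<open>Each factor of the differential is a power of a transported entry, and a morphism
  respects powers, products and transition maps.\<close>

lemma barm_bard:
  assumes fin: "finite (topspace S)" and M: "abelian_data S M" and N: "abelian_data S N"
    and \<phi>: "\<phi> \<in> data_hom S M N" and c: "c \<in> carrier (bar S M (Suc n))"
  shows "barm S \<phi> n (bard S M n c) = bard S N n (barm S \<phi> (Suc n) c)"
  unfolding barm_def[of S \<phi> n] bard_def[of S N]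
proof (rule restrict_ext)
  fix ys assume ys: "ys \<in> chains S n"
  interpret M: comm_group "stalk M (hd ys)" using data_comm_group[OF M chains_hd[OF ys]] .
  interpret N: comm_group "stalk N (hd ys)" using data_comm_group[OF N chains_hd[OF ys]] .
  note h = data_hom_hom[OF \<phi> chains_hd[OF ys]]
  interpret h: group_hom "stalk M (hd ys)" "stalk N (hd ys)" "\<phi> (hd ys)"
    by (rule hom_group_homI[OF M.comm_group_axioms N.comm_group_axioms h])
  note t = bard_term_closed[OF M c _ chains_hd[OF ys]]
  have "\<phi> (hd ys) (bard S M n c ys) = finprod (stalk N (hd ys)) (\<lambda>xs. \<phi> (hd ys)
     (ztr S M (hd xs) (hd ys) (c xs) [^]\<^bsub>stalk M (hd ys)\<^esub> inc xs ys)) (chains S (Suc n))"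
    unfolding bard_apply[OF M ys]
    by (rule M.finprod_hom[OF N.comm_group_axioms h finite_chains[OF fin]]) (auto intro!: t)
  also have "\<dots> = finprod (stalk N (hd ys)) (\<lambda>xs. ztr S N (hd xs) (hd ys) (barm S \<phi> (Suc n) c xs)
      [^]\<^bsub>stalk N (hd ys)\<^esub> inc xs ys) (chains S (Suc n))"
  proof (rule N.finprod_cong')
    fix xs assume xs: "xs \<in> chains S (Suc n)"
    note cx = bar_closed[OF M c xs]
    show "\<phi> (hd ys) (ztr S M (hd xs) (hd ys) (c xs) [^]\<^bsub>stalk M (hd ys)\<^esub> inc xs ys) =
        ztr S N (hd xs) (hd ys) (barm S \<phi> (Suc n) c xs) [^]\<^bsub>stalk N (hd ys)\<^esub> inc xs ys"
      using xs h.hom_int_pow[OF ztr_closed[OF M chains_hd[OF xs] chains_hd[OF ys] cx]]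
        ztr_natural[OF M N \<phi> chains_hd[OF xs] chains_hd[OF ys] cx]
      by (simp add: barm_def)
  qed (auto intro!: bard_term_closed[OF N barm_closed[OF M N \<phi> c] _ chains_hd[OF ys]])
  finally show "\<phi> (hd ys) (bard S M n c ys) = finprod (stalk N (hd ys)) (\<lambda>xs. ztr S N (hd xs) (hd ys)
      (barm S \<phi> (Suc n) c xs) [^]\<^bsub>stalk N (hd ys)\<^esub> inc xs ys) (chains S (Suc n))" .
qed

lemma barm_surj:
  assumes "abelian_data S M" "abelian_data S N" "data_epi S M N \<pi>" "c \<in> carrier (bar S N n)"
  shows "\<exists>b \<in> carrier (bar S M n). barm S \<pi> n b = c"
proof -
  have "\<exists>b. b \<in> carrier (stalk M (hd xs)) \<and> \<pi> (hd xs) b = c xs" if "xs \<in> chains S n" for xs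
  proof -
    have "c xs \<in> \<pi> (hd xs) ` carrier (stalk M (hd xs))"
      using assms(3) chains_hd[OF that] bar_closed[OF assms(2,4) that] by (simp add: data_epi_def)
    then show ?thesis by auto
  qed
  then obtain b where b: "\<And>xs. xs \<in> chains S n \<Longrightarrow> b xs \<in> carrier (stalk M (hd xs)) \<and> \<pi> (hd xs) (b xs) = c xs"
    by metis
  have "barm S \<pi> n (restrict b (chains S n)) = c"
    using b assms(4) unfolding carrier_bar[OF assms(2)] barm_def by (auto simp: fun_eq_iff PiE_iff extensional_def)
  moreover have "restrict b (chains S n) \<in> carrier (bar S M n)"
    using b unfolding carrier_bar[OF assms(1)] by auto
  ultimately show ?thesis by blast
qed

text \<open>The kernel keeps the type and the transition maps of \<open>F\<close>, and
  \<open>G\<close> may live elsewhere. Kernels of maps between data in \<open>'g\<close> thus stay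
  among the data that have projective covers in \<open>'g\<close>.\<close>

definition ker_data :: "('a, 'g) ab_data \<Rightarrow> ('a, 'h) ab_data \<Rightarrow> ('a \<Rightarrow> 'g \<Rightarrow> 'h) \<Rightarrow> ('a, 'g) ab_data" where
  "ker_data F G \<phi> = \<lparr>stalk = (\<lambda>p. (stalk F p)\<lparr>carrier := kernel (stalk F p) (stalk G p) (\<phi> p)\<rparr>),
     trans_map = trans_map F\<rparr>"

lemma ker_data_simps:
  "carrier (stalk (ker_data F G \<phi>) p) = {a \<in> carrier (stalk F p). \<phi> p a = \<one>\<^bsub>stalk G p\<^esub>}"
  "\<one>\<^bsub>stalk (ker_data F G \<phi>) p\<^esub> = \<one>\<^bsub>stalk F p\<^esub>"
  "x \<otimes>\<^bsub>stalk (ker_data F G \<phi>) p\<^esub> y = x \<otimes>\<^bsub>stalk F p\<^esub> y"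
  "trans_map (ker_data F G \<phi>) = trans_map F"
  by (simp_all add: ker_data_def kernel_def)

lemma abelian_ker_data:
  assumes "abelian_data S F" "abelian_data S G" "\<phi> \<in> data_hom S F G"
  shows "abelian_data S (ker_data F G \<phi>)"
proof (rule abelian_dataI)
  fix p assume p: "p \<in> topspace S"
  interpret group_hom "stalk F p" "stalk G p" "\<phi> p" using data_hom_group_hom[OF assms p] .
  show "comm_group (stalk (ker_data F G \<phi>) p)"
    unfolding ker_data_def using comm_group_subgroup[OF data_comm_group[OF assms(1) p] subgroup_kernel] by simp
  fix a assume "a \<in> carrier (stalk (ker_data F G \<phi>) p)"
  then show "trans_map (ker_data F G \<phi>) p p a = a"
    using data_trans_id[OF assms(1) p] by (simp add: ker_data_simps)
next
  fix p q assume pq: "spec_le S p q"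
  then have p: "p \<in> topspace S" and q: "q \<in> topspace S" by (auto simp: spec_le_topspace)
  interpret G: group_hom "stalk G p" "stalk G q" "trans_map G p q"
    by (rule hom_group_homI[OF data_comm_group[OF assms(2) p] data_comm_group[OF assms(2) q] data_trans_hom[OF assms(2) pq]])
  show "trans_map (ker_data F G \<phi>) p q \<in> hom (stalk (ker_data F G \<phi>) p) (stalk (ker_data F G \<phi>) q)"
  proof (rule homI)
    fix x assume x: "x \<in> carrier (stalk (ker_data F G \<phi>) p)"
    then show "trans_map (ker_data F G \<phi>) p q x \<in> carrier (stalk (ker_data F G \<phi>) q)"
      using data_hom_natural[OF assms(3) pq] data_trans_closed[OF assms(1) pq] by (simp add: ker_data_simps)
    fix y assume "y \<in> carrier (stalk (ker_data F G \<phi>) p)"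
    then show "trans_map (ker_data F G \<phi>) p q (x \<otimes>\<^bsub>stalk (ker_data F G \<phi>) p\<^esub> y) =
        trans_map (ker_data F G \<phi>) p q x \<otimes>\<^bsub>stalk (ker_data F G \<phi>) q\<^esub> trans_map (ker_data F G \<phi>) p q y"
      using x hom_mult[OF data_trans_hom[OF assms(1) pq]] by (simp add: ker_data_simps)
  qed
next
  fix p q r a assume "spec_le S p q" "spec_le S q r" "a \<in> carrier (stalk (ker_data F G \<phi>) p)"
  then show "trans_map (ker_data F G \<phi>) q r (trans_map (ker_data F G \<phi>) p q a) = trans_map (ker_data F G \<phi>) p r a"
    using data_trans_comp[OF assms(1)] by (simp add: ker_data_simps)
qed

lemma ker_data_incl: "(\<lambda>p a. a) \<in> data_hom S (ker_data F G \<phi>) F"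
  by (rule data_homI) (auto intro!: homI simp: ker_data_simps)

context
  fixes S :: "'a topology" and B :: "('a, 'g) ab_data" and C :: "('a, 'h) ab_data" and \<pi>
  assumes fin: "finite (topspace S)" and B: "abelian_data S B" and C: "abelian_data S C"
    and \<pi>: "\<pi> \<in> data_hom S B C"
begin

lemma bar_ker_data_iff:
  "c \<in> carrier (bar S (ker_data B C \<pi>) n) \<longleftrightarrow> c \<in> carrier (bar S B n) \<and> barm S \<pi> n c = \<one>\<^bsub>bar S C n\<^esub>"
  unfolding carrier_bar[OF abelian_ker_data[OF B C \<pi>]] carrier_bar[OF B] bar_one[OF C] barm_def ker_data_simps
  by (auto simp: PiE_iff fun_eq_iff restrict_def)

text \<open>The inclusion into \<open>B\<close> is a morphism that acts as the identity on bar
  chains, so its compatibility with the differentials is the claimed equality.\<close>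

lemma bard_ker_data:
  assumes c: "c \<in> carrier (bar S (ker_data B C \<pi>) (Suc n))"
  shows "bard S (ker_data B C \<pi>) n c = bard S B n c"
proof -
  note K = abelian_ker_data[OF B C \<pi>]
  have id: "barm S (\<lambda>p a. a) m x = x" if "x \<in> carrier (bar S (ker_data B C \<pi>) m)" for m x
    using that unfolding carrier_bar[OF K] barm_def by (auto simp: fun_eq_iff PiE_iff extensional_def)
  show ?thesis
    using barm_bard[OF fin K B ker_data_incl c] unfolding id[OF c] id[OF bard_closed[OF K c]] .
qed

end

section \<open>Dimension shifting in the bar complex\<close>

definition exact_at :: "'a topology \<Rightarrow> ('a, 'g) ab_data \<Rightarrow> nat \<Rightarrow> bool" where
  "exact_at S M n \<longleftrightarrow> (\<forall>c \<in> carrier (bar S M (Suc n)). bard S M n c = \<one>\<^bsub>bar S M n\<^esub> \<longrightarrow>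
     c \<in> bard S M (Suc n) ` carrier (bar S M (Suc (Suc n))))"

text \<open>For an epimorphism \<open>\<pi>\<close> this is injectivity of the map that the
  inclusion of its kernel into \<open>B\<close> induces on bar homology of degree \<open>n\<close>,
  written with chains of \<open>B\<close> only.\<close>

definition inj_at :: "'a topology \<Rightarrow> ('a, 'g) ab_data \<Rightarrow> ('a, 'h) ab_data \<Rightarrow> ('a \<Rightarrow> 'g \<Rightarrow> 'h) \<Rightarrow> nat \<Rightarrow> bool" where
  "inj_at S B C \<pi> n \<longleftrightarrow> (\<forall>b \<in> carrier (bar S B (Suc n)). barm S \<pi> n (bard S B n b) = \<one>\<^bsub>bar S C n\<^esub> \<longrightarrow>
     (\<exists>a \<in> carrier (bar S B (Suc n)). barm S \<pi> (Suc n) a = \<one>\<^bsub>bar S C (Suc n)\<^esub> \<and> bard S B n a = bard S B n b))"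

text \<open>\<open>exact_at\<close> with index \<open>n\<close> concerns degree
  \<open>n + 1\<close>; degree 0 is left out because the bar homology there is the colimit
  itself.\<close>

definition acyclic_data :: "'a topology \<Rightarrow> ('a, 'g) ab_data \<Rightarrow> bool" where
  "acyclic_data S M \<longleftrightarrow> (\<forall>n. exact_at S M n)"

context
  fixes S :: "'a topology" and B :: "('a, 'g) ab_data" and C :: "('a, 'h) ab_data" and \<pi>
  assumes fin: "finite (topspace S)" and B: "abelian_data S B" and C: "abelian_data S C"
    and epi: "data_epi S B C \<pi>"
begin

lemma epi_hom: "\<pi> \<in> data_hom S B C"
  using epi by (simp add: data_epi_def)

text \<open>When \<open>C\<close> has no homology in degree \<open>n + 1\<close> the connecting map
  vanishes: the image of \<open>b\<close> bounds some \<open>c\<close>, and dividing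
  \<open>b\<close> by the boundary of a lift of \<open>c\<close> moves it into the kernel without
  changing its own boundary.\<close>

lemma inj_at_of_exact:
  assumes "exact_at S C n"
  shows "inj_at S B C \<pi> n"
  unfolding inj_at_def
proof (intro ballI impI)
  fix b assume b: "b \<in> carrier (bar S B (Suc n))" and "barm S \<pi> n (bard S B n b) = \<one>\<^bsub>bar S C n\<^esub>"
  then have "bard S C n (barm S \<pi> (Suc n) b) = \<one>\<^bsub>bar S C n\<^esub>"
    using barm_bard[OF fin B C epi_hom b] by simp
  then obtain c where c: "c \<in> carrier (bar S C (Suc (Suc n)))" "barm S \<pi> (Suc n) b = bard S C (Suc n) c"
    using assms barm_closed[OF B C epi_hom b] unfolding exact_at_def by blast
  obtain b' where b': "b' \<in> carrier (bar S B (Suc (Suc n)))" "barm S \<pi> (Suc (Suc n)) b' = c"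
    using barm_surj[OF B C epi c(1)] by blast
  interpret B1: comm_group "bar S B (Suc n)" by (rule comm_group_bar[OF B])
  interpret C1: comm_group "bar S C (Suc n)" by (rule comm_group_bar[OF C])
  interpret B0: comm_group "bar S B n" by (rule comm_group_bar[OF B])
  interpret m: group_hom "bar S B (Suc n)" "bar S C (Suc n)" "barm S \<pi> (Suc n)"
    by (rule hom_group_homI[OF B1.comm_group_axioms C1.comm_group_axioms barm_hom[OF B C epi_hom]])
  interpret d: group_hom "bar S B (Suc n)" "bar S B n" "bard S B n"
    by (rule hom_group_homI[OF B1.comm_group_axioms B0.comm_group_axioms bard_hom[OF B]])
  let ?db = "bard S B (Suc n) b'"
  have db: "?db \<in> carrier (bar S B (Suc n))" by (rule bard_closed[OF B b'(1)])
  let ?a = "b \<otimes>\<^bsub>bar S B (Suc n)\<^esub> inv\<^bsub>bar S B (Suc n)\<^esub> ?db"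
  have "barm S \<pi> (Suc n) ?db = barm S \<pi> (Suc n) b"
    using barm_bard[OF fin B C epi_hom b'(1)] b'(2) c(2) by simp
  then have "barm S \<pi> (Suc n) ?a = \<one>\<^bsub>bar S C (Suc n)\<^esub>"
    using b db by simp
  moreover have "bard S B n ?a = bard S B n b"
    using b db bard_bard[OF B fin b'(1)] by simp
  ultimately show "\<exists>a \<in> carrier (bar S B (Suc n)). barm S \<pi> (Suc n) a = \<one>\<^bsub>bar S C (Suc n)\<^esub> \<and> bard S B n a = bard S B n b"
    using b db by (intro bexI[of _ ?a]) auto
qed

text \<open>A cycle of the kernel bounds in \<open>B\<close> because the homology of
  \<open>B\<close> vanishes, and \<open>inj_at\<close> moves the bounding chain into the
  kernel.\<close>

lemma exact_at_kernel:
  assumes "inj_at S B C \<pi> (Suc n)" "exact_at S B n"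
  shows "exact_at S (ker_data B C \<pi>) n"
  unfolding exact_at_def
proof (intro ballI impI)
  note K = bar_ker_data_iff[OF fin B C epi_hom] and dK = bard_ker_data[OF fin B C epi_hom]
  fix c assume c: "c \<in> carrier (bar S (ker_data B C \<pi>) (Suc n))"
    and dc: "bard S (ker_data B C \<pi>) n c = \<one>\<^bsub>bar S (ker_data B C \<pi>) n\<^esub>"
  have cB: "c \<in> carrier (bar S B (Suc n))" "barm S \<pi> (Suc n) c = \<one>\<^bsub>bar S C (Suc n)\<^esub>"
    using c unfolding K by auto
  have "bard S B n c = \<one>\<^bsub>bar S B n\<^esub>"
    using dc unfolding dK[OF c] bar_one[OF abelian_ker_data[OF B C epi_hom]] bar_one[OF B] ker_data_simps .
  then obtain b where b: "b \<in> carrier (bar S B (Suc (Suc n)))" "c = bard S B (Suc n) b"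
    using assms(2) cB(1) unfolding exact_at_def by blast
  then obtain a where a: "a \<in> carrier (bar S B (Suc (Suc n)))"
    "barm S \<pi> (Suc (Suc n)) a = \<one>\<^bsub>bar S C (Suc (Suc n))\<^esub>" "bard S B (Suc n) a = c"
    using assms(1) cB(2) unfolding inj_at_def by blast
  then have "a \<in> carrier (bar S (ker_data B C \<pi>) (Suc (Suc n)))" unfolding K by blast
  then show "c \<in> bard S (ker_data B C \<pi>) (Suc n) ` carrier (bar S (ker_data B C \<pi>) (Suc (Suc n)))"
    using a(3) dK by (intro image_eqI[of _ _ a]) auto
qed

text \<open>The boundary of a lift of the cycle \<open>c\<close> lies in the kernel;
  \<open>inj_at\<close> lets the lift be corrected to a cycle of \<open>B\<close>, which bounds
  there.\<close>

lemma exact_at_cokernel: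
  assumes "exact_at S B n" "inj_at S B C \<pi> n"
  shows "exact_at S C n"
  unfolding exact_at_def
proof (intro ballI impI)
  fix c assume c: "c \<in> carrier (bar S C (Suc n))" and dc: "bard S C n c = \<one>\<^bsub>bar S C n\<^esub>"
  obtain b where b: "b \<in> carrier (bar S B (Suc n))" "barm S \<pi> (Suc n) b = c"
    using barm_surj[OF B C epi c] by blast
  then have "barm S \<pi> n (bard S B n b) = \<one>\<^bsub>bar S C n\<^esub>"
    using barm_bard[OF fin B C epi_hom b(1)] dc by simp
  then obtain a where a: "a \<in> carrier (bar S B (Suc n))" "barm S \<pi> (Suc n) a = \<one>\<^bsub>bar S C (Suc n)\<^esub>"
    "bard S B n a = bard S B n b"
    using assms(2) b unfolding inj_at_def by blast
  interpret B1: comm_group "bar S B (Suc n)" by (rule comm_group_bar[OF B])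
  interpret C1: comm_group "bar S C (Suc n)" by (rule comm_group_bar[OF C])
  interpret B0: comm_group "bar S B n" by (rule comm_group_bar[OF B])
  interpret m: group_hom "bar S B (Suc n)" "bar S C (Suc n)" "barm S \<pi> (Suc n)"
    by (rule hom_group_homI[OF B1.comm_group_axioms C1.comm_group_axioms barm_hom[OF B C epi_hom]])
  interpret d: group_hom "bar S B (Suc n)" "bar S B n" "bard S B n"
    by (rule hom_group_homI[OF B1.comm_group_axioms B0.comm_group_axioms bard_hom[OF B]])
  let ?e = "b \<otimes>\<^bsub>bar S B (Suc n)\<^esub> inv\<^bsub>bar S B (Suc n)\<^esub> a"
  have e: "?e \<in> carrier (bar S B (Suc n))" using a b by simp
  moreover have "bard S B n ?e = \<one>\<^bsub>bar S B n\<^esub>"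
    using a b by (simp del: d.hom_closed add: d.hom_closed[OF b(1)])
  ultimately obtain z where z: "z \<in> carrier (bar S B (Suc (Suc n)))" "?e = bard S B (Suc n) z"
    using assms(1) unfolding exact_at_def by blast
  have "c = barm S \<pi> (Suc n) ?e" using a b c by simp
  also have "\<dots> = bard S C (Suc n) (barm S \<pi> (Suc (Suc n)) z)"
    unfolding z(2) by (rule barm_bard[OF fin B C epi_hom z(1)])
  finally show "c \<in> bard S C (Suc n) ` carrier (bar S C (Suc (Suc n)))"
    using barm_closed[OF B C epi_hom z(1)] by (rule image_eqI)
qed

text \<open>With no homology of the kernel in degree \<open>n + 1\<close> there is nothing to map.
  The index of \<open>inj_at\<close> is one higher because \<open>exact_at\<close> starts counting
  at degree 1.\<close>

lemma inj_at_of_exact_kernel: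
  assumes "exact_at S (ker_data B C \<pi>) n"
  shows "inj_at S B C \<pi> (Suc n)"
  unfolding inj_at_def
proof (intro ballI impI)
  note K = bar_ker_data_iff[OF fin B C epi_hom] and dK = bard_ker_data[OF fin B C epi_hom]
  fix b assume b: "b \<in> carrier (bar S B (Suc (Suc n)))"
    and "barm S \<pi> (Suc n) (bard S B (Suc n) b) = \<one>\<^bsub>bar S C (Suc n)\<^esub>"
  then have db: "bard S B (Suc n) b \<in> carrier (bar S (ker_data B C \<pi>) (Suc n))"
    unfolding K using bard_closed[OF B b] by blast
  have "bard S (ker_data B C \<pi>) n (bard S B (Suc n) b) = \<one>\<^bsub>bar S (ker_data B C \<pi>) n\<^esub>"
    unfolding dK[OF db] bard_bard[OF B fin b] bar_one[OF abelian_ker_data[OF B C epi_hom]] bar_one[OF B] ker_data_simps ..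
  then obtain a where a: "a \<in> carrier (bar S (ker_data B C \<pi>) (Suc (Suc n)))"
    "bard S B (Suc n) b = bard S (ker_data B C \<pi>) (Suc n) a"
    using assms db unfolding exact_at_def by blast
  then show "\<exists>a \<in> carrier (bar S B (Suc (Suc n))). barm S \<pi> (Suc (Suc n)) a = \<one>\<^bsub>bar S C (Suc (Suc n))\<^esub> \<and>
      bard S B (Suc n) a = bard S B (Suc n) b"
    using dK[OF a(1)] unfolding K by (intro bexI[of _ a]) auto
qed

lemma acyclic_kernel: "acyclic_data S B \<Longrightarrow> acyclic_data S C \<Longrightarrow> acyclic_data S (ker_data B C \<pi>)"
  unfolding acyclic_data_def by (intro allI exact_at_kernel inj_at_of_exact) auto

end

section \<open>Degree zero: the relations of the colimit as bar boundaries\<close>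

definition bar_aug :: "'a topology \<Rightarrow> ('a, 'g) ab_data \<Rightarrow> ('a list \<Rightarrow> 'g) \<Rightarrow> 'a \<Rightarrow> 'g" where
  "bar_aug S M c = (\<lambda>p \<in> topspace S. bard S M 0 c [p])"

lemma chains_0: "xs \<in> chains S 0 \<longleftrightarrow> (\<exists>p \<in> topspace S. xs = [p])"
  by (auto simp: chains_def length_Suc_conv)

lemma chains_1: "xs \<in> chains S (Suc 0) \<longleftrightarrow> (\<exists>p q. spec_le S p q \<and> xs = [p, q])"
  by (auto simp: chains_def length_Suc_conv spec_le_topspace)

lemma inc_pair: "inc [z, w] [p] = (if w = p then 1 else 0) - (if z = p then 1 else 0)"
proof -
  have "{..<length [z, w]} = {0, 1}" by auto
  then show ?thesis by (simp add: inc_def del_def)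
qed

text \<open>One-point chains correspond to points, so nothing is lost by reading the boundary on
  points.\<close>

lemma bar_aug_eq_iff:
  assumes "abelian_data S M" "c \<in> carrier (bar S M (Suc 0))" "c' \<in> carrier (bar S M (Suc 0))"
  shows "bar_aug S M c = bar_aug S M c' \<longleftrightarrow> bard S M 0 c = bard S M 0 c'"
proof
  assume eq: "bar_aug S M c = bar_aug S M c'"
  show "bard S M 0 c = bard S M 0 c'"
  proof (rule PiE_ext[of _ "chains S 0" "\<lambda>xs. carrier (stalk M (hd xs))"])
    show "bard S M 0 c \<in> (\<Pi>\<^sub>E xs\<in>chains S 0. carrier (stalk M (hd xs)))"
      "bard S M 0 c' \<in> (\<Pi>\<^sub>E xs\<in>chains S 0. carrier (stalk M (hd xs)))"
      using bard_closed[OF assms(1,2)] bard_closed[OF assms(1,3)] unfolding carrier_bar[OF assms(1)] by auto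
    fix xs assume "xs \<in> chains S 0"
    then obtain p where p: "p \<in> topspace S" "xs = [p]" by (auto simp: chains_0)
    from fun_cong[OF eq, of p] p(1) show "bard S M 0 c xs = bard S M 0 c' xs"
      unfolding p(2) by (simp add: bar_aug_def)
  qed
qed (simp add: bar_aug_def)

context
  fixes S :: "'a topology" and M :: "('a, 'g) ab_data"
  assumes fin: "finite (topspace S)" and M: "abelian_data S M"
begin

lemma bar_aug_hom: "bar_aug S M \<in> hom (bar S M (Suc 0)) (data_sum S M)"
proof (rule homI)
  have 0: "[p] \<in> chains S 0" if "p \<in> topspace S" for p using that by (simp add: chains_0)
  fix x assume x: "x \<in> carrier (bar S M (Suc 0))"
  show "bar_aug S M x \<in> carrier (data_sum S M)"
    unfolding data_sum_carrier[OF fin M] bar_aug_def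
    using bar_closed[OF M bard_closed[OF M x] 0] by auto
  fix y assume y: "y \<in> carrier (bar S M (Suc 0))"
  show "bar_aug S M (x \<otimes>\<^bsub>bar S M (Suc 0)\<^esub> y) = bar_aug S M x \<otimes>\<^bsub>data_sum S M\<^esub> bar_aug S M y"
    unfolding data_sum_mult bar_aug_def hom_mult[OF bard_hom[OF M] x y] bar_mult[OF M, of 0]
    by (rule restrict_ext) (simp add: 0)
qed

text \<open>Deleting the first point of \<open>[z, w]\<close> leaves \<open>[w]\<close> with sign
  plus, deleting the second leaves \<open>[z]\<close> with sign minus, and this difference is the
  relator; for \<open>z = w\<close> both sides are trivial.\<close>

lemma bar_aug_single:
  assumes zw: "spec_le S z w" and a: "a \<in> carrier (stalk M z)"
  shows "bar_aug S M (psingle (chains S (Suc 0)) (\<lambda>xs. stalk M (hd xs)) [z, w] a) = relator S M z w a"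
    (is "bar_aug S M ?s = _")
proof -
  have zin: "z \<in> topspace S" and win: "w \<in> topspace S" using zw by (auto simp: spec_le_topspace)
  have zwc: "[z, w] \<in> chains S (Suc 0)" using zw by (auto simp: chains_1)
  have tra: "trans_map M z w a \<in> carrier (stalk M w)" by (rule data_trans_closed[OF M zw a])
  have "bar_aug S M ?s p = relator S M z w a p" if p: "p \<in> topspace S" for p
  proof -
    interpret comm_group "stalk M p" using data_comm_group[OF M p] .
    have pc: "[p] \<in> chains S 0" using p by (simp add: chains_0)
    let ?t = "\<lambda>xs. ztr S M (hd xs) p (?s xs) [^]\<^bsub>stalk M p\<^esub> inc xs [p]"
    have ta: "ztr S M z p a \<in> carrier (stalk M p)" by (rule ztr_closed[OF M zin p a])
    have one: "ztr S M q p \<one>\<^bsub>stalk M q\<^esub> = \<one>\<^bsub>stalk M p\<^esub>" if "q \<in> topspace S" for q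
      by (rule hom_one[OF ztr_hom[OF M that p] data_group[OF M that] is_group])
    have "bar_aug S M ?s p = finprod (stalk M p) ?t (chains S (Suc 0))"
      using p bard_apply[OF M pc, of ?s] by (simp add: bar_aug_def)
    also have "\<dots> = finprod (stalk M p) (\<lambda>xs. if xs = [z, w] then ztr S M z p a [^]\<^bsub>stalk M p\<^esub> inc [z, w] [p]
        else \<one>\<^bsub>stalk M p\<^esub>) (chains S (Suc 0))"
    proof (rule finprod_cong')
      fix xs assume xs: "xs \<in> chains S (Suc 0)"
      show "?t xs = (if xs = [z, w] then ztr S M z p a [^]\<^bsub>stalk M p\<^esub> inc [z, w] [p] else \<one>\<^bsub>stalk M p\<^esub>)"
      proof (cases "xs = [z, w]")
        case True
        then show ?thesis using xs by (simp add: psingle_def)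
      next
        case False
        then show ?thesis using xs one[OF chains_hd[OF xs]] by (simp add: psingle_def)
      qed
    qed (auto intro!: int_pow_closed ta)
    also have "\<dots> = ztr S M z p a [^]\<^bsub>stalk M p\<^esub> inc [z, w] [p]"
      by (rule finprod_singleton_swap[OF zwc finite_chains[OF fin]]) (auto intro!: int_pow_closed ta)
    also have "\<dots> = relator S M z w a p"
    proof -
      have "relator S M z w a p = (if p = w then trans_map M z w a else \<one>\<^bsub>stalk M p\<^esub>) \<otimes>\<^bsub>stalk M p\<^esub>
          inv\<^bsub>stalk M p\<^esub> (if p = z then a else \<one>\<^bsub>stalk M p\<^esub>)"
        unfolding relator_def data_sum_inv[OF M sum_incl_closed[OF fin M zin a]] data_sum_mult
        using p by (simp add: sum_incl_def)
      moreover have "ztr S M z p a [^]\<^bsub>stalk M p\<^esub> inc [z, w] [p] = \<dots>"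
      proof (cases "w = p"; cases "z = p")
        assume "w = p" "z = p"
        then show ?thesis using data_trans_id[OF M zin a] a by (simp add: inc_pair)
      next
        assume "w = p" "z \<noteq> p"
        then show ?thesis using tra zw by (simp add: inc_pair ztr_def)
      next
        assume "w \<noteq> p" "z = p"
        then show ?thesis using data_trans_id[OF M zin a] a zin
          by (simp add: inc_pair ztr_def spec_le_refl int_pow_neg[of _ 1, simplified])
      next
        assume "w \<noteq> p" "z \<noteq> p"
        then show ?thesis by (auto simp: inc_pair)
      qed
      ultimately show ?thesis by simp
    qed
    finally show ?thesis .
  qed
  moreover have "relator S M z w a \<in> extensional (topspace S)"
    using relator_closed[OF fin M zw a] unfolding data_sum_carrier[OF fin M] by (simp add: PiE_def)
  moreover have "bar_aug S M ?s \<in> extensional (topspace S)" by (simp add: bar_aug_def)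
  ultimately show ?thesis by (intro extensionalityI[of _ "topspace S"])
qed

lemma bar_aug_in_relations:
  assumes "c \<in> carrier (bar S M (Suc 0))"
  shows "bar_aug S M c \<in> colim_relations S M"
proof -
  interpret N: subgroup "colim_relations S M" "data_sum S M" by (rule subgroup_colim_relations[OF fin M])
  interpret group_hom "bar S M (Suc 0)" "data_sum S M" "bar_aug S M"
    by (rule hom_group_homI[OF comm_group_bar[OF M] comm_group_data_sum[OF fin M] bar_aug_hom])
  note cb = carrier_bar[OF M, of "Suc 0"]
  show ?thesis
  proof (rule product_group_induct[where I = "chains S (Suc 0)" and G = "\<lambda>xs. stalk M (hd xs)"])
    show "c \<in> (\<Pi>\<^sub>E xs\<in>chains S (Suc 0). carrier (stalk M (hd xs)))" using assms unfolding cb .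
    show "bar_aug S M (\<lambda>xs\<in>chains S (Suc 0). \<one>\<^bsub>stalk M (hd xs)\<^esub>) \<in> colim_relations S M"
      using hom_one N.one_closed unfolding bar_one[OF M] by simp
  next
    fix x y assume xy: "x \<in> (\<Pi>\<^sub>E xs\<in>chains S (Suc 0). carrier (stalk M (hd xs)))"
      "y \<in> (\<Pi>\<^sub>E xs\<in>chains S (Suc 0). carrier (stalk M (hd xs)))"
      and "bar_aug S M x \<in> colim_relations S M" "bar_aug S M y \<in> colim_relations S M"
    then have "bar_aug S M x \<otimes>\<^bsub>data_sum S M\<^esub> bar_aug S M y \<in> colim_relations S M" by (intro N.m_closed)
    then show "bar_aug S M (\<lambda>xs\<in>chains S (Suc 0). x xs \<otimes>\<^bsub>stalk M (hd xs)\<^esub> y xs) \<in> colim_relations S M"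
      using hom_mult[of x y] xy unfolding cb[symmetric] bar_mult[OF M, of "Suc 0"] by simp
  next
    fix xs a assume "xs \<in> chains S (Suc 0)" and a: "a \<in> carrier (stalk M (hd xs))"
    then obtain z w where zw: "spec_le S z w" "xs = [z, w]" by (auto simp: chains_1)
    then show "bar_aug S M (psingle (chains S (Suc 0)) (\<lambda>xs. stalk M (hd xs)) xs a) \<in> colim_relations S M"
      using bar_aug_single[OF zw(1)] a relator_in_relations[OF zw(1)] by simp
  qed (auto intro: finite_chains[OF fin] data_group[OF M] chains_hd)
qed

text \<open>Two-point chains with a single entry correspond to relators, and both groups are
  generated by such elements. A relation thus always comes with a chain, which can be lifted along
  an epimorphism or restricted to a subspace.\<close>

lemma relations_iff_bar_aug:
  "x \<in> colim_relations S M \<longleftrightarrow> (\<exists>c \<in> carrier (bar S M (Suc 0)). x = bar_aug S M c)"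
proof
  assume x: "x \<in> colim_relations S M"
  interpret bar_aug: group_hom "bar S M (Suc 0)" "data_sum S M" "bar_aug S M"
    by (rule hom_group_homI[OF comm_group_bar[OF M] comm_group_data_sum[OF fin M] bar_aug_hom])
  have "(\<lambda>x. x) x \<in> bar_aug S M ` carrier (bar S M (Suc 0))"
  proof (rule relations_hom_in[OF fin M bar_aug.H.is_group _ bar_aug.img_is_subgroup _ x])
    show "(\<lambda>x. x) \<in> hom (data_sum S M) (data_sum S M)" by (rule homI) auto
    fix p q a assume pq: "spec_le S p q" "a \<in> carrier (stalk M p)"
    show "relator S M p q a \<in> bar_aug S M ` carrier (bar S M (Suc 0))"
      unfolding bar_aug_single[OF pq, symmetric] carrier_bar[OF M]
      by (rule imageI, rule psingle_in_PiE) (auto intro: data_group[OF M] chains_hd simp: pq)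
  qed
  then show "\<exists>c \<in> carrier (bar S M (Suc 0)). x = bar_aug S M c" by auto
qed (use bar_aug_in_relations in auto)

end

lemma bar_aug_barm:
  assumes "finite (topspace S)" "abelian_data S M" "abelian_data S N" "\<phi> \<in> data_hom S M N"
    "c \<in> carrier (bar S M (Suc 0))"
  shows "bar_aug S N (barm S \<phi> (Suc 0) c) = push S S N \<phi> (bar_aug S M c)"
  unfolding bar_aug_def push_def barm_bard[OF assms, symmetric]
  by (rule restrict_ext) (simp add: barm_def chains_0)

lemma push_self: "push S S N \<phi> x = (\<lambda>p\<in>topspace S. \<phi> p (x p))"
  by (auto simp: push_def)

lemma push_surj:
  assumes "finite (topspace S)" "abelian_data S M" "abelian_data S N" "data_epi S M N \<pi>" "y \<in> carrier (data_sum S N)"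
  shows "\<exists>x \<in> carrier (data_sum S M). push S S N \<pi> x = y"
proof -
  have "\<exists>b. b \<in> carrier (stalk M p) \<and> \<pi> p b = y p" if "p \<in> topspace S" for p
  proof -
    have "y p \<in> carrier (stalk N p)" using assms(5) that unfolding data_sum_carrier[OF assms(1,3)] by auto
    then have "y p \<in> \<pi> p ` carrier (stalk M p)" using assms(4) that by (simp add: data_epi_def)
    then show ?thesis by auto
  qed
  then obtain b where b: "\<And>p. p \<in> topspace S \<Longrightarrow> b p \<in> carrier (stalk M p) \<and> \<pi> p (b p) = y p"
    by metis
  have "push S S N \<pi> (restrict b (topspace S)) = y"
    using b assms(5) unfolding data_sum_carrier[OF assms(1,3)] push_self
    by (auto simp: fun_eq_iff PiE_iff extensional_def)
  moreover have "restrict b (topspace S) \<in> carrier (data_sum S M)"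
    using b unfolding data_sum_carrier[OF assms(1,2)] by auto
  ultimately show ?thesis by blast
qed

lemma data_sum_ker_data_iff:
  assumes "finite (topspace S)" "abelian_data S B" "abelian_data S C" "\<pi> \<in> data_hom S B C"
  shows "x \<in> carrier (data_sum S (ker_data B C \<pi>)) \<longleftrightarrow>
    x \<in> carrier (data_sum S B) \<and> push S S C \<pi> x = \<one>\<^bsub>data_sum S C\<^esub>"
  unfolding data_sum_carrier[OF assms(1) abelian_ker_data[OF assms(2-4)]] data_sum_carrier[OF assms(1,2)]
    push_self data_sum_one ker_data_simps
  by (auto simp: PiE_iff fun_eq_iff restrict_def)

text \<open>Left exactness of the colimit when \<open>C\<close> has no homology in degree 1: the
  chain of \<open>B\<close> that produces the relation is replaced, through \<open>inj_at\<close>,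
  by a chain of the kernel with the same boundary.\<close>

lemma kernel_relations:
  assumes fin: "finite (topspace S)" and B: "abelian_data S B" and C: "abelian_data S C" and epi: "data_epi S B C \<pi>"
    and "exact_at S C 0" and x: "x \<in> carrier (data_sum S (ker_data B C \<pi>))" and xB: "x \<in> colim_relations S B"
  shows "x \<in> colim_relations S (ker_data B C \<pi>)"
proof -
  note hom = epi_hom[OF fin B C epi]
  note K = abelian_ker_data[OF B C hom]
  obtain b where b: "b \<in> carrier (bar S B (Suc 0))" "x = bar_aug S B b"
    using xB unfolding relations_iff_bar_aug[OF fin B] by blast
  have p1: "push S S C \<pi> x = \<one>\<^bsub>data_sum S C\<^esub>"
    using x unfolding data_sum_ker_data_iff[OF fin B C hom] by blast
  have px: "\<pi> p (x p) = \<one>\<^bsub>stalk C p\<^esub>" if "p \<in> topspace S" for p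
    using fun_cong[OF p1, of p] that by (simp add: push_self)
  have "barm S \<pi> 0 (bard S B 0 b) = \<one>\<^bsub>bar S C 0\<^esub>"
    unfolding barm_def bar_one[OF C]
    by (rule restrict_ext) (use px in \<open>auto simp: chains_0 b(2) bar_aug_def\<close>)
  then obtain a where a: "a \<in> carrier (bar S B (Suc 0))" "barm S \<pi> (Suc 0) a = \<one>\<^bsub>bar S C (Suc 0)\<^esub>"
    "bard S B 0 a = bard S B 0 b"
    using inj_at_of_exact[OF fin B C epi assms(5)] b(1) unfolding inj_at_def by blast
  then have aK: "a \<in> carrier (bar S (ker_data B C \<pi>) (Suc 0))"
    unfolding bar_ker_data_iff[OF fin B C hom] by blast
  have "x = bar_aug S (ker_data B C \<pi>) a"
    unfolding b(2) bar_aug_def bard_ker_data[OF fin B C hom aK] a(3) ..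
  then show ?thesis using aK relations_iff_bar_aug[OF fin K] by blast
qed

text \<open>The chain that produces the relation in \<open>C\<close> lifts to \<open>B\<close>;
  dividing \<open>x\<close> by the relation coming from this lift leaves an element of the
  kernel.\<close>

lemma colim_right_exact:
  assumes fin: "finite (topspace S)" and B: "abelian_data S B" and C: "abelian_data S C" and epi: "data_epi S B C \<pi>"
    and x: "x \<in> carrier (data_sum S B)" and xC: "push S S C \<pi> x \<in> colim_relations S C"
  shows "\<exists>y \<in> carrier (data_sum S (ker_data B C \<pi>)). x \<otimes>\<^bsub>data_sum S B\<^esub> inv\<^bsub>data_sum S B\<^esub> y \<in> colim_relations S B"
proof -
  note hom = epi_hom[OF fin B C epi]
  obtain c where c: "c \<in> carrier (bar S C (Suc 0))" "push S S C \<pi> x = bar_aug S C c"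
    using xC unfolding relations_iff_bar_aug[OF fin C] by blast
  obtain b where b: "b \<in> carrier (bar S B (Suc 0))" "barm S \<pi> (Suc 0) b = c"
    using barm_surj[OF B C epi c(1)] by blast
  let ?r = "bar_aug S B b"
  have r: "?r \<in> colim_relations S B" by (rule bar_aug_in_relations[OF fin B b(1)])
  have rc: "?r \<in> carrier (data_sum S B)" by (rule hom_in_carrier[OF bar_aug_hom[OF fin B] b(1)])
  interpret B: comm_group "data_sum S B" by (rule comm_group_data_sum[OF fin B])
  interpret p: group_hom "data_sum S B" "data_sum S C" "push S S C \<pi>"
    by (rule hom_group_homI[OF comm_group_data_sum[OF fin B] comm_group_data_sum[OF fin C]
        push_hom[OF fin fin subspace_of_refl B C hom]])
  let ?y = "x \<otimes>\<^bsub>data_sum S B\<^esub> inv\<^bsub>data_sum S B\<^esub> ?r"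
  have pr: "push S S C \<pi> ?r = push S S C \<pi> x"
    using bar_aug_barm[OF fin B C hom b(1)] b(2) c(2) by simp
  have yB: "?y \<in> carrier (data_sum S B)" by (rule B.m_closed[OF x B.inv_closed[OF rc]])
  have "push S S C \<pi> ?y = \<one>\<^bsub>data_sum S C\<^esub>"
    unfolding p.hom_mult[OF x B.inv_closed[OF rc]] p.hom_inv[OF rc] pr by (rule p.H.r_inv[OF p.hom_closed[OF x]])
  then have "?y \<in> carrier (data_sum S (ker_data B C \<pi>))"
    unfolding data_sum_ker_data_iff[OF fin B C hom] using yB by blast
  moreover have "x \<otimes>\<^bsub>data_sum S B\<^esub> inv\<^bsub>data_sum S B\<^esub> ?y = ?r"
    unfolding B.inv_mult[OF x B.inv_closed[OF rc]] B.inv_inv[OF rc]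
    using B.m_assoc[OF x B.inv_closed[OF x] rc] x rc by (metis B.l_one B.r_inv)
  ultimately show ?thesis using r by (intro bexI[of _ ?y]) simp_all
qed

section \<open>Exact sequences of data and exactness of their colimits\<close>

definition exact_seq :: "'a topology \<Rightarrow> (nat \<Rightarrow> ('a, 'g) ab_data) \<Rightarrow> (nat \<Rightarrow> 'a \<Rightarrow> 'g \<Rightarrow> 'g) \<Rightarrow> bool" where
  "exact_seq S K \<delta> \<longleftrightarrow> (\<forall>n. abelian_data S (K n)) \<and> (\<forall>n. \<delta> n \<in> data_hom S (K (Suc n)) (K n)) \<and>
     data_epi S (K 1) (K 0) (\<delta> 0) \<and>
     (\<forall>n. \<forall>p \<in> topspace S. \<delta> (Suc n) p ` carrier (stalk (K (Suc (Suc n))) p) =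
        kernel (stalk (K (Suc n)) p) (stalk (K n) p) (\<delta> n p))"

text \<open>For exact \<open>K\<close> the \<open>n\<close>-th syzygy is the image of
  \<open>\<delta> n\<close>, hence a quotient of \<open>K (Suc n)\<close> by the next syzygy; at
  index 0 the map is onto and the image is all of \<open>K 0\<close>.\<close>

fun syzygy :: "(nat \<Rightarrow> ('a, 'g) ab_data) \<Rightarrow> (nat \<Rightarrow> 'a \<Rightarrow> 'g \<Rightarrow> 'g) \<Rightarrow> nat \<Rightarrow> ('a, 'g) ab_data" where
  "syzygy K \<delta> 0 = K 0"
| "syzygy K \<delta> (Suc n) = ker_data (K (Suc n)) (K n) (\<delta> n)"

context
  fixes S :: "'a topology" and K :: "nat \<Rightarrow> ('a, 'g) ab_data" and \<delta>
  assumes fin: "finite (topspace S)" and ex: "exact_seq S K \<delta>"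
begin

lemma exact_seq_data: "abelian_data S (K n)" and exact_seq_hom: "\<delta> n \<in> data_hom S (K (Suc n)) (K n)"
  using ex unfolding exact_seq_def by simp_all

lemma abelian_syzygy: "abelian_data S (syzygy K \<delta> n)"
  by (cases n) (simp_all add: exact_seq_data abelian_ker_data exact_seq_hom)

lemma exact_seq_epi: "data_epi S (K (Suc n)) (syzygy K \<delta> n) (\<delta> n)"
proof (cases n)
  case 0
  then show ?thesis using ex by (simp add: exact_seq_def)
next
  case (Suc m)
  have im: "\<delta> (Suc m) p ` carrier (stalk (K (Suc (Suc m))) p) = carrier (stalk (syzygy K \<delta> (Suc m)) p)"
    if "p \<in> topspace S" for p
    using ex that by (simp add: exact_seq_def ker_data_def)
  have "\<delta> (Suc m) \<in> data_hom S (K (Suc (Suc m))) (syzygy K \<delta> (Suc m))"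
  proof (rule data_homI)
    fix p assume p: "p \<in> topspace S"
    show "\<delta> (Suc m) p \<in> hom (stalk (K (Suc (Suc m))) p) (stalk (syzygy K \<delta> (Suc m)) p)"
    proof (rule homI)
      fix x assume x: "x \<in> carrier (stalk (K (Suc (Suc m))) p)"
      show "\<delta> (Suc m) p x \<in> carrier (stalk (syzygy K \<delta> (Suc m)) p)"
        using im[OF p] x by blast
      fix y assume "y \<in> carrier (stalk (K (Suc (Suc m))) p)"
      then show "\<delta> (Suc m) p (x \<otimes>\<^bsub>stalk (K (Suc (Suc m))) p\<^esub> y) =
          \<delta> (Suc m) p x \<otimes>\<^bsub>stalk (syzygy K \<delta> (Suc m)) p\<^esub> \<delta> (Suc m) p y"
        using hom_mult[OF data_hom_hom[OF exact_seq_hom p] x] by (simp add: ker_data_simps)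
    qed
  next
    fix p q a assume "spec_le S p q" "a \<in> carrier (stalk (K (Suc (Suc m))) p)"
    then show "\<delta> (Suc m) q (trans_map (K (Suc (Suc m))) p q a) = trans_map (syzygy K \<delta> (Suc m)) p q (\<delta> (Suc m) p a)"
      using data_hom_natural[OF exact_seq_hom] by (simp add: ker_data_simps)
  qed
  then show ?thesis using im Suc by (simp add: data_epi_def)
qed

text \<open>Replacing the target by a subdatum leaves the kernel alone, as both have the same
  units.\<close>

lemma ker_data_syzygy: "ker_data (K (Suc n)) (syzygy K \<delta> n) (\<delta> n) = syzygy K \<delta> (Suc n)"
  by (cases n) (simp_all add: ker_data_def kernel_def)

lemma push_syzygy: "push S S (syzygy K \<delta> n) (\<delta> n) x = push S S (K n) (\<delta> n) x"
  by (simp add: push_self)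

lemma push_exact_seq_closed:
  "x \<in> carrier (data_sum S (K (Suc n))) \<Longrightarrow> push S S (K n) (\<delta> n) x \<in> carrier (data_sum S (syzygy K \<delta> n))"
  unfolding push_syzygy[symmetric]
  by (rule hom_in_carrier[OF push_hom[OF fin fin subspace_of_refl exact_seq_data abelian_syzygy
        epi_hom[OF fin exact_seq_data abelian_syzygy exact_seq_epi]]])

lemma push_exact_seq_one:
  assumes "x \<in> carrier (data_sum S (K (Suc (Suc n))))"
  shows "push S S (K n) (\<delta> n) (push S S (K (Suc n)) (\<delta> (Suc n)) x) = \<one>\<^bsub>data_sum S (K n)\<^esub>"
  using push_exact_seq_closed[OF assms]
  by (simp only: syzygy.simps data_sum_ker_data_iff[OF fin exact_seq_data exact_seq_data exact_seq_hom])

text \<open>Induction along the short exact sequences of consecutive syzygies; the kernel of an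
  epimorphism of acyclic data is acyclic.\<close>

lemma acyclic_syzygy:
  assumes "\<And>n. acyclic_data S (K n)"
  shows "acyclic_data S (syzygy K \<delta> n)"
proof (induction n)
  case (Suc n)
  from acyclic_kernel[OF fin exact_seq_data abelian_syzygy exact_seq_epi assms Suc]
  show ?case unfolding ker_data_syzygy .
qed (simp add: assms)

text \<open>The image of \<open>x\<close> dies in the colimit of \<open>K n\<close>. Since the
  syzygies are acyclic it dies already in the colimit of the \<open>n\<close>-th syzygy, and right
  exactness for \<open>K (Suc n)\<close> over that syzygy yields the preimage.\<close>

lemma colim_exact:
  assumes acyc: "\<And>n. acyclic_data S (K n)"
    and x: "x \<in> carrier (data_sum S (K (Suc n)))" and xN: "push S S (K n) (\<delta> n) x \<in> colim_relations S (K n)"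
  shows "\<exists>y \<in> carrier (data_sum S (K (Suc (Suc n)))).
    x \<otimes>\<^bsub>data_sum S (K (Suc n))\<^esub> inv\<^bsub>data_sum S (K (Suc n))\<^esub> push S S (K (Suc n)) (\<delta> (Suc n)) y \<in> colim_relations S (K (Suc n))"
proof -
  let ?u = "push S S (K n) (\<delta> n) x"
  have "?u \<in> colim_relations S (syzygy K \<delta> n)"
  proof (cases n)
    case (Suc m)
    have "exact_at S (syzygy K \<delta> m) 0"
      using acyclic_syzygy[OF acyc] by (simp add: acyclic_data_def)
    from kernel_relations[OF fin exact_seq_data abelian_syzygy exact_seq_epi this, of ?u]
    show ?thesis unfolding ker_data_syzygy using push_exact_seq_closed[OF x] xN Suc by blast
  qed (use xN in simp)
  then have "push S S (syzygy K \<delta> n) (\<delta> n) x \<in> colim_relations S (syzygy K \<delta> n)"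
    unfolding push_syzygy .
  from colim_right_exact[OF fin exact_seq_data abelian_syzygy exact_seq_epi x this]
  obtain v where v: "v \<in> carrier (data_sum S (syzygy K \<delta> (Suc n)))"
    "x \<otimes>\<^bsub>data_sum S (K (Suc n))\<^esub> inv\<^bsub>data_sum S (K (Suc n))\<^esub> v \<in> colim_relations S (K (Suc n))"
    unfolding ker_data_syzygy by blast
  obtain y where "y \<in> carrier (data_sum S (K (Suc (Suc n))))" "push S S (K (Suc n)) (\<delta> (Suc n)) y = v"
    using push_surj[OF fin exact_seq_data abelian_syzygy exact_seq_epi v(1)] unfolding push_syzygy by blast
  then show ?thesis using v(2) by blast
qed

text \<open>The second hypothesis is the vanishing of the positive homology of the colimits of the
  resolution. It gives the first bar homology of every syzygy, and dimension shifting propagates the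
  vanishing to all degrees.\<close>

lemma acyclic_of_colim_exact:
  assumes acyc: "\<And>n. acyclic_data S (K (Suc n))"
    and cex: "\<And>n x. x \<in> carrier (data_sum S (K (Suc (Suc n)))) \<Longrightarrow>
      push S S (K (Suc n)) (\<delta> (Suc n)) x \<in> colim_relations S (K (Suc n)) \<Longrightarrow>
      \<exists>y \<in> carrier (data_sum S (K (Suc (Suc (Suc n))))). x \<otimes>\<^bsub>data_sum S (K (Suc (Suc n)))\<^esub>
        inv\<^bsub>data_sum S (K (Suc (Suc n)))\<^esub> push S S (K (Suc (Suc n))) (\<delta> (Suc (Suc n))) y \<in> colim_relations S (K (Suc (Suc n)))"
  shows "acyclic_data S (K 0)"
proof -
  \<comment> \<open>The colimit of the next syzygy embeds into that of \<open>K (Suc n)\<close>;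
    this is where exactness of the colimits is spent.\<close>
  have inj: "inj_at S (K (Suc n)) (syzygy K \<delta> n) (\<delta> n) 0" for n
    unfolding inj_at_def
  proof (intro ballI impI)
    fix b assume b: "b \<in> carrier (bar S (K (Suc n)) (Suc 0))"
      and db: "barm S (\<delta> n) 0 (bard S (K (Suc n)) 0 b) = \<one>\<^bsub>bar S (syzygy K \<delta> n) 0\<^esub>"
    let ?x = "bar_aug S (K (Suc n)) b"
    have x: "?x \<in> carrier (data_sum S (K (Suc n)))"
      by (rule hom_in_carrier[OF bar_aug_hom[OF fin exact_seq_data] b])
    have xN: "?x \<in> colim_relations S (K (Suc n))" by (rule bar_aug_in_relations[OF fin exact_seq_data b])
    have "push S S (syzygy K \<delta> n) (\<delta> n) ?x = \<one>\<^bsub>data_sum S (syzygy K \<delta> n)\<^esub>"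
      unfolding push_self data_sum_one
    proof (rule restrict_ext)
      fix p assume p: "p \<in> topspace S"
      then have "[p] \<in> chains S 0" by (simp add: chains_0)
      with fun_cong[OF db, of "[p]"] p show "\<delta> n p (?x p) = \<one>\<^bsub>stalk (syzygy K \<delta> n) p\<^esub>"
        by (simp add: barm_def bar_one[OF abelian_syzygy] bar_aug_def)
    qed
    then have "?x \<in> carrier (data_sum S (syzygy K \<delta> (Suc n)))"
      unfolding ker_data_syzygy[symmetric] data_sum_ker_data_iff[OF fin exact_seq_data abelian_syzygy
        epi_hom[OF fin exact_seq_data abelian_syzygy exact_seq_epi]] using x by blast
    then obtain y where y: "y \<in> carrier (data_sum S (K (Suc (Suc n))))" "push S S (K (Suc n)) (\<delta> (Suc n)) y = ?x"
      using push_surj[OF fin exact_seq_data abelian_syzygy exact_seq_epi] unfolding push_syzygy by blast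
    \<comment> \<open>The lift \<open>y\<close> of \<open>?x\<close> has its image among the
      relations, so by exactness it differs by a relation from the image of some \<open>z\<close>.
      The chain \<open>c\<close> of that relation, pushed forward, lies in the kernel and still has
      augmentation \<open>?x\<close>.\<close>
    have "push S S (K (Suc n)) (\<delta> (Suc n)) y \<in> colim_relations S (K (Suc n))" unfolding y(2) by (rule xN)
    from cex[OF y(1) this] obtain z where z: "z \<in> carrier (data_sum S (K (Suc (Suc (Suc n)))))"
      "y \<otimes>\<^bsub>data_sum S (K (Suc (Suc n)))\<^esub> inv\<^bsub>data_sum S (K (Suc (Suc n)))\<^esub>
        push S S (K (Suc (Suc n))) (\<delta> (Suc (Suc n))) z \<in> colim_relations S (K (Suc (Suc n)))" by blast
    let ?dz = "push S S (K (Suc (Suc n))) (\<delta> (Suc (Suc n))) z"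
    obtain c where c: "c \<in> carrier (bar S (K (Suc (Suc n))) (Suc 0))"
      "y \<otimes>\<^bsub>data_sum S (K (Suc (Suc n)))\<^esub> inv\<^bsub>data_sum S (K (Suc (Suc n)))\<^esub> ?dz = bar_aug S (K (Suc (Suc n))) c"
      using z(2) unfolding relations_iff_bar_aug[OF fin exact_seq_data] by blast
    have dz: "?dz \<in> carrier (data_sum S (K (Suc (Suc n))))"
      by (rule hom_in_carrier[OF push_hom[OF fin fin subspace_of_refl exact_seq_data exact_seq_data exact_seq_hom] z(1)])
    interpret p: group_hom "data_sum S (K (Suc (Suc n)))" "data_sum S (K (Suc n))" "push S S (K (Suc n)) (\<delta> (Suc n))"
      by (rule hom_group_homI[OF comm_group_data_sum[OF fin exact_seq_data] comm_group_data_sum[OF fin exact_seq_data]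
          push_hom[OF fin fin subspace_of_refl exact_seq_data exact_seq_data exact_seq_hom]])
    let ?a = "barm S (\<delta> (Suc n)) (Suc 0) c"
    have a: "?a \<in> carrier (bar S (K (Suc n)) (Suc 0))"
      by (rule barm_closed[OF exact_seq_data exact_seq_data exact_seq_hom c(1)])
    have "bar_aug S (K (Suc n)) ?a = push S S (K (Suc n)) (\<delta> (Suc n)) (bar_aug S (K (Suc (Suc n))) c)"
      by (rule bar_aug_barm[OF fin exact_seq_data exact_seq_data exact_seq_hom c(1)])
    also have "\<dots> = ?x"
      unfolding c(2)[symmetric] p.hom_mult[OF y(1) p.G.inv_closed[OF dz]] p.hom_inv[OF dz] push_exact_seq_one[OF z(1)] y(2)
        p.H.inv_one by (rule p.H.r_one[OF x])
    finally have "bard S (K (Suc n)) 0 ?a = bard S (K (Suc n)) 0 b"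
      unfolding bar_aug_eq_iff[OF exact_seq_data a b] .
    moreover have "barm S (\<delta> n) (Suc 0) ?a = \<one>\<^bsub>bar S (syzygy K \<delta> n) (Suc 0)\<^esub>"
    proof -
      have aK: "?a \<in> carrier (bar S (syzygy K \<delta> (Suc n)) (Suc 0))"
        by (rule barm_closed[OF exact_seq_data abelian_syzygy epi_hom[OF fin exact_seq_data abelian_syzygy exact_seq_epi] c(1)])
      then show ?thesis unfolding ker_data_syzygy[symmetric]
        bar_ker_data_iff[OF fin exact_seq_data abelian_syzygy epi_hom[OF fin exact_seq_data abelian_syzygy exact_seq_epi]]
        by blast
    qed
    ultimately show "\<exists>a \<in> carrier (bar S (K (Suc n)) (Suc 0)).
        barm S (\<delta> n) (Suc 0) a = \<one>\<^bsub>bar S (syzygy K \<delta> n) (Suc 0)\<^esub> \<and> bard S (K (Suc n)) 0 a = bard S (K (Suc n)) 0 b"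
      using a by blast
  qed
  \<comment> \<open>All syzygies are treated at once: degree \<open>m + 2\<close> of the
    \<open>n\<close>-th reduces to degree \<open>m + 1\<close> of the next.\<close>
  have "exact_at S (syzygy K \<delta> n) m" for m n
  proof (induction m arbitrary: n)
    case 0
    show ?case
      by (rule exact_at_cokernel[OF fin exact_seq_data abelian_syzygy exact_seq_epi _ inj])
        (use acyc in \<open>simp add: acyclic_data_def\<close>)
  next
    case (Suc m)
    show ?case
    proof (rule exact_at_cokernel[OF fin exact_seq_data abelian_syzygy exact_seq_epi])
      show "exact_at S (K (Suc n)) (Suc m)" using acyc by (simp add: acyclic_data_def)
      show "inj_at S (K (Suc n)) (syzygy K \<delta> n) (\<delta> n) (Suc m)"
        by (rule inj_at_of_exact_kernel[OF fin exact_seq_data abelian_syzygy exact_seq_epi])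
          (use Suc in \<open>simp only: ker_data_syzygy\<close>)
    qed
  qed
  from this[of 0] show ?thesis by (simp add: acyclic_data_def)
qed

end

subsection \<open>Integers on an up-set and sums of them\<close>

definition upclosed :: "'a topology \<Rightarrow> 'a set \<Rightarrow> bool" where
  "upclosed S U \<longleftrightarrow> (\<forall>p q. spec_le S p q \<longrightarrow> p \<in> U \<longrightarrow> q \<in> U)"

text \<open>All stalks share integer addition and only the carriers depend on the point, so for an
  up-set \<open>U\<close> the identity can serve as every transition map. The choice
  \<open>U = UNIV\<close> gives constant coefficients.\<close>

definition zdata :: "'a set \<Rightarrow> ('a, int) ab_data" where
  "zdata U = \<lparr>stalk = (\<lambda>p. integer_group\<lparr>carrier := {k. p \<in> U \<or> k = 0}\<rparr>), trans_map = (\<lambda>_ _ a. a)\<rparr>"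

lemma zdata_simps [simp]:
  "carrier (stalk (zdata U) p) = {k. p \<in> U \<or> k = 0}"
  "\<one>\<^bsub>stalk (zdata U) p\<^esub> = 0"
  "x \<otimes>\<^bsub>stalk (zdata U) p\<^esub> y = x + y"
  "trans_map (zdata U) = (\<lambda>_ _ a. a)"
  by (simp_all add: zdata_def)

lemma comm_group_zdata: "comm_group (stalk (zdata U) p)"
proof -
  have "subgroup {k. p \<in> U \<or> k = 0} integer_group" by (rule group.subgroupI) auto
  from comm_group_subgroup[OF abelian_integer_group this] show ?thesis by (simp add: zdata_def)
qed

lemma zdata_const: "zdata UNIV = const_int_data"
  by (simp add: zdata_def const_int_data_def integer_group_def)

lemma abelian_zdata: "upclosed S U \<Longrightarrow> abelian_data S (zdata U)"
  by (rule abelian_dataI) (auto simp: comm_group_zdata upclosed_def intro!: homI)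

lemma abelian_zdata_UNIV: "abelian_data S (zdata UNIV)"
  by (rule abelian_zdata) (simp add: upclosed_def)

lemma finprod_integer_group: "finite A \<Longrightarrow> finprod integer_group f A = sum f A"
proof (induction A rule: finite_induct)
  case empty
  interpret comm_group integer_group by (rule abelian_integer_group)
  show ?case by simp
next
  case (insert a A)
  interpret comm_group integer_group by (rule abelian_integer_group)
  show ?case using insert by simp
qed

text \<open>Written additively the differential is a plain integer matrix. The case distinction in
  \<open>ztr\<close> disappears because \<open>inc\<close> vanishes unless the least point of
  \<open>xs\<close> is below that of \<open>ys\<close>.\<close>

lemma bard_zdata:
  assumes fin: "finite (topspace S)" and U: "upclosed S U" and c: "c \<in> carrier (bar S (zdata U) (Suc n))"
    and ys: "ys \<in> chains S n"
  shows "bard S (zdata U) n c ys = (\<Sum>xs\<in>chains S (Suc n). inc xs ys * c xs)"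
proof -
  let ?G = "stalk (zdata U) (hd ys)"
  note M = abelian_zdata[OF U]
  interpret G: comm_group ?G by (rule comm_group_zdata)
  interpret h: group_hom ?G integer_group "\<lambda>k. k"
    by (rule hom_group_homI[OF G.comm_group_axioms abelian_integer_group]) (auto intro!: homI)
  let ?t = "\<lambda>xs. ztr S (zdata U) (hd xs) (hd ys) (c xs)"
  have t: "?t xs \<in> carrier ?G" if "xs \<in> chains S (Suc n)" for xs
    by (rule ztr_closed[OF M chains_hd[OF that] chains_hd[OF ys] bar_closed[OF M c that]])
  have "bard S (zdata U) n c ys = finprod integer_group (\<lambda>xs. ?t xs [^]\<^bsub>?G\<^esub> inc xs ys) (chains S (Suc n))"
    unfolding bard_apply[OF M ys]
    by (rule G.finprod_hom[OF abelian_integer_group h.homh finite_chains[OF fin]])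
      (auto intro!: bard_term_closed[OF M c _ chains_hd[OF ys]] simp del: zdata_simps)
  also have "\<dots> = (\<Sum>xs\<in>chains S (Suc n). ?t xs [^]\<^bsub>?G\<^esub> inc xs ys)"
    by (rule finprod_integer_group[OF finite_chains[OF fin]])
  also have "\<dots> = (\<Sum>xs\<in>chains S (Suc n). inc xs ys * c xs)"
  proof (rule sum.cong)
    fix xs assume xs: "xs \<in> chains S (Suc n)"
    have "?t xs [^]\<^bsub>?G\<^esub> inc xs ys = inc xs ys * ?t xs"
      using h.hom_int_pow[OF t[OF xs], of "inc xs ys"] by simp
    also have "\<dots> = inc xs ys * c xs"
      using inc_nonzero_le[OF xs ys] by (cases "inc xs ys = 0") (simp_all add: ztr_def)
    finally show "?t xs [^]\<^bsub>?G\<^esub> inc xs ys = inc xs ys * c xs" .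
  qed simp
  finally show ?thesis .
qed

lemma bar_zdata_iff:
  assumes "upclosed S U"
  shows "c \<in> carrier (bar S (zdata U) n) \<longleftrightarrow>
    c \<in> extensional (chains S n) \<and> (\<forall>xs \<in> chains S n. hd xs \<notin> U \<longrightarrow> c xs = 0)"
  unfolding carrier_bar[OF abelian_zdata[OF assms]] by (auto simp: PiE_iff)

lemma data_sum_zdata_iff:
  assumes "finite (topspace S)" "upclosed S U"
  shows "x \<in> carrier (data_sum S (zdata U)) \<longleftrightarrow>
    x \<in> extensional (topspace S) \<and> (\<forall>p \<in> topspace S. p \<notin> U \<longrightarrow> x p = 0)"
  unfolding data_sum_carrier[OF assms(1) abelian_zdata[OF assms(2)]] by (auto simp: PiE_iff)

lemma exact_at_zdata_empty:
  assumes U: "upclosed S U" and "topspace S \<inter> U = {}"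
  shows "exact_at S (zdata U) n"
  unfolding exact_at_def
proof (intro ballI impI)
  note M = abelian_zdata[OF U]
  interpret d: group_hom "bar S (zdata U) (Suc (Suc n))" "bar S (zdata U) (Suc n)" "bard S (zdata U) (Suc n)"
    by (rule hom_group_homI[OF comm_group_bar[OF M] comm_group_bar[OF M] bard_hom[OF M]])
  fix c assume "c \<in> carrier (bar S (zdata U) (Suc n))"
  then have "c = \<one>\<^bsub>bar S (zdata U) (Suc n)\<^esub>"
    using assms(2) chains_hd[of _ S "Suc n"] unfolding bar_zdata_iff[OF U] bar_one[OF M]
    by (auto simp: fun_eq_iff extensional_def restrict_def)
  then show "c \<in> bard S (zdata U) (Suc n) ` carrier (bar S (zdata U) (Suc (Suc n)))"
    using d.hom_one by (intro image_eqI[of _ _ "\<one>\<^bsub>bar S (zdata U) (Suc (Suc n))\<^esub>"]) auto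
qed

text \<open>Splits off the deletion of the first entry; the remaining deletions keep
  \<open>x\<close> and have their signs reversed. This is the identity behind the contraction of a
  cone.\<close>

lemma inc_Cons:
  "inc (x # zs) (y # ys) = (if zs = y # ys then 1 else 0) - (if y = x then inc zs ys else 0)"
proof -
  have "inc (x # zs) (y # ys) = (if del 0 (x # zs) = y # ys then 1 else 0) +
      (\<Sum>i<length zs. if del (Suc i) (x # zs) = y # ys then (-1) ^ Suc i else 0)"
    unfolding inc_def length_Cons sum.lessThan_Suc_shift by simp
  also have "del 0 (x # zs) = zs" by (simp add: del_def)
  also have "(\<Sum>i<length zs. if del (Suc i) (x # zs) = y # ys then (-1) ^ Suc i else 0) =
      (\<Sum>i<length zs. - (if y = x then (if del i zs = ys then (-1) ^ i else 0) else 0 :: int))"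
    by (intro sum.cong) (auto simp: del_def)
  also have "\<dots> = - (if y = x then inc zs ys else 0)"
    unfolding sum_negf inc_def by simp
  finally show ?thesis by simp
qed

lemma inj_on_Cons1: "inj_on ((#) x) A"
  by (simp add: inj_on_def)

text \<open>Prepending the least element \<open>x\<close> of the support is a contracting homotopy.\<close>

lemma exact_at_zdata_cone:
  assumes fin: "finite (topspace S)" and x: "x \<in> topspace S"
    and U: "\<And>q. q \<in> topspace S \<Longrightarrow> q \<in> U \<longleftrightarrow> spec_le S x q"
  shows "exact_at S (zdata U) n"
  unfolding exact_at_def
proof (intro ballI impI)
  have up: "upclosed S U"
    unfolding upclosed_def using U spec_le_trans[of S x] spec_le_topspace[of S] by blast
  have xU: "x \<in> U" using U[OF x] spec_le_refl[OF x] by simp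
  fix c assume c: "c \<in> carrier (bar S (zdata U) (Suc n))"
    and dc: "bard S (zdata U) n c = \<one>\<^bsub>bar S (zdata U) n\<^esub>"
  define b where "b = (\<lambda>ys\<in>chains S (Suc (Suc n)). if hd ys = x then c (tl ys) else 0)"
  have b: "b \<in> carrier (bar S (zdata U) (Suc (Suc n)))"
    unfolding bar_zdata_iff[OF up] b_def using xU by auto
  \<comment> \<open>\<open>U\<close> is the set of points above \<open>x\<close>, so prepending
    \<open>x\<close> needs only that the chain starts in \<open>U\<close>.\<close>
  have Cons: "x # zs \<in> chains S (Suc (Suc n)) \<longleftrightarrow> zs \<in> chains S (Suc n) \<and> hd zs \<in> U" for zs
  proof
    assume "zs \<in> chains S (Suc n) \<and> hd zs \<in> U"
    then show "x # zs \<in> chains S (Suc (Suc n))"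
      using chains_hd_le[of zs S "Suc n"] x spec_le_trans[of S x "hd zs"] U[OF chains_hd[of zs S "Suc n"]]
      by (auto simp: chains_def)
  next
    assume "x # zs \<in> chains S (Suc (Suc n))"
    then show "zs \<in> chains S (Suc n) \<and> hd zs \<in> U" using U by (cases zs) (auto simp: chains_def)
  qed
  have "bard S (zdata U) (Suc n) b ys = c ys" if ys: "ys \<in> chains S (Suc n)" for ys
  proof -
    obtain y ys' where y: "ys = y # ys'" using ys by (cases ys) (auto simp: chains_def)
    have ys': "ys' \<in> chains S n" using ys unfolding y by (auto simp: chains_def)
    have "bard S (zdata U) (Suc n) b ys = (\<Sum>xs\<in>chains S (Suc (Suc n)). inc xs ys * b xs)"
      by (rule bard_zdata[OF fin up b ys])
    also have "\<dots> = (\<Sum>xs\<in>(#) x ` {zs \<in> chains S (Suc n). hd zs \<in> U}. inc xs ys * c (tl xs))"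
    proof (rule sum.mono_neutral_cong_right[OF finite_chains[OF fin]])
      show "(#) x ` {zs \<in> chains S (Suc n). hd zs \<in> U} \<subseteq> chains S (Suc (Suc n))" using Cons by auto
      show "\<forall>xs\<in>chains S (Suc (Suc n)) - (#) x ` {zs \<in> chains S (Suc n). hd zs \<in> U}. inc xs ys * b xs = 0"
      proof
        fix xs assume xs: "xs \<in> chains S (Suc (Suc n)) - (#) x ` {zs \<in> chains S (Suc n). hd zs \<in> U}"
        have "hd xs \<noteq> x"
        proof
          assume "hd xs = x"
          moreover have "xs \<noteq> []" using xs by (auto simp: chains_def)
          ultimately have "xs = x # tl xs" by (cases xs) auto
          then show False using xs Cons[of "tl xs"] by (metis (no_types, lifting) DiffE imageI mem_Collect_eq)
        qed
        then show "inc xs ys * b xs = 0" using xs by (simp add: b_def)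
      qed
      fix xs assume "xs \<in> (#) x ` {zs \<in> chains S (Suc n). hd zs \<in> U}"
      then obtain zs where "xs = x # zs" "x # zs \<in> chains S (Suc (Suc n))" using Cons by auto
      then show "inc xs ys * b xs = inc xs ys * c (tl xs)" by (simp add: b_def)
    qed
    also have "\<dots> = (\<Sum>zs\<in>{zs \<in> chains S (Suc n). hd zs \<in> U}. inc (x # zs) ys * c zs)"
      by (simp add: sum.reindex inj_on_Cons1)
    \<comment> \<open>Chains that start outside \<open>U\<close> are put back, as \<open>c\<close>
      is zero on them.\<close>
    also have "\<dots> = (\<Sum>zs\<in>chains S (Suc n). inc (x # zs) ys * c zs)"
    proof (rule sum.mono_neutral_left[OF finite_chains[OF fin]])
      show "\<forall>i\<in>chains S (Suc n) - {zs \<in> chains S (Suc n). hd zs \<in> U}. inc (x # i) ys * c i = 0"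
        using c unfolding bar_zdata_iff[OF up] by simp
    qed auto
    also have "\<dots> = (\<Sum>zs\<in>chains S (Suc n). (if zs = ys then c zs else 0) - (if y = x then inc zs ys' * c zs else 0))"
      unfolding y inc_Cons by (intro sum.cong) (auto simp: algebra_simps)
    also have "\<dots> = c ys - (if y = x then (\<Sum>zs\<in>chains S (Suc n). inc zs ys' * c zs) else 0)"
      unfolding sum_subtractf using ys finite_chains[OF fin] by (simp add: sum.delta)
    \<comment> \<open>The correction term is the boundary of \<open>c\<close> at the tail of
      \<open>ys\<close>, which vanishes because \<open>c\<close> is a cycle.\<close>
    also have "(\<Sum>zs\<in>chains S (Suc n). inc zs ys' * c zs) = 0"
      using bard_zdata[OF fin up c ys'] dc ys' by (simp add: bar_one[OF abelian_zdata[OF up]])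
    finally show ?thesis by simp
  qed
  moreover have "bard S (zdata U) (Suc n) b \<in> extensional (chains S (Suc n))" by (simp add: bard_def)
  moreover have "c \<in> extensional (chains S (Suc n))" using c unfolding bar_zdata_iff[OF up] by blast
  ultimately have "c = bard S (zdata U) (Suc n) b" by (intro extensionalityI) auto
  then show "c \<in> bard S (zdata U) (Suc n) ` carrier (bar S (zdata U) (Suc (Suc n)))" using b by (rule image_eqI)
qed

text \<open>A cycle is moved into \<open>F\<close>, bounded there, and the bounding chain is moved
  back; the retraction makes the round trip the identity.\<close>

lemma exact_at_retract:
  assumes fin: "finite (topspace S)" and P: "abelian_data S P" and F: "abelian_data S F"
    and i: "i \<in> data_hom S P F" and r: "r \<in> data_hom S F P"
    and ri: "\<And>p a. p \<in> topspace S \<Longrightarrow> a \<in> carrier (stalk P p) \<Longrightarrow> r p (i p a) = a"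
    and ex: "exact_at S F n"
  shows "exact_at S P n"
  unfolding exact_at_def
proof (intro ballI impI)
  fix c assume c: "c \<in> carrier (bar S P (Suc n))" and dc: "bard S P n c = \<one>\<^bsub>bar S P n\<^esub>"
  interpret g: group_hom "bar S P n" "bar S F n" "barm S i n"
    by (rule hom_group_homI[OF comm_group_bar[OF P] comm_group_bar[OF F] barm_hom[OF P F i]])
  note ic = barm_closed[OF P F i c]
  have "bard S F n (barm S i (Suc n) c) = \<one>\<^bsub>bar S F n\<^esub>"
    unfolding barm_bard[OF fin P F i c, symmetric] dc by (rule g.hom_one)
  then obtain b where b: "b \<in> carrier (bar S F (Suc (Suc n)))" "barm S i (Suc n) c = bard S F (Suc n) b"
    using ex ic unfolding exact_at_def by blast
  have "c = barm S r (Suc n) (barm S i (Suc n) c)"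
  proof (rule extensionalityI)
    show "c \<in> extensional (chains S (Suc n))" using c unfolding carrier_bar[OF P] by (simp add: PiE_iff)
    fix xs assume xs: "xs \<in> chains S (Suc n)"
    then show "c xs = barm S r (Suc n) (barm S i (Suc n) c) xs"
      using ri[OF chains_hd[OF xs] bar_closed[OF P c xs]] by (simp add: barm_def)
  qed (simp add: barm_def)
  also have "\<dots> = bard S P (Suc n) (barm S r (Suc (Suc n)) b)"
    unfolding b(2) by (rule barm_bard[OF fin F P r b(1)])
  finally show "c \<in> bard S P (Suc n) ` carrier (bar S P (Suc (Suc n)))"
    using barm_closed[OF F P r b(1)] by (rule image_eqI)
qed

section \<open>Free data and their coordinates\<close>

definition fdata :: "('a \<Rightarrow> 'j set) \<Rightarrow> ('a, 'j \<Rightarrow>\<^sub>0 int) ab_data" where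
  "fdata D = \<lparr>stalk = (\<lambda>p. free_Abelian_group (D p)), trans_map = (\<lambda>_ _ a. a)\<rparr>"

definition mono_index :: "'a topology \<Rightarrow> ('a \<Rightarrow> 'j set) \<Rightarrow> bool" where
  "mono_index S D \<longleftrightarrow> (\<forall>p q. spec_le S p q \<longrightarrow> D p \<subseteq> D q)"

lemma fdata_simps [simp]:
  "stalk (fdata D) p = free_Abelian_group (D p)" "trans_map (fdata D) = (\<lambda>_ _ a. a)"
  by (simp_all add: fdata_def)

lemma abelian_fdata:
  assumes "mono_index S D"
  shows "abelian_data S (fdata D)"
proof (rule abelian_dataI)
  fix p q assume "spec_le S p q"
  then have "D p \<subseteq> D q" using assms by (simp add: mono_index_def)
  then show "trans_map (fdata D) p q \<in> hom (stalk (fdata D) p) (stalk (fdata D) q)"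
    by (auto intro!: homI)
qed (simp_all add: abelian_free_Abelian_group)

lemma upclosed_index: "mono_index S D \<Longrightarrow> upclosed S {q. j \<in> D q}"
  by (auto simp: mono_index_def upclosed_def)

text \<open>With \<open>coord_incl\<close> this displays the integers on
  \<open>{q. j \<in> D q}\<close> as the direct summand of the free datum that belongs to the basis
  element \<open>j\<close>.\<close>

lemma coord_hom: "(\<lambda>p a. Poly_Mapping.lookup a j) \<in> data_hom S (fdata D) (zdata {q. j \<in> D q})"
proof (rule data_homI)
  fix p
  show "(\<lambda>a. Poly_Mapping.lookup a j) \<in> hom (stalk (fdata D) p) (stalk (zdata {q. j \<in> D q}) p)"
    by (rule homI) (auto simp: Poly_Mapping.lookup_add subset_iff in_keys_iff)
qed simp

lemma coord_incl: "(\<lambda>p k. frag_cmul k (frag_of j)) \<in> data_hom S (zdata {q. j \<in> D q}) (fdata D)"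
proof (rule data_homI)
  fix p
  show "(\<lambda>k. frag_cmul k (frag_of j)) \<in> hom (stalk (zdata {q. j \<in> D q}) p) (stalk (fdata D) p)"
    by (rule homI) (auto simp: frag_cmul_distrib keys_frag_of)
qed simp

lemma keys_minus_coord:
  assumes "Poly_Mapping.keys a \<subseteq> insert j J"
  shows "Poly_Mapping.keys (a - frag_cmul (Poly_Mapping.lookup a j) (frag_of j)) \<subseteq> J"
  using assms by (auto simp: subset_iff in_keys_iff Poly_Mapping.lookup_minus split: if_splits)

text \<open>Finitely many chains with finitely supported values involve only finitely many basis
  elements. Induction on this set \<open>J\<close> bounds one coordinate at a time, and each
  correction clears its coordinate without touching the others.\<close>

lemma exact_at_fdata:
  assumes fin: "finite (topspace S)" and D: "mono_index S D"
    and ex: "\<And>j. exact_at S (zdata {q. j \<in> D q}) n"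
  shows "exact_at S (fdata D) n"
proof -
  note F = abelian_fdata[OF D]
  interpret B1: comm_group "bar S (fdata D) (Suc n)" by (rule comm_group_bar[OF F])
  interpret B2: comm_group "bar S (fdata D) (Suc (Suc n))" by (rule comm_group_bar[OF F])
  interpret d0: group_hom "bar S (fdata D) (Suc n)" "bar S (fdata D) n" "bard S (fdata D) n"
    by (rule hom_group_homI[OF comm_group_bar[OF F] comm_group_bar[OF F] bard_hom[OF F]])
  interpret d1: group_hom "bar S (fdata D) (Suc (Suc n))" "bar S (fdata D) (Suc n)" "bard S (fdata D) (Suc n)"
    by (rule hom_group_homI[OF comm_group_bar[OF F] comm_group_bar[OF F] bard_hom[OF F]])
  have key: "c \<in> bard S (fdata D) (Suc n) ` carrier (bar S (fdata D) (Suc (Suc n)))"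
    if "finite J" "c \<in> carrier (bar S (fdata D) (Suc n))" "bard S (fdata D) n c = \<one>\<^bsub>bar S (fdata D) n\<^esub>"
      "\<And>xs. xs \<in> chains S (Suc n) \<Longrightarrow> Poly_Mapping.keys (c xs) \<subseteq> J" for J c
    using that
  proof (induction J arbitrary: c)
    case empty
    then have "c xs = 0" if "xs \<in> chains S (Suc n)" for xs using that by simp
    then have "c = \<one>\<^bsub>bar S (fdata D) (Suc n)\<^esub>"
      using empty(1) unfolding carrier_bar[OF F] bar_one[OF F]
      by (auto simp: fun_eq_iff PiE_iff extensional_def restrict_def)
    then show ?case using subgroup.one_closed[OF d1.img_is_subgroup] by (simp only:)
  next
    case (insert j J)
    let ?U = "{q. j \<in> D q}"
    note Z = abelian_zdata[OF upclosed_index[OF D, of j]]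
    interpret k: group_hom "bar S (fdata D) n" "bar S (zdata ?U) n" "barm S (\<lambda>p a. Poly_Mapping.lookup a j) n"
      by (rule hom_group_homI[OF comm_group_bar[OF F] comm_group_bar[OF Z] barm_hom[OF F Z coord_hom]])
    let ?cj = "barm S (\<lambda>p a. Poly_Mapping.lookup a j) (Suc n) c"
    have cj: "?cj \<in> carrier (bar S (zdata ?U) (Suc n))" by (rule barm_closed[OF F Z coord_hom insert.prems(1)])
    have "bard S (zdata ?U) n ?cj = \<one>\<^bsub>bar S (zdata ?U) n\<^esub>"
      unfolding barm_bard[OF fin F Z coord_hom insert.prems(1), symmetric] insert.prems(2) by (rule k.hom_one)
    then obtain b where b: "b \<in> carrier (bar S (zdata ?U) (Suc (Suc n)))" "?cj = bard S (zdata ?U) (Suc n) b"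
      using ex[of j] cj unfolding exact_at_def by blast
    let ?b' = "barm S (\<lambda>p k. frag_cmul k (frag_of j)) (Suc (Suc n)) b"
    have b': "?b' \<in> carrier (bar S (fdata D) (Suc (Suc n)))" by (rule barm_closed[OF Z F coord_incl b(1)])
    \<comment> \<open>\<open>?e\<close> is a boundary and carries exactly the \<open>j\<close>-th
      coordinate of \<open>c\<close>, so dividing by it removes \<open>j\<close> from the
      supports.\<close>
    let ?e = "bard S (fdata D) (Suc n) ?b'"
    have e: "?e \<in> carrier (bar S (fdata D) (Suc n))" by (rule d1.hom_closed[OF b'])
    have e_eq: "?e = barm S (\<lambda>p k. frag_cmul k (frag_of j)) (Suc n) ?cj"
      unfolding b(2) by (rule barm_bard[OF fin Z F coord_incl b(1), symmetric])
    let ?c' = "c \<otimes>\<^bsub>bar S (fdata D) (Suc n)\<^esub> inv\<^bsub>bar S (fdata D) (Suc n)\<^esub> ?e"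
    have c': "?c' \<in> carrier (bar S (fdata D) (Suc n))" using insert.prems(1) e by simp
    have dc': "bard S (fdata D) n ?c' = \<one>\<^bsub>bar S (fdata D) n\<^esub>"
      unfolding d0.hom_mult[OF insert.prems(1) B1.inv_closed[OF e]] d0.hom_inv[OF e] bard_bard[OF F fin b']
        insert.prems(2) by simp
    have "Poly_Mapping.keys (?c' xs) \<subseteq> J" if xs: "xs \<in> chains S (Suc n)" for xs
    proof -
      have kc: "Poly_Mapping.keys (?e xs) \<subseteq> D (hd xs)" using bar_closed[OF F e xs] by simp
      have "?c' xs = c xs - ?e xs"
        unfolding bar_mult[OF F] bar_inv[OF F e] using xs inv_free_Abelian_group[OF kc] by simp
      also have "?e xs = frag_cmul (Poly_Mapping.lookup (c xs) j) (frag_of j)"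
        unfolding e_eq using xs by (simp add: barm_def)
      finally show ?thesis using keys_minus_coord[OF insert.prems(3)[OF xs]] by simp
    qed
    from insert.IH[OF c' dc' this] obtain z where z: "z \<in> carrier (bar S (fdata D) (Suc (Suc n)))"
      "?c' = bard S (fdata D) (Suc n) z" by blast
    have "c = ?c' \<otimes>\<^bsub>bar S (fdata D) (Suc n)\<^esub> ?e"
      using B1.m_assoc[OF insert.prems(1) B1.inv_closed[OF e] e] insert.prems(1) e by simp
    also have "\<dots> = bard S (fdata D) (Suc n) (z \<otimes>\<^bsub>bar S (fdata D) (Suc (Suc n))\<^esub> ?b')"
      unfolding z(2) d1.hom_mult[OF z(1) b'] ..
    finally show ?case by (rule image_eqI[OF _ B2.m_closed[OF z(1) b']])
  qed
  show ?thesis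
    unfolding exact_at_def
  proof (intro ballI impI)
    fix c assume "c \<in> carrier (bar S (fdata D) (Suc n))" "bard S (fdata D) n c = \<one>\<^bsub>bar S (fdata D) n\<^esub>"
    then show "c \<in> bard S (fdata D) (Suc n) ` carrier (bar S (fdata D) (Suc (Suc n)))"
      by (rule key[rotated, of _ "\<Union>xs\<in>chains S (Suc n). Poly_Mapping.keys (c xs)"])
        (auto simp: finite_chains[OF fin])
  qed
qed

text \<open>The same elimination of basis elements as for bar cycles, with relations in place of
  boundaries. The hypothesis on coordinates survives each step because a relation is divided
  out.\<close>

lemma relations_fdata:
  assumes fin: "finite (topspace S)" and D: "mono_index S D" and x: "x \<in> carrier (data_sum S (fdata D))"
    and rel: "\<And>j. push S S (zdata {q. j \<in> D q}) (\<lambda>p a. Poly_Mapping.lookup a j) x \<in> colim_relations S (zdata {q. j \<in> D q})"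
  shows "x \<in> colim_relations S (fdata D)"
proof -
  note F = abelian_fdata[OF D]
  interpret N: subgroup "colim_relations S (fdata D)" "data_sum S (fdata D)" by (rule subgroup_colim_relations[OF fin F])
  interpret C: comm_group "data_sum S (fdata D)" by (rule comm_group_data_sum[OF fin F])
  have key: "x \<in> colim_relations S (fdata D)"
    if "finite J" "x \<in> carrier (data_sum S (fdata D))"
      "\<And>j. push S S (zdata {q. j \<in> D q}) (\<lambda>p a. Poly_Mapping.lookup a j) x \<in> colim_relations S (zdata {q. j \<in> D q})"
      "\<And>p. p \<in> topspace S \<Longrightarrow> Poly_Mapping.keys (x p) \<subseteq> J" for J x
    using that
  proof (induction J arbitrary: x)
    case empty
    then have "x p = 0" if "p \<in> topspace S" for p using that by simp
    then have "x = \<one>\<^bsub>data_sum S (fdata D)\<^esub>"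
      using empty(1) unfolding data_sum_carrier[OF fin F] data_sum_one
      by (auto simp: fun_eq_iff PiE_iff extensional_def restrict_def)
    then show ?case using N.one_closed by (simp only:)
  next
    case (insert j J)
    let ?U = "{q. j \<in> D q}"
    note Z = abelian_zdata[OF upclosed_index[OF D]]
    let ?e = "push S S (fdata D) (\<lambda>p k. frag_cmul k (frag_of j)) (push S S (zdata ?U) (\<lambda>p a. Poly_Mapping.lookup a j) x)"
    have eN: "?e \<in> colim_relations S (fdata D)"
      by (rule push_relations[OF fin fin subspace_of_refl Z F coord_incl insert.prems(2)])
    have e: "?e \<in> carrier (data_sum S (fdata D))" using eN N.subset by blast
    let ?x' = "x \<otimes>\<^bsub>data_sum S (fdata D)\<^esub> inv\<^bsub>data_sum S (fdata D)\<^esub> ?e"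
    have x': "?x' \<in> carrier (data_sum S (fdata D))" by (rule C.m_closed[OF insert.prems(1) C.inv_closed[OF e]])
    have rel': "push S S (zdata {q. i \<in> D q}) (\<lambda>p a. Poly_Mapping.lookup a i) ?x' \<in> colim_relations S (zdata {q. i \<in> D q})" for i
    proof -
      interpret h: group_hom "data_sum S (fdata D)" "data_sum S (zdata {q. i \<in> D q})"
        "push S S (zdata {q. i \<in> D q}) (\<lambda>p a. Poly_Mapping.lookup a i)"
        by (rule hom_group_homI[OF comm_group_data_sum[OF fin F] comm_group_data_sum[OF fin Z]
          push_hom[OF fin fin subspace_of_refl F Z coord_hom]])
      interpret Ni: subgroup "colim_relations S (zdata {q. i \<in> D q})" "data_sum S (zdata {q. i \<in> D q})"
        by (rule subgroup_colim_relations[OF fin Z])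
      show ?thesis
        unfolding h.hom_mult[OF insert.prems(1) C.inv_closed[OF e]] h.hom_inv[OF e]
        by (intro Ni.m_closed Ni.m_inv_closed insert.prems(2) push_relations[OF fin fin subspace_of_refl F Z coord_hom eN])
    qed
    have "Poly_Mapping.keys (?x' p) \<subseteq> J" if p: "p \<in> topspace S" for p
    proof -
      have ep: "?e p = frag_cmul (Poly_Mapping.lookup (x p) j) (frag_of j)"
        using p by (simp add: push_self)
      have kc: "Poly_Mapping.keys (?e p) \<subseteq> D p"
        using e p unfolding data_sum_carrier[OF fin F] by (auto simp: PiE_iff simp del: frag_cmul_eq_0_iff)
      have "?x' p = x p - ?e p"
        unfolding data_sum_mult data_sum_inv[OF F e] using p inv_free_Abelian_group[OF kc] by simp
      then show ?thesis unfolding ep using keys_minus_coord[OF insert.prems(3)[OF p]] by simp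
    qed
    from insert.IH[OF x' rel' this] have "?x' \<in> colim_relations S (fdata D)" .
    then have "?x' \<otimes>\<^bsub>data_sum S (fdata D)\<^esub> ?e \<in> colim_relations S (fdata D)" using eN by (rule N.m_closed)
    also have "?x' \<otimes>\<^bsub>data_sum S (fdata D)\<^esub> ?e = x"
      by (simp only: C.m_assoc[OF insert.prems(1) C.inv_closed[OF e] e] C.l_inv[OF e] C.r_one[OF insert.prems(1)])
    finally show ?case .
  qed
  have keys: "finite (\<Union>p\<in>topspace S. Poly_Mapping.keys (x p))" using fin by simp
  show ?thesis by (rule key[OF keys x rel]) auto
qed

text \<open>Injectivity of the map to the integers that adds up all entries of a class in the
  colimit. The form covers supports that miss \<open>S\<close>, where the colimit is zero, together
  with those where it is infinite cyclic.\<close>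

definition sum_exact :: "'a topology \<Rightarrow> 'a set \<Rightarrow> bool" where
  "sum_exact S U \<longleftrightarrow>
     (\<forall>x \<in> carrier (data_sum S (zdata U)). (\<Sum>p\<in>topspace S. x p) = 0 \<longrightarrow> x \<in> colim_relations S (zdata U))"

context
  fixes S :: "'a topology" and U :: "'a set"
  assumes fin: "finite (topspace S)" and U: "upclosed S U"
begin

lemma sum_hom: "(\<lambda>x. \<Sum>p\<in>topspace S. x p) \<in> hom (data_sum S (zdata U)) integer_group"
  by (rule homI) (simp_all add: sum.distrib)

lemma sum_sum_incl: "p \<in> topspace S \<Longrightarrow> (\<Sum>q\<in>topspace S. sum_incl S (zdata U) p k q) = k"
  using fin by (simp add: sum_incl_def cong: if_cong)

text \<open>A relator takes \<open>a\<close> away at \<open>p\<close> and puts it back at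
  \<open>q\<close>, so its total is zero.\<close>

lemma relations_sum_zero:
  assumes "x \<in> colim_relations S (zdata U)"
  shows "(\<Sum>p\<in>topspace S. x p) = 0"
proof -
  note M = abelian_zdata[OF U]
  interpret h: group_hom "data_sum S (zdata U)" integer_group "\<lambda>x. \<Sum>p\<in>topspace S. x p"
    by (rule hom_group_homI[OF comm_group_data_sum[OF fin M] abelian_integer_group sum_hom])
  have "(\<lambda>x. \<Sum>p\<in>topspace S. x p) x \<in> {0}"
  proof (rule relations_hom_in[OF fin M group_integer_group sum_hom _ _ assms])
    show "subgroup {0} integer_group" by (rule group.subgroupI) auto
    fix p q a assume pq: "spec_le S p q" and a: "a \<in> carrier (stalk (zdata U) p)"
    have p: "p \<in> topspace S" and q: "q \<in> topspace S" using pq by (auto simp: spec_le_topspace)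
    note ap = sum_incl_closed[OF fin M p a]
    have aq: "sum_incl S (zdata U) q (trans_map (zdata U) p q a) \<in> carrier (data_sum S (zdata U))"
      by (rule sum_incl_closed[OF fin M q data_trans_closed[OF M pq a]])
    show "(\<Sum>i\<in>topspace S. relator S (zdata U) p q a i) \<in> {0}"
      unfolding relator_def h.hom_mult[OF aq h.G.inv_closed[OF ap]] h.hom_inv[OF ap]
      using sum_sum_incl[OF p] sum_sum_incl[OF q] by simp
  qed
  then show ?thesis by simp
qed

lemma sum_exact_empty: "topspace S \<inter> U = {} \<Longrightarrow> sum_exact S U"
  unfolding sum_exact_def
proof (intro ballI impI)
  note M = abelian_zdata[OF U]
  fix x assume "topspace S \<inter> U = {}" "x \<in> carrier (data_sum S (zdata U))"
  then have "x = \<one>\<^bsub>data_sum S (zdata U)\<^esub>"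
    unfolding data_sum_zdata_iff[OF fin U] data_sum_one by (auto simp: fun_eq_iff extensional_def restrict_def)
  then show "x \<in> colim_relations S (zdata U)"
    using subgroup.one_closed[OF subgroup_colim_relations[OF fin M]] by (simp only:)
qed

text \<open>Modulo relators every entry can be moved to the least point \<open>x0\<close> of the
  support; a class is then determined by its total.\<close>

lemma sum_exact_cone:
  assumes x0: "x0 \<in> topspace S" "\<And>q. q \<in> topspace S \<Longrightarrow> q \<in> U \<Longrightarrow> spec_le S x0 q" "x0 \<in> U"
  shows "sum_exact S U"
proof -
  note M = abelian_zdata[OF U]
  interpret C: comm_group "data_sum S (zdata U)" by (rule comm_group_data_sum[OF fin M])
  interpret N: subgroup "colim_relations S (zdata U)" "data_sum S (zdata U)" by (rule subgroup_colim_relations[OF fin M])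
  let ?b = "\<lambda>k. sum_incl S (zdata U) x0 k"
  have b: "?b k \<in> carrier (data_sum S (zdata U))" for k
    by (rule sum_incl_closed[OF fin M x0(1)]) (simp add: x0)
  have bm: "?b (k + l) = ?b k \<otimes>\<^bsub>data_sum S (zdata U)\<^esub> ?b l" for k l
    unfolding data_sum_mult by (auto simp: sum_incl_def)
  have rel: "x \<otimes>\<^bsub>data_sum S (zdata U)\<^esub> inv\<^bsub>data_sum S (zdata U)\<^esub> ?b (\<Sum>p\<in>topspace S. x p) \<in> colim_relations S (zdata U)"
    if "x \<in> (\<Pi>\<^sub>E p\<in>topspace S. carrier (stalk (zdata U) p))" for x
  proof (rule product_group_induct[OF fin _ that, where P = "\<lambda>x. x \<otimes>\<^bsub>data_sum S (zdata U)\<^esub>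
      inv\<^bsub>data_sum S (zdata U)\<^esub> ?b (\<Sum>p\<in>topspace S. x p) \<in> colim_relations S (zdata U)"])
    show "group (stalk (zdata U) i)" for i using comm_group_zdata[of U i] by (simp add: comm_group_def)
    have "?b 0 = \<one>\<^bsub>data_sum S (zdata U)\<^esub>" unfolding data_sum_one by (auto simp: sum_incl_def)
    then show "(\<lambda>p\<in>topspace S. \<one>\<^bsub>stalk (zdata U) p\<^esub>) \<otimes>\<^bsub>data_sum S (zdata U)\<^esub> inv\<^bsub>data_sum S (zdata U)\<^esub>
        ?b (\<Sum>p\<in>topspace S. (\<lambda>p\<in>topspace S. \<one>\<^bsub>stalk (zdata U) p\<^esub>) p) \<in> colim_relations S (zdata U)"
      unfolding data_sum_one[symmetric] using N.one_closed by (simp del: one_sum_group mult_sum_group add: data_sum_one)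
  next
    fix x y assume xy: "x \<in> (\<Pi>\<^sub>E p\<in>topspace S. carrier (stalk (zdata U) p))" "y \<in> (\<Pi>\<^sub>E p\<in>topspace S. carrier (stalk (zdata U) p))"
      and rx: "x \<otimes>\<^bsub>data_sum S (zdata U)\<^esub> inv\<^bsub>data_sum S (zdata U)\<^esub> ?b (\<Sum>p\<in>topspace S. x p) \<in> colim_relations S (zdata U)"
      and ry: "y \<otimes>\<^bsub>data_sum S (zdata U)\<^esub> inv\<^bsub>data_sum S (zdata U)\<^esub> ?b (\<Sum>p\<in>topspace S. y p) \<in> colim_relations S (zdata U)"
    have x: "x \<in> carrier (data_sum S (zdata U))" and y: "y \<in> carrier (data_sum S (zdata U))"
      using xy unfolding data_sum_carrier[OF fin M] by auto
    let ?xb = "inv\<^bsub>data_sum S (zdata U)\<^esub> ?b (\<Sum>p\<in>topspace S. x p)" and ?yb = "inv\<^bsub>data_sum S (zdata U)\<^esub> ?b (\<Sum>p\<in>topspace S. y p)"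
    have s: "(\<Sum>p\<in>topspace S. (x \<otimes>\<^bsub>data_sum S (zdata U)\<^esub> y) p) = (\<Sum>p\<in>topspace S. x p) + (\<Sum>p\<in>topspace S. y p)"
      by (simp add: sum.distrib)
    have "(x \<otimes>\<^bsub>data_sum S (zdata U)\<^esub> y) \<otimes>\<^bsub>data_sum S (zdata U)\<^esub> inv\<^bsub>data_sum S (zdata U)\<^esub>
        (?b (\<Sum>p\<in>topspace S. x p) \<otimes>\<^bsub>data_sum S (zdata U)\<^esub> ?b (\<Sum>p\<in>topspace S. y p))
        = (x \<otimes>\<^bsub>data_sum S (zdata U)\<^esub> ?xb) \<otimes>\<^bsub>data_sum S (zdata U)\<^esub> (y \<otimes>\<^bsub>data_sum S (zdata U)\<^esub> ?yb)"
      using x y b by (simp add: C.inv_mult C.m_ac del: mult_sum_group inv_sum_group)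
    then show "(\<lambda>p\<in>topspace S. x p \<otimes>\<^bsub>stalk (zdata U) p\<^esub> y p) \<otimes>\<^bsub>data_sum S (zdata U)\<^esub> inv\<^bsub>data_sum S (zdata U)\<^esub>
        ?b (\<Sum>p\<in>topspace S. (\<lambda>p\<in>topspace S. x p \<otimes>\<^bsub>stalk (zdata U) p\<^esub> y p) p) \<in> colim_relations S (zdata U)"
      unfolding data_sum_mult[symmetric] s bm using N.m_closed[OF rx ry] by (simp only:)
  next
    fix q k assume q: "q \<in> topspace S" and k: "k \<in> carrier (stalk (zdata U) q)"
    show "psingle (topspace S) (stalk (zdata U)) q k \<otimes>\<^bsub>data_sum S (zdata U)\<^esub> inv\<^bsub>data_sum S (zdata U)\<^esub>
        ?b (\<Sum>p\<in>topspace S. psingle (topspace S) (stalk (zdata U)) q k p) \<in> colim_relations S (zdata U)"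
      unfolding sum_incl_psingle[symmetric] sum_sum_incl[OF q]
    proof (cases "q \<in> U")
      case True
      from relator_in_relations[OF x0(2)[OF q True], of k "zdata U"]
      show "sum_incl S (zdata U) q k \<otimes>\<^bsub>data_sum S (zdata U)\<^esub> inv\<^bsub>data_sum S (zdata U)\<^esub> ?b k \<in> colim_relations S (zdata U)"
        by (simp add: relator_def x0 del: mult_sum_group)
    next
      case False
      then have "sum_incl S (zdata U) q k = ?b k" using k by (auto simp: sum_incl_def)
      then show "sum_incl S (zdata U) q k \<otimes>\<^bsub>data_sum S (zdata U)\<^esub> inv\<^bsub>data_sum S (zdata U)\<^esub> ?b k \<in> colim_relations S (zdata U)"
        using C.r_inv[OF b] N.one_closed by (simp only:)
    qed
  qed
  show ?thesis
    unfolding sum_exact_def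
  proof (intro ballI impI)
    fix x assume x: "x \<in> carrier (data_sum S (zdata U))" and s: "(\<Sum>p\<in>topspace S. x p) = 0"
    have "?b 0 = \<one>\<^bsub>data_sum S (zdata U)\<^esub>" unfolding data_sum_one by (auto simp: sum_incl_def)
    with rel[of x] x s show "x \<in> colim_relations S (zdata U)"
      unfolding data_sum_carrier[OF fin M, symmetric] by (simp only: C.inv_one C.r_one)
  qed
qed

text \<open>The inverse of summation puts \<open>k\<close> at the point \<open>x0\<close>; the total
  of that family is \<open>k\<close>, which gives injectivity, and \<open>sum_exact\<close> gives
  surjectivity.\<close>

lemma colim_zdata_iso:
  assumes "sum_exact S U" "x0 \<in> topspace S" "x0 \<in> U"
  shows "integer_group \<cong> colim S (zdata U)"
proof -
  note M = abelian_zdata[OF U]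
  interpret C: comm_group "data_sum S (zdata U)" by (rule comm_group_data_sum[OF fin M])
  interpret L: comm_group "colim S (zdata U)" by (rule comm_group_colim[OF fin M])
  let ?b = "\<lambda>k. sum_incl S (zdata U) x0 k"
  have b: "?b k \<in> carrier (data_sum S (zdata U))" for k
    by (rule sum_incl_closed[OF fin M assms(2)]) (simp add: assms)
  have bm: "?b (k + l) = ?b k \<otimes>\<^bsub>data_sum S (zdata U)\<^esub> ?b l" for k l
    unfolding data_sum_mult by (auto simp: sum_incl_def)
  have hom: "(\<lambda>k. cls S (zdata U) (?b k)) \<in> hom integer_group (colim S (zdata U))"
  proof (rule homI)
    show "cls S (zdata U) (?b k) \<in> carrier (colim S (zdata U))" for k
      unfolding carrier_colim using b by (rule imageI)
    show "cls S (zdata U) (?b (k \<otimes>\<^bsub>integer_group\<^esub> l)) = cls S (zdata U) (?b k) \<otimes>\<^bsub>colim S (zdata U)\<^esub> cls S (zdata U) (?b l)" for k l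
      unfolding mult_integer_group bm cls_mult[OF fin M b b] ..
  qed
  interpret h: group_hom integer_group "colim S (zdata U)" "\<lambda>k. cls S (zdata U) (?b k)"
    by (rule hom_group_homI[OF abelian_integer_group L.comm_group_axioms hom])
  have "(\<lambda>k. cls S (zdata U) (?b k)) \<in> iso integer_group (colim S (zdata U))"
  proof (rule h.iso_iff[THEN iffD2], intro conjI ballI impI subsetI)
    fix z assume "z \<in> carrier (colim S (zdata U))"
    then obtain x where x: "x \<in> carrier (data_sum S (zdata U))" "z = cls S (zdata U) x"
      unfolding carrier_colim by blast
    let ?s = "\<Sum>p\<in>topspace S. x p"
    interpret s: group_hom "data_sum S (zdata U)" integer_group "\<lambda>x. \<Sum>p\<in>topspace S. x p"
      by (rule hom_group_homI[OF C.comm_group_axioms abelian_integer_group sum_hom])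
    let ?d = "x \<otimes>\<^bsub>data_sum S (zdata U)\<^esub> inv\<^bsub>data_sum S (zdata U)\<^esub> ?b ?s"
    have d: "?d \<in> carrier (data_sum S (zdata U))" by (rule C.m_closed[OF x(1) C.inv_closed[OF b]])
    have "(\<Sum>p\<in>topspace S. ?d p) = 0"
      unfolding s.hom_mult[OF x(1) C.inv_closed[OF b]] s.hom_inv[OF b] sum_sum_incl[OF assms(2)] by simp
    then have "?d \<in> colim_relations S (zdata U)" using assms(1) d unfolding sum_exact_def by blast
    then have "z = cls S (zdata U) (?b ?s)" unfolding x(2) cls_eq_iff[OF fin M x(1) b] .
    then show "z \<in> (\<lambda>k. cls S (zdata U) (?b k)) ` carrier integer_group" by (rule image_eqI) simp
  next
    fix k assume "cls S (zdata U) (?b k) = \<one>\<^bsub>colim S (zdata U)\<^esub>"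
    then have "?b k \<in> colim_relations S (zdata U)" unfolding cls_one_iff[OF fin M b] .
    from relations_sum_zero[OF this] show "k = \<one>\<^bsub>integer_group\<^esub>"
      unfolding sum_sum_incl[OF assms(2)] by simp
  qed
  then show ?thesis unfolding is_iso_def by blast
qed

text \<open>The isomorphism and the summation are two homomorphisms from an infinite cyclic group to
  the integers, hence the second is a multiple of the first, by some \<open>?m\<close>. A family
  with the single entry 1 has total 1, so \<open>?m\<close> is not zero and a vanishing total makes
  the class trivial. An empty support would make the colimit zero.\<close>

lemma sum_exact_of_iso:
  assumes "colim S (zdata U) \<cong> integer_group"
  shows "sum_exact S U" "topspace S \<inter> U \<noteq> {}"
proof -
  note M = abelian_zdata[OF U]
  interpret C: comm_group "data_sum S (zdata U)" by (rule comm_group_data_sum[OF fin M])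
  obtain \<phi> where \<phi>: "\<phi> \<in> iso (colim S (zdata U)) integer_group" using assms unfolding is_iso_def by blast
  then have \<phi>h: "\<phi> \<in> hom (colim S (zdata U)) integer_group" and bij: "bij_betw \<phi> (carrier (colim S (zdata U))) UNIV"
    by (auto simp: iso_def)
  interpret L: comm_group "colim S (zdata U)" by (rule comm_group_colim[OF fin M])
  let ?h = "\<lambda>x. \<phi> (cls S (zdata U) x)"
  interpret h: group_hom "data_sum S (zdata U)" integer_group ?h
    by (rule hom_group_homI[OF C.comm_group_axioms abelian_integer_group])
      (use hom_compose[OF cls_hom[OF fin M] \<phi>h] in \<open>simp add: comp_def\<close>)
  have ker: "x \<in> colim_relations S (zdata U)" if x: "x \<in> carrier (data_sum S (zdata U))" and "?h x = 0" for x
  proof -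
    have "\<phi> \<one>\<^bsub>colim S (zdata U)\<^esub> = 0" using hom_one[OF \<phi>h L.is_group group_integer_group] by simp
    moreover have "cls S (zdata U) x \<in> carrier (colim S (zdata U))" unfolding carrier_colim using x by (rule imageI)
    ultimately have "cls S (zdata U) x = \<one>\<^bsub>colim S (zdata U)\<^esub>"
      using bij that(2) L.one_closed unfolding bij_betw_def inj_on_def by metis
    then show ?thesis unfolding cls_one_iff[OF fin M x] .
  qed
  interpret s: group_hom "data_sum S (zdata U)" integer_group "\<lambda>x. \<Sum>p\<in>topspace S. x p"
    by (rule hom_group_homI[OF C.comm_group_axioms abelian_integer_group sum_hom])
  \<comment> \<open>\<open>x1\<close> represents the generator of the colimit that corresponds to 1,
    and \<open>?m\<close> will be its total.\<close>
  have "1 \<in> \<phi> ` carrier (colim S (zdata U))" using bij by (simp add: bij_betw_def)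
  then obtain x1 where x1: "x1 \<in> carrier (data_sum S (zdata U))" "?h x1 = 1"
    unfolding carrier_colim by auto
  let ?m = "\<Sum>p\<in>topspace S. x1 p"
  have sum_eq: "(\<Sum>p\<in>topspace S. x p) = ?h x * ?m" if x: "x \<in> carrier (data_sum S (zdata U))" for x
  proof -
    have p: "x1 [^]\<^bsub>data_sum S (zdata U)\<^esub> ?h x \<in> carrier (data_sum S (zdata U))" by (rule C.int_pow_closed[OF x1(1)])
    let ?d = "x \<otimes>\<^bsub>data_sum S (zdata U)\<^esub> inv\<^bsub>data_sum S (zdata U)\<^esub> (x1 [^]\<^bsub>data_sum S (zdata U)\<^esub> ?h x)"
    have "?h ?d = 0"
      unfolding h.hom_mult[OF x C.inv_closed[OF p]] h.hom_inv[OF p] h.hom_int_pow[OF x1(1)] x1(2) by simp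
    then have "?d \<in> colim_relations S (zdata U)" by (rule ker[OF C.m_closed[OF x C.inv_closed[OF p]]])
    from relations_sum_zero[OF this] show ?thesis
      unfolding s.hom_mult[OF x C.inv_closed[OF p]] s.hom_inv[OF p] s.hom_int_pow[OF x1(1)] by simp
  qed
  show ne: "topspace S \<inter> U \<noteq> {}"
  proof
    assume "topspace S \<inter> U = {}"
    then have "x1 = \<one>\<^bsub>data_sum S (zdata U)\<^esub>"
      using x1(1) unfolding data_sum_zdata_iff[OF fin U] data_sum_one by (auto simp: fun_eq_iff extensional_def restrict_def)
    then show False using h.hom_one x1(2) by (simp only: one_integer_group zero_neq_one)
  qed
  then obtain p where p: "p \<in> topspace S" "p \<in> U" by blast
  have a: "sum_incl S (zdata U) p 1 \<in> carrier (data_sum S (zdata U))"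
    by (rule sum_incl_closed[OF fin M p(1)]) (simp add: p)
  have "?m \<noteq> 0" using sum_eq[OF a] unfolding sum_sum_incl[OF p(1)] by auto
  then show "sum_exact S U"
    unfolding sum_exact_def using sum_eq ker by simp
qed

end

lemma data_epiI:
  assumes "\<phi> \<in> data_hom X F G" "\<And>p. p \<in> topspace X \<Longrightarrow> \<phi> p ` carrier (stalk F p) = carrier (stalk G p)"
  shows "data_epi X F G \<phi>"
  using assms by (simp add: data_epi_def)

section \<open>Passing to an open subset\<close>

lemma chains_subtopology:
  assumes "upclosed S U"
  shows "chains (subtopology S U) n = {xs \<in> chains S n. hd xs \<in> U}"
proof (intro equalityI subsetI)
  fix xs assume "xs \<in> chains (subtopology S U) n"
  moreover from this have "sorted_wrt (spec_le S) xs"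
    unfolding chains_def by (auto simp: spec_le_subtopology intro: sorted_wrt_mono_rel[rotated])
  ultimately show "xs \<in> {xs \<in> chains S n. hd xs \<in> U}"
    using chains_hd[of xs "subtopology S U" n] by (auto simp: chains_def)
next
  fix xs assume xs: "xs \<in> {xs \<in> chains S n. hd xs \<in> U}"
  then have "set xs \<subseteq> U"
    using assms chains_hd_le[of xs S n] unfolding upclosed_def by blast
  moreover have "sorted_wrt (spec_le (subtopology S U)) xs"
    by (rule sorted_wrt_mono_rel[of xs "spec_le S"])
      (use xs \<open>set xs \<subseteq> U\<close> in \<open>auto simp: spec_le_subtopology chains_def\<close>)
  ultimately show "xs \<in> chains (subtopology S U) n" using xs by (auto simp: chains_def)
qed

context
  fixes S :: "'a topology" and U :: "'a set"
  assumes fin: "finite (topspace S)" and U: "upclosed S U"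
begin

private lemma fin': "finite (topspace (subtopology S U))"
  using fin by (simp add: topspace_subtopology)

private lemma upU: "upclosed (subtopology S U) UNIV"
  by (simp add: upclosed_def)

text \<open>A chain of \<open>S\<close> lies in \<open>U\<close> as soon as it starts there, and
  \<open>zdata U\<close> is zero elsewhere, so only zero entries are discarded.\<close>

lemma bard_restrict:
  assumes c: "c \<in> carrier (bar S (zdata U) (Suc n))"
  shows "restrict c (chains (subtopology S U) (Suc n)) \<in> carrier (bar (subtopology S U) (zdata UNIV) (Suc n))"
    and "bard (subtopology S U) (zdata UNIV) n (restrict c (chains (subtopology S U) (Suc n))) =
      restrict (bard S (zdata U) n c) (chains (subtopology S U) n)"
proof -
  let ?S = "subtopology S U" and ?r = "restrict c (chains (subtopology S U) (Suc n))"
  show r: "?r \<in> carrier (bar ?S (zdata UNIV) (Suc n))"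
    unfolding bar_zdata_iff[OF upU] by simp
  show "bard ?S (zdata UNIV) n ?r = restrict (bard S (zdata U) n c) (chains ?S n)"
  proof (rule extensionalityI)
    fix ys assume ys: "ys \<in> chains ?S n"
    then have ysS: "ys \<in> chains S n" by (simp add: chains_subtopology[OF U])
    have "bard ?S (zdata UNIV) n ?r ys = (\<Sum>xs\<in>chains ?S (Suc n). inc xs ys * c xs)"
      unfolding bard_zdata[OF fin' upU r ys] by (intro sum.cong) auto
    also have "\<dots> = (\<Sum>xs\<in>chains S (Suc n). inc xs ys * c xs)"
      using c unfolding bar_zdata_iff[OF U]
      by (intro sum.mono_neutral_left finite_chains[OF fin]) (auto simp: chains_subtopology[OF U])
    also have "\<dots> = bard S (zdata U) n c ys" by (rule bard_zdata[OF fin U c ysS, symmetric])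
    finally show "bard ?S (zdata UNIV) n ?r ys = restrict (bard S (zdata U) n c) (chains ?S n) ys" using ys by simp
  qed (unfold bard_def, rule restrict_extensional, rule restrict_extensional)
qed

text \<open>A face of a chain in \<open>U\<close> starts in \<open>U\<close> again, so the boundary
  of an extension by zero has no nonzero entry outside \<open>U\<close>.\<close>

lemma bard_extend:
  assumes c: "c \<in> carrier (bar (subtopology S U) (zdata UNIV) (Suc n))"
  defines "ext \<equiv> \<lambda>n c. \<lambda>xs\<in>chains S n. if xs \<in> chains (subtopology S U) n then c xs else (0::int)"
  shows "ext (Suc n) c \<in> carrier (bar S (zdata U) (Suc n))"
    and "bard S (zdata U) n (ext (Suc n) c) = ext n (bard (subtopology S U) (zdata UNIV) n c)"
proof -
  let ?S = "subtopology S U"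
  show e: "ext (Suc n) c \<in> carrier (bar S (zdata U) (Suc n))"
    unfolding bar_zdata_iff[OF U] ext_def by (simp add: chains_subtopology[OF U])
  show "bard S (zdata U) n (ext (Suc n) c) = ext n (bard ?S (zdata UNIV) n c)"
  proof (rule extensionalityI)
    fix ys assume ys: "ys \<in> chains S n"
    have "bard S (zdata U) n (ext (Suc n) c) ys = (\<Sum>xs\<in>chains S (Suc n). inc xs ys * ext (Suc n) c xs)"
      by (rule bard_zdata[OF fin U e ys])
    also have "\<dots> = (\<Sum>xs\<in>chains ?S (Suc n). inc xs ys * c xs)"
      by (intro sum.mono_neutral_cong_right finite_chains[OF fin])
        (auto simp: ext_def chains_subtopology[OF U])
    also have "\<dots> = ext n (bard ?S (zdata UNIV) n c) ys"
    proof (cases "ys \<in> chains ?S n")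
      case True
      then show ?thesis using ys bard_zdata[OF fin' upU c True] by (simp add: ext_def)
    next
      case False
      have "inc xs ys * c xs = 0" if "xs \<in> chains ?S (Suc n)" for xs
      proof (rule ccontr)
        assume "inc xs ys * c xs \<noteq> 0"
        then have "spec_le S (hd xs) (hd ys)"
          using inc_nonzero_le[OF _ ys, of xs] that by (simp add: chains_subtopology[OF U])
        moreover have "hd xs \<in> U" using that by (simp add: chains_subtopology[OF U])
        ultimately have "hd ys \<in> U" using U unfolding upclosed_def by blast
        then show False using False ys by (simp add: chains_subtopology[OF U])
      qed
      then have "(\<Sum>xs\<in>chains ?S (Suc n). inc xs ys * c xs) = 0" by (intro sum.neutral ballI)
      then show ?thesis using False ys by (simp add: ext_def)
    qed
    finally show "bard S (zdata U) n (ext (Suc n) c) ys = ext n (bard ?S (zdata UNIV) n c) ys" .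
  qed (simp_all add: bard_def ext_def)
qed

text \<open>Restriction and extension by zero are inverse isomorphisms between the bar complex of
  \<open>U\<close> with constant coefficients and that of \<open>S\<close> with coefficients
  supported on \<open>U\<close>.\<close>

lemma exact_at_subtopology:
  "exact_at (subtopology S U) (zdata UNIV) n \<longleftrightarrow> exact_at S (zdata U) n"
proof
  let ?S = "subtopology S U"
  let ?ext = "\<lambda>n c. \<lambda>xs\<in>chains S n. if xs \<in> chains ?S n then c xs else (0::int)"
  have sub: "chains ?S m \<subseteq> chains S m" for m by (auto simp: chains_subtopology[OF U])
  {
    assume ex: "exact_at ?S (zdata UNIV) n"
    show "exact_at S (zdata U) n"
      unfolding exact_at_def
    proof (intro ballI impI)
      fix c assume c: "c \<in> carrier (bar S (zdata U) (Suc n))" and dc: "bard S (zdata U) n c = \<one>\<^bsub>bar S (zdata U) n\<^esub>"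
      let ?r = "restrict c (chains ?S (Suc n))"
      have "bard ?S (zdata UNIV) n ?r = \<one>\<^bsub>bar ?S (zdata UNIV) n\<^esub>"
        unfolding bard_restrict(2)[OF c] dc bar_one[OF abelian_zdata[OF U]] bar_one[OF abelian_zdata_UNIV]
        using sub by (auto simp: fun_eq_iff restrict_def)
      then obtain b where b: "b \<in> carrier (bar ?S (zdata UNIV) (Suc (Suc n)))" "?r = bard ?S (zdata UNIV) (Suc n) b"
        using ex bard_restrict(1)[OF c] unfolding exact_at_def by blast
      have "c = ?ext (Suc n) ?r"
        using c unfolding bar_zdata_iff[OF U] by (auto simp: fun_eq_iff extensional_def restrict_def chains_subtopology[OF U])
      also have "\<dots> = bard S (zdata U) (Suc n) (?ext (Suc (Suc n)) b)"
        unfolding b(2) by (rule bard_extend(2)[OF b(1), symmetric])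
      finally show "c \<in> bard S (zdata U) (Suc n) ` carrier (bar S (zdata U) (Suc (Suc n)))"
        using bard_extend(1)[OF b(1)] by (rule image_eqI)
    qed
  }
  assume ex: "exact_at S (zdata U) n"
  show "exact_at ?S (zdata UNIV) n"
    unfolding exact_at_def
  proof (intro ballI impI)
    fix c assume c: "c \<in> carrier (bar ?S (zdata UNIV) (Suc n))"
      and dc: "bard ?S (zdata UNIV) n c = \<one>\<^bsub>bar ?S (zdata UNIV) n\<^esub>"
    have "bard S (zdata U) n (?ext (Suc n) c) = \<one>\<^bsub>bar S (zdata U) n\<^esub>"
      unfolding bard_extend(2)[OF c] dc bar_one[OF abelian_zdata[OF U]] bar_one[OF abelian_zdata_UNIV]
      by (auto simp: fun_eq_iff restrict_def)
    then obtain b where b: "b \<in> carrier (bar S (zdata U) (Suc (Suc n)))" "?ext (Suc n) c = bard S (zdata U) (Suc n) b"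
      using ex bard_extend(1)[OF c] unfolding exact_at_def by blast
    have "c = restrict (?ext (Suc n) c) (chains ?S (Suc n))"
      using c sub unfolding bar_zdata_iff[OF upU] by (auto simp: fun_eq_iff extensional_def restrict_def)
    also have "\<dots> = bard ?S (zdata UNIV) (Suc n) (restrict b (chains ?S (Suc (Suc n))))"
      unfolding b(2) by (rule bard_restrict(2)[OF b(1), symmetric])
    finally show "c \<in> bard ?S (zdata UNIV) (Suc n) ` carrier (bar ?S (zdata UNIV) (Suc (Suc n)))"
      using bard_restrict(1)[OF b(1)] by (rule image_eqI)
  qed
qed

lemma zdata_incl_hom: "(\<lambda>p a. a) \<in> data_hom (subtopology S U) (zdata UNIV) (zdata U)"
  by (rule data_homI) (auto intro!: homI simp: topspace_subtopology)

text \<open>For the converse, a chain over \<open>S\<close> that produces the relation is restricted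
  to \<open>U\<close>.\<close>

lemma relations_subtopology_iff:
  assumes x: "x \<in> carrier (data_sum (subtopology S U) (zdata UNIV))"
  shows "x \<in> colim_relations (subtopology S U) (zdata UNIV) \<longleftrightarrow>
    push (subtopology S U) S (zdata U) (\<lambda>p a. a) x \<in> colim_relations S (zdata U)"
proof
  let ?S = "subtopology S U"
  assume "x \<in> colim_relations ?S (zdata UNIV)"
  then show "push ?S S (zdata U) (\<lambda>p a. a) x \<in> colim_relations S (zdata U)"
    by (rule push_relations[OF fin' fin subspace_of_subtopology abelian_zdata_UNIV abelian_zdata[OF U] zdata_incl_hom])
next
  let ?S = "subtopology S U"
  assume "push ?S S (zdata U) (\<lambda>p a. a) x \<in> colim_relations S (zdata U)"
  then obtain c where c: "c \<in> carrier (bar S (zdata U) (Suc 0))" "push ?S S (zdata U) (\<lambda>p a. a) x = bar_aug S (zdata U) c"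
    unfolding relations_iff_bar_aug[OF fin abelian_zdata[OF U]] by blast
  have "x = bar_aug ?S (zdata UNIV) (restrict c (chains ?S (Suc 0)))"
  proof (rule extensionalityI)
    show "x \<in> extensional (topspace ?S)" using x unfolding data_sum_zdata_iff[OF fin' upU] by blast
    fix p assume p: "p \<in> topspace ?S"
    then have pS: "p \<in> topspace S" "[p] \<in> chains ?S 0" by (auto simp: topspace_subtopology chains_0)
    from fun_cong[OF c(2), of p] show "x p = bar_aug ?S (zdata UNIV) (restrict c (chains ?S (Suc 0))) p"
      using p pS by (simp add: push_def bar_aug_def bard_restrict(2)[OF c(1)])
  qed (simp add: bar_aug_def)
  then show "x \<in> colim_relations ?S (zdata UNIV)"
    using bar_aug_in_relations[OF fin' abelian_zdata_UNIV bard_restrict(1)[OF c(1)]] by simp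
qed

lemma colim_subtopology_iso: "colim (subtopology S U) (zdata UNIV) \<cong> colim S (zdata U)"
proof -
  let ?S = "subtopology S U"
  let ?p = "push ?S S (zdata U) (\<lambda>p a. a)" and ?h = "colim_map ?S (zdata UNIV) S (zdata U) (\<lambda>p a. a)"
  note M = abelian_zdata[OF U]
  note hyps = fin' fin subspace_of_subtopology abelian_zdata_UNIV M zdata_incl_hom
  interpret h: group_hom "colim ?S (zdata UNIV)" "colim S (zdata U)" ?h
    by (rule hom_group_homI[OF comm_group_colim[OF fin' abelian_zdata_UNIV] comm_group_colim[OF fin M] colim_map_hom[OF hyps]])
  have "?h \<in> iso (colim ?S (zdata UNIV)) (colim S (zdata U))"
  proof (rule h.iso_iff[THEN iffD2], intro conjI ballI impI subsetI)
    fix z assume "z \<in> carrier (colim S (zdata U))"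
    then obtain x where x: "x \<in> carrier (data_sum S (zdata U))" "z = cls S (zdata U) x"
      unfolding carrier_colim by blast
    let ?r = "restrict x (topspace ?S)"
    have r: "?r \<in> carrier (data_sum ?S (zdata UNIV))" unfolding data_sum_zdata_iff[OF fin' upU] by simp
    have "?p ?r = x"
      using x(1) unfolding data_sum_zdata_iff[OF fin U] push_def
      by (auto simp: fun_eq_iff extensional_def restrict_def topspace_subtopology)
    then have "z = ?h (cls ?S (zdata UNIV) ?r)" unfolding x(2) colim_map_cls[OF hyps r] by simp
    then show "z \<in> ?h ` carrier (colim ?S (zdata UNIV))"
      by (rule image_eqI) (use r in \<open>auto simp: carrier_colim\<close>)
  next
    fix z assume "z \<in> carrier (colim ?S (zdata UNIV))" and one: "?h z = \<one>\<^bsub>colim S (zdata U)\<^esub>"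
    then obtain x where x: "x \<in> carrier (data_sum ?S (zdata UNIV))" "z = cls ?S (zdata UNIV) x"
      unfolding carrier_colim by blast
    have px: "?p x \<in> carrier (data_sum S (zdata U))" by (rule hom_in_carrier[OF push_hom[OF hyps] x(1)])
    have "?p x \<in> colim_relations S (zdata U)"
      using one unfolding x(2) colim_map_cls[OF hyps x(1)] cls_one_iff[OF fin M px] .
    then have "x \<in> colim_relations ?S (zdata UNIV)" unfolding relations_subtopology_iff[OF x(1)] .
    then show "z = \<one>\<^bsub>colim ?S (zdata UNIV)\<^esub>" unfolding x(2) cls_one_iff[OF fin' abelian_zdata_UNIV x(1)] .
  qed
  then show ?thesis unfolding is_iso_def by blast
qed

end

text \<open>Serves to replace the integers on an up-set by their copy coded in
  \<open>'g\<close>.\<close>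

lemma colim_iso_of_data_iso:
  assumes fin: "finite (topspace S)" and F: "abelian_data S F" and G: "abelian_data S G"
    and i: "i \<in> data_hom S F G" and r: "r \<in> data_hom S G F"
    and ri: "\<And>p a. p \<in> topspace S \<Longrightarrow> a \<in> carrier (stalk F p) \<Longrightarrow> r p (i p a) = a"
    and ir: "\<And>p a. p \<in> topspace S \<Longrightarrow> a \<in> carrier (stalk G p) \<Longrightarrow> i p (r p a) = a"
  shows "colim S F \<cong> colim S G"
proof -
  note hi = fin fin subspace_of_refl F G i and hr = fin fin subspace_of_refl G F r
  interpret h: group_hom "colim S F" "colim S G" "colim_map S F S G i"
    by (rule hom_group_homI[OF comm_group_colim[OF fin F] comm_group_colim[OF fin G] colim_map_hom[OF hi]])
  have 1: "push S S F r (push S S G i x) = x" if "x \<in> carrier (data_sum S F)" for x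
    using that ri unfolding data_sum_carrier[OF fin F] push_self
    by (auto simp: fun_eq_iff PiE_iff extensional_def)
  have 2: "push S S G i (push S S F r x) = x" if "x \<in> carrier (data_sum S G)" for x
    using that ir unfolding data_sum_carrier[OF fin G] push_self
    by (auto simp: fun_eq_iff PiE_iff extensional_def)
  have *: "colim_map S G S F r (colim_map S F S G i z) = z" if z: "z \<in> carrier (colim S F)" for z
  proof -
    obtain x where x: "x \<in> carrier (data_sum S F)" "z = cls S F x" using z unfolding carrier_colim by blast
    show ?thesis
      unfolding x(2) colim_map_cls[OF hi x(1)] colim_map_cls[OF hr hom_in_carrier[OF push_hom[OF hi] x(1)]] 1[OF x(1)] ..
  qed
  have **: "colim_map S F S G i (colim_map S G S F r z) = z" if z: "z \<in> carrier (colim S G)" for z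
  proof -
    obtain x where x: "x \<in> carrier (data_sum S G)" "z = cls S G x" using z unfolding carrier_colim by blast
    show ?thesis
      unfolding x(2) colim_map_cls[OF hr x(1)] colim_map_cls[OF hi hom_in_carrier[OF push_hom[OF hr] x(1)]] 2[OF x(1)] ..
  qed
  have "bij_betw (colim_map S F S G i) (carrier (colim S F)) (carrier (colim S G))"
    by (rule bij_betw_byWitness[where f' = "colim_map S G S F r"])
      (use * ** hom_in_carrier[OF colim_map_hom[OF hi]] hom_in_carrier[OF colim_map_hom[OF hr]] in auto)
  then show ?thesis using h.homh unfolding is_iso_def iso_def by blast
qed

subsection \<open>Projective data and resolutions\<close>

text \<open>Transport of structure along a coding \<open>e\<close>. With \<open>e\<close> injective
  on a set \<open>A\<close> that contains all carriers, the single map \<open>inv_into A e\<close>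
  decodes every stalk.\<close>

definition tdata :: "('h \<Rightarrow> 'g) \<Rightarrow> 'h set \<Rightarrow> ('a, 'h) ab_data \<Rightarrow> ('a, 'g) ab_data" where
  "tdata e A F = \<lparr>stalk = (\<lambda>p. \<lparr>carrier = e ` carrier (stalk F p),
       mult = (\<lambda>x y. e (inv_into A e x \<otimes>\<^bsub>stalk F p\<^esub> inv_into A e y)), one = e \<one>\<^bsub>stalk F p\<^esub>\<rparr>),
     trans_map = (\<lambda>p q a. e (trans_map F p q (inv_into A e a)))\<rparr>"

lemma tdata_simps [simp]:
  "carrier (stalk (tdata e A F) p) = e ` carrier (stalk F p)"
  "x \<otimes>\<^bsub>stalk (tdata e A F) p\<^esub> y = e (inv_into A e x \<otimes>\<^bsub>stalk F p\<^esub> inv_into A e y)"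
  "\<one>\<^bsub>stalk (tdata e A F) p\<^esub> = e \<one>\<^bsub>stalk F p\<^esub>"
  "trans_map (tdata e A F) p q a = e (trans_map F p q (inv_into A e a))"
  by (simp_all add: tdata_def)

context
  fixes X :: "'a topology" and F :: "('a, 'h) ab_data" and e :: "'h \<Rightarrow> 'g" and A :: "'h set"
  assumes F: "abelian_data X F" and e: "inj_on e A"
    and A: "\<And>p. p \<in> topspace X \<Longrightarrow> carrier (stalk F p) \<subseteq> A"
begin

lemma tdata_inv: "p \<in> topspace X \<Longrightarrow> a \<in> carrier (stalk F p) \<Longrightarrow> inv_into A e (e a) = a"
  using A by (intro inv_into_f_f[OF e]) auto

lemma abelian_tdata: "abelian_data X (tdata e A F)"
proof (rule abelian_dataI)
  fix p assume p: "p \<in> topspace X"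
  interpret comm_group "stalk F p" by (rule data_comm_group[OF F p])
  have inv: "inv_into A e (e a) = a" if "a \<in> carrier (stalk F p)" for a by (rule tdata_inv[OF p that])
  show "comm_group (stalk (tdata e A F) p)"
  proof (rule comm_groupI)
    fix x assume "x \<in> carrier (stalk (tdata e A F) p)"
    then obtain a where a: "a \<in> carrier (stalk F p)" "x = e a" by auto
    show "\<exists>y\<in>carrier (stalk (tdata e A F) p). y \<otimes>\<^bsub>stalk (tdata e A F) p\<^esub> x = \<one>\<^bsub>stalk (tdata e A F) p\<^esub>"
      by (rule bexI[of _ "e (inv\<^bsub>stalk F p\<^esub> a)"]) (use a in \<open>simp_all add: inv\<close>)
  qed (auto simp: inv m_ac)
  show "trans_map (tdata e A F) p p a = a" if "a \<in> carrier (stalk (tdata e A F) p)" for a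
    using that by (auto simp: inv data_trans_id[OF F p])
next
  fix p q assume pq: "spec_le X p q"
  then have p: "p \<in> topspace X" and q: "q \<in> topspace X" by (auto simp: spec_le_topspace)
  interpret P: comm_group "stalk F p" by (rule data_comm_group[OF F p])
  show "trans_map (tdata e A F) p q \<in> hom (stalk (tdata e A F) p) (stalk (tdata e A F) q)"
    by (rule homI) (auto simp: tdata_inv[OF p] tdata_inv[OF q] data_trans_closed[OF F pq] hom_mult[OF data_trans_hom[OF F pq]])
next
  fix p q r a assume pq: "spec_le X p q" and qr: "spec_le X q r" and a: "a \<in> carrier (stalk (tdata e A F) p)"
  then have p: "p \<in> topspace X" and q: "q \<in> topspace X" by (auto simp: spec_le_topspace)
  show "trans_map (tdata e A F) q r (trans_map (tdata e A F) p q a) = trans_map (tdata e A F) p r a"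
    using a by (auto simp: tdata_inv[OF p] tdata_inv[OF q] data_trans_closed[OF F pq] data_trans_comp[OF F pq qr])
qed

lemma tdata_hom: "(\<lambda>p. e) \<in> data_hom X F (tdata e A F)"
proof (rule data_homI)
  fix p assume p: "p \<in> topspace X"
  show "e \<in> hom (stalk F p) (stalk (tdata e A F) p)"
    by (rule homI) (simp_all add: tdata_inv[OF p])
next
  fix p q a assume "spec_le X p q" "a \<in> carrier (stalk F p)"
  then show "e (trans_map F p q a) = trans_map (tdata e A F) p q (e a)"
    using tdata_inv[OF spec_le_topspace(1)] by simp
qed

lemma tdata_inv_hom: "(\<lambda>p. inv_into A e) \<in> data_hom X (tdata e A F) F"
proof (rule data_homI)
  fix p assume p: "p \<in> topspace X"
  interpret P: comm_group "stalk F p" by (rule data_comm_group[OF F p])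
  show "inv_into A e \<in> hom (stalk (tdata e A F) p) (stalk F p)"
    by (rule homI) (auto simp: tdata_inv[OF p])
next
  fix p q a assume pq: "spec_le X p q" and a: "a \<in> carrier (stalk (tdata e A F) p)"
  then have p: "p \<in> topspace X" and q: "q \<in> topspace X" by (auto simp: spec_le_topspace)
  show "inv_into A e (trans_map (tdata e A F) p q a) = trans_map F p q (inv_into A e a)"
    using a by (auto simp: tdata_inv[OF p] tdata_inv[OF q] data_trans_closed[OF F pq])
qed

end

text \<open>The basis element \<open>(x, m)\<close> is a generator \<open>m\<close> placed at
  \<open>x\<close> and present at all points above. The free datum is thus the sum, over
  \<open>x\<close> and \<open>m \<in> I x\<close>, of copies of the integers on
  \<open>up_set X x\<close>.\<close>

definition free_index :: "'a topology \<Rightarrow> ('a \<Rightarrow> 'i set) \<Rightarrow> 'a \<Rightarrow> ('a \<times> 'i) set" where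
  "free_index X I q = {(x, m). spec_le X x q \<and> m \<in> I x}"

lemma mono_free_index: "mono_index X (free_index X I)"
  unfolding mono_index_def free_index_def using spec_le_trans by auto

lemma hom_free_Abelian_group_eq:
  assumes "group G" "h \<in> hom (free_Abelian_group D) G" "k \<in> hom (free_Abelian_group D) G"
    "\<And>j. j \<in> D \<Longrightarrow> h (frag_of j) = k (frag_of j)" "Poly_Mapping.keys u \<subseteq> D"
  shows "h u = k u"
proof -
  interpret h: group_hom "free_Abelian_group D" G h
    using assms by (simp add: group_hom_def group_hom_axioms_def)
  interpret k: group_hom "free_Abelian_group D" G k
    using assms by (simp add: group_hom_def group_hom_axioms_def)
  show ?thesis
  proof (rule free_Abelian_group_induct[OF assms(5)])
    show "h 0 = k 0" using h.hom_one k.hom_one by simp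
  next
    fix x y assume xy: "Poly_Mapping.keys x \<subseteq> D" "Poly_Mapping.keys y \<subseteq> D" "h x = k x" "h y = k y"
    then have x: "x \<in> carrier (free_Abelian_group D)" and y: "y \<in> carrier (free_Abelian_group D)" by simp_all
    have "x - y = x \<otimes>\<^bsub>free_Abelian_group D\<^esub> inv\<^bsub>free_Abelian_group D\<^esub> y"
      using xy by simp
    then show "h (x - y) = k (x - y)"
      by (simp only: h.hom_mult[OF x h.G.inv_closed[OF y]] k.hom_mult[OF x h.G.inv_closed[OF y]]
          h.hom_inv[OF y] k.hom_inv[OF y] xy(3,4))
  qed (rule assms(4))
qed

text \<open>At a point \<open>q\<close> the generator \<open>(x, m)\<close> is the transition of the
  same generator at \<open>x\<close>, so a morphism is determined by its values there.\<close>

lemma free_data_hom_eq: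
  assumes G: "abelian_data X G" and h: "h \<in> data_hom X (fdata (free_index X I)) G"
    and k: "k \<in> data_hom X (fdata (free_index X I)) G"
    and eq: "\<And>x m. x \<in> topspace X \<Longrightarrow> m \<in> I x \<Longrightarrow> h x (frag_of (x, m)) = k x (frag_of (x, m))"
    and q: "q \<in> topspace X" and u: "u \<in> carrier (stalk (fdata (free_index X I)) q)"
  shows "h q u = k q u"
proof (rule hom_free_Abelian_group_eq[OF data_group[OF G q]])
  show "h q \<in> hom (free_Abelian_group (free_index X I q)) (stalk G q)"
    "k q \<in> hom (free_Abelian_group (free_index X I q)) (stalk G q)"
    using data_hom_hom[OF h q] data_hom_hom[OF k q] by simp_all
  fix j assume "j \<in> free_index X I q"
  then obtain x m where j: "j = (x, m)" "spec_le X x q" "m \<in> I x" by (auto simp: free_index_def)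
  then have x: "x \<in> topspace X" by (simp add: spec_le_topspace)
  then have "frag_of j \<in> carrier (stalk (fdata (free_index X I)) x)"
    using j by (simp add: free_index_def spec_le_refl keys_frag_of)
  from data_hom_natural[OF h j(2) this] data_hom_natural[OF k j(2) this]
  show "h q (frag_of j) = k q (frag_of j)" using eq[OF x j(3)] j(1) by simp
qed (use u in simp)

lemma free_data_lift:
  assumes G: "abelian_data X G" and g: "\<And>x m. x \<in> topspace X \<Longrightarrow> m \<in> I x \<Longrightarrow> g x m \<in> carrier (stalk G x)"
  shows "\<exists>h \<in> data_hom X (fdata (free_index X I)) G. \<forall>x \<in> topspace X. \<forall>m \<in> I x. h x (frag_of (x, m)) = g x m"
proof -
  \<comment> \<open>Naturality forces the value of \<open>(x, m)\<close> at \<open>q\<close> to be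
    the transition of \<open>g x m\<close>.\<close>
  let ?D = "free_index X I" and ?f = "\<lambda>q (x, m). trans_map G x q (g x m)"
  have f: "?f q j \<in> carrier (stalk G q)" if "j \<in> ?D q" for q j
    using that data_trans_closed[OF G] g spec_le_topspace(1) by (force simp: free_index_def)
  have "\<exists>h. h \<in> hom (free_Abelian_group (?D q)) (stalk G q) \<and> (\<forall>j \<in> ?D q. h (frag_of j) = ?f q j)"
    if q: "q \<in> topspace X" for q
  proof -
    interpret comm_group "stalk G q" by (rule data_comm_group[OF G q])
    have im: "?f q ` ?D q \<subseteq> carrier (stalk G q)" using f by blast
    show ?thesis
    proof (rule free_Abelian_group_universal[OF im])
      fix h assume h: "h \<in> hom (free_Abelian_group (?D q)) (stalk G q)"
        and hf: "\<And>j. j \<in> ?D q \<Longrightarrow> h (frag_of j) = ?f q j"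
      show ?thesis by (intro exI[of _ h] conjI ballI h hf)
    qed
  qed
  then have "\<exists>h. \<forall>q \<in> topspace X. h q \<in> hom (free_Abelian_group (?D q)) (stalk G q) \<and> (\<forall>j \<in> ?D q. h q (frag_of j) = ?f q j)"
    by (intro bchoice ballI)
  then obtain h where hh: "\<forall>q \<in> topspace X. h q \<in> hom (free_Abelian_group (?D q)) (stalk G q) \<and> (\<forall>j \<in> ?D q. h q (frag_of j) = ?f q j)"
    by (elim exE)
  have h: "h q \<in> hom (free_Abelian_group (?D q)) (stalk G q)" if "q \<in> topspace X" for q
    using bspec[OF hh that] by (rule conjunct1)
  have hf: "h q (frag_of j) = ?f q j" if "q \<in> topspace X" "j \<in> ?D q" for q j
    using bspec[OF conjunct2[OF bspec[OF hh that(1)]] that(2)] .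
  have hom: "h \<in> data_hom X (fdata ?D) G"
  proof (rule data_homI)
    fix p q a assume pq: "spec_le X p q" and a: "a \<in> carrier (stalk (fdata ?D) p)"
    then have p: "p \<in> topspace X" and q: "q \<in> topspace X" by (auto simp: spec_le_topspace)
    have sub: "?D p \<subseteq> ?D q" using mono_free_index[of X I] pq unfolding mono_index_def by blast
    have "h q a = trans_map G p q (h p a)"
    proof (rule hom_free_Abelian_group_eq[OF data_group[OF G q]])
      show "h q \<in> hom (free_Abelian_group (?D p)) (stalk G q)"
        using h[OF q] sub unfolding hom_def by (auto simp: Pi_iff)
      show "(\<lambda>a. trans_map G p q (h p a)) \<in> hom (free_Abelian_group (?D p)) (stalk G q)"
        using hom_compose[OF h[OF p] data_trans_hom[OF G pq]] by (simp add: comp_def)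
      fix j assume j: "j \<in> ?D p"
      then obtain x m where xm: "j = (x, m)" "spec_le X x p" "m \<in> I x" by (auto simp: free_index_def)
      have "g x m \<in> carrier (stalk G x)" using g xm by (simp add: spec_le_topspace)
      then show "h q (frag_of j) = trans_map G p q (h p (frag_of j))"
        using hf[OF p j] hf[OF q subsetD[OF sub j]] xm(1) data_trans_comp[OF G xm(2) pq] by simp
    qed (use a in simp)
    then show "h q (trans_map (fdata ?D) p q a) = trans_map G p q (h p a)" by simp
  qed (simp add: h)
  have "h x (frag_of (x, m)) = g x m" if "x \<in> topspace X" "m \<in> I x" for x m
    using hf[OF that(1), of "(x, m)"] that data_trans_id[OF G that(1) g[OF that]]
    by (simp add: free_index_def spec_le_refl)
  then show ?thesis by (intro bexI[OF _ hom] ballI)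
qed

text \<open>Stated directly and not through \<open>projective_data\<close>, whose test data must
  have the same type as the projective, while a free datum is to be tested against data of other
  types.\<close>

lemma free_data_projective:
  assumes G: "abelian_data X G" and H: "abelian_data X H" and epi: "data_epi X G H \<pi>"
    and \<phi>: "\<phi> \<in> data_hom X (fdata (free_index X I)) H"
  shows "\<exists>\<psi> \<in> data_hom X (fdata (free_index X I)) G.
    \<forall>p \<in> topspace X. \<forall>a \<in> carrier (stalk (fdata (free_index X I)) p). \<pi> p (\<psi> p a) = \<phi> p a"
proof -
  have "\<exists>b. b \<in> carrier (stalk G x) \<and> \<pi> x b = \<phi> x (frag_of (x, m))" if x: "x \<in> topspace X" and m: "m \<in> I x" for x m
  proof -
    have "frag_of (x, m) \<in> carrier (stalk (fdata (free_index X I)) x)"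
      using x m by (simp add: free_index_def spec_le_refl keys_frag_of)
    then have "\<phi> x (frag_of (x, m)) \<in> \<pi> x ` carrier (stalk G x)"
      using data_hom_closed[OF \<phi> x] epi x by (simp add: data_epi_def)
    then show ?thesis by auto
  qed
  then obtain g where g: "\<And>x m. x \<in> topspace X \<Longrightarrow> m \<in> I x \<Longrightarrow> g x m \<in> carrier (stalk G x)"
    "\<And>x m. x \<in> topspace X \<Longrightarrow> m \<in> I x \<Longrightarrow> \<pi> x (g x m) = \<phi> x (frag_of (x, m))"
    by metis
  have "\<exists>h \<in> data_hom X (fdata (free_index X I)) G. \<forall>x \<in> topspace X. \<forall>m \<in> I x. h x (frag_of (x, m)) = g x m"
    by (rule free_data_lift[OF G g(1)])
  then obtain \<psi> where \<psi>: "\<psi> \<in> data_hom X (fdata (free_index X I)) G"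
    "\<forall>x \<in> topspace X. \<forall>m \<in> I x. \<psi> x (frag_of (x, m)) = g x m"
    by (elim bexE)
  have \<pi>: "\<pi> \<in> data_hom X G H" using epi by (simp add: data_epi_def)
  have "\<pi> p (\<psi> p a) = \<phi> p a" if "p \<in> topspace X" "a \<in> carrier (stalk (fdata (free_index X I)) p)" for p a
    using free_data_hom_eq[OF H data_hom_comp[OF \<psi>(1) \<pi>] \<phi> _ that] \<psi>(2) g(2) by simp
  then show ?thesis by (intro bexI[OF _ \<psi>(1)] ballI)
qed

text \<open>The free abelian group on an infinite set is equipotent to its basis, and
  \<open>A \<times> UNIV\<close> has the cardinality of \<open>'g\<close> for finite nonempty
  \<open>A\<close>. An empty \<open>A\<close> gives the trivial group and is treated apart.\<close>

lemma free_group_encoding: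
  assumes "infinite (UNIV :: 'g set)" "finite (A :: 'a set)"
  obtains e :: "('a \<times> 'g \<Rightarrow>\<^sub>0 int) \<Rightarrow> 'g" where "inj_on e (carrier (free_Abelian_group (A \<times> UNIV)))"
proof -
  have "carrier (free_Abelian_group (A \<times> (UNIV :: 'g set))) \<lesssim> (UNIV :: 'g set)"
  proof (cases "A = {}")
    case True
    then have "carrier (free_Abelian_group (A \<times> (UNIV :: 'g set))) = {0}"
      by (auto simp: free_Abelian_group_def)
    then show ?thesis by (simp add: finite_lepoll_infinite assms(1))
  next
    case False
    then have inf: "infinite (A \<times> (UNIV :: 'g set))" using assms(1) by (simp add: finite_cartesian_product_iff)
    have "|A| \<le>o |UNIV :: 'g set|"
      using finite_lepoll_infinite[OF assms] unfolding lepoll_def card_of_ordLeq .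
    then have "|A \<times> (UNIV :: 'g set)| \<le>o |UNIV :: 'g set|"
      by (rule card_of_Times_ordLeq_infinite[OF assms(1) _ card_of_mono1[OF subset_refl]])
    then have "A \<times> (UNIV :: 'g set) \<lesssim> (UNIV :: 'g set)"
      unfolding lepoll_def card_of_ordLeq .
    with eqpoll_free_Abelian_group_infinite[OF inf] show ?thesis by (rule lepoll_trans1)
  qed
  then obtain e :: "('a \<times> 'g \<Rightarrow>\<^sub>0 int) \<Rightarrow> 'g" where "inj_on e (carrier (free_Abelian_group (A \<times> UNIV)))"
    unfolding lepoll_def by (elim exE conjE)
  then show ?thesis by (rule that)
qed

text \<open>Every stalk element is taken as a generator at its own point, so the morphism sending
  each generator to the element it names is onto. The coding \<open>e\<close> comes along for
  transporting this cover into \<open>'g\<close>.\<close>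

lemma free_cover:
  assumes inf: "infinite (UNIV :: 'g set)" and fin: "finite (topspace X)"
    and F: "abelian_data X (F :: ('a, 'g) ab_data)"
  shows "\<exists>(e :: ('a \<times> 'g \<Rightarrow>\<^sub>0 int) \<Rightarrow> 'g) A \<pi>. inj_on e A \<and>
    (\<forall>p. carrier (stalk (fdata (free_index X (\<lambda>x. carrier (stalk F x)))) p) \<subseteq> A) \<and>
    data_epi X (fdata (free_index X (\<lambda>x. carrier (stalk F x)))) F \<pi>"
proof -
  let ?I = "\<lambda>x. carrier (stalk F x)"
  obtain e :: "('a \<times> 'g \<Rightarrow>\<^sub>0 int) \<Rightarrow> 'g" where e: "inj_on e (carrier (free_Abelian_group (topspace X \<times> UNIV)))"
    by (rule free_group_encoding[OF inf fin])
  have A: "carrier (stalk (fdata (free_index X ?I)) p) \<subseteq> carrier (free_Abelian_group (topspace X \<times> UNIV))" for p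
    using spec_le_topspace(1)[of X] by (fastforce simp: free_index_def)
  obtain \<pi> where \<pi>: "\<pi> \<in> data_hom X (fdata (free_index X ?I)) F"
    "\<forall>x \<in> topspace X. \<forall>m \<in> ?I x. \<pi> x (frag_of (x, m)) = m"
    using free_data_lift[OF F, of ?I "\<lambda>x m. m"] by blast
  have "\<pi> p ` carrier (stalk (fdata (free_index X ?I)) p) = carrier (stalk F p)" if p: "p \<in> topspace X" for p
  proof
    show "\<pi> p ` carrier (stalk (fdata (free_index X ?I)) p) \<subseteq> carrier (stalk F p)"
      using data_hom_closed[OF \<pi>(1) p] by blast
    show "carrier (stalk F p) \<subseteq> \<pi> p ` carrier (stalk (fdata (free_index X ?I)) p)"
    proof
      fix m assume m: "m \<in> carrier (stalk F p)"
      then show "m \<in> \<pi> p ` carrier (stalk (fdata (free_index X ?I)) p)"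
        using p bspec[OF bspec[OF \<pi>(2) p] m] by (intro image_eqI[of _ _ "frag_of (p, m)"]) (auto simp: free_index_def spec_le_refl keys_frag_of)
    qed
  qed
  then have "data_epi X (fdata (free_index X ?I)) F \<pi>" by (rule data_epiI[OF \<pi>(1)])
  then show ?thesis
    by (intro exI[of _ e] exI[of _ "carrier (free_Abelian_group (topspace X \<times> UNIV))"] exI[of _ \<pi>] conjI allI e A)
qed

text \<open>A lifting problem for the coded datum is pulled back to the free datum, where generators
  can be lifted one by one, and the solution is composed with the decoding.\<close>

lemma projective_tdata:
  fixes e :: "('a \<times> 'i \<Rightarrow>\<^sub>0 int) \<Rightarrow> 'g"
  assumes e: "inj_on e A" and A: "\<And>p. p \<in> topspace X \<Longrightarrow> carrier (stalk (fdata (free_index X I)) p) \<subseteq> A"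
  shows "projective_data X (tdata e A (fdata (free_index X I)))"
  unfolding projective_data_def
proof (intro conjI allI impI; (elim conjE)?)
  let ?F = "fdata (free_index X I)"
  note F = abelian_fdata[OF mono_free_index[of X I]]
  show "abelian_data X (tdata e A ?F)" by (rule abelian_tdata[OF F e A])
  fix G H :: "('a, 'g) ab_data" and \<pi> \<phi>
  assume G: "abelian_data X G" and H: "abelian_data X H" and epi: "data_epi X G H \<pi>"
    and \<phi>: "\<phi> \<in> data_hom X (tdata e A ?F) H"
  have th: "(\<lambda>p. e) \<in> data_hom X ?F (tdata e A ?F)" by (rule tdata_hom[OF F e A])
  obtain \<psi> where \<psi>: "\<psi> \<in> data_hom X ?F G"
    "\<forall>p \<in> topspace X. \<forall>a \<in> carrier (stalk ?F p). \<pi> p (\<psi> p a) = \<phi> p (e a)"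
    using free_data_projective[OF G H epi data_hom_comp[OF th \<phi>]] by (elim bexE)
  show "\<exists>\<psi> \<in> data_hom X (tdata e A ?F) G. \<forall>p \<in> topspace X. \<forall>a \<in> carrier (stalk (tdata e A ?F) p). \<pi> p (\<psi> p a) = \<phi> p a"
  proof (intro bexI[of _ "\<lambda>p a. \<psi> p (inv_into A e a)"] ballI)
    show "(\<lambda>p a. \<psi> p (inv_into A e a)) \<in> data_hom X (tdata e A ?F) G"
      using data_hom_comp[OF tdata_inv_hom[OF F e A] \<psi>(1)] by simp
    fix p a assume p: "p \<in> topspace X" and "a \<in> carrier (stalk (tdata e A ?F) p)"
    then obtain u where u: "u \<in> carrier (stalk ?F p)" "a = e u" by auto
    then show "\<pi> p (\<psi> p (inv_into A e a)) = \<phi> p a"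
      using tdata_inv[OF F e A p u(1)] bspec[OF bspec[OF \<psi>(2) p] u(1)] by simp
  qed
qed

text \<open>The free cover lives in another type; its coded copy is a projective in
  \<open>'g\<close> with the same image.\<close>

lemma projective_cover:
  assumes "infinite (UNIV :: 'g set)" "finite (topspace X)" "abelian_data X (F :: ('a, 'g) ab_data)"
  shows "\<exists>(P :: ('a, 'g) ab_data) \<pi>. projective_data X P \<and> data_epi X P F \<pi>"
proof -
  let ?F = "fdata (free_index X (\<lambda>x. carrier (stalk F x)))"
  note FF = abelian_fdata[OF mono_free_index[of X "\<lambda>x. carrier (stalk F x)"]]
  obtain e :: "('a \<times> 'g \<Rightarrow>\<^sub>0 int) \<Rightarrow> 'g" and A \<pi> where e: "inj_on e A" and A': "\<forall>p. carrier (stalk ?F p) \<subseteq> A"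
    and epi': "data_epi X ?F F \<pi>"
    using free_cover[OF assms] by (elim exE conjE)
  note A = A'[rule_format]
  have \<pi>: "\<pi> \<in> data_hom X ?F F" "\<And>p. p \<in> topspace X \<Longrightarrow> \<pi> p ` carrier (stalk ?F p) = carrier (stalk F p)"
    using epi' by (simp_all add: data_epi_def)
  have "(\<lambda>p a. \<pi> p (inv_into A e a)) \<in> data_hom X (tdata e A ?F) F"
    using data_hom_comp[OF tdata_inv_hom[OF FF e A] \<pi>(1)] by simp
  moreover have "(\<lambda>a. \<pi> p (inv_into A e a)) ` carrier (stalk (tdata e A ?F) p) = carrier (stalk F p)" if p: "p \<in> topspace X" for p
  proof -
    have "(\<lambda>a. \<pi> p (inv_into A e a)) ` carrier (stalk (tdata e A ?F) p) = \<pi> p ` carrier (stalk ?F p)"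
      unfolding tdata_simps image_image by (rule image_cong[OF refl]) (simp only: tdata_inv[OF FF e A p])
    then show ?thesis using \<pi>(2)[OF p] by simp
  qed
  ultimately have "data_epi X (tdata e A ?F) F (\<lambda>p a. \<pi> p (inv_into A e a))"
    by (rule data_epiI)
  with projective_tdata[OF e A] show ?thesis by (intro exI conjI)
qed

lemma projective_lift:
  assumes "projective_data X (P :: ('a, 'g) ab_data)" "abelian_data X (G :: ('a, 'g) ab_data)"
    "abelian_data X (H :: ('a, 'g) ab_data)" "data_epi X G H \<pi>" "\<phi> \<in> data_hom X P H"
  shows "\<exists>\<psi> \<in> data_hom X P G. \<forall>p \<in> topspace X. \<forall>a \<in> carrier (stalk P p). \<pi> p (\<psi> p a) = \<phi> p a"
  using assms(1)[unfolded projective_data_def, THEN conjunct2, rule_format, of G H \<pi> \<phi>] assms(2-5) by simp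

text \<open>The identity of \<open>P\<close> lifts through a free cover. The lift is taken with the
  cover coded in \<open>'g\<close>, where projectivity applies, and is then decoded so that the
  coordinate lemmas for \<open>fdata\<close> become available.\<close>

lemma projective_retract:
  assumes "infinite (UNIV :: 'g set)" "finite (topspace X)" and P: "projective_data X (P :: ('a, 'g) ab_data)"
  shows "\<exists>(I :: 'a \<Rightarrow> 'g set). \<exists>i \<in> data_hom X P (fdata (free_index X I)). \<exists>r \<in> data_hom X (fdata (free_index X I)) P.
    \<forall>p \<in> topspace X. \<forall>a \<in> carrier (stalk P p). r p (i p a) = a"
proof -
  let ?I = "\<lambda>x. carrier (stalk P x)"
  let ?F = "fdata (free_index X ?I)"
  note FF = abelian_fdata[OF mono_free_index[of X ?I]]
  have aP: "abelian_data X P" using P by (simp add: projective_data_def)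
  obtain e :: "('a \<times> 'g \<Rightarrow>\<^sub>0 int) \<Rightarrow> 'g" and A \<pi> where e: "inj_on e A" and A': "\<forall>p. carrier (stalk ?F p) \<subseteq> A"
    and epi': "data_epi X ?F P \<pi>"
    using free_cover[OF assms(1,2) aP] by (elim exE conjE)
  note A = A'[rule_format]
  have \<pi>: "\<pi> \<in> data_hom X ?F P" "\<And>p. p \<in> topspace X \<Longrightarrow> \<pi> p ` carrier (stalk ?F p) = carrier (stalk P p)"
    using epi' by (simp_all add: data_epi_def)
  let ?T = "tdata e A ?F" and ?\<pi> = "\<lambda>p a. \<pi> p (inv_into A e a)"
  have "?\<pi> \<in> data_hom X ?T P"
    using data_hom_comp[OF tdata_inv_hom[OF FF e A] \<pi>(1)] by simp
  moreover have "?\<pi> p ` carrier (stalk ?T p) = carrier (stalk P p)" if p: "p \<in> topspace X" for p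
  proof -
    have "?\<pi> p ` carrier (stalk ?T p) = \<pi> p ` carrier (stalk ?F p)"
      unfolding tdata_simps image_image by (rule image_cong[OF refl]) (simp only: tdata_inv[OF FF e A p])
    then show ?thesis using \<pi>(2)[OF p] by simp
  qed
  ultimately have epi: "data_epi X ?T P ?\<pi>" by (rule data_epiI)
  have "\<exists>\<psi> \<in> data_hom X P ?T. \<forall>p \<in> topspace X. \<forall>a \<in> carrier (stalk P p). ?\<pi> p (\<psi> p a) = a"
    by (rule projective_lift[OF P abelian_tdata[OF FF e A] aP epi data_hom_id[OF aP]])
  then obtain \<psi> where \<psi>: "\<psi> \<in> data_hom X P ?T" "\<forall>p \<in> topspace X. \<forall>a \<in> carrier (stalk P p). ?\<pi> p (\<psi> p a) = a"
    by (elim bexE)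
  have "(\<lambda>p a. inv_into A e (\<psi> p a)) \<in> data_hom X P ?F"
    using data_hom_comp[OF \<psi>(1) tdata_inv_hom[OF FF e A]] by simp
  then show ?thesis
    by (intro exI[of _ ?I] bexI[of _ "\<lambda>p a. inv_into A e (\<psi> p a)"] bexI[OF _ \<pi>(1)] \<psi>(2))
qed

section \<open>Resolutions and comparison maps\<close>

definition res_seq :: "('a, 'g) ab_data \<Rightarrow> ('a, 'g) resolution \<Rightarrow> nat \<Rightarrow> ('a, 'g) ab_data" where
  "res_seq F R n = (case n of 0 \<Rightarrow> F | Suc m \<Rightarrow> res_obj R m)"

definition res_maps :: "('a, 'g) resolution \<Rightarrow> nat \<Rightarrow> 'a \<Rightarrow> 'g \<Rightarrow> 'g" where
  "res_maps R n = (case n of 0 \<Rightarrow> res_aug R | Suc m \<Rightarrow> res_diff R m)"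

lemma res_seq_simps [simp]:
  "res_seq F R 0 = F" "res_seq F R (Suc n) = res_obj R n"
  "res_maps R 0 = res_aug R" "res_maps R (Suc n) = res_diff R n"
  by (simp_all add: res_seq_def res_maps_def)

lemma projective_abelian: "projective_data X P \<Longrightarrow> abelian_data X P"
  by (simp add: projective_data_def)

lemma exact_seq_resolution:
  assumes F: "abelian_data X F" and R: "projective_resolution X F R"
  shows "exact_seq X (res_seq F R) (res_maps R)"
  unfolding exact_seq_def
proof (intro conjI allI ballI)
  fix n
  show "abelian_data X (res_seq F R n)"
    using F R projective_abelian by (cases n) (auto simp: projective_resolution_def)
  show "res_maps R n \<in> data_hom X (res_seq F R (Suc n)) (res_seq F R n)"
    using R by (cases n) (auto simp: projective_resolution_def data_epi_def)
  fix p assume "p \<in> topspace X"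
  then show "res_maps R (Suc n) p ` carrier (stalk (res_seq F R (Suc (Suc n))) p) =
      kernel (stalk (res_seq F R (Suc n)) p) (stalk (res_seq F R n) p) (res_maps R n p)"
    using R by (cases n) (auto simp: projective_resolution_def)
next
  show "data_epi X (res_seq F R 1) (res_seq F R 0) (res_maps R 0)"
    using R by (simp add: projective_resolution_def)
qed

text \<open>Surjectivity and the equality of image and kernel are conditions at single points, so
  they survive restriction.\<close>

lemma exact_seq_subspace:
  assumes "exact_seq X K \<delta>" "subspace_of S X"
  shows "exact_seq S K \<delta>"
  unfolding exact_seq_def
proof (intro conjI allI ballI)
  note ex = assms(1)[unfolded exact_seq_def]
  fix n
  show "abelian_data S (K n)"
    by (rule abelian_data_subspace[OF _ assms(2)]) (use ex in blast)
  show "\<delta> n \<in> data_hom S (K (Suc n)) (K n)"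
    by (rule data_hom_subspace[OF _ assms(2)]) (use ex in blast)
  fix p assume "p \<in> topspace S"
  then have "p \<in> topspace X" by (rule subspace_ofD(1)[OF assms(2)])
  then show "\<delta> (Suc n) p ` carrier (stalk (K (Suc (Suc n))) p) =
      kernel (stalk (K (Suc n)) p) (stalk (K n) p) (\<delta> n p)"
    using ex by blast
next
  show "data_epi S (K 1) (K 0) (\<delta> 0)"
    by (rule data_epi_subspace[OF _ assms(2)]) (use assms(1)[unfolded exact_seq_def] in blast)
qed

text \<open>Each kernel is again a datum in \<open>'g\<close>, hence has a projective cover, and the
  process repeats; \<open>K n\<close> below is the \<open>n\<close>-th kernel, with
  \<open>K 0 = F\<close>.\<close>

lemma resolution_exists:
  assumes inf: "infinite (UNIV :: 'g set)" and fin: "finite (topspace X)" and F: "abelian_data X (F :: ('a, 'g) ab_data)"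
  shows "\<exists>R. projective_resolution X F R"
proof -
  define cov :: "('a, 'g) ab_data \<Rightarrow> ('a, 'g) ab_data \<times> ('a \<Rightarrow> 'g \<Rightarrow> 'g)" where
    "cov G = (SOME c. projective_data X (fst c) \<and> data_epi X (fst c) G (snd c))" for G
  have "\<exists>c :: ('a, 'g) ab_data \<times> ('a \<Rightarrow> 'g \<Rightarrow> 'g). projective_data X (fst c) \<and> data_epi X (fst c) G (snd c)" if G: "abelian_data X G" for G :: "('a, 'g) ab_data"
  proof -
    obtain P :: "('a, 'g) ab_data" and \<pi> where "projective_data X P" "data_epi X P G \<pi>"
      using projective_cover[OF inf fin G] by (elim exE conjE)
    then show ?thesis by (intro exI[of _ "(P, \<pi>)"]) simp
  qed
  from someI_ex[OF this] have cov: "projective_data X (fst (cov G))" "data_epi X (fst (cov G)) G (snd (cov G))"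
    if "abelian_data X G" for G using that unfolding cov_def by auto
  define K where "K = rec_nat F (\<lambda>n G. ker_data (fst (cov G)) G (snd (cov G)))"
  have K0: "K 0 = F" and KS: "K (Suc n) = ker_data (fst (cov (K n))) (K n) (snd (cov (K n)))" for n
    by (simp_all add: K_def)
  have K: "abelian_data X (K n)" for n
  proof (induction n)
    case (Suc n)
    have "snd (cov (K n)) \<in> data_hom X (fst (cov (K n))) (K n)" using cov(2)[OF Suc] by (simp add: data_epi_def)
    then show ?case unfolding KS by (rule abelian_ker_data[OF projective_abelian[OF cov(1)[OF Suc]] Suc])
  qed (simp add: K0 F)
  define R where "R = \<lparr>res_obj = (\<lambda>n. fst (cov (K n))), res_diff = (\<lambda>n. snd (cov (K (Suc n)))), res_aug = snd (cov (K 0))\<rparr>"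
  have im: "snd (cov (K (Suc n))) p ` carrier (stalk (fst (cov (K (Suc n)))) p) =
      kernel (stalk (fst (cov (K n))) p) (stalk (K n) p) (snd (cov (K n)) p)" if "p \<in> topspace X" for n p
  proof -
    have "snd (cov (K (Suc n))) p ` carrier (stalk (fst (cov (K (Suc n)))) p) = carrier (stalk (K (Suc n)) p)"
      using cov(2)[OF K[of "Suc n"]] that by (simp add: data_epi_def)
    then show ?thesis by (simp add: KS ker_data_simps kernel_def)
  qed
  have "projective_resolution X F R"
    unfolding projective_resolution_def
  proof (intro conjI allI ballI)
    fix n
    show "projective_data X (res_obj R n)" using cov(1)[OF K] by (simp add: R_def)
    have "snd (cov (K (Suc n))) \<in> data_hom X (fst (cov (K (Suc n)))) (K (Suc n))"
      using cov(2)[OF K] by (simp add: data_epi_def)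
    from data_hom_comp[OF this ker_data_incl[of X "fst (cov (K n))" "K n" "snd (cov (K n))", folded KS]]
    show "res_diff R n \<in> data_hom X (res_obj R (Suc n)) (res_obj R n)" by (simp add: R_def)
    fix p assume p: "p \<in> topspace X"
    show "res_diff R (Suc n) p ` carrier (stalk (res_obj R (Suc (Suc n))) p) =
        kernel (stalk (res_obj R (Suc n)) p) (stalk (res_obj R n) p) (res_diff R n p)"
      using im[OF p, of "Suc n"] by (simp add: R_def kernel_def KS[of n] ker_data_simps)
  next
    show "data_epi X (res_obj R 0) F (res_aug R)" using cov(2)[OF K[of 0]] by (simp add: R_def K0)
    fix p assume "p \<in> topspace X"
    from im[OF this, of 0] show "res_diff R 0 p ` carrier (stalk (res_obj R 1) p) =
        kernel (stalk (res_obj R 0) p) (stalk F p) (res_aug R p)"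
      by (simp add: R_def K0)
  qed
  then show ?thesis by blast
qed

lemma proj_res_resolution:
  assumes "infinite (UNIV :: 'g set)" "finite (topspace X)" "abelian_data X (F :: ('a, 'g) ab_data)"
  shows "projective_resolution X F (proj_res X F)"
  unfolding proj_res_def by (rule someI_ex[OF resolution_exists[OF assms]])

lemma data_hom_into_syzygy:
  assumes "\<phi> \<in> data_hom S F (K n)"
    "\<And>p a. p \<in> topspace S \<Longrightarrow> a \<in> carrier (stalk F p) \<Longrightarrow> \<phi> p a \<in> carrier (stalk (syzygy K \<delta> n) p)"
  shows "\<phi> \<in> data_hom S F (syzygy K \<delta> n)"
proof (cases n)
  case (Suc m)
  show ?thesis
  proof (rule data_homI)
    fix p assume p: "p \<in> topspace S"
    show "\<phi> p \<in> hom (stalk F p) (stalk (syzygy K \<delta> n) p)"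
    proof (rule homI)
      show "\<phi> p x \<in> carrier (stalk (syzygy K \<delta> n) p)" if "x \<in> carrier (stalk F p)" for x by (rule assms(2)[OF p that])
      show "\<phi> p (x \<otimes>\<^bsub>stalk F p\<^esub> y) = \<phi> p x \<otimes>\<^bsub>stalk (syzygy K \<delta> n) p\<^esub> \<phi> p y"
        if "x \<in> carrier (stalk F p)" "y \<in> carrier (stalk F p)" for x y
        using hom_mult[OF data_hom_hom[OF assms(1) p] that] Suc by (simp add: ker_data_simps)
    qed
  next
    fix p q a assume "spec_le S p q" "a \<in> carrier (stalk F p)"
    then show "\<phi> q (trans_map F p q a) = trans_map (syzygy K \<delta> n) p q (\<phi> p a)"
      using data_hom_natural[OF assms(1)] Suc by (simp add: ker_data_simps)
  qed
qed (use assms(1) in simp)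

text \<open>Exactness makes each term of the target cover its syzygy, and projectivity of the source
  lifts through this cover to give the next component.\<close>

lemma comparison_exists:
  fixes K K' :: "nat \<Rightarrow> ('a, 'g) ab_data"
  assumes fin: "finite (topspace S)" and ex: "exact_seq S K \<delta>" and ex': "exact_seq S K' \<delta>'" and K0: "K' 0 = K 0"
    and proj: "\<And>n. projective_data S (K (Suc n))"
  shows "\<exists>\<psi>. (\<forall>n. \<psi> n \<in> data_hom S (K n) (K' n)) \<and> \<psi> 0 = (\<lambda>p a. a) \<and>
    (\<forall>n. \<forall>p \<in> topspace S. \<forall>a \<in> carrier (stalk (K (Suc n)) p). \<delta>' n p (\<psi> (Suc n) p a) = \<psi> n p (\<delta> n p a))"
proof -
  \<comment> \<open>The last conjunct is the invariant that makes the next lift possible: the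
    composite with \<open>\<delta> n\<close> lands in the syzygy of the target.\<close>
  define P where "P n x \<longleftrightarrow> x \<in> data_hom S (K n) (K' n) \<and> (n = 0 \<longrightarrow> x = (\<lambda>p a. a)) \<and>
    (\<forall>p \<in> topspace S. \<forall>a \<in> carrier (stalk (K (Suc n)) p). x p (\<delta> n p a) \<in> carrier (stalk (syzygy K' \<delta>' n) p))" for n x
  define Q where "Q n x y \<longleftrightarrow> (\<forall>p \<in> topspace S. \<forall>a \<in> carrier (stalk (K (Suc n)) p). \<delta>' n p (y p a) = x p (\<delta> n p a))"
    for n and x y :: "'a \<Rightarrow> 'g \<Rightarrow> 'g"
  note d = exact_seq_hom[OF fin ex] and a = exact_seq_data[OF fin ex] and a' = exact_seq_data[OF fin ex']
  have "\<exists>f. \<forall>n. P n (f n) \<and> Q n (f n) (f (Suc n))"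
  proof (rule dependent_nat_choice)
    have "P 0 (\<lambda>p a. a)"
      unfolding P_def using data_hom_id[OF a[of 0]] data_hom_closed[OF d[of 0]] by (simp add: K0)
    then show "\<exists>x. P 0 x" by blast
  next
    fix x n assume Px: "P n x"
    then have x: "x \<in> data_hom S (K n) (K' n)" and xs: "\<And>p a. p \<in> topspace S \<Longrightarrow> a \<in> carrier (stalk (K (Suc n)) p) \<Longrightarrow>
        x p (\<delta> n p a) \<in> carrier (stalk (syzygy K' \<delta>' n) p)" unfolding P_def by blast+
    have "(\<lambda>p a. x p (\<delta> n p a)) \<in> data_hom S (K (Suc n)) (syzygy K' \<delta>' n)"
      by (rule data_hom_into_syzygy[where F = "K (Suc n)", OF data_hom_comp[OF d x] xs])
    from projective_lift[OF proj a' abelian_syzygy[OF fin ex'] exact_seq_epi[OF fin ex'] this]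
    obtain y where y: "y \<in> data_hom S (K (Suc n)) (K' (Suc n))"
      "\<forall>p \<in> topspace S. \<forall>a \<in> carrier (stalk (K (Suc n)) p). \<delta>' n p (y p a) = x p (\<delta> n p a)"
      by (elim bexE)
    have "y p (\<delta> (Suc n) p b) \<in> carrier (stalk (syzygy K' \<delta>' (Suc n)) p)"
      if p: "p \<in> topspace S" and b: "b \<in> carrier (stalk (K (Suc (Suc n))) p)" for p b
    proof -
      have db: "\<delta> (Suc n) p b \<in> carrier (stalk (K (Suc n)) p)" by (rule data_hom_closed[OF d p b])
      have "\<delta> (Suc n) p b \<in> kernel (stalk (K (Suc n)) p) (stalk (K n) p) (\<delta> n p)"
        using ex p b unfolding exact_seq_def by blast
      then have dd: "\<delta> n p (\<delta> (Suc n) p b) = \<one>\<^bsub>stalk (K n) p\<^esub>" by (simp add: kernel_def)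
      have "\<delta>' n p (y p (\<delta> (Suc n) p b)) = x p (\<delta> n p (\<delta> (Suc n) p b))"
        using bspec[OF bspec[OF y(2) p] db] .
      also have "\<dots> = \<one>\<^bsub>stalk (K' n) p\<^esub>" unfolding dd by (rule data_hom_one[OF a a' x p])
      finally show ?thesis using data_hom_closed[OF y(1) p db] by (simp add: ker_data_simps)
    qed
    then have "P (Suc n) y" unfolding P_def using y(1) by blast
    moreover have "Q n x y" unfolding Q_def by (rule y(2))
    ultimately show "\<exists>y. P (Suc n) y \<and> Q n x y" by blast
  qed
  then obtain \<psi> where "\<forall>n. P n (\<psi> n) \<and> Q n (\<psi> n) (\<psi> (Suc n))" by (elim exE)
  then show ?thesis unfolding P_def Q_def by (intro exI[of _ \<psi>]) simp
qed

lemma exact_at_trivial: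
  assumes M: "abelian_data S M" and triv: "\<And>p a. p \<in> topspace S \<Longrightarrow> a \<in> carrier (stalk M p) \<Longrightarrow> a = \<one>\<^bsub>stalk M p\<^esub>"
  shows "exact_at S M n"
  unfolding exact_at_def
proof (intro ballI impI)
  interpret d: group_hom "bar S M (Suc (Suc n))" "bar S M (Suc n)" "bard S M (Suc n)"
    by (rule hom_group_homI[OF comm_group_bar[OF M] comm_group_bar[OF M] bard_hom[OF M]])
  fix c assume c: "c \<in> carrier (bar S M (Suc n))"
  have "c = \<one>\<^bsub>bar S M (Suc n)\<^esub>"
  proof (rule extensionalityI)
    show "c \<in> extensional (chains S (Suc n))" using c unfolding carrier_bar[OF M] by (simp add: PiE_iff)
    fix xs assume "xs \<in> chains S (Suc n)"
    then show "c xs = \<one>\<^bsub>bar S M (Suc n)\<^esub> xs"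
      using triv[OF chains_hd bar_closed[OF M c]] by (simp add: bar_one[OF M])
  qed (simp add: bar_one[OF M])
  then show "c \<in> bard S M (Suc n) ` carrier (bar S M (Suc (Suc n)))"
    using subgroup.one_closed[OF d.img_is_subgroup] by (simp only:)
qed

section \<open>Products of two data\<close>

definition prod_data :: "('a, 'g) ab_data \<Rightarrow> ('a, 'h) ab_data \<Rightarrow> ('a, 'g \<times> 'h) ab_data" where
  "prod_data A B = \<lparr>stalk = (\<lambda>p. stalk A p \<times>\<times> stalk B p),
     trans_map = (\<lambda>p q x. (trans_map A p q (fst x), trans_map B p q (snd x)))\<rparr>"

lemma prod_data_simps [simp]:
  "carrier (stalk (prod_data A B) p) = carrier (stalk A p) \<times> carrier (stalk B p)"
  "\<one>\<^bsub>stalk (prod_data A B) p\<^esub> = (\<one>\<^bsub>stalk A p\<^esub>, \<one>\<^bsub>stalk B p\<^esub>)"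
  "x \<otimes>\<^bsub>stalk (prod_data A B) p\<^esub> y = (fst x \<otimes>\<^bsub>stalk A p\<^esub> fst y, snd x \<otimes>\<^bsub>stalk B p\<^esub> snd y)"
  "trans_map (prod_data A B) p q x = (trans_map A p q (fst x), trans_map B p q (snd x))"
  by (simp_all add: prod_data_def DirProd_def case_prod_beta)

context
  fixes S :: "'a topology" and A :: "('a, 'g) ab_data" and B :: "('a, 'h) ab_data"
  assumes fin: "finite (topspace S)" and A: "abelian_data S A" and B: "abelian_data S B"
begin

lemma abelian_prod_data: "abelian_data S (prod_data A B)"
proof (rule abelian_dataI)
  fix p assume p: "p \<in> topspace S"
  interpret A: comm_group "stalk A p" by (rule data_comm_group[OF A p])
  interpret B: comm_group "stalk B p" by (rule data_comm_group[OF B p])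
  show "comm_group (stalk (prod_data A B) p)"
  proof (rule comm_groupI)
    fix x assume "x \<in> carrier (stalk (prod_data A B) p)"
    then show "\<exists>y\<in>carrier (stalk (prod_data A B) p). y \<otimes>\<^bsub>stalk (prod_data A B) p\<^esub> x = \<one>\<^bsub>stalk (prod_data A B) p\<^esub>"
      by (intro bexI[of _ "(inv\<^bsub>stalk A p\<^esub> fst x, inv\<^bsub>stalk B p\<^esub> snd x)"]) auto
  qed (auto simp: A.m_ac B.m_ac)
  show "trans_map (prod_data A B) p p a = a" if "a \<in> carrier (stalk (prod_data A B) p)" for a
    using that data_trans_id[OF A p] data_trans_id[OF B p] by auto
next
  fix p q assume pq: "spec_le S p q"
  show "trans_map (prod_data A B) p q \<in> hom (stalk (prod_data A B) p) (stalk (prod_data A B) q)"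
    by (rule homI) (auto simp: data_trans_closed[OF A pq] data_trans_closed[OF B pq]
        hom_mult[OF data_trans_hom[OF A pq]] hom_mult[OF data_trans_hom[OF B pq]])
next
  fix p q r a assume "spec_le S p q" "spec_le S q r" "a \<in> carrier (stalk (prod_data A B) p)"
  then show "trans_map (prod_data A B) q r (trans_map (prod_data A B) p q a) = trans_map (prod_data A B) p r a"
    using data_trans_comp[OF A] data_trans_comp[OF B] by auto
qed

lemma fst_hom: "(\<lambda>p. fst) \<in> data_hom S (prod_data A B) A"
  and snd_hom: "(\<lambda>p. snd) \<in> data_hom S (prod_data A B) B"
  by (rule data_homI; auto intro!: homI)+

lemma inl_hom: "(\<lambda>p a. (a, \<one>\<^bsub>stalk B p\<^esub>)) \<in> data_hom S A (prod_data A B)"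
proof (rule data_homI)
  fix p assume p: "p \<in> topspace S"
  interpret B: group "stalk B p" by (rule data_group[OF B p])
  show "(\<lambda>a. (a, \<one>\<^bsub>stalk B p\<^esub>)) \<in> hom (stalk A p) (stalk (prod_data A B) p)" by (rule homI) auto
next
  fix p q a assume pq: "spec_le S p q"
  have "trans_map B p q \<one>\<^bsub>stalk B p\<^esub> = \<one>\<^bsub>stalk B q\<^esub>"
    by (rule hom_one[OF data_trans_hom[OF B pq]]) (use pq data_group[OF B] in \<open>auto simp: spec_le_topspace\<close>)
  then show "(trans_map A p q a, \<one>\<^bsub>stalk B q\<^esub>) = trans_map (prod_data A B) p q (a, \<one>\<^bsub>stalk B p\<^esub>)" by simp
qed

lemma inr_hom: "(\<lambda>p b. (\<one>\<^bsub>stalk A p\<^esub>, b)) \<in> data_hom S B (prod_data A B)"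
proof (rule data_homI)
  fix p assume p: "p \<in> topspace S"
  interpret A: group "stalk A p" by (rule data_group[OF A p])
  show "(\<lambda>b. (\<one>\<^bsub>stalk A p\<^esub>, b)) \<in> hom (stalk B p) (stalk (prod_data A B) p)" by (rule homI) auto
next
  fix p q b assume pq: "spec_le S p q"
  have "trans_map A p q \<one>\<^bsub>stalk A p\<^esub> = \<one>\<^bsub>stalk A q\<^esub>"
    by (rule hom_one[OF data_trans_hom[OF A pq]]) (use pq data_group[OF A] in \<open>auto simp: spec_le_topspace\<close>)
  then show "(\<one>\<^bsub>stalk A q\<^esub>, trans_map B p q b) = trans_map (prod_data A B) p q (\<one>\<^bsub>stalk A p\<^esub>, b)" by simp
qed

text \<open>Bounding chains are found in the two components separately and paired; the projections
  then identify the boundary of the pair.\<close>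

lemma acyclic_prod_data:
  assumes "acyclic_data S A" "acyclic_data S B"
  shows "acyclic_data S (prod_data A B)"
  unfolding acyclic_data_def exact_at_def
proof (intro allI ballI impI)
  note P = abelian_prod_data
  fix n c assume c: "c \<in> carrier (bar S (prod_data A B) (Suc n))"
    and dc: "bard S (prod_data A B) n c = \<one>\<^bsub>bar S (prod_data A B) n\<^esub>"
  interpret f: group_hom "bar S (prod_data A B) n" "bar S A n" "barm S (\<lambda>p. fst) n"
    by (rule hom_group_homI[OF comm_group_bar[OF P] comm_group_bar[OF A] barm_hom[OF P A fst_hom]])
  interpret s: group_hom "bar S (prod_data A B) n" "bar S B n" "barm S (\<lambda>p. snd) n"
    by (rule hom_group_homI[OF comm_group_bar[OF P] comm_group_bar[OF B] barm_hom[OF P B snd_hom]])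
  have "bard S A n (barm S (\<lambda>p. fst) (Suc n) c) = \<one>\<^bsub>bar S A n\<^esub>"
    unfolding barm_bard[OF fin P A fst_hom c, symmetric] dc by (rule f.hom_one)
  then obtain a where a: "a \<in> carrier (bar S A (Suc (Suc n)))" "barm S (\<lambda>p. fst) (Suc n) c = bard S A (Suc n) a"
    using assms(1) barm_closed[OF P A fst_hom c] unfolding acyclic_data_def exact_at_def by blast
  have "bard S B n (barm S (\<lambda>p. snd) (Suc n) c) = \<one>\<^bsub>bar S B n\<^esub>"
    unfolding barm_bard[OF fin P B snd_hom c, symmetric] dc by (rule s.hom_one)
  then obtain b where b: "b \<in> carrier (bar S B (Suc (Suc n)))" "barm S (\<lambda>p. snd) (Suc n) c = bard S B (Suc n) b"
    using assms(2) barm_closed[OF P B snd_hom c] unfolding acyclic_data_def exact_at_def by blast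
  let ?e = "\<lambda>xs\<in>chains S (Suc (Suc n)). (a xs, b xs)"
  have e: "?e \<in> carrier (bar S (prod_data A B) (Suc (Suc n)))"
    using a(1) b(1) unfolding carrier_bar[OF P] carrier_bar[OF A] carrier_bar[OF B] by auto
  have "barm S (\<lambda>p. fst) (Suc (Suc n)) ?e = a" "barm S (\<lambda>p. snd) (Suc (Suc n)) ?e = b"
    using a(1) b(1) unfolding carrier_bar[OF A] carrier_bar[OF B] barm_def
    by (auto simp: fun_eq_iff PiE_iff extensional_def)
  then have f: "barm S (\<lambda>p. fst) (Suc n) (bard S (prod_data A B) (Suc n) ?e) = barm S (\<lambda>p. fst) (Suc n) c"
    and s: "barm S (\<lambda>p. snd) (Suc n) (bard S (prod_data A B) (Suc n) ?e) = barm S (\<lambda>p. snd) (Suc n) c"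
    using barm_bard[OF fin P A fst_hom e] barm_bard[OF fin P B snd_hom e] a(2) b(2) by simp_all
  have "c = bard S (prod_data A B) (Suc n) ?e"
  proof (rule extensionalityI)
    show "c \<in> extensional (chains S (Suc n))" using c unfolding carrier_bar[OF P] by (simp add: PiE_iff)
    fix xs assume xs: "xs \<in> chains S (Suc n)"
    from fun_cong[OF f, of xs] fun_cong[OF s, of xs] xs show "c xs = bard S (prod_data A B) (Suc n) ?e xs"
      by (simp add: barm_def prod_eq_iff)
  qed (simp add: bard_def)
  then show "c \<in> bard S (prod_data A B) (Suc n) ` carrier (bar S (prod_data A B) (Suc (Suc n)))"
    using e by (rule image_eqI)
qed

text \<open>\<open>z\<close> is the product of the images of its two projections under the
  injections into the product.\<close>

lemma relations_prod_data:
  assumes z: "z \<in> carrier (data_sum S (prod_data A B))"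
    and "push S S A (\<lambda>p. fst) z \<in> colim_relations S A" "push S S B (\<lambda>p. snd) z \<in> colim_relations S B"
  shows "z \<in> colim_relations S (prod_data A B)"
proof -
  note P = abelian_prod_data
  interpret N: subgroup "colim_relations S (prod_data A B)" "data_sum S (prod_data A B)"
    by (rule subgroup_colim_relations[OF fin P])
  let ?l = "push S S (prod_data A B) (\<lambda>p a. (a, \<one>\<^bsub>stalk B p\<^esub>)) (push S S A (\<lambda>p. fst) z)"
  let ?r = "push S S (prod_data A B) (\<lambda>p b. (\<one>\<^bsub>stalk A p\<^esub>, b)) (push S S B (\<lambda>p. snd) z)"
  have "?l \<otimes>\<^bsub>data_sum S (prod_data A B)\<^esub> ?r \<in> colim_relations S (prod_data A B)"
    by (intro N.m_closed push_relations[OF fin fin subspace_of_refl A P inl_hom assms(2)]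
        push_relations[OF fin fin subspace_of_refl B P inr_hom assms(3)])
  also have "?l \<otimes>\<^bsub>data_sum S (prod_data A B)\<^esub> ?r = z"
    unfolding data_sum_mult
  proof (rule extensionalityI[of _ "topspace S"])
    show "z \<in> extensional (topspace S)" using z unfolding data_sum_carrier[OF fin P] by (simp add: PiE_iff)
    fix p assume p: "p \<in> topspace S"
    interpret A: group "stalk A p" by (rule data_group[OF A p])
    interpret B: group "stalk B p" by (rule data_group[OF B p])
    have "z p \<in> carrier (stalk (prod_data A B) p)" using z p unfolding data_sum_carrier[OF fin P] by (auto simp: PiE_iff)
    then show "(\<lambda>p\<in>topspace S. ?l p \<otimes>\<^bsub>stalk (prod_data A B) p\<^esub> ?r p) p = z p"
      using p by (auto simp: push_self)
  qed simp
  finally show ?thesis .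
qed

end

subsection \<open>The mapping cone of a comparison of resolutions\<close>

text \<open>Both sequences resolve the same datum and \<open>\<psi>\<close> is the identity on it.
  The terms are asked to be exact and nothing more, so that a resolution restricted to a fibre
  qualifies.\<close>

locale resolution_map =
  fixes S :: "'a topology" and K K' :: "nat \<Rightarrow> ('a, 'g) ab_data" and \<delta> \<delta>' \<psi> :: "nat \<Rightarrow> 'a \<Rightarrow> 'g \<Rightarrow> 'g"
  assumes fin: "finite (topspace S)" and ex: "exact_seq S K \<delta>" and ex': "exact_seq S K' \<delta>'"
    and K0: "K' 0 = K 0" and \<psi>: "\<psi> n \<in> data_hom S (K n) (K' n)"
    and \<psi>0: "p \<in> topspace S \<Longrightarrow> a \<in> carrier (stalk (K 0) p) \<Longrightarrow> \<psi> 0 p a = a"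
    and commute: "p \<in> topspace S \<Longrightarrow> a \<in> carrier (stalk (K (Suc n)) p) \<Longrightarrow> \<delta>' n p (\<psi> (Suc n) p a) = \<psi> n p (\<delta> n p a)"
begin

lemmas KA = exact_seq_data[OF fin ex] and KB = exact_seq_data[OF fin ex']
lemmas dA = exact_seq_hom[OF fin ex] and dB = exact_seq_hom[OF fin ex']

text \<open>In degree 0 the two copies of the resolved datum cancel, so the left factor is zero
  there; it is written as the kernel of the identity to keep the units and operations of
  \<open>K 0\<close>.\<close>

definition cone_left :: "nat \<Rightarrow> ('a, 'g) ab_data" where
  "cone_left n = (case n of 0 \<Rightarrow> ker_data (K 0) (K 0) (\<lambda>p a. a) | Suc m \<Rightarrow> K (Suc m))"

definition cone :: "nat \<Rightarrow> ('a, 'g \<times> 'g) ab_data" where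
  "cone n = prod_data (cone_left n) (K' (Suc n))"

text \<open>In additive notation, \<open>(a, b)\<close> goes to
  \<open>(- \<delta> a, \<psi> a + \<delta>' b)\<close>. For \<open>n = 0\<close> the left factor of
  the target is zero, hence the constant.\<close>

definition cone_diff :: "nat \<Rightarrow> 'a \<Rightarrow> 'g \<times> 'g \<Rightarrow> 'g \<times> 'g" where
  "cone_diff n p x = (if n = 0 then \<one>\<^bsub>stalk (K 0) p\<^esub> else inv\<^bsub>stalk (K n) p\<^esub> \<delta> n p (fst x),
     \<psi> (Suc n) p (fst x) \<otimes>\<^bsub>stalk (K' (Suc n)) p\<^esub> \<delta>' (Suc n) p (snd x))"

lemma cone_left_simps [simp]: "cone_left (Suc n) = K (Suc n)"
  "carrier (stalk (cone_left 0) p) = {a \<in> carrier (stalk (K 0) p). a = \<one>\<^bsub>stalk (K 0) p\<^esub>}"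
  "\<one>\<^bsub>stalk (cone_left n) p\<^esub> = \<one>\<^bsub>stalk (K n) p\<^esub>"
  "x \<otimes>\<^bsub>stalk (cone_left n) p\<^esub> y = x \<otimes>\<^bsub>stalk (K n) p\<^esub> y"
  "trans_map (cone_left n) = trans_map (K n)"
  by (simp_all add: cone_left_def ker_data_simps split: nat.split)

lemma abelian_cone_left: "abelian_data S (cone_left n)"
  by (cases n) (simp_all add: cone_left_def KA abelian_ker_data data_hom_id)

lemma abelian_cone: "abelian_data S (cone n)"
  unfolding cone_def by (rule abelian_prod_data[OF fin abelian_cone_left KB])

lemma dd: "p \<in> topspace S \<Longrightarrow> a \<in> carrier (stalk (K (Suc (Suc n))) p) \<Longrightarrow> \<delta> n p (\<delta> (Suc n) p a) = \<one>\<^bsub>stalk (K n) p\<^esub>"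
  and dd': "p \<in> topspace S \<Longrightarrow> a' \<in> carrier (stalk (K' (Suc (Suc n))) p) \<Longrightarrow> \<delta>' n p (\<delta>' (Suc n) p a') = \<one>\<^bsub>stalk (K' n) p\<^esub>"
proof -
  assume p: "p \<in> topspace S" and a: "a \<in> carrier (stalk (K (Suc (Suc n))) p)"
  then have "\<delta> (Suc n) p a \<in> kernel (stalk (K (Suc n)) p) (stalk (K n) p) (\<delta> n p)"
    using ex unfolding exact_seq_def by blast
  then show "\<delta> n p (\<delta> (Suc n) p a) = \<one>\<^bsub>stalk (K n) p\<^esub>" by (simp add: kernel_def)
next
  assume p: "p \<in> topspace S" and a: "a' \<in> carrier (stalk (K' (Suc (Suc n))) p)"
  then have "\<delta>' (Suc n) p a' \<in> kernel (stalk (K' (Suc n)) p) (stalk (K' n) p) (\<delta>' n p)"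
    using ex' unfolding exact_seq_def by blast
  then show "\<delta>' n p (\<delta>' (Suc n) p a') = \<one>\<^bsub>stalk (K' n) p\<^esub>" by (simp add: kernel_def)
qed

lemma exactA: "p \<in> topspace S \<Longrightarrow> a \<in> carrier (stalk (K (Suc n)) p) \<Longrightarrow> \<delta> n p a = \<one>\<^bsub>stalk (K n) p\<^esub> \<Longrightarrow>
    \<exists>b \<in> carrier (stalk (K (Suc (Suc n))) p). \<delta> (Suc n) p b = a"
  and exactB: "p \<in> topspace S \<Longrightarrow> a' \<in> carrier (stalk (K' (Suc n)) p) \<Longrightarrow> \<delta>' n p a' = \<one>\<^bsub>stalk (K' n) p\<^esub> \<Longrightarrow>
    \<exists>b \<in> carrier (stalk (K' (Suc (Suc n))) p). \<delta>' (Suc n) p b = a'"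
proof -
  assume p: "p \<in> topspace S" "a \<in> carrier (stalk (K (Suc n)) p)" "\<delta> n p a = \<one>\<^bsub>stalk (K n) p\<^esub>"
  then have "a \<in> kernel (stalk (K (Suc n)) p) (stalk (K n) p) (\<delta> n p)" by (simp add: kernel_def)
  then have "a \<in> \<delta> (Suc n) p ` carrier (stalk (K (Suc (Suc n))) p)"
    using ex p(1) unfolding exact_seq_def by blast
  then show "\<exists>b \<in> carrier (stalk (K (Suc (Suc n))) p). \<delta> (Suc n) p b = a" by auto
next
  assume p: "p \<in> topspace S" "a' \<in> carrier (stalk (K' (Suc n)) p)" "\<delta>' n p a' = \<one>\<^bsub>stalk (K' n) p\<^esub>"
  then have "a' \<in> kernel (stalk (K' (Suc n)) p) (stalk (K' n) p) (\<delta>' n p)" by (simp add: kernel_def)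
  then have "a' \<in> \<delta>' (Suc n) p ` carrier (stalk (K' (Suc (Suc n))) p)"
    using ex' p(1) unfolding exact_seq_def by blast
  then show "\<exists>b \<in> carrier (stalk (K' (Suc (Suc n))) p). \<delta>' (Suc n) p b = a'" by auto
qed

lemma cone_carrier: "x \<in> carrier (stalk (cone n) p) \<longleftrightarrow>
    fst x \<in> carrier (stalk (cone_left n) p) \<and> snd x \<in> carrier (stalk (K' (Suc n)) p)"
  by (auto simp: cone_def mem_Times_iff)

lemma cone_diff_hom: "cone_diff n \<in> data_hom S (cone (Suc n)) (cone n)"
proof (rule data_homI)
  fix p assume p: "p \<in> topspace S"
  interpret A: comm_group "stalk (K n) p" by (rule data_comm_group[OF KA p])
  interpret B: comm_group "stalk (K' (Suc n)) p" by (rule data_comm_group[OF KB p])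
  note da = data_hom_closed[OF dA p] and db = data_hom_closed[OF dB p] and ps = data_hom_closed[OF \<psi> p]
  show "cone_diff n p \<in> hom (stalk (cone (Suc n)) p) (stalk (cone n) p)"
  proof (rule homI)
    fix x assume x: "x \<in> carrier (stalk (cone (Suc n)) p)"
    have fx: "fst x \<in> carrier (stalk (K (Suc n)) p)" and sx: "snd x \<in> carrier (stalk (K' (Suc (Suc n))) p)"
      using x unfolding cone_carrier by auto
    show "cone_diff n p x \<in> carrier (stalk (cone n) p)"
      using A.one_closed A.inv_closed[OF da[OF fx]] B.m_closed[OF ps[OF fx] db[OF sx]]
      by (cases n) (simp_all add: cone_carrier cone_diff_def)
    fix y assume y: "y \<in> carrier (stalk (cone (Suc n)) p)"
    show "cone_diff n p (x \<otimes>\<^bsub>stalk (cone (Suc n)) p\<^esub> y) = cone_diff n p x \<otimes>\<^bsub>stalk (cone n) p\<^esub> cone_diff n p y"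
    proof -
      have fy: "fst y \<in> carrier (stalk (K (Suc n)) p)" and sy: "snd y \<in> carrier (stalk (K' (Suc (Suc n))) p)"
        using y unfolding cone_carrier by auto
      have "inv\<^bsub>stalk (K n) p\<^esub> \<delta> n p (fst x \<otimes>\<^bsub>stalk (K (Suc n)) p\<^esub> fst y) =
          inv\<^bsub>stalk (K n) p\<^esub> \<delta> n p (fst x) \<otimes>\<^bsub>stalk (K n) p\<^esub> inv\<^bsub>stalk (K n) p\<^esub> \<delta> n p (fst y)"
        unfolding hom_mult[OF data_hom_hom[OF dA p] fx fy] by (rule A.inv_mult[OF da[OF fx] da[OF fy]])
      moreover have "\<psi> (Suc n) p (fst x \<otimes>\<^bsub>stalk (K (Suc n)) p\<^esub> fst y) \<otimes>\<^bsub>stalk (K' (Suc n)) p\<^esub>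
            \<delta>' (Suc n) p (snd x \<otimes>\<^bsub>stalk (K' (Suc (Suc n))) p\<^esub> snd y) =
          (\<psi> (Suc n) p (fst x) \<otimes>\<^bsub>stalk (K' (Suc n)) p\<^esub> \<delta>' (Suc n) p (snd x)) \<otimes>\<^bsub>stalk (K' (Suc n)) p\<^esub>
          (\<psi> (Suc n) p (fst y) \<otimes>\<^bsub>stalk (K' (Suc n)) p\<^esub> \<delta>' (Suc n) p (snd y))"
        unfolding hom_mult[OF data_hom_hom[OF \<psi> p] fx fy] hom_mult[OF data_hom_hom[OF dB p] sx sy]
        using ps[OF fx] ps[OF fy] db[OF sx] db[OF sy] by (simp add: B.m_ac)
      moreover have "\<one>\<^bsub>stalk (K 0) p\<^esub> \<otimes>\<^bsub>stalk (K 0) p\<^esub> \<one>\<^bsub>stalk (K 0) p\<^esub> = \<one>\<^bsub>stalk (K 0) p\<^esub>"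
        using group.is_monoid[OF data_group[OF KA p]] monoid.l_one monoid.one_closed by metis
      ultimately show ?thesis by (simp add: cone_def cone_diff_def)
    qed
  qed
next
  fix p q x assume pq: "spec_le S p q" and x: "x \<in> carrier (stalk (cone (Suc n)) p)"
  then have p: "p \<in> topspace S" and q: "q \<in> topspace S" by (auto simp: spec_le_topspace)
  have f: "fst x \<in> carrier (stalk (K (Suc n)) p)" and s: "snd x \<in> carrier (stalk (K' (Suc (Suc n))) p)"
    using x unfolding cone_carrier by auto
  note tA = data_trans_hom[OF KA pq] and tB = data_trans_hom[OF KB pq]
  have one: "trans_map (K 0) p q \<one>\<^bsub>stalk (K 0) p\<^esub> = \<one>\<^bsub>stalk (K 0) q\<^esub>"
    by (rule hom_one[OF tA data_group[OF KA p] data_group[OF KA q]])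
  have inv: "trans_map (K n) p q (inv\<^bsub>stalk (K n) p\<^esub> \<delta> n p (fst x)) = inv\<^bsub>stalk (K n) q\<^esub> trans_map (K n) p q (\<delta> n p (fst x))"
    by (rule hom_inv[OF data_group[OF KA p] data_group[OF KA q] tA data_hom_closed[OF dA p f]])
  show "cone_diff n q (trans_map (cone (Suc n)) p q x) = trans_map (cone n) p q (cone_diff n p x)"
    using one inv f s data_hom_natural[OF dA pq f] data_hom_natural[OF dB pq s] data_hom_natural[OF \<psi> pq f]
      hom_mult[OF tB data_hom_closed[OF \<psi> p f] data_hom_closed[OF dB p s]]
    by (auto simp: cone_def cone_diff_def)
qed

text \<open>A cycle \<open>(a, b)\<close> of the cone has \<open>a\<close> a cycle of
  \<open>K\<close>. Once a preimage of \<open>a\<close> up to sign is chosen, the defect in the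
  second component is a cycle of \<open>K'\<close> and hence a boundary.\<close>

lemma exact_seq_cone: "exact_seq S cone cone_diff"
  unfolding exact_seq_def
proof (intro conjI allI ballI)
  fix n p assume p: "p \<in> topspace S"
  interpret A1: comm_group "stalk (K (Suc n)) p" by (rule data_comm_group[OF KA p])
  interpret A2: comm_group "stalk (K (Suc (Suc n))) p" by (rule data_comm_group[OF KA p])
  interpret B1: comm_group "stalk (K' (Suc n)) p" by (rule data_comm_group[OF KB p])
  interpret B2: comm_group "stalk (K' (Suc (Suc n))) p" by (rule data_comm_group[OF KB p])
  interpret B3: comm_group "stalk (K' (Suc (Suc (Suc n)))) p" by (rule data_comm_group[OF KB p])
  interpret A0: comm_group "stalk (K n) p" by (rule data_comm_group[OF KA p])
  interpret dA0: group_hom "stalk (K (Suc n)) p" "stalk (K n) p" "\<delta> n p" by (rule data_hom_group_hom[OF KA KA dA p])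
  interpret dA1: group_hom "stalk (K (Suc (Suc n))) p" "stalk (K (Suc n)) p" "\<delta> (Suc n) p" by (rule data_hom_group_hom[OF KA KA dA p])
  interpret dB1: group_hom "stalk (K' (Suc (Suc n))) p" "stalk (K' (Suc n)) p" "\<delta>' (Suc n) p" by (rule data_hom_group_hom[OF KB KB dB p])
  interpret dB2: group_hom "stalk (K' (Suc (Suc (Suc n)))) p" "stalk (K' (Suc (Suc n))) p" "\<delta>' (Suc (Suc n)) p" by (rule data_hom_group_hom[OF KB KB dB p])
  interpret p1: group_hom "stalk (K (Suc n)) p" "stalk (K' (Suc n)) p" "\<psi> (Suc n) p" by (rule data_hom_group_hom[OF KA KB \<psi> p])
  interpret p2: group_hom "stalk (K (Suc (Suc n))) p" "stalk (K' (Suc (Suc n))) p" "\<psi> (Suc (Suc n)) p" by (rule data_hom_group_hom[OF KA KB \<psi> p])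
  have one: "\<one>\<^bsub>stalk (cone n) p\<^esub> = (\<one>\<^bsub>stalk (K n) p\<^esub>, \<one>\<^bsub>stalk (K' (Suc n)) p\<^esub>)" by (simp add: cone_def)
  show "cone_diff (Suc n) p ` carrier (stalk (cone (Suc (Suc n))) p) =
      kernel (stalk (cone (Suc n)) p) (stalk (cone n) p) (cone_diff n p)"
  proof (intro equalityI subsetI)
    fix z assume "z \<in> cone_diff (Suc n) p ` carrier (stalk (cone (Suc (Suc n))) p)"
    then obtain x where x: "x \<in> carrier (stalk (cone (Suc (Suc n))) p)" "z = cone_diff (Suc n) p x" by blast
    then have a: "fst x \<in> carrier (stalk (K (Suc (Suc n))) p)" and b: "snd x \<in> carrier (stalk (K' (Suc (Suc (Suc n)))) p)"
      unfolding cone_carrier by auto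
    have "z \<in> carrier (stalk (cone (Suc n)) p)" unfolding x(2) by (rule data_hom_closed[OF cone_diff_hom p x(1)])
    moreover have "\<delta> n p (inv\<^bsub>stalk (K (Suc n)) p\<^esub> \<delta> (Suc n) p (fst x)) = \<one>\<^bsub>stalk (K n) p\<^esub>"
      unfolding dA0.hom_inv[OF dA1.hom_closed[OF a]] dd[OF p a] by (rule A0.inv_one)
    moreover have "\<psi> (Suc n) p (inv\<^bsub>stalk (K (Suc n)) p\<^esub> \<delta> (Suc n) p (fst x)) \<otimes>\<^bsub>stalk (K' (Suc n)) p\<^esub>
        \<delta>' (Suc n) p (\<psi> (Suc (Suc n)) p (fst x) \<otimes>\<^bsub>stalk (K' (Suc (Suc n))) p\<^esub> \<delta>' (Suc (Suc n)) p (snd x)) = \<one>\<^bsub>stalk (K' (Suc n)) p\<^esub>"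
      unfolding p1.hom_inv[OF dA1.hom_closed[OF a]] dB1.hom_mult[OF p2.hom_closed[OF a] dB2.hom_closed[OF b]]
        dd'[OF p b] commute[OF p a] B1.r_one[OF p1.hom_closed[OF dA1.hom_closed[OF a]]]
      by (rule B1.l_inv[OF p1.hom_closed[OF dA1.hom_closed[OF a]]])
    ultimately show "z \<in> kernel (stalk (cone (Suc n)) p) (stalk (cone n) p) (cone_diff n p)"
      unfolding kernel_def one x(2) by (auto simp: cone_diff_def)
  next
    fix z assume "z \<in> kernel (stalk (cone (Suc n)) p) (stalk (cone n) p) (cone_diff n p)"
    then have z: "z \<in> carrier (stalk (cone (Suc n)) p)" and dz: "cone_diff n p z = (\<one>\<^bsub>stalk (K n) p\<^esub>, \<one>\<^bsub>stalk (K' (Suc n)) p\<^esub>)"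
      unfolding kernel_def one by auto
    obtain a b where ab: "z = (a, b)" by (cases z)
    have a: "a \<in> carrier (stalk (K (Suc n)) p)" and b: "b \<in> carrier (stalk (K' (Suc (Suc n))) p)"
      using z unfolding cone_carrier ab by auto
    have s: "\<psi> (Suc n) p a \<otimes>\<^bsub>stalk (K' (Suc n)) p\<^esub> \<delta>' (Suc n) p b = \<one>\<^bsub>stalk (K' (Suc n)) p\<^esub>"
      using dz unfolding ab cone_diff_def by simp
    have pa: "inv\<^bsub>stalk (K' (Suc n)) p\<^esub> \<psi> (Suc n) p a = \<delta>' (Suc n) p b"
    proof (rule B1.inv_equality)
      show "\<delta>' (Suc n) p b \<otimes>\<^bsub>stalk (K' (Suc n)) p\<^esub> \<psi> (Suc n) p a = \<one>\<^bsub>stalk (K' (Suc n)) p\<^esub>"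
        unfolding B1.m_comm[OF dB1.hom_closed[OF b] p1.hom_closed[OF a]] by (rule s)
    qed (rule p1.hom_closed[OF a], rule dB1.hom_closed[OF b])
    have "\<delta> n p a = \<one>\<^bsub>stalk (K n) p\<^esub>"
    proof (cases n)
      \<comment> \<open>Here the first component carries no condition; that \<open>a\<close> dies
        under the augmentation comes from the second one, because \<open>\<psi> 0\<close> is the
        identity.\<close>
      case 0
      have "\<psi> (Suc n) p a = inv\<^bsub>stalk (K' (Suc n)) p\<^esub> \<delta>' (Suc n) p b"
        unfolding pa[symmetric] by (rule B1.inv_inv[OF p1.hom_closed[OF a], symmetric])
      then have "\<delta>' n p (\<psi> (Suc n) p a) = inv\<^bsub>stalk (K' n) p\<^esub> \<delta>' n p (\<delta>' (Suc n) p b)"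
        using hom_inv[OF data_group[OF KB p] data_group[OF KB p] data_hom_hom[OF dB p] dB1.hom_closed[OF b]] by simp
      also have "\<dots> = \<one>\<^bsub>stalk (K' n) p\<^esub>"
        unfolding dd'[OF p b] by (rule monoid.inv_one[OF group.is_monoid[OF data_group[OF KB p]]])
      finally show ?thesis using commute[OF p a] \<psi>0[OF p, of "\<delta> 0 p a"] data_hom_closed[OF dA p a] K0 0 by simp
    next
      case (Suc m)
      then have "inv\<^bsub>stalk (K n) p\<^esub> \<delta> n p a = \<one>\<^bsub>stalk (K n) p\<^esub>" using dz unfolding ab cone_diff_def by simp
      then show ?thesis using a dA0.hom_closed[OF a] A0.inv_eq_1_iff by blast
    qed
    then obtain a0 where a0: "a0 \<in> carrier (stalk (K (Suc (Suc n))) p)" "\<delta> (Suc n) p a0 = a" using exactA[OF p a] by blast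
    \<comment> \<open>The inverse compensates the sign in \<open>cone_diff\<close>.\<close>
    let ?a = "inv\<^bsub>stalk (K (Suc (Suc n))) p\<^esub> a0"
    have a'1: "?a \<in> carrier (stalk (K (Suc (Suc n))) p)" by (rule A2.inv_closed[OF a0(1)])
    have da: "\<delta> (Suc n) p ?a = inv\<^bsub>stalk (K (Suc n)) p\<^esub> a"
      unfolding dA1.hom_inv[OF a0(1)] a0(2) ..
    have a'2: "inv\<^bsub>stalk (K (Suc n)) p\<^esub> \<delta> (Suc n) p ?a = a"
      unfolding da by (rule A1.inv_inv[OF a])
    note a' = a'1 a'2 and pa' = p2.hom_closed[OF a'1]
    let ?c = "inv\<^bsub>stalk (K' (Suc (Suc n))) p\<^esub> \<psi> (Suc (Suc n)) p ?a \<otimes>\<^bsub>stalk (K' (Suc (Suc n))) p\<^esub> b"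
    have c: "?c \<in> carrier (stalk (K' (Suc (Suc n))) p)" by (rule B2.m_closed[OF B2.inv_closed[OF pa'] b])
    have "\<delta>' (Suc n) p (\<psi> (Suc (Suc n)) p ?a) = \<delta>' (Suc n) p b"
      unfolding commute[OF p a'(1)] da p1.hom_inv[OF a] by (rule pa)
    then have "\<delta>' (Suc n) p ?c = \<one>\<^bsub>stalk (K' (Suc n)) p\<^esub>"
      unfolding dB1.hom_mult[OF B2.inv_closed[OF pa'] b] dB1.hom_inv[OF pa']
      by (simp only: B1.l_inv[OF dB1.hom_closed[OF b]])
    then obtain b0 where b0: "b0 \<in> carrier (stalk (K' (Suc (Suc (Suc n)))) p)" "\<delta>' (Suc (Suc n)) p b0 = ?c"
      using exactB[OF p c] by blast
    have "z = cone_diff (Suc n) p (?a, b0)"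
      unfolding cone_diff_def ab fst_conv snd_conv b0(2) a'(2)
      unfolding B2.m_assoc[OF pa' B2.inv_closed[OF pa'] b, symmetric] B2.r_inv[OF pa'] B2.l_one[OF b] by simp
    moreover have "(?a, b0) \<in> carrier (stalk (cone (Suc (Suc n))) p)" unfolding cone_carrier using a'(1) b0(1) by simp
    ultimately show "z \<in> cone_diff (Suc n) p ` carrier (stalk (cone (Suc (Suc n))) p)" by (rule image_eqI)
  qed
next
  show "data_epi S (cone 1) (cone 0) (cone_diff 0)"
  proof (rule data_epiI)
    show "cone_diff 0 \<in> data_hom S (cone 1) (cone 0)" using cone_diff_hom[of 0] by simp
    fix p assume p: "p \<in> topspace S"
    interpret B1: comm_group "stalk (K' (Suc 0)) p" by (rule data_comm_group[OF KB p])
    interpret dB: group_hom "stalk (K' (Suc 0)) p" "stalk (K' 0) p" "\<delta>' 0 p" by (rule data_hom_group_hom[OF KB KB dB p])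
    show "cone_diff 0 p ` carrier (stalk (cone 1) p) = carrier (stalk (cone 0) p)"
    proof (intro equalityI subsetI)
      fix z assume "z \<in> cone_diff 0 p ` carrier (stalk (cone 1) p)"
      then show "z \<in> carrier (stalk (cone 0) p)" using data_hom_closed[OF cone_diff_hom[of 0] p] by auto
    next
      fix z assume z: "z \<in> carrier (stalk (cone 0) p)"
      then have f: "fst z = \<one>\<^bsub>stalk (K 0) p\<^esub>" and y: "snd z \<in> carrier (stalk (K' (Suc 0)) p)" unfolding cone_carrier by auto
      have "\<delta>' 0 p (snd z) \<in> carrier (stalk (K 0) p)" using data_hom_closed[OF dB p y] K0 by simp
      moreover have "\<delta> 0 p ` carrier (stalk (K (Suc 0)) p) = carrier (stalk (K 0) p)"
        using ex p by (simp add: exact_seq_def data_epi_def)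
      \<comment> \<open>\<open>\<delta> 0\<close> is onto, so some \<open>a\<close> has the same
        image in the resolved datum as \<open>snd z\<close>; then \<open>\<psi> (Suc 0) p a\<close>
        and \<open>snd z\<close> differ by a boundary.\<close>
      ultimately obtain a where a: "a \<in> carrier (stalk (K (Suc 0)) p)" "\<delta> 0 p a = \<delta>' 0 p (snd z)" by force
      have pa: "\<psi> (Suc 0) p a \<in> carrier (stalk (K' (Suc 0)) p)" by (rule data_hom_closed[OF \<psi> p a(1)])
      have "\<delta>' 0 p (\<psi> (Suc 0) p a) = \<delta>' 0 p (snd z)"
        using commute[OF p a(1)] \<psi>0[OF p data_hom_closed[OF dA p a(1)]] a(2) by simp
      then have "\<delta>' 0 p (inv\<^bsub>stalk (K' (Suc 0)) p\<^esub> \<psi> (Suc 0) p a \<otimes>\<^bsub>stalk (K' (Suc 0)) p\<^esub> snd z) = \<one>\<^bsub>stalk (K' 0) p\<^esub>"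
        using pa y by simp
      from exactB[OF p _ this] pa y obtain b where b: "b \<in> carrier (stalk (K' (Suc (Suc 0))) p)"
        "\<delta>' (Suc 0) p b = inv\<^bsub>stalk (K' (Suc 0)) p\<^esub> \<psi> (Suc 0) p a \<otimes>\<^bsub>stalk (K' (Suc 0)) p\<^esub> snd z" by auto
      have "z = cone_diff 0 p (a, b)"
        using f pa y b B1.m_assoc[of "\<psi> (Suc 0) p a" "inv\<^bsub>stalk (K' (Suc 0)) p\<^esub> \<psi> (Suc 0) p a" "snd z", symmetric]
        by (simp add: cone_diff_def prod_eq_iff)
      moreover have "(a, b) \<in> carrier (stalk (cone 1) p)" using a b by (simp add: cone_carrier)
      ultimately show "z \<in> cone_diff 0 p ` carrier (stalk (cone 1) p)" by (rule image_eqI)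
    qed
  qed
qed (simp_all add: abelian_cone cone_diff_hom)

lemma acyclic_cone:
  assumes "\<And>n. acyclic_data S (K (Suc n))" "\<And>n. acyclic_data S (K' (Suc n))"
  shows "acyclic_data S (cone n)"
proof -
  have "acyclic_data S (cone_left n)"
  proof (cases n)
    case 0
    show ?thesis unfolding acyclic_data_def 0
      by (intro allI exact_at_trivial[OF abelian_cone_left]) simp
  qed (simp add: assms)
  then show ?thesis unfolding cone_def by (rule acyclic_prod_data[OF fin abelian_cone_left KB _ assms(2)])
qed

text \<open>The index starts at \<open>Suc n\<close> because the first component of
  \<open>cone_diff 0\<close> is constant.\<close>

lemma push_fst_cone:
  assumes "w \<in> carrier (data_sum S (cone (Suc (Suc n))))"
  shows "push S S (K (Suc n)) (\<lambda>p. fst) (push S S (cone (Suc n)) (cone_diff (Suc n)) w) =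
    inv\<^bsub>data_sum S (K (Suc n))\<^esub> push S S (K (Suc n)) (\<delta> (Suc n)) (push S S (K (Suc (Suc n))) (\<lambda>p. fst) w)"
proof -
  have f: "push S S (K (Suc (Suc n))) (\<lambda>p. fst) w \<in> carrier (data_sum S (K (Suc (Suc n))))"
    using assms unfolding data_sum_carrier[OF fin abelian_cone] data_sum_carrier[OF fin KA] push_self
    by (auto simp: cone_carrier PiE_iff)
  note c = hom_in_carrier[OF push_hom[OF fin fin subspace_of_refl KA KA dA] f]
  show ?thesis unfolding data_sum_inv[OF KA c]
    by (rule extensionalityI[of _ "topspace S"]) (simp_all add: push_self cone_diff_def)
qed

lemma push_snd_cone:
  "push S S (K' (Suc n)) (\<lambda>p. snd) (push S S (cone n) (cone_diff n) w) =
    push S S (K' (Suc n)) (\<psi> (Suc n)) (push S S (K (Suc n)) (\<lambda>p. fst) w) \<otimes>\<^bsub>data_sum S (K' (Suc n))\<^esub>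
    push S S (K' (Suc n)) (\<delta>' (Suc n)) (push S S (K' (Suc (Suc n))) (\<lambda>p. snd) w)"
  unfolding data_sum_mult by (rule extensionalityI[of _ "topspace S"]) (simp_all add: push_self cone_diff_def)

lemma cone_fst_hom: "(\<lambda>p. fst) \<in> data_hom S (cone n) (cone_left n)"
  and cone_snd_hom: "(\<lambda>p. snd) \<in> data_hom S (cone n) (K' (Suc n))"
  unfolding cone_def by (rule fst_hom[OF fin abelian_cone_left KB], rule snd_hom[OF fin abelian_cone_left KB])

text \<open>The pair of \<open>x\<close> and the inverse of \<open>b\<close> is a cycle in the
  colimit of the cone. Exactness of the colimits of the cone makes it a boundary, and the first
  component of the bounding element, inverted, is the required \<open>a\<close>.\<close>

lemma quasi_iso_inj:
  assumes acyc: "\<And>n. acyclic_data S (K (Suc n))" "\<And>n. acyclic_data S (K' (Suc n))"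
    and x: "x \<in> carrier (data_sum S (K (Suc n)))"
    and dx: "n \<noteq> 0 \<Longrightarrow> push S S (K n) (\<delta> n) x \<in> colim_relations S (K n)"
    and b: "b \<in> carrier (data_sum S (K' (Suc (Suc n))))"
    and xb: "push S S (K' (Suc n)) (\<psi> (Suc n)) x \<otimes>\<^bsub>data_sum S (K' (Suc n))\<^esub>
      inv\<^bsub>data_sum S (K' (Suc n))\<^esub> push S S (K' (Suc n)) (\<delta>' (Suc n)) b \<in> colim_relations S (K' (Suc n))"
  shows "\<exists>a \<in> carrier (data_sum S (K (Suc (Suc n)))). x \<otimes>\<^bsub>data_sum S (K (Suc n))\<^esub>
    inv\<^bsub>data_sum S (K (Suc n))\<^esub> push S S (K (Suc n)) (\<delta> (Suc n)) a \<in> colim_relations S (K (Suc n))"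
proof -
  interpret B2: comm_group "data_sum S (K' (Suc (Suc n)))" by (rule comm_group_data_sum[OF fin KB])
  interpret A2: comm_group "data_sum S (K (Suc (Suc n)))" by (rule comm_group_data_sum[OF fin KA])
  interpret A1: comm_group "data_sum S (K (Suc n))" by (rule comm_group_data_sum[OF fin KA])
  interpret pB: group_hom "data_sum S (K' (Suc (Suc n)))" "data_sum S (K' (Suc n))" "push S S (K' (Suc n)) (\<delta>' (Suc n))"
    by (rule hom_group_homI[OF comm_group_data_sum[OF fin KB] comm_group_data_sum[OF fin KB] push_hom[OF fin fin subspace_of_refl KB KB dB]])
  interpret pA: group_hom "data_sum S (K (Suc (Suc n)))" "data_sum S (K (Suc n))" "push S S (K (Suc n)) (\<delta> (Suc n))"
    by (rule hom_group_homI[OF comm_group_data_sum[OF fin KA] comm_group_data_sum[OF fin KA] push_hom[OF fin fin subspace_of_refl KA KA dA]])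
  let ?b = "inv\<^bsub>data_sum S (K' (Suc (Suc n)))\<^esub> b"
  have b': "?b \<in> carrier (data_sum S (K' (Suc (Suc n))))" by (rule B2.inv_closed[OF b])
  define z where "z = (\<lambda>p\<in>topspace S. (x p, ?b p))"
  have z: "z \<in> carrier (data_sum S (cone (Suc n)))"
    using x b' unfolding data_sum_carrier[OF fin KA] data_sum_carrier[OF fin KB] data_sum_carrier[OF fin abelian_cone] z_def
    by (auto simp: cone_carrier)
  have fz: "push S S (K (Suc n)) (\<lambda>p. fst) z = x" and sz: "push S S (K' (Suc (Suc n))) (\<lambda>p. snd) z = ?b"
    using x b' unfolding data_sum_carrier[OF fin KA] data_sum_carrier[OF fin KB] z_def push_self
    by (auto simp: fun_eq_iff PiE_iff extensional_def)
  note dz = hom_in_carrier[OF push_hom[OF fin fin subspace_of_refl abelian_cone abelian_cone cone_diff_hom] z]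
  have "push S S (cone n) (cone_diff n) z \<in> colim_relations S (cone n)"
    unfolding cone_def[of n]
  proof (rule relations_prod_data[OF fin abelian_cone_left KB dz[unfolded cone_def[of n]]])
    show "push S S (cone_left n) (\<lambda>p. fst) (push S S (prod_data (cone_left n) (K' (Suc n))) (cone_diff n) z) \<in> colim_relations S (cone_left n)"
    proof (cases n)
      case 0
      then have "push S S (cone_left n) (\<lambda>p. fst) (push S S (prod_data (cone_left n) (K' (Suc n))) (cone_diff n) z) = \<one>\<^bsub>data_sum S (cone_left n)\<^esub>"
        unfolding push_self data_sum_one by (auto simp: cone_diff_def fun_eq_iff restrict_def)
      then show ?thesis using subgroup.one_closed[OF subgroup_colim_relations[OF fin abelian_cone_left]] by (simp only:)
    next
      case (Suc m)
      have N: "push S S (K (Suc m)) (\<delta> (Suc m)) x \<in> colim_relations S (K (Suc m))" using dx Suc by simp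
      have "push S S (K (Suc m)) (\<lambda>p. fst) (push S S (cone (Suc m)) (cone_diff (Suc m)) z) =
          inv\<^bsub>data_sum S (K (Suc m))\<^esub> push S S (K (Suc m)) (\<delta> (Suc m)) x"
        using push_fst_cone[of z m] z fz unfolding Suc by simp
      also have "\<dots> \<in> colim_relations S (K (Suc m))"
        by (rule subgroup.m_inv_closed[OF subgroup_colim_relations[OF fin KA] N])
      finally show ?thesis unfolding Suc cone_def by simp
    qed
    show "push S S (K' (Suc n)) (\<lambda>p. snd) (push S S (prod_data (cone_left n) (K' (Suc n))) (cone_diff n) z) \<in> colim_relations S (K' (Suc n))"
      using push_snd_cone[of n z] xb unfolding fz sz pB.hom_inv[OF b] cone_def[of n] by (simp only:)
  qed
  from colim_exact[OF fin exact_seq_cone acyclic_cone[OF acyc] z this]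
  obtain w where w: "w \<in> carrier (data_sum S (cone (Suc (Suc n))))" and
    zw: "z \<otimes>\<^bsub>data_sum S (cone (Suc n))\<^esub> inv\<^bsub>data_sum S (cone (Suc n))\<^esub> push S S (cone (Suc n)) (cone_diff (Suc n)) w \<in> colim_relations S (cone (Suc n))"
    by blast
  note fh = cone_fst_hom[of "Suc n", unfolded cone_left_simps(1)]
  interpret pf: group_hom "data_sum S (cone (Suc n))" "data_sum S (K (Suc n))" "push S S (K (Suc n)) (\<lambda>p. fst)"
    by (rule hom_group_homI[OF comm_group_data_sum[OF fin abelian_cone] comm_group_data_sum[OF fin KA] push_hom[OF fin fin subspace_of_refl abelian_cone KA fh]])
  note dw = hom_in_carrier[OF push_hom[OF fin fin subspace_of_refl abelian_cone abelian_cone cone_diff_hom] w]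
  let ?a = "push S S (K (Suc (Suc n))) (\<lambda>p. fst) w"
  have a: "?a \<in> carrier (data_sum S (K (Suc (Suc n))))"
    by (rule hom_in_carrier[OF push_hom[OF fin fin subspace_of_refl abelian_cone KA cone_fst_hom[of "Suc (Suc n)", unfolded cone_left_simps(1)]] w])
  from push_relations[OF fin fin subspace_of_refl abelian_cone KA fh zw]
  have "x \<otimes>\<^bsub>data_sum S (K (Suc n))\<^esub> inv\<^bsub>data_sum S (K (Suc n))\<^esub> (inv\<^bsub>data_sum S (K (Suc n))\<^esub> push S S (K (Suc n)) (\<delta> (Suc n)) ?a) \<in> colim_relations S (K (Suc n))"
    unfolding pf.hom_mult[OF z pf.G.inv_closed[OF dw]] pf.hom_inv[OF dw] push_fst_cone[OF w] fz .
  then show ?thesis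
    by (intro bexI[of _ "inv\<^bsub>data_sum S (K (Suc (Suc n)))\<^esub> ?a"] A2.inv_closed[OF a]) (simp only: pA.hom_inv[OF a])
qed

text \<open>In additive notation, the pair \<open>(0, y)\<close> in \<open>cone n\<close> is the
  boundary of some \<open>(x, b)\<close> modulo relations. Its components say that
  \<open>\<psi> x + \<delta>' b = y\<close> and, for \<open>n \<noteq> 0\<close>, that
  \<open>\<delta> x = 0\<close>.\<close>

lemma quasi_iso_surj:
  assumes acyc: "\<And>n. acyclic_data S (K (Suc n))" "\<And>n. acyclic_data S (K' (Suc n))"
    and y: "y \<in> carrier (data_sum S (K' (Suc n)))"
    and dy: "n \<noteq> 0 \<Longrightarrow> push S S (K' n) (\<delta>' n) y \<in> colim_relations S (K' n)"
  shows "\<exists>x \<in> carrier (data_sum S (K (Suc n))). \<exists>b \<in> carrier (data_sum S (K' (Suc (Suc n)))).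
    (n \<noteq> 0 \<longrightarrow> push S S (K n) (\<delta> n) x \<in> colim_relations S (K n)) \<and>
    y \<otimes>\<^bsub>data_sum S (K' (Suc n))\<^esub> inv\<^bsub>data_sum S (K' (Suc n))\<^esub>
      (push S S (K' (Suc n)) (\<psi> (Suc n)) x \<otimes>\<^bsub>data_sum S (K' (Suc n))\<^esub> push S S (K' (Suc n)) (\<delta>' (Suc n)) b) \<in> colim_relations S (K' (Suc n))"
proof -
  define z where "z = (\<lambda>p\<in>topspace S. (\<one>\<^bsub>stalk (K n) p\<^esub>, y p))"
  have oneA: "\<one>\<^bsub>stalk (K n) p\<^esub> \<in> carrier (stalk (cone_left n) p)" if "p \<in> topspace S" for p
    using group.is_monoid[OF data_group[OF abelian_cone_left that, of n]] monoid.one_closed by fastforce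
  have z: "z \<in> carrier (data_sum S (cone n))"
    using y oneA unfolding data_sum_carrier[OF fin KB] data_sum_carrier[OF fin abelian_cone] z_def
    by (auto simp: cone_carrier)
  have sz: "push S S (K' (Suc n)) (\<lambda>p. snd) z = y"
    using y unfolding data_sum_carrier[OF fin KB] z_def push_self by (auto simp: fun_eq_iff PiE_iff extensional_def)
  have fz: "push S S (K n) (\<lambda>p. fst) z = \<one>\<^bsub>data_sum S (K n)\<^esub>"
    unfolding push_self data_sum_one z_def by (auto simp: fun_eq_iff)
  interpret C: comm_group "data_sum S (cone n)" by (rule comm_group_data_sum[OF fin abelian_cone])
  have "\<exists>w \<in> carrier (data_sum S (cone (Suc n))).
    z \<otimes>\<^bsub>data_sum S (cone n)\<^esub> inv\<^bsub>data_sum S (cone n)\<^esub> push S S (cone n) (cone_diff n) w \<in> colim_relations S (cone n)"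
  proof (cases n)
    \<comment> \<open>In the lowest degree no cycle condition is available, but
      \<open>cone_diff 0\<close> is onto at every point and gives a preimage on the nose.\<close>
    case 0
    have "data_epi S (cone (Suc 0)) (cone 0) (cone_diff 0)" using exact_seq_cone by (simp add: exact_seq_def)
    from push_surj[OF fin abelian_cone abelian_cone this, of z] z 0
    obtain w where "w \<in> carrier (data_sum S (cone (Suc n)))" "push S S (cone n) (cone_diff n) w = z" by auto
    then show ?thesis
      using C.r_inv[OF z] subgroup.one_closed[OF subgroup_colim_relations[OF fin abelian_cone]]
      by (intro bexI[of _ w]) (simp_all only:)
  next
    case (Suc m)
    have zm: "z \<in> carrier (data_sum S (cone (Suc m)))" using z Suc by simp
    note dz = hom_in_carrier[OF push_hom[OF fin fin subspace_of_refl abelian_cone abelian_cone cone_diff_hom] zm]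
    have "push S S (cone m) (cone_diff m) z \<in> colim_relations S (cone m)"
      unfolding cone_def[of m]
    proof (rule relations_prod_data[OF fin abelian_cone_left KB dz[unfolded cone_def[of m]]])
      have one: "\<delta> n p \<one>\<^bsub>stalk (K (Suc n)) p\<^esub> = \<one>\<^bsub>stalk (K n) p\<^esub>" "\<psi> n p \<one>\<^bsub>stalk (K n) p\<^esub> = \<one>\<^bsub>stalk (K' n) p\<^esub>"
        if "p \<in> topspace S" for p n
        using data_hom_one[OF KA KA dA that] data_hom_one[OF KA KB \<psi> that] by auto
      have "push S S (cone_left m) (\<lambda>p. fst) (push S S (prod_data (cone_left m) (K' (Suc m))) (cone_diff m) z) = \<one>\<^bsub>data_sum S (cone_left m)\<^esub>"
        unfolding push_self data_sum_one
      proof (rule restrict_ext)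
        fix p assume p: "p \<in> topspace S"
        have "inv\<^bsub>stalk (K m) p\<^esub> \<one>\<^bsub>stalk (K m) p\<^esub> = \<one>\<^bsub>stalk (K m) p\<^esub>"
          by (rule monoid.inv_one[OF group.is_monoid[OF data_group[OF KA p]]])
        then show "fst ((\<lambda>p\<in>topspace S. cone_diff m p (z p)) p) = \<one>\<^bsub>stalk (cone_left m) p\<^esub>"
          using p one[OF p] Suc by (simp add: cone_diff_def z_def)
      qed
      then show "push S S (cone_left m) (\<lambda>p. fst) (push S S (prod_data (cone_left m) (K' (Suc m))) (cone_diff m) z) \<in> colim_relations S (cone_left m)"
        using subgroup.one_closed[OF subgroup_colim_relations[OF fin abelian_cone_left]] by (simp only:)
      have "push S S (K' (Suc m)) (\<lambda>p. snd) (push S S (prod_data (cone_left m) (K' (Suc m))) (cone_diff m) z) = push S S (K' n) (\<delta>' n) y"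
        unfolding push_self
      proof (rule restrict_ext)
        fix p assume p: "p \<in> topspace S"
        interpret B: group "stalk (K' n) p" by (rule data_group[OF KB p])
        have "y p \<in> carrier (stalk (K' (Suc n)) p)" using y p unfolding data_sum_carrier[OF fin KB] by auto
        from B.l_one[OF data_hom_closed[OF dB p this]]
        show "snd ((\<lambda>p\<in>topspace S. cone_diff m p (z p)) p) = \<delta>' n p (y p)"
          using p one[OF p] Suc by (simp add: cone_diff_def z_def)
      qed
      then show "push S S (K' (Suc m)) (\<lambda>p. snd) (push S S (prod_data (cone_left m) (K' (Suc m))) (cone_diff m) z) \<in> colim_relations S (K' (Suc m))"
        using dy Suc by simp
    qed
    from colim_exact[OF fin exact_seq_cone acyclic_cone[OF acyc] zm this] show ?thesis unfolding Suc .
  qed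
  then obtain w where w: "w \<in> carrier (data_sum S (cone (Suc n)))" and
    zw: "z \<otimes>\<^bsub>data_sum S (cone n)\<^esub> inv\<^bsub>data_sum S (cone n)\<^esub> push S S (cone n) (cone_diff n) w \<in> colim_relations S (cone n)"
    by blast
  note dw = hom_in_carrier[OF push_hom[OF fin fin subspace_of_refl abelian_cone abelian_cone cone_diff_hom] w]
  let ?a = "push S S (K (Suc n)) (\<lambda>p. fst) w" and ?b = "push S S (K' (Suc (Suc n))) (\<lambda>p. snd) w"
  have a: "?a \<in> carrier (data_sum S (K (Suc n)))"
    by (rule hom_in_carrier[OF push_hom[OF fin fin subspace_of_refl abelian_cone KA cone_fst_hom[of "Suc n", unfolded cone_left_simps(1)]] w])
  have b: "?b \<in> carrier (data_sum S (K' (Suc (Suc n))))"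
    by (rule hom_in_carrier[OF push_hom[OF fin fin subspace_of_refl abelian_cone KB cone_snd_hom] w])
  interpret ps: group_hom "data_sum S (cone n)" "data_sum S (K' (Suc n))" "push S S (K' (Suc n)) (\<lambda>p. snd)"
    by (rule hom_group_homI[OF comm_group_data_sum[OF fin abelian_cone] comm_group_data_sum[OF fin KB] push_hom[OF fin fin subspace_of_refl abelian_cone KB cone_snd_hom]])
  from push_relations[OF fin fin subspace_of_refl abelian_cone KB cone_snd_hom zw]
  have 1: "y \<otimes>\<^bsub>data_sum S (K' (Suc n))\<^esub> inv\<^bsub>data_sum S (K' (Suc n))\<^esub>
      (push S S (K' (Suc n)) (\<psi> (Suc n)) ?a \<otimes>\<^bsub>data_sum S (K' (Suc n))\<^esub> push S S (K' (Suc n)) (\<delta>' (Suc n)) ?b) \<in> colim_relations S (K' (Suc n))"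
    unfolding ps.hom_mult[OF z C.inv_closed[OF dw]] ps.hom_inv[OF dw] push_snd_cone sz .
  have 2: "push S S (K n) (\<delta> n) ?a \<in> colim_relations S (K n)" if "n \<noteq> 0"
  proof -
    obtain m where m: "n = Suc m" using \<open>n \<noteq> 0\<close> by (cases n) auto
    note fh = cone_fst_hom[of "Suc m", unfolded cone_left_simps(1)]
    interpret A: comm_group "data_sum S (K (Suc m))" by (rule comm_group_data_sum[OF fin KA])
    interpret pf: group_hom "data_sum S (cone (Suc m))" "data_sum S (K (Suc m))" "push S S (K (Suc m)) (\<lambda>p. fst)"
      by (rule hom_group_homI[OF comm_group_data_sum[OF fin abelian_cone] comm_group_data_sum[OF fin KA] push_hom[OF fin fin subspace_of_refl abelian_cone KA fh]])
    have da: "push S S (K (Suc m)) (\<delta> (Suc m)) ?a \<in> carrier (data_sum S (K (Suc m)))"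
      using hom_in_carrier[OF push_hom[OF fin fin subspace_of_refl KA KA dA] a] unfolding m .
    from push_relations[OF fin fin subspace_of_refl abelian_cone KA fh zw[unfolded m]]
    have "push S S (K (Suc m)) (\<lambda>p. fst) z \<otimes>\<^bsub>data_sum S (K (Suc m))\<^esub>
        inv\<^bsub>data_sum S (K (Suc m))\<^esub> (inv\<^bsub>data_sum S (K (Suc m))\<^esub> push S S (K (Suc m)) (\<delta> (Suc m)) ?a) \<in> colim_relations S (K (Suc m))"
      unfolding pf.hom_mult[OF z[unfolded m] pf.G.inv_closed[OF dw[unfolded m]]] pf.hom_inv[OF dw[unfolded m]] push_fst_cone[OF w[unfolded m]]
      unfolding m .
    then show ?thesis unfolding m fz[unfolded m] A.inv_inv[OF da[unfolded m]] A.l_one[OF da[unfolded m]] .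
  qed
  show ?thesis using a b 1 2 by blast
qed

end

section \<open>Projective data on a subspace\<close>

lemma mono_index_subspace: "mono_index X D \<Longrightarrow> subspace_of S X \<Longrightarrow> mono_index S D"
  by (auto simp: mono_index_def subspace_of_def)

lemma free_index_coord:
  "{q. (x, m) \<in> free_index X I q} = (if x \<in> topspace X \<and> m \<in> I x then up_set X x else {})"
  by (auto simp: free_index_def up_set_def spec_le_topspace)

lemma upclosed_up_set: "subspace_of S X \<Longrightarrow> upclosed S (up_set X x)"
  unfolding upclosed_def up_set_def subspace_of_def using spec_le_trans[of X x] by blast

lemma upclosed_empty: "upclosed S {}"
  by (simp add: upclosed_def)

text \<open>\<open>P\<close> need not stay projective on \<open>S\<close>, but it remains a retract
  of a free datum, each of whose coordinates is zero or the integers on some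
  \<open>up_set X x\<close>.\<close>

lemma acyclic_projective:
  assumes inf: "infinite (UNIV :: 'g set)" and finX: "finite (topspace X)" and sub: "subspace_of S X"
    and P: "projective_data X (P :: ('a, 'g) ab_data)"
    and acyc: "\<And>x. x \<in> topspace X \<Longrightarrow> acyclic_data S (zdata (up_set X x))"
  shows "acyclic_data S P"
proof -
  have fin: "finite (topspace S)"
    using finX sub finite_subset unfolding subspace_of_def by blast
  obtain I :: "'a \<Rightarrow> 'g set" and i r where i: "i \<in> data_hom X P (fdata (free_index X I))"
    and r: "r \<in> data_hom X (fdata (free_index X I)) P"
    and ri: "\<forall>p \<in> topspace X. \<forall>a \<in> carrier (stalk P p). r p (i p a) = a"
    using projective_retract[OF inf finX P] by (elim exE bexE)
  note D = mono_index_subspace[OF mono_free_index[of X I] sub]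
  have coord: "exact_at S (zdata {q. j \<in> free_index X I q}) n" for j n
  proof (cases j)
    case (Pair x m)
    show ?thesis
      unfolding Pair free_index_coord
      using acyc[of x] exact_at_zdata_empty[OF upclosed_empty, of S n] by (auto simp: acyclic_data_def)
  qed
  have "r p (i p a) = a" if "p \<in> topspace S" "a \<in> carrier (stalk P p)" for p a
    using bspec[OF bspec[OF ri subspace_ofD(1)[OF sub that(1)]] that(2)] .
  then show ?thesis
    unfolding acyclic_data_def
    by (intro allI exact_at_retract[OF fin abelian_data_subspace[OF projective_abelian[OF P] sub] abelian_fdata[OF D]
        data_hom_subspace[OF i sub] data_hom_subspace[OF r sub] _ exact_at_fdata[OF fin D coord]])
qed

text \<open>Outside \<open>T\<close> both sides are units, and at points of \<open>T\<close> outside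
  \<open>S\<close> the morphism \<open>\<psi>\<close> preserves the unit.\<close>

lemma push_push:
  assumes "subspace_of S T" "subspace_of T V" "abelian_data T G" "abelian_data V H"
    and \<psi>: "\<psi> \<in> data_hom T G H"
  shows "push T V H \<psi> (push S T G \<phi> x) = push S V H (\<lambda>p a. \<psi> p (\<phi> p a)) x"
  unfolding push_def
proof (rule restrict_ext)
  fix p assume "p \<in> topspace V"
  have ST: "p \<in> topspace S \<Longrightarrow> p \<in> topspace T" using subspace_ofD(1)[OF assms(1)] .
  have one: "p \<in> topspace T \<Longrightarrow> \<psi> p \<one>\<^bsub>stalk G p\<^esub> = \<one>\<^bsub>stalk H p\<^esub>"
    by (rule data_hom_one[OF assms(3) abelian_data_subspace[OF assms(4,2)] \<psi>])
  show "(if p \<in> topspace T then \<psi> p ((\<lambda>i\<in>topspace T. if i \<in> topspace S then \<phi> i (x i) else \<one>\<^bsub>stalk G i\<^esub>) p) else \<one>\<^bsub>stalk H p\<^esub>) =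
      (if p \<in> topspace S then \<psi> p (\<phi> p (x p)) else \<one>\<^bsub>stalk H p\<^esub>)"
    using ST one by auto
qed

lemma push_cong:
  assumes "\<And>p. p \<in> topspace S \<Longrightarrow> \<phi> p (x p) = \<psi> p (x p)"
  shows "push S T G \<phi> x = push S T G \<psi> x"
  unfolding push_def by (rule restrict_ext) (simp add: assms)

text \<open>Abstracts the pair of a fibre and the preimage of a closure. For every \<open>x\<close>
  the colimits of the integers on \<open>up_set X x\<close> over \<open>S\<close> and over
  \<open>T\<close> embed into the integers by summation and are nonzero together, so the inclusion
  induces an isomorphism between them.\<close>

locale space_pair =
  fixes X S T :: "'a topology"
  assumes finX: "finite (topspace X)" and ST: "subspace_of S T" and TX: "subspace_of T X"
    and exS: "\<And>x. x \<in> topspace X \<Longrightarrow> sum_exact S (up_set X x)"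
    and exT: "\<And>x. x \<in> topspace X \<Longrightarrow> sum_exact T (up_set X x)"
    and meet: "\<And>x. x \<in> topspace X \<Longrightarrow> topspace T \<inter> up_set X x \<noteq> {} \<Longrightarrow> topspace S \<inter> up_set X x \<noteq> {}"
begin

lemma SX: "subspace_of S X"
  using ST TX unfolding subspace_of_def by blast

lemma finS: "finite (topspace S)" and finT: "finite (topspace T)"
  using finX SX TX finite_subset unfolding subspace_of_def by blast+

lemma mono_sub: "mono_index S (free_index X I)" "mono_index T (free_index X I)"
  by (rule mono_index_subspace[OF mono_free_index SX], rule mono_index_subspace[OF mono_free_index TX])

lemma sum_exact_coord: "sum_exact S {q. j \<in> free_index X I q}" "sum_exact T {q. j \<in> free_index X I q}"
  using exS exT sum_exact_empty[OF finS upclosed_empty] sum_exact_empty[OF finT upclosed_empty]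
  by (cases j; simp add: free_index_coord)+

lemma sum_coord_push:
  assumes "x \<in> carrier (data_sum S (fdata (free_index X I)))"
  shows "(\<Sum>p\<in>topspace T. Poly_Mapping.lookup (push S T (fdata (free_index X I)) (\<lambda>p a. a) x p) j) =
    (\<Sum>p\<in>topspace S. Poly_Mapping.lookup (x p) j)"
proof -
  have "topspace S \<subseteq> topspace T" using ST by (simp add: subspace_of_def)
  then show ?thesis
    by (intro sum.mono_neutral_cong_right finT) (auto simp: push_def)
qed

text \<open>Extension by zero preserves the total of each coordinate. Totals vanish for relations
  over \<open>T\<close>, and over \<open>S\<close> a vanishing total already makes a
  relation.\<close>

lemma free_incl_relations:
  fixes I :: "'a \<Rightarrow> 'i set"
  assumes c: "c \<in> carrier (data_sum S (fdata (free_index X I)))"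
    and N: "push S T (fdata (free_index X I)) (\<lambda>p a. a) c \<in> colim_relations T (fdata (free_index X I))"
  shows "c \<in> colim_relations S (fdata (free_index X I))"
proof (rule relations_fdata[OF finS mono_sub(1) c])
  fix j
  let ?D = "free_index X I" and ?U = "{q. j \<in> free_index X I q}"
  note F = abelian_fdata[OF mono_sub(1), of I] and FT = abelian_fdata[OF mono_sub(2), of I]
  note UT = upclosed_index[OF mono_sub(2), of j I] and US = upclosed_index[OF mono_sub(1), of j I]
  have "push T T (zdata ?U) (\<lambda>p a. Poly_Mapping.lookup a j) (push S T (fdata ?D) (\<lambda>p a. a) c) \<in> colim_relations T (zdata ?U)"
    by (rule push_relations[OF finT finT subspace_of_refl FT abelian_zdata[OF UT] coord_hom N])
  from relations_sum_zero[OF finT UT this] have "(\<Sum>p\<in>topspace S. Poly_Mapping.lookup (c p) j) = 0"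
    unfolding sum_coord_push[OF c, symmetric] by (simp add: push_self)
  moreover have "push S S (zdata ?U) (\<lambda>p a. Poly_Mapping.lookup a j) c \<in> carrier (data_sum S (zdata ?U))"
    by (rule hom_in_carrier[OF push_hom[OF finS finS subspace_of_refl F abelian_zdata[OF US] coord_hom] c])
  ultimately show "push S S (zdata ?U) (\<lambda>p a. Poly_Mapping.lookup a j) c \<in> colim_relations S (zdata ?U)"
  by (intro mp[OF bspec[OF sum_exact_coord(1)[of j I, unfolded sum_exact_def]]]) (simp_all add: push_self)
qed

text \<open>A basis element with nonzero total is present at some point of \<open>T\<close>, so by
  \<open>meet\<close> also at a point \<open>s j\<close> of \<open>S\<close>. Concentrating the
  total there gives a family with the same totals as \<open>b\<close>.\<close>

lemma free_incl_surj:
  fixes I :: "'a \<Rightarrow> 'i set"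
  assumes b: "b \<in> carrier (data_sum T (fdata (free_index X I)))"
  shows "\<exists>a \<in> carrier (data_sum S (fdata (free_index X I))). b \<otimes>\<^bsub>data_sum T (fdata (free_index X I))\<^esub>
    inv\<^bsub>data_sum T (fdata (free_index X I))\<^esub> push S T (fdata (free_index X I)) (\<lambda>p a. a) a \<in> colim_relations T (fdata (free_index X I))"
proof -
  let ?D = "free_index X I" and ?F = "fdata (free_index X I)"
  note FS = abelian_fdata[OF mono_sub(1), of I] and FT = abelian_fdata[OF mono_sub(2), of I]
  define t where "t = (\<Sum>p\<in>topspace T. b p)"
  have lt: "Poly_Mapping.lookup t j = (\<Sum>p\<in>topspace T. Poly_Mapping.lookup (b p) j)" for j
    unfolding t_def by (simp add: lookup_sum)
  have "\<exists>s. s \<in> topspace S \<and> j \<in> ?D s" if j: "j \<in> Poly_Mapping.keys t" for j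
  proof -
    have "(\<Sum>p\<in>topspace T. Poly_Mapping.lookup (b p) j) \<noteq> 0" using j by (simp add: in_keys_iff lt)
    then obtain p where p: "p \<in> topspace T" "Poly_Mapping.lookup (b p) j \<noteq> 0" by (meson sum.not_neutral_contains_not_neutral)
    have "Poly_Mapping.keys (b p) \<subseteq> ?D p" using b p(1) unfolding data_sum_carrier[OF finT FT] by (auto simp: PiE_iff)
    then have jD: "j \<in> ?D p" using p(2) by (auto simp: in_keys_iff)
    obtain x m where xm: "j = (x, m)" by (cases j)
    have x: "x \<in> topspace X" "m \<in> I x" "p \<in> up_set X x" using jD unfolding xm by (auto simp: free_index_def up_set_def spec_le_topspace)
    then obtain s where "s \<in> topspace S" "s \<in> up_set X x" using meet[OF x(1)] p(1) by blast
    then show ?thesis using x(2) by (intro exI[of _ s]) (simp add: xm free_index_def up_set_def)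
  qed
  then obtain s where s: "\<And>j. j \<in> Poly_Mapping.keys t \<Longrightarrow> s j \<in> topspace S \<and> j \<in> ?D (s j)" by metis
  define a where "a = (\<lambda>p\<in>topspace S. \<Sum>j\<in>{j \<in> Poly_Mapping.keys t. s j = p}. frag_cmul (Poly_Mapping.lookup t j) (frag_of j))"
  have la: "Poly_Mapping.lookup (a p) j = (if j \<in> Poly_Mapping.keys t \<and> s j = p then Poly_Mapping.lookup t j else 0)"
    if "p \<in> topspace S" for p j
  proof -
    have "Poly_Mapping.lookup (a p) j = (\<Sum>k\<in>{k \<in> Poly_Mapping.keys t. s k = p}. if j = k then Poly_Mapping.lookup t k else 0)"
      using that unfolding a_def by (simp add: lookup_sum if_distrib cong: if_cong)
    then show ?thesis by simp
  qed
  have a: "a \<in> carrier (data_sum S ?F)"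
    unfolding data_sum_carrier[OF finS FS]
  proof (rule PiE_I)
    fix p assume p: "p \<in> topspace S"
    show "a p \<in> carrier (stalk ?F p)" using s la[OF p] by (auto simp: in_keys_iff split: if_splits)
  qed (simp add: a_def)
  let ?e = "push S T ?F (\<lambda>p a. a) a"
  have e: "?e \<in> carrier (data_sum T ?F)"
    by (rule hom_in_carrier[OF push_hom[OF finS finT ST FS FT data_hom_id[OF FS]] a])
  interpret C: comm_group "data_sum T ?F" by (rule comm_group_data_sum[OF finT FT])
  let ?d = "b \<otimes>\<^bsub>data_sum T ?F\<^esub> inv\<^bsub>data_sum T ?F\<^esub> ?e"
  have d: "?d \<in> carrier (data_sum T ?F)" by (rule C.m_closed[OF b C.inv_closed[OF e]])
  have dp: "?d p = b p - ?e p" if p: "p \<in> topspace T" for p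
  proof -
    have "Poly_Mapping.keys (?e p) \<subseteq> ?D p" using e p unfolding data_sum_carrier[OF finT FT] by (auto simp: PiE_iff)
    then show ?thesis unfolding data_sum_mult data_sum_inv[OF FT e] using p by simp
  qed
  have "?d \<in> colim_relations T ?F"
  proof (rule relations_fdata[OF finT mono_sub(2) d])
    fix j
    let ?U = "{q. j \<in> ?D q}"
    note UT = upclosed_index[OF mono_sub(2), of j I]
    have "(\<Sum>p\<in>topspace S. Poly_Mapping.lookup (a p) j) = (\<Sum>p\<in>topspace S. if j \<in> Poly_Mapping.keys t \<and> s j = p then Poly_Mapping.lookup t j else 0)"
      by (rule sum.cong) (simp_all add: la)
    also have "\<dots> = Poly_Mapping.lookup t j"
      using s[of j] finS by (cases "j \<in> Poly_Mapping.keys t") (simp_all add: in_keys_iff)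
    finally have "(\<Sum>p\<in>topspace T. Poly_Mapping.lookup (?e p) j) = Poly_Mapping.lookup t j"
      unfolding sum_coord_push[OF a] .
    moreover have "(\<Sum>p\<in>topspace T. Poly_Mapping.lookup (?d p) j) = (\<Sum>p\<in>topspace T. Poly_Mapping.lookup (b p) j - Poly_Mapping.lookup (?e p) j)"
      by (rule sum.cong[OF refl]) (simp only: dp Poly_Mapping.lookup_minus)
    ultimately have "(\<Sum>p\<in>topspace T. Poly_Mapping.lookup (?d p) j) = 0"
      using lt[of j] by (simp only: sum_subtractf diff_self)
    moreover have "push T T (zdata ?U) (\<lambda>p a. Poly_Mapping.lookup a j) ?d \<in> carrier (data_sum T (zdata ?U))"
      by (rule hom_in_carrier[OF push_hom[OF finT finT subspace_of_refl FT abelian_zdata[OF UT] coord_hom] d])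
    ultimately show "push T T (zdata ?U) (\<lambda>p a. Poly_Mapping.lookup a j) ?d \<in> colim_relations T (zdata ?U)"
  by (intro mp[OF bspec[OF sum_exact_coord(2)[of j I, unfolded sum_exact_def]]]) (simp_all add: push_self)
  qed
  then show ?thesis using a by blast
qed

context
  fixes P :: "('a, 'g) ab_data"
  assumes inf: "infinite (UNIV :: 'g set)" and P: "projective_data X P"
begin

lemma retract_sub:
  obtains I :: "'a \<Rightarrow> 'g set" and i r where
    "i \<in> data_hom T P (fdata (free_index X I))" "r \<in> data_hom T (fdata (free_index X I)) P"
    "i \<in> data_hom S P (fdata (free_index X I))" "r \<in> data_hom S (fdata (free_index X I)) P"
    "\<forall>p \<in> topspace T. \<forall>a \<in> carrier (stalk P p). r p (i p a) = a"
proof -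
  obtain I :: "'a \<Rightarrow> 'g set" and i r where i: "i \<in> data_hom X P (fdata (free_index X I))"
    and r: "r \<in> data_hom X (fdata (free_index X I)) P"
    and ri: "\<forall>p \<in> topspace X. \<forall>a \<in> carrier (stalk P p). r p (i p a) = a"
    using projective_retract[OF inf finX P] by (elim exE bexE)
  have "\<forall>p \<in> topspace T. \<forall>a \<in> carrier (stalk P p). r p (i p a) = a"
    using ri subspace_ofD(1)[OF TX] by simp
  from data_hom_subspace[OF i TX] data_hom_subspace[OF r TX] data_hom_subspace[OF i SX] data_hom_subspace[OF r SX] this
  show ?thesis by (rule that)
qed

lemma abelian_sub: "abelian_data S P" "abelian_data T P"
  by (rule abelian_data_subspace[OF projective_abelian[OF P] SX], rule abelian_data_subspace[OF projective_abelian[OF P] TX])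

text \<open>The two maps of the retraction commute with extension by units, so the claim passes from
  the free datum to its retract \<open>P\<close>.\<close>

lemma incl_relations:
  assumes c: "c \<in> carrier (data_sum S P)" and N: "push S T P (\<lambda>p a. a) c \<in> colim_relations T P"
  shows "c \<in> colim_relations S P"
proof (rule retract_sub)
  fix I :: "'a \<Rightarrow> 'g set" and i r
  assume iT: "i \<in> data_hom T P (fdata (free_index X I))" and rT: "r \<in> data_hom T (fdata (free_index X I)) P"
    and iS: "i \<in> data_hom S P (fdata (free_index X I))" and rS: "r \<in> data_hom S (fdata (free_index X I)) P"
    and ri: "\<forall>p \<in> topspace T. \<forall>a \<in> carrier (stalk P p). r p (i p a) = a"
  let ?F = "fdata (free_index X I)"
  note FS = abelian_fdata[OF mono_sub(1), of I] and FT = abelian_fdata[OF mono_sub(2), of I]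
  let ?ic = "push S S ?F i c"
  have ic: "?ic \<in> carrier (data_sum S ?F)"
    by (rule hom_in_carrier[OF push_hom[OF finS finS subspace_of_refl abelian_sub(1) FS iS] c])
  have "push S T ?F (\<lambda>p a. a) ?ic = push T T ?F i (push S T P (\<lambda>p a. a) c)"
    unfolding push_push[OF subspace_of_refl ST FS FT data_hom_id[OF FS]]
      push_push[OF ST subspace_of_refl abelian_sub(2) FT iT] ..
  also have "\<dots> \<in> colim_relations T ?F"
    by (rule push_relations[OF finT finT subspace_of_refl abelian_sub(2) FT iT N])
  finally have "?ic \<in> colim_relations S ?F" by (rule free_incl_relations[OF ic])
  from push_relations[OF finS finS subspace_of_refl FS abelian_sub(1) rS this]
  have "push S S P r ?ic \<in> colim_relations S P" .
  also have "push S S P r ?ic = c"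
  proof (rule extensionalityI[of _ "topspace S"])
    show "c \<in> extensional (topspace S)" using c unfolding data_sum_carrier[OF finS abelian_sub(1)] by (simp add: PiE_iff)
    fix p assume p: "p \<in> topspace S"
    then have "c p \<in> carrier (stalk P p)" using c unfolding data_sum_carrier[OF finS abelian_sub(1)] by auto
    then show "push S S P r ?ic p = c p" using p bspec[OF ri subspace_ofD(1)[OF ST p]] by (simp add: push_self)
  qed (simp add: push_self)
  finally show ?thesis .
qed

lemma incl_surj:
  assumes b: "b \<in> carrier (data_sum T P)"
  shows "\<exists>a \<in> carrier (data_sum S P). b \<otimes>\<^bsub>data_sum T P\<^esub> inv\<^bsub>data_sum T P\<^esub> push S T P (\<lambda>p a. a) a \<in> colim_relations T P"
proof (rule retract_sub)
  fix I :: "'a \<Rightarrow> 'g set" and i r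
  assume iT: "i \<in> data_hom T P (fdata (free_index X I))" and rT: "r \<in> data_hom T (fdata (free_index X I)) P"
    and iS: "i \<in> data_hom S P (fdata (free_index X I))" and rS: "r \<in> data_hom S (fdata (free_index X I)) P"
    and ri: "\<forall>p \<in> topspace T. \<forall>a \<in> carrier (stalk P p). r p (i p a) = a"
  let ?F = "fdata (free_index X I)"
  note FS = abelian_fdata[OF mono_sub(1), of I] and FT = abelian_fdata[OF mono_sub(2), of I]
  let ?ib = "push T T ?F i b"
  have ib: "?ib \<in> carrier (data_sum T ?F)"
    by (rule hom_in_carrier[OF push_hom[OF finT finT subspace_of_refl abelian_sub(2) FT iT] b])
  obtain a where a: "a \<in> carrier (data_sum S ?F)"
    "?ib \<otimes>\<^bsub>data_sum T ?F\<^esub> inv\<^bsub>data_sum T ?F\<^esub> push S T ?F (\<lambda>p a. a) a \<in> colim_relations T ?F"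
    using free_incl_surj[OF ib] by blast
  have e: "push S T ?F (\<lambda>p a. a) a \<in> carrier (data_sum T ?F)"
    by (rule hom_in_carrier[OF push_hom[OF finS finT ST FS FT data_hom_id[OF FS]] a(1)])
  interpret p: group_hom "data_sum T ?F" "data_sum T P" "push T T P r"
    by (rule hom_group_homI[OF comm_group_data_sum[OF finT FT] comm_group_data_sum[OF finT abelian_sub(2)]
        push_hom[OF finT finT subspace_of_refl FT abelian_sub(2) rT]])
  have rib: "push T T P r ?ib = b"
  proof (rule extensionalityI[of _ "topspace T"])
    show "b \<in> extensional (topspace T)" using b unfolding data_sum_carrier[OF finT abelian_sub(2)] by (simp add: PiE_iff)
    fix p assume p: "p \<in> topspace T"
    then have "b p \<in> carrier (stalk P p)" using b unfolding data_sum_carrier[OF finT abelian_sub(2)] by auto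
    then show "push T T P r ?ib p = b p" using p bspec[OF ri p] by (simp add: push_self)
  qed (simp add: push_self)
  have re: "push T T P r (push S T ?F (\<lambda>p a. a) a) = push S T P (\<lambda>p a. a) (push S S P r a)"
    unfolding push_push[OF subspace_of_refl ST abelian_sub(1,2) data_hom_id[OF abelian_sub(1)]]
      push_push[OF ST subspace_of_refl FT abelian_sub(2) rT] ..
  have ra: "push S S P r a \<in> carrier (data_sum S P)"
    by (rule hom_in_carrier[OF push_hom[OF finS finS subspace_of_refl FS abelian_sub(1) rS] a(1)])
  from push_relations[OF finT finT subspace_of_refl FT abelian_sub(2) rT a(2)]
  have "b \<otimes>\<^bsub>data_sum T P\<^esub> inv\<^bsub>data_sum T P\<^esub> push S T P (\<lambda>p a. a) (push S S P r a) \<in> colim_relations T P"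
    unfolding p.hom_mult[OF ib p.G.inv_closed[OF e]] p.hom_inv[OF e] rib re .
  then show ?thesis using ra by blast
qed

end

end

subsection \<open>Colimits of resolutions\<close>

text \<open>In an exact sequence \<open>K\<close> the datum \<open>K 0\<close> is the one being resolved, hence the shift by one.\<close>

definition ccx :: "'a topology \<Rightarrow> (nat \<Rightarrow> ('a, 'g) ab_data) \<Rightarrow> nat \<Rightarrow> ('a \<Rightarrow> 'g) set monoid" where
  "ccx S K n = colim S (K (Suc n))"

definition ccd :: "'a topology \<Rightarrow> (nat \<Rightarrow> ('a, 'g) ab_data) \<Rightarrow> (nat \<Rightarrow> 'a \<Rightarrow> 'g \<Rightarrow> 'g) \<Rightarrow> nat \<Rightarrow> ('a \<Rightarrow> 'g) set \<Rightarrow> ('a \<Rightarrow> 'g) set" where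
  "ccd S K \<delta> n = colim_map S (K (Suc (Suc n))) S (K (Suc n)) (\<delta> (Suc n))"

lemma colim_cplx_ccx: "colim_cplx S R = ccx S (res_seq F R)" "colim_diff S R = ccd S (res_seq F R) (res_maps R)"
  by (simp_all add: fun_eq_iff colim_cplx_def colim_diff_def ccx_def ccd_def)

context
  fixes S :: "'a topology" and K :: "nat \<Rightarrow> ('a, 'g) ab_data" and \<delta>
  assumes fin: "finite (topspace S)" and ex: "exact_seq S K \<delta>"
begin

private lemmas A = exact_seq_data[OF fin ex] and d = exact_seq_hom[OF fin ex]

lemma ccd_cls: "x \<in> carrier (data_sum S (K (Suc (Suc n)))) \<Longrightarrow>
    ccd S K \<delta> n (cls S (K (Suc (Suc n))) x) = cls S (K (Suc n)) (push S S (K (Suc n)) (\<delta> (Suc n)) x)"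
  unfolding ccd_def by (rule colim_map_cls[OF fin fin subspace_of_refl A A d])

lemma push_diff_closed: "x \<in> carrier (data_sum S (K (Suc n))) \<Longrightarrow> push S S (K n) (\<delta> n) x \<in> carrier (data_sum S (K n))"
  by (rule hom_in_carrier[OF push_hom[OF fin fin subspace_of_refl A A d]])

lemma chain_complex_ccx: "chain_complex (ccx S K) (ccd S K \<delta>)"
  unfolding chain_complex_def
proof (intro conjI allI ballI)
  fix n
  show "comm_group (ccx S K n)" unfolding ccx_def by (rule comm_group_colim[OF fin A])
  show "ccd S K \<delta> n \<in> hom (ccx S K (Suc n)) (ccx S K n)"
    unfolding ccx_def ccd_def by (rule colim_map_hom[OF fin fin subspace_of_refl A A d])
  fix z assume "z \<in> carrier (ccx S K (Suc (Suc n)))"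
  then obtain x where x: "x \<in> carrier (data_sum S (K (Suc (Suc (Suc n)))))" "z = cls S (K (Suc (Suc (Suc n)))) x"
    unfolding ccx_def carrier_colim by blast
  have one: "\<one>\<^bsub>data_sum S (K (Suc n))\<^esub> \<in> colim_relations S (K (Suc n))"
    by (rule subgroup.one_closed[OF subgroup_colim_relations[OF fin A]])
  then have onec: "\<one>\<^bsub>data_sum S (K (Suc n))\<^esub> \<in> carrier (data_sum S (K (Suc n)))"
    using subgroup.subset[OF subgroup_colim_relations[OF fin A]] by blast
  show "ccd S K \<delta> n (ccd S K \<delta> (Suc n) z) = \<one>\<^bsub>ccx S K n\<^esub>"
    unfolding x(2) ccd_cls[OF x(1)] ccd_cls[OF push_diff_closed[OF x(1)]] push_exact_seq_one[OF fin ex x(1)] ccx_def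
    using one cls_one_iff[OF fin A onec] by blast
qed

lemma cls_cycles_Suc:
  assumes "x \<in> carrier (data_sum S (K (Suc (Suc n))))"
  shows "cls S (K (Suc (Suc n))) x \<in> cycles (ccx S K) (ccd S K \<delta>) (Suc n) \<longleftrightarrow>
    push S S (K (Suc n)) (\<delta> (Suc n)) x \<in> colim_relations S (K (Suc n))"
  unfolding cycles_Suc using assms
  by (simp add: ccd_cls[OF assms] ccx_def carrier_colim cls_one_iff[OF fin A push_diff_closed[OF assms]])

lemma cls_boundaries:
  assumes x: "x \<in> carrier (data_sum S (K (Suc n)))"
  shows "cls S (K (Suc n)) x \<in> boundaries (ccx S K) (ccd S K \<delta>) n \<longleftrightarrow>
    (\<exists>y \<in> carrier (data_sum S (K (Suc (Suc n)))). x \<otimes>\<^bsub>data_sum S (K (Suc n))\<^esub>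
      inv\<^bsub>data_sum S (K (Suc n))\<^esub> push S S (K (Suc n)) (\<delta> (Suc n)) y \<in> colim_relations S (K (Suc n)))"
proof
  assume "cls S (K (Suc n)) x \<in> boundaries (ccx S K) (ccd S K \<delta>) n"
  then obtain y where y: "y \<in> carrier (data_sum S (K (Suc (Suc n))))"
    "cls S (K (Suc n)) x = ccd S K \<delta> n (cls S (K (Suc (Suc n))) y)"
    unfolding boundaries_def ccx_def carrier_colim by blast
  show "\<exists>y \<in> carrier (data_sum S (K (Suc (Suc n)))). x \<otimes>\<^bsub>data_sum S (K (Suc n))\<^esub>
      inv\<^bsub>data_sum S (K (Suc n))\<^esub> push S S (K (Suc n)) (\<delta> (Suc n)) y \<in> colim_relations S (K (Suc n))"
    using y(2) unfolding ccd_cls[OF y(1)] cls_eq_iff[OF fin A x push_diff_closed[OF y(1)]]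
    using y(1) by blast
next
  assume "\<exists>y \<in> carrier (data_sum S (K (Suc (Suc n)))). x \<otimes>\<^bsub>data_sum S (K (Suc n))\<^esub>
      inv\<^bsub>data_sum S (K (Suc n))\<^esub> push S S (K (Suc n)) (\<delta> (Suc n)) y \<in> colim_relations S (K (Suc n))"
  then obtain y where y: "y \<in> carrier (data_sum S (K (Suc (Suc n))))"
    "x \<otimes>\<^bsub>data_sum S (K (Suc n))\<^esub> inv\<^bsub>data_sum S (K (Suc n))\<^esub> push S S (K (Suc n)) (\<delta> (Suc n)) y \<in> colim_relations S (K (Suc n))"
    by blast
  have "cls S (K (Suc n)) x = ccd S K \<delta> n (cls S (K (Suc (Suc n))) y)"
    unfolding ccd_cls[OF y(1)] cls_eq_iff[OF fin A x push_diff_closed[OF y(1)]] by (rule y(2))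
  moreover have "cls S (K (Suc (Suc n))) y \<in> carrier (ccx S K (Suc n))"
    unfolding ccx_def carrier_colim using y(1) by (rule imageI)
  ultimately show "cls S (K (Suc n)) x \<in> boundaries (ccx S K) (ccd S K \<delta>) n"
    unfolding boundaries_def by (rule image_eqI)
qed

lemma trivial_homology_of_acyclic:
  assumes "\<And>n. acyclic_data S (K n)" "i > 0"
  shows "trivial_group (chain_homology (ccx S K) (ccd S K \<delta>) i)"
  unfolding trivial_chain_homology_iff[OF chain_complex_ccx]
proof
  obtain n where i: "i = Suc n" using assms(2) by (cases i) auto
  fix z assume z: "z \<in> cycles (ccx S K) (ccd S K \<delta>) i"
  then have "z \<in> carrier (ccx S K (Suc n))" unfolding i cycles_Suc by simp
  then obtain x where x: "x \<in> carrier (data_sum S (K (Suc (Suc n))))" "z = cls S (K (Suc (Suc n))) x"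
    unfolding ccx_def carrier_colim by blast
  have "push S S (K (Suc n)) (\<delta> (Suc n)) x \<in> colim_relations S (K (Suc n))"
    using z unfolding i x(2) cls_cycles_Suc[OF x(1)] .
  from colim_exact[OF fin ex assms(1) x(1) this]
  show "z \<in> boundaries (ccx S K) (ccd S K \<delta>) i" unfolding i x(2) cls_boundaries[OF x(1)] .
qed

lemma acyclic_of_trivial_homology:
  assumes "\<And>n. acyclic_data S (K (Suc n))"
    and triv: "\<And>i. i > 0 \<Longrightarrow> trivial_group (chain_homology (ccx S K) (ccd S K \<delta>) i)"
  shows "acyclic_data S (K 0)"
proof (rule acyclic_of_colim_exact[OF fin ex assms(1)])
  fix n x assume x: "x \<in> carrier (data_sum S (K (Suc (Suc n))))"
    and px: "push S S (K (Suc n)) (\<delta> (Suc n)) x \<in> colim_relations S (K (Suc n))"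
  from px have "cls S (K (Suc (Suc n))) x \<in> cycles (ccx S K) (ccd S K \<delta>) (Suc n)"
    unfolding cls_cycles_Suc[OF x] .
  then have "cls S (K (Suc (Suc n))) x \<in> boundaries (ccx S K) (ccd S K \<delta>) (Suc n)"
    using triv[of "Suc n"] unfolding trivial_chain_homology_iff[OF chain_complex_ccx] by blast
  then show "\<exists>y \<in> carrier (data_sum S (K (Suc (Suc (Suc n))))). x \<otimes>\<^bsub>data_sum S (K (Suc (Suc n)))\<^esub>
        inv\<^bsub>data_sum S (K (Suc (Suc n)))\<^esub> push S S (K (Suc (Suc n))) (\<delta> (Suc (Suc n))) y \<in> colim_relations S (K (Suc (Suc n)))"
    unfolding cls_boundaries[OF x] .
qed

text \<open>The augmentation is onto, and by right exactness of the colimit the kernel it has on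
  colimits is the image of the next term.\<close>

lemma homology_0_iso: "chain_homology (ccx S K) (ccd S K \<delta>) 0 \<cong> colim S (K 0)"
proof -
  let ?h = "colim_map S (K (Suc 0)) S (K 0) (\<delta> 0)"
  note hyps = fin fin subspace_of_refl A A d
  have epi: "data_epi S (K (Suc 0)) (K 0) (\<delta> 0)" using ex by (simp add: exact_seq_def)
  have hc: "?h (cls S (K (Suc 0)) x) = cls S (K 0) (push S S (K 0) (\<delta> 0) x)" if "x \<in> carrier (data_sum S (K (Suc 0)))" for x
    by (rule colim_map_cls[OF hyps that])
  interpret h: group_hom "ccx S K 0" "colim S (K 0)" ?h
    unfolding ccx_def by (rule hom_group_homI[OF comm_group_colim[OF fin A] comm_group_colim[OF fin A] colim_map_hom[OF hyps]])
  have surj: "?h ` carrier (ccx S K 0) = carrier (colim S (K 0))"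
  proof
    show "?h ` carrier (ccx S K 0) \<subseteq> carrier (colim S (K 0))" using h.hom_closed by blast
    show "carrier (colim S (K 0)) \<subseteq> ?h ` carrier (ccx S K 0)"
    proof
      fix z assume "z \<in> carrier (colim S (K 0))"
      then obtain y where y: "y \<in> carrier (data_sum S (K 0))" "z = cls S (K 0) y" unfolding carrier_colim by blast
      obtain x where x: "x \<in> carrier (data_sum S (K (Suc 0)))" "push S S (K 0) (\<delta> 0) x = y"
        using push_surj[OF fin A A epi y(1)] by blast
      have "z = ?h (cls S (K (Suc 0)) x)" unfolding hc[OF x(1)] x(2) y(2) ..
      moreover have "cls S (K (Suc 0)) x \<in> carrier (ccx S K 0)" unfolding ccx_def carrier_colim using x(1) by (rule imageI)
      ultimately show "z \<in> ?h ` carrier (ccx S K 0)" by (rule image_eqI)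
    qed
  qed
  have ker: "kernel (ccx S K 0) (colim S (K 0)) ?h = boundaries (ccx S K) (ccd S K \<delta>) 0"
  proof (intro equalityI subsetI)
    fix z assume "z \<in> kernel (ccx S K 0) (colim S (K 0)) ?h"
    then have z: "z \<in> carrier (colim S (K (Suc 0)))" "?h z = \<one>\<^bsub>colim S (K 0)\<^esub>" by (auto simp: kernel_def ccx_def)
    obtain x where x: "x \<in> carrier (data_sum S (K (Suc 0)))" "z = cls S (K (Suc 0)) x" using z(1) unfolding carrier_colim by blast
    have "push S S (K 0) (\<delta> 0) x \<in> colim_relations S (K 0)"
      using z(2) unfolding x(2) hc[OF x(1)] cls_one_iff[OF fin A push_diff_closed[OF x(1)]] .
    from colim_right_exact[OF fin A A epi x(1) this] obtain v where
      v: "v \<in> carrier (data_sum S (syzygy K \<delta> (Suc 0)))"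
      "x \<otimes>\<^bsub>data_sum S (K (Suc 0))\<^esub> inv\<^bsub>data_sum S (K (Suc 0))\<^esub> v \<in> colim_relations S (K (Suc 0))" by auto
    obtain y where "y \<in> carrier (data_sum S (K (Suc (Suc 0))))" "push S S (K (Suc 0)) (\<delta> (Suc 0)) y = v"
      using push_surj[OF fin A abelian_syzygy[OF fin ex] exact_seq_epi[OF fin ex] v(1)] unfolding push_syzygy[OF fin ex] by blast
    then show "z \<in> boundaries (ccx S K) (ccd S K \<delta>) 0" unfolding x(2) cls_boundaries[OF x(1)] using v(2) by blast
  next
    fix z assume "z \<in> boundaries (ccx S K) (ccd S K \<delta>) 0"
    then obtain y where y: "y \<in> carrier (data_sum S (K (Suc (Suc 0))))" "z = ccd S K \<delta> 0 (cls S (K (Suc (Suc 0))) y)"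
      unfolding boundaries_def ccx_def carrier_colim by blast
    note dy = push_diff_closed[OF y(1)]
    have "?h z = cls S (K 0) \<one>\<^bsub>data_sum S (K 0)\<^esub>"
      unfolding y(2) ccd_cls[OF y(1)] hc[OF dy] push_exact_seq_one[OF fin ex y(1)] ..
    also have "\<dots> = \<one>\<^bsub>colim S (K 0)\<^esub>"
      by (rule hom_one[OF cls_hom[OF fin A]]) (use comm_group_data_sum[OF fin A] comm_group_colim[OF fin A] in \<open>auto simp: comm_group_def\<close>)
    finally have "?h z = \<one>\<^bsub>colim S (K 0)\<^esub>" .
    moreover have "z \<in> carrier (ccx S K 0)" unfolding y(2) ccd_cls[OF y(1)] ccx_def carrier_colim using dy by (rule imageI)
    ultimately show "z \<in> kernel (ccx S K 0) (colim S (K 0)) ?h" by (simp add: kernel_def)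
  qed
  have "chain_homology (ccx S K) (ccd S K \<delta>) 0 = ccx S K 0 Mod kernel (ccx S K 0) (colim S (K 0)) ?h"
    unfolding ker chain_homology_def cycles_0 by simp
  then show ?thesis using h.FactGroup_iso[OF surj] by simp
qed

end

lemma chain_map_ccx:
  assumes finS: "finite (topspace S)" and finT: "finite (topspace T)" and ST: "subspace_of S T"
    and ex: "exact_seq S K \<delta>" and ex': "exact_seq T K' \<delta>'"
    and \<phi>: "\<And>n. \<phi> n \<in> data_hom S (K n) (K' n)"
    and comm: "\<And>n p a. p \<in> topspace S \<Longrightarrow> a \<in> carrier (stalk (K (Suc n)) p) \<Longrightarrow> \<delta>' n p (\<phi> (Suc n) p a) = \<phi> n p (\<delta> n p a)"
  shows "chain_map (ccx S K) (ccd S K \<delta>) (ccx T K') (ccd T K' \<delta>') (\<lambda>n. colim_map S (K (Suc n)) T (K' (Suc n)) (\<phi> (Suc n)))"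
  unfolding chain_map_def
proof (intro conjI allI ballI)
  note A = exact_seq_data[OF finS ex] and B = exact_seq_data[OF finT ex']
  note dA = exact_seq_hom[OF finS ex] and dB = exact_seq_hom[OF finT ex']
  fix n
  show "colim_map S (K (Suc n)) T (K' (Suc n)) (\<phi> (Suc n)) \<in> hom (ccx S K n) (ccx T K' n)"
    unfolding ccx_def by (rule colim_map_hom[OF finS finT ST A B \<phi>])
  fix z assume "z \<in> carrier (ccx S K (Suc n))"
  then obtain x where x: "x \<in> carrier (data_sum S (K (Suc (Suc n))))" and z: "z = cls S (K (Suc (Suc n))) x"
    unfolding ccx_def carrier_colim by blast
  have px: "push S T (K' (Suc (Suc n))) (\<phi> (Suc (Suc n))) x \<in> carrier (data_sum T (K' (Suc (Suc n))))"
    by (rule hom_in_carrier[OF push_hom[OF finS finT ST A B \<phi>] x])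
  have "push T T (K' (Suc n)) (\<delta>' (Suc n)) (push S T (K' (Suc (Suc n))) (\<phi> (Suc (Suc n))) x)
      = push S T (K' (Suc n)) (\<lambda>p a. \<delta>' (Suc n) p (\<phi> (Suc (Suc n)) p a)) x"
    by (rule push_push[OF ST subspace_of_refl B B dB])
  also have "\<dots> = push S T (K' (Suc n)) (\<lambda>p a. \<phi> (Suc n) p (\<delta> (Suc n) p a)) x"
    by (rule push_cong) (rule comm, assumption, use x in \<open>auto simp: data_sum_carrier[OF finS A]\<close>)
  also have "\<dots> = push S T (K' (Suc n)) (\<phi> (Suc n)) (push S S (K (Suc n)) (\<delta> (Suc n)) x)"
    by (rule push_push[OF subspace_of_refl ST A B \<phi>, symmetric])
  finally show "ccd T K' \<delta>' n (colim_map S (K (Suc (Suc n))) T (K' (Suc (Suc n))) (\<phi> (Suc (Suc n))) z) =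
      colim_map S (K (Suc n)) T (K' (Suc n)) (\<phi> (Suc n)) (ccd S K \<delta> n z)"
    unfolding z colim_map_cls[OF finS finT ST A B \<phi> x] ccd_cls[OF finT ex' px] ccd_cls[OF finS ex x]
      colim_map_cls[OF finS finT ST A B \<phi> push_diff_closed[OF finS ex x]] by simp
qed

context comm_group
begin

lemma diff_trans:
  assumes "subgroup N G" "x \<in> carrier G" "y \<in> carrier G" "z \<in> carrier G"
    and "x \<otimes> inv y \<in> N" "y \<otimes> inv z \<in> N"
  shows "x \<otimes> inv z \<in> N"
proof -
  have "(x \<otimes> inv y) \<otimes> (y \<otimes> inv z) = x \<otimes> (inv y \<otimes> y) \<otimes> inv z"
    using assms(2-4) by (simp only: m_assoc inv_closed m_closed)
  then have "(x \<otimes> inv y) \<otimes> (y \<otimes> inv z) = x \<otimes> inv z" using assms(2-4) by simp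
  then show ?thesis using subgroup.m_closed[OF assms(1,5,6)] by simp
qed

lemma diff_in_subgroup:
  assumes "subgroup N G" "x \<in> carrier G" "y \<in> carrier G" "x \<otimes> inv y \<in> N" "x \<in> N"
  shows "y \<in> N"
proof -
  have "inv (x \<otimes> inv y) \<otimes> x = y \<otimes> (inv x \<otimes> x)"
    using assms(2,3) by (simp only: inv_mult_group inv_inv m_assoc inv_closed m_closed)
  then have "inv (x \<otimes> inv y) \<otimes> x = y" using assms(2,3) by simp
  then show ?thesis
    using subgroup.m_closed[OF assms(1) subgroup.m_inv_closed[OF assms(1,4)] assms(5)] by simp
qed

end

lemma (in group_hom) hom_diff: "x \<in> carrier G \<Longrightarrow> y \<in> carrier G \<Longrightarrow> h (x \<otimes> inv y) = h x \<otimes>\<^bsub>H\<^esub> inv\<^bsub>H\<^esub> h y"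
  by simp

text \<open>Together with \<open>cls_cyclesI\<close> this treats all degrees uniformly:
  \<open>\<delta> i\<close> is a differential of the complex for \<open>i \<noteq> 0\<close>,
  whereas \<open>\<delta> 0\<close> is the augmentation, on which cycles impose nothing.\<close>

lemma cls_cyclesD:
  assumes "finite (topspace S)" "exact_seq S K \<delta>" "x \<in> carrier (data_sum S (K (Suc i)))"
    "cls S (K (Suc i)) x \<in> cycles (ccx S K) (ccd S K \<delta>) i" "i \<noteq> 0"
  shows "push S S (K i) (\<delta> i) x \<in> colim_relations S (K i)"
  using assms(3-5) cls_cycles_Suc[OF assms(1,2)] by (cases i) auto

lemma cls_cyclesI:
  assumes "finite (topspace S)" "exact_seq S K \<delta>" "x \<in> carrier (data_sum S (K (Suc i)))"
    "i \<noteq> 0 \<Longrightarrow> push S S (K i) (\<delta> i) x \<in> colim_relations S (K i)"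
  shows "cls S (K (Suc i)) x \<in> cycles (ccx S K) (ccd S K \<delta>) i"
  using assms(3,4) cls_cycles_Suc[OF assms(1,2)]
  by (cases i) (auto simp: cycles_0 ccx_def carrier_colim)

lemma cycles_cls:
  assumes "finite (topspace S)" "exact_seq S K \<delta>" "z \<in> cycles (ccx S K) (ccd S K \<delta>) i"
  shows "\<exists>x \<in> carrier (data_sum S (K (Suc i))). z = cls S (K (Suc i)) x"
proof -
  have "z \<in> carrier (ccx S K i)"
    using subgroup.subset[OF subgroup_cycles[OF chain_complex_ccx[OF assms(1,2)]]] assms(3) by blast
  then show ?thesis unfolding ccx_def carrier_colim by blast
qed

text \<open>The map factors through the colimits of \<open>K'\<close> over \<open>S\<close>. There
  the cone shows that \<open>\<psi>\<close> induces isomorphisms on homology, and from index 1 on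
  the colimits of \<open>K'\<close> over \<open>S\<close> and \<open>T\<close> agree. Elements over
  \<open>T\<close> are therefore replaced by elements over \<open>S\<close> modulo relations before
  the cone is applied.\<close>

lemma (in space_pair) base_change_iso:
  fixes K K' :: "nat \<Rightarrow> ('a, 'g) ab_data"
  assumes inf: "infinite (UNIV :: 'g set)"
    and rm: "resolution_map S K K' \<delta> \<delta>' \<psi>" and exX: "exact_seq X K' \<delta>'"
    and proj: "\<And>n. projective_data X (K' (Suc n))"
    and acyc: "\<And>n. acyclic_data S (K (Suc n))" "\<And>n. acyclic_data S (K' (Suc n))"
  shows "chain_homology_map (ccx T K') (ccd T K' \<delta>') (\<lambda>n. colim_map S (K (Suc n)) T (K' (Suc n)) (\<psi> (Suc n))) i
    \<in> iso (chain_homology (ccx S K) (ccd S K \<delta>) i) (chain_homology (ccx T K') (ccd T K' \<delta>') i)"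
proof -
  interpret resolution_map S K K' \<delta> \<delta>' \<psi> by (rule rm)
  note exT' = exact_seq_subspace[OF exX TX]
  note A = exact_seq_data[OF finS ex] and B = exact_seq_data[OF finS ex'] and BT = exact_seq_data[OF finT exT']
  note dBT = exact_seq_hom[OF finT exT']
  let ?I = "\<lambda>n. push S T (K' n) (\<lambda>p a. a)" and ?P = "\<lambda>n. push S S (K' n) (\<psi> n)"
  let ?d = "\<lambda>n. push S S (K n) (\<delta> n)" and ?dS = "\<lambda>n. push S S (K' n) (\<delta>' n)" and ?dT = "\<lambda>n. push T T (K' n) (\<delta>' n)"
  let ?N = "\<lambda>n. colim_relations T (K' n)"
  interpret T: comm_group "data_sum T (K' n)" for n by (rule comm_group_data_sum[OF finT BT])
  interpret I: group_hom "data_sum S (K' n)" "data_sum T (K' n)" "?I n" for n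
    by (rule hom_group_homI[OF comm_group_data_sum[OF finS B] comm_group_data_sum[OF finT BT]
        push_hom[OF finS finT ST B BT data_hom_id[OF B]]])
  interpret dT: group_hom "data_sum T (K' (Suc n))" "data_sum T (K' n)" "?dT n" for n
    by (rule hom_group_homI[OF comm_group_data_sum[OF finT BT] comm_group_data_sum[OF finT BT]
        push_hom[OF finT finT subspace_of_refl BT BT dBT]])
  interpret c: group_hom "data_sum T (K' n)" "colim T (K' n)" "cls T (K' n)" for n
    by (rule hom_group_homI[OF comm_group_data_sum[OF finT BT] comm_group_colim[OF finT BT] cls_hom[OF finT BT]])
  note N = subgroup_colim_relations[OF finT BT]
  have Pcl: "?P n x \<in> carrier (data_sum S (K' n))" if "x \<in> carrier (data_sum S (K n))" for n x
    by (rule hom_in_carrier[OF push_hom[OF finS finS subspace_of_refl A B \<psi>] that])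
  note dScl = push_diff_closed[OF finS ex'] and dTcl = push_diff_closed[OF finT exT']
  have dI: "?dT n (?I (Suc n) a) = ?I n (?dS n a)" for n a
    unfolding push_push[OF ST subspace_of_refl BT BT dBT] push_push[OF subspace_of_refl ST B BT data_hom_id[OF B]] ..
  have dN: "?dT n a \<in> ?N n" if "a \<in> ?N (Suc n)" for n a
    by (rule push_relations[OF finT finT subspace_of_refl BT BT dBT that])
  have h: "colim_map S (K (Suc n)) T (K' (Suc n)) (\<psi> (Suc n)) (cls S (K (Suc n)) x) = cls T (K' (Suc n)) (?I (Suc n) (?P (Suc n) x))"
    if "x \<in> carrier (data_sum S (K (Suc n)))" for n x
    unfolding colim_map_cls[OF finS finT ST A BT \<psi> that] push_push[OF subspace_of_refl ST B BT data_hom_id[OF B]] ..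
  have surj: "\<exists>a \<in> carrier (data_sum S (K' (Suc n))). y \<otimes>\<^bsub>data_sum T (K' (Suc n))\<^esub> inv\<^bsub>data_sum T (K' (Suc n))\<^esub> ?I (Suc n) a \<in> ?N (Suc n)"
    if "y \<in> carrier (data_sum T (K' (Suc n)))" for n y
    by (rule incl_surj[OF inf proj that])
  show ?thesis
  proof (rule chain_homology_map_iso[OF chain_complex_ccx[OF finS ex] chain_complex_ccx[OF finT exT']])
    show "chain_map (ccx S K) (ccd S K \<delta>) (ccx T K') (ccd T K' \<delta>') (\<lambda>n. colim_map S (K (Suc n)) T (K' (Suc n)) (\<psi> (Suc n)))"
      by (rule chain_map_ccx[where \<phi> = \<psi>, OF finS finT ST ex exT']) (rule \<psi>, erule (1) commute)
  next
    fix c assume c: "c \<in> cycles (ccx S K) (ccd S K \<delta>) i"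
      and hb: "colim_map S (K (Suc i)) T (K' (Suc i)) (\<psi> (Suc i)) c \<in> boundaries (ccx T K') (ccd T K' \<delta>') i"
    obtain x where x: "x \<in> carrier (data_sum S (K (Suc i)))" "c = cls S (K (Suc i)) x"
      using cycles_cls[OF finS ex c] by blast
    note Px = Pcl[OF x(1)]
    obtain y where y: "y \<in> carrier (data_sum T (K' (Suc (Suc i))))"
      "?I (Suc i) (?P (Suc i) x) \<otimes>\<^bsub>data_sum T (K' (Suc i))\<^esub> inv\<^bsub>data_sum T (K' (Suc i))\<^esub> ?dT (Suc i) y \<in> ?N (Suc i)"
      using hb unfolding x(2) h[OF x(1)] cls_boundaries[OF finT exT' I.hom_closed[OF Px]] by blast
    \<comment> \<open>The bounding element is moved from \<open>T\<close> to
      \<open>S\<close>.\<close>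
    obtain a where a: "a \<in> carrier (data_sum S (K' (Suc (Suc i))))"
      "y \<otimes>\<^bsub>data_sum T (K' (Suc (Suc i)))\<^esub> inv\<^bsub>data_sum T (K' (Suc (Suc i)))\<^esub> ?I (Suc (Suc i)) a \<in> ?N (Suc (Suc i))"
      using surj[OF y(1)] by blast
    from dN[OF a(2)] have "?dT (Suc i) y \<otimes>\<^bsub>data_sum T (K' (Suc i))\<^esub> inv\<^bsub>data_sum T (K' (Suc i))\<^esub> ?I (Suc i) (?dS (Suc i) a) \<in> ?N (Suc i)"
      unfolding dT.hom_diff[OF y(1) I.hom_closed[OF a(1)]] dI .
    from T.diff_trans[OF N I.hom_closed[OF Px] dTcl[OF y(1)] I.hom_closed[OF dScl[OF a(1)]] y(2) this]
    have "?I (Suc i) (?P (Suc i) x \<otimes>\<^bsub>data_sum S (K' (Suc i))\<^esub> inv\<^bsub>data_sum S (K' (Suc i))\<^esub> ?dS (Suc i) a) \<in> ?N (Suc i)"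
      unfolding I.hom_diff[OF Px dScl[OF a(1)]] .
    from incl_relations[OF inf proj I.G.m_closed[OF Px I.G.inv_closed[OF dScl[OF a(1)]]] this]
    have rel: "?P (Suc i) x \<otimes>\<^bsub>data_sum S (K' (Suc i))\<^esub> inv\<^bsub>data_sum S (K' (Suc i))\<^esub> ?dS (Suc i) a \<in> colim_relations S (K' (Suc i))" .
    have dx: "i \<noteq> 0 \<Longrightarrow> ?d i x \<in> colim_relations S (K i)"
      using cls_cyclesD[OF finS ex x(1)] c unfolding x(2) by blast
    from quasi_iso_inj[OF acyc x(1) dx a(1) rel]
    show "c \<in> boundaries (ccx S K) (ccd S K \<delta>) i"
      unfolding x(2) cls_boundaries[OF finS ex x(1)] .
  next
    fix z assume z: "z \<in> cycles (ccx T K') (ccd T K' \<delta>') i"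
    obtain y where y: "y \<in> carrier (data_sum T (K' (Suc i)))" "z = cls T (K' (Suc i)) y"
      using cycles_cls[OF finT exT' z] by blast
    obtain a where a: "a \<in> carrier (data_sum S (K' (Suc i)))"
      "y \<otimes>\<^bsub>data_sum T (K' (Suc i))\<^esub> inv\<^bsub>data_sum T (K' (Suc i))\<^esub> ?I (Suc i) a \<in> ?N (Suc i)"
      using surj[OF y(1)] by blast
    have da: "?dS i a \<in> colim_relations S (K' i)" if "i \<noteq> 0"
    proof -
      from that obtain m where m: "i = Suc m" by (cases i) auto
      from dN[OF a(2)] have 1: "?dT i y \<otimes>\<^bsub>data_sum T (K' i)\<^esub> inv\<^bsub>data_sum T (K' i)\<^esub> ?I i (?dS i a) \<in> ?N i"
        unfolding dT.hom_diff[OF y(1) I.hom_closed[OF a(1)]] dI .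
      have 2: "?dT i y \<in> ?N i"
        using cls_cyclesD[OF finT exT' y(1) _ that] z unfolding y(2) by blast
      have "?I i (?dS i a) \<in> ?N i"
        by (rule T.diff_in_subgroup[OF N dTcl[OF y(1)] I.hom_closed[OF dScl[OF a(1)]] 1 2])
      then show ?thesis unfolding m by (rule incl_relations[OF inf proj dScl[OF a(1)[unfolded m]]])
    qed
    obtain x b where x: "x \<in> carrier (data_sum S (K (Suc i)))" and b: "b \<in> carrier (data_sum S (K' (Suc (Suc i))))"
      and dx: "i \<noteq> 0 \<longrightarrow> ?d i x \<in> colim_relations S (K i)"
      and rel: "a \<otimes>\<^bsub>data_sum S (K' (Suc i))\<^esub> inv\<^bsub>data_sum S (K' (Suc i))\<^esub>
        (?P (Suc i) x \<otimes>\<^bsub>data_sum S (K' (Suc i))\<^esub> ?dS (Suc i) b) \<in> colim_relations S (K' (Suc i))"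
      using quasi_iso_surj[OF acyc a(1) da] by blast
    note Px = Pcl[OF x] and db = dScl[OF b]
    note IP = I.hom_closed[OF Px] and Id = I.hom_closed[OF db]
    from push_relations[OF finS finT ST B BT data_hom_id[OF B] rel]
    have "?I (Suc i) a \<otimes>\<^bsub>data_sum T (K' (Suc i))\<^esub> inv\<^bsub>data_sum T (K' (Suc i))\<^esub>
        (?I (Suc i) (?P (Suc i) x) \<otimes>\<^bsub>data_sum T (K' (Suc i))\<^esub> ?I (Suc i) (?dS (Suc i) b)) \<in> ?N (Suc i)"
      unfolding I.hom_diff[OF a(1) I.G.m_closed[OF Px db]] I.hom_mult[OF Px db] .
    from T.diff_trans[OF N y(1) I.hom_closed[OF a(1)] T.m_closed[OF IP Id] a(2) this]
    have "y \<otimes>\<^bsub>data_sum T (K' (Suc i))\<^esub> inv\<^bsub>data_sum T (K' (Suc i))\<^esub> ?I (Suc i) (?P (Suc i) x) \<otimes>\<^bsub>data_sum T (K' (Suc i))\<^esub>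
      inv\<^bsub>data_sum T (K' (Suc i))\<^esub> ?dT (Suc i) (?I (Suc (Suc i)) b) \<in> ?N (Suc i)"
      unfolding dI T.inv_mult[OF IP Id] T.m_assoc[OF y(1) T.inv_closed[OF IP] T.inv_closed[OF Id]] .
    then have bd: "cls T (K' (Suc i)) (y \<otimes>\<^bsub>data_sum T (K' (Suc i))\<^esub> inv\<^bsub>data_sum T (K' (Suc i))\<^esub> ?I (Suc i) (?P (Suc i) x))
        \<in> boundaries (ccx T K') (ccd T K' \<delta>') i"
      unfolding cls_boundaries[OF finT exT' T.m_closed[OF y(1) T.inv_closed[OF IP]]]
      using I.hom_closed[OF b] by blast
    show "\<exists>x \<in> cycles (ccx S K) (ccd S K \<delta>) i. z \<otimes>\<^bsub>ccx T K' i\<^esub> inv\<^bsub>ccx T K' i\<^esub>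
        colim_map S (K (Suc i)) T (K' (Suc i)) (\<psi> (Suc i)) x \<in> boundaries (ccx T K') (ccd T K' \<delta>') i"
    proof
      show "cls S (K (Suc i)) x \<in> cycles (ccx S K) (ccd S K \<delta>) i"
        using cls_cyclesI[OF finS ex x] dx by blast
      show "z \<otimes>\<^bsub>ccx T K' i\<^esub> inv\<^bsub>ccx T K' i\<^esub> colim_map S (K (Suc i)) T (K' (Suc i)) (\<psi> (Suc i)) (cls S (K (Suc i)) x)
          \<in> boundaries (ccx T K') (ccd T K' \<delta>') i"
        using bd unfolding h[OF x] y(2) ccx_def[of T K' i] c.hom_diff[OF y(1) IP] .
    qed
  qed
qed

section \<open>Homology and the base change map in terms of exact sequences\<close>

lemma exact_seq_proj_res:
  assumes "infinite (UNIV :: 'g set)" "finite (topspace X)" "abelian_data X (F :: ('a, 'g) ab_data)"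
  shows "exact_seq X (res_seq F (proj_res X F)) (res_maps (proj_res X F))"
  by (rule exact_seq_resolution[OF assms(3) proj_res_resolution[OF assms]])

lemma projective_proj_res:
  assumes "infinite (UNIV :: 'g set)" "finite (topspace X)" "abelian_data X (F :: ('a, 'g) ab_data)"
  shows "projective_data X (res_seq F (proj_res X F) (Suc n))"
  using proj_res_resolution[OF assms] by (simp add: projective_resolution_def)

definition comparison_seq :: "(nat \<Rightarrow> 'a \<Rightarrow> 'g \<Rightarrow> 'g) \<Rightarrow> nat \<Rightarrow> 'a \<Rightarrow> 'g \<Rightarrow> 'g" where
  "comparison_seq \<phi> n = (case n of 0 \<Rightarrow> (\<lambda>p a. a) | Suc m \<Rightarrow> \<phi> m)"

lemma comparison_seq_simps [simp]: "comparison_seq \<phi> 0 = (\<lambda>p a. a)" "comparison_seq \<phi> (Suc n) = \<phi> n"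
  by (simp_all add: comparison_seq_def)

lemma resolution_map_comparison:
  assumes fin: "finite (topspace S)" and ex: "exact_seq S (res_seq F R) (res_maps R)"
    and ex': "exact_seq S (res_seq F R') (res_maps R')" and \<phi>: "comparison_map S R R' \<phi>"
  shows "resolution_map S (res_seq F R) (res_seq F R') (res_maps R) (res_maps R') (comparison_seq \<phi>)"
proof (rule resolution_map.intro[OF fin ex ex'])
  have F: "abelian_data S F" using exact_seq_data[OF fin ex, of 0] by simp
  show "comparison_seq \<phi> n \<in> data_hom S (res_seq F R n) (res_seq F R' n)" for n
    using \<phi> data_hom_id[OF F] by (cases n) (simp_all add: comparison_map_def)
  show "res_maps R' n p (comparison_seq \<phi> (Suc n) p a) = comparison_seq \<phi> n p (res_maps R n p a)"
    if "p \<in> topspace S" "a \<in> carrier (stalk (res_seq F R (Suc n)) p)" for n p a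
    using \<phi> that by (cases n) (simp_all add: comparison_map_def)
qed simp_all

lemma comparison_map_some:
  assumes fin: "finite (topspace S)" and ex: "exact_seq S (res_seq F R) (res_maps R)"
    and ex': "exact_seq S (res_seq F R') (res_maps R')" and proj: "\<And>n. projective_data S (res_seq F R (Suc n))"
  shows "comparison_map S R R' (SOME \<phi>. comparison_map S R R' \<phi>)"
proof -
  obtain \<psi> where \<psi>: "\<forall>n. \<psi> n \<in> data_hom S (res_seq F R n) (res_seq F R' n)" "\<psi> 0 = (\<lambda>p a. a)"
    "\<forall>n. \<forall>p \<in> topspace S. \<forall>a \<in> carrier (stalk (res_seq F R (Suc n)) p).
      res_maps R' n p (\<psi> (Suc n) p a) = \<psi> n p (res_maps R n p a)"
    using comparison_exists[OF fin ex ex' _ proj] by auto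
  have "comparison_map S R R' (\<lambda>n. \<psi> (Suc n))"
    unfolding comparison_map_def
  proof (intro conjI allI ballI)
    show "\<psi> (Suc n) \<in> data_hom S (res_obj R n) (res_obj R' n)" for n using spec[OF \<psi>(1), of "Suc n"] by simp
    show "res_aug R' p (\<psi> (Suc 0) p a) = res_aug R p a"
      if "p \<in> topspace S" "a \<in> carrier (stalk (res_obj R 0) p)" for p a
      using bspec[OF bspec[OF spec[OF \<psi>(3), of 0] that(1)], of a] that(2) by (simp add: \<psi>(2))
    show "res_diff R' n p (\<psi> (Suc (Suc n)) p a) = \<psi> (Suc n) p (res_diff R n p a)"
      if "p \<in> topspace S" "a \<in> carrier (stalk (res_obj R (Suc n)) p)" for n p a
      using bspec[OF bspec[OF spec[OF \<psi>(3), of "Suc n"] that(1)], of a] that(2) by simp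
  qed
  then show ?thesis by (rule someI[where P = "comparison_map S R R'"])
qed

text \<open>The complexes begin with term 1 of a sequence, so \<open>F\<close> on the right is a
  placeholder for term 0 and is to be instantiated with the resolved datum.\<close>

lemma resolution_homology_map_ccx:
  "resolution_homology_map i S R T R' =
    chain_homology_map (ccx T (res_seq F R')) (ccd T (res_seq F R') (res_maps R'))
      (\<lambda>n. colim_map S (res_seq F R (Suc n)) T (res_seq F R' (Suc n)) (comparison_seq (SOME \<phi>. comparison_map S R R' \<phi>) (Suc n))) i"
  unfolding resolution_homology_map_def Let_def colim_cplx_ccx[of T R' F] by simp

lemma homology_ccx:
  "homology i S F = chain_homology (ccx S (res_seq F (proj_res S F))) (ccd S (res_seq F (proj_res S F)) (res_maps (proj_res S F))) i"
  unfolding homology_def colim_cplx_ccx[of S _ F] ..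

lemma derived_shriek_stalk:
  "stalk (derived_shriek i X Y f F) y = chain_homology (ccx (preimage_space X f (down_set Y y)) (res_seq F (proj_res X F)))
    (ccd (preimage_space X f (down_set Y y)) (res_seq F (proj_res X F)) (res_maps (proj_res X F))) i"
  by (simp add: derived_shriek_def shriek_def shriek_map_def Let_def ccx_def[abs_def] ccd_def[abs_def])

lemma resolution_map_comp:
  assumes ST: "subspace_of S T"
    and \<phi>: "resolution_map S K K' \<delta> \<delta>' \<phi>" and \<theta>: "resolution_map T K' K'' \<delta>' \<delta>'' \<theta>"
  shows "resolution_map S K K'' \<delta> \<delta>'' (\<lambda>n p a. \<theta> n p (\<phi> n p a))"
proof -
  interpret \<phi>: resolution_map S K K' \<delta> \<delta>' \<phi> by (rule \<phi>)
  interpret \<theta>: resolution_map T K' K'' \<delta>' \<delta>'' \<theta> by (rule \<theta>)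
  note sub = subspace_ofD(1)[OF ST]
  show ?thesis
  proof (rule resolution_map.intro[OF \<phi>.fin \<phi>.ex exact_seq_subspace[OF \<theta>.ex' ST]])
    show "K'' 0 = K 0" using \<theta>.K0 \<phi>.K0 by simp
    show "(\<lambda>p a. \<theta> n p (\<phi> n p a)) \<in> data_hom S (K n) (K'' n)" for n
      by (rule data_hom_comp[OF \<phi>.\<psi> data_hom_subspace[OF \<theta>.\<psi> ST]])
    show "\<theta> 0 p (\<phi> 0 p a) = a" if "p \<in> topspace S" "a \<in> carrier (stalk (K 0) p)" for p a
      unfolding \<phi>.\<psi>0[OF that] by (rule \<theta>.\<psi>0[OF sub[OF that(1)] that(2)[folded \<phi>.K0]])
    show "\<delta>'' n p (\<theta> (Suc n) p (\<phi> (Suc n) p a)) = \<theta> n p (\<phi> n p (\<delta> n p a))"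
      if "p \<in> topspace S" "a \<in> carrier (stalk (K (Suc n)) p)" for n p a
      unfolding \<theta>.commute[OF sub[OF that(1)] data_hom_closed[OF \<phi>.\<psi> that]] \<phi>.commute[OF that] ..
  qed
qed

text \<open>Merges the two comparisons that make up the base change map into one over the smaller
  space, so that a single mapping cone settles the matter.\<close>

lemma chain_homology_map_comparison_comp:
  assumes finS: "finite (topspace S)" and finT: "finite (topspace T)" and ST: "subspace_of S T"
    and \<phi>: "resolution_map S K K' \<delta> \<delta>' \<phi>" and \<theta>: "resolution_map T K' K'' \<delta>' \<delta>'' \<theta>"
    and z: "z \<in> carrier (chain_homology (ccx S K) (ccd S K \<delta>) i)"
  shows "chain_homology_map (ccx T K'') (ccd T K'' \<delta>'') (\<lambda>n. colim_map T (K' (Suc n)) T (K'' (Suc n)) (\<theta> (Suc n))) i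
      (chain_homology_map (ccx T K') (ccd T K' \<delta>') (\<lambda>n. colim_map S (K (Suc n)) T (K' (Suc n)) (\<phi> (Suc n))) i z) =
    chain_homology_map (ccx T K'') (ccd T K'' \<delta>'') (\<lambda>n. colim_map S (K (Suc n)) T (K'' (Suc n)) (\<lambda>p a. \<theta> (Suc n) p (\<phi> (Suc n) p a))) i z"
    (is "?L = ?R")
proof -
  interpret \<phi>: resolution_map S K K' \<delta> \<delta>' \<phi> by (rule \<phi>)
  interpret \<theta>: resolution_map T K' K'' \<delta>' \<delta>'' \<theta> by (rule \<theta>)
  interpret \<theta>\<phi>: resolution_map S K K'' \<delta> \<delta>'' "\<lambda>n p a. \<theta> n p (\<phi> n p a)"
    by (rule resolution_map_comp[OF ST \<phi> \<theta>])
  note A = exact_seq_data[OF finS \<phi>.ex] and B = exact_seq_data[OF finT \<theta>.ex] and C = exact_seq_data[OF finT \<theta>.ex']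
  have c1: "chain_map (ccx S K) (ccd S K \<delta>) (ccx T K') (ccd T K' \<delta>') (\<lambda>n. colim_map S (K (Suc n)) T (K' (Suc n)) (\<phi> (Suc n)))"
    by (rule chain_map_ccx[where \<phi> = \<phi>, OF finS finT ST \<phi>.ex \<theta>.ex]) (rule \<phi>.\<psi>, erule (1) \<phi>.commute)
  have c2: "chain_map (ccx T K') (ccd T K' \<delta>') (ccx T K'') (ccd T K'' \<delta>'') (\<lambda>n. colim_map T (K' (Suc n)) T (K'' (Suc n)) (\<theta> (Suc n)))"
    by (rule chain_map_ccx[where \<phi> = \<theta>, OF finT finT subspace_of_refl \<theta>.ex \<theta>.ex']) (rule \<theta>.\<psi>, erule (1) \<theta>.commute)
  have c3: "chain_map (ccx S K) (ccd S K \<delta>) (ccx T K'') (ccd T K'' \<delta>'') (\<lambda>n. colim_map S (K (Suc n)) T (K'' (Suc n)) (\<lambda>p a. \<theta> (Suc n) p (\<phi> (Suc n) p a)))"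
    by (rule chain_map_ccx[where \<phi> = "\<lambda>n p a. \<theta> n p (\<phi> n p a)", OF finS finT ST \<phi>.ex \<theta>.ex']) (rule \<theta>\<phi>.\<psi>, erule (1) \<theta>\<phi>.commute)
  note cS = chain_complex_ccx[OF finS \<phi>.ex] and cT = chain_complex_ccx[OF finT \<theta>.ex] and cT' = chain_complex_ccx[OF finT \<theta>.ex']
  obtain w where w: "w \<in> cycles (ccx S K) (ccd S K \<delta>) i" "z = hclass (ccx S K) (ccd S K \<delta>) i w"
    using z unfolding carrier_chain_homology by blast
  obtain x where x: "x \<in> carrier (data_sum S (K (Suc i)))" "w = cls S (K (Suc i)) x"
    using cycles_cls[OF finS \<phi>.ex w(1)] by blast
  have px: "push S T (K' (Suc i)) (\<phi> (Suc i)) x \<in> carrier (data_sum T (K' (Suc i)))"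
    by (rule hom_in_carrier[OF push_hom[OF finS finT ST A B \<phi>.\<psi>] x(1)])
  have eq: "colim_map T (K' (Suc i)) T (K'' (Suc i)) (\<theta> (Suc i)) (colim_map S (K (Suc i)) T (K' (Suc i)) (\<phi> (Suc i)) w) =
      colim_map S (K (Suc i)) T (K'' (Suc i)) (\<lambda>p a. \<theta> (Suc i) p (\<phi> (Suc i) p a)) w"
    unfolding x(2) colim_map_cls[OF finS finT ST A B \<phi>.\<psi> x(1)] colim_map_cls[OF finS finT ST A C \<theta>\<phi>.\<psi> x(1)]
      colim_map_cls[OF finT finT subspace_of_refl B C \<theta>.\<psi> px] push_push[OF ST subspace_of_refl B C \<theta>.\<psi>] ..
  show "?L = ?R"
    unfolding w(2) chain_homology_map_class[OF cS cT c1 w(1)]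
      chain_homology_map_class[OF cT cT' c2 chain_map_cycles[OF cS cT c1 w(1)]]
      chain_homology_map_class[OF cS cT' c3 w(1)] eq ..
qed

text \<open>Homology maps are computed on classes of cycles, so two of them are known to agree on
  the carrier alone.\<close>

lemma iso_cong:
  assumes h: "h \<in> iso G H" and eq: "\<And>x. x \<in> carrier G \<Longrightarrow> k x = h x" and G: "group G"
  shows "k \<in> iso G H"
proof -
  interpret group G by (rule G)
  have b: "bij_betw h (carrier G) (carrier H)" and hom: "h \<in> hom G H" using h by (auto simp: iso_def)
  have "bij_betw k (carrier G) (carrier H)" using b bij_betw_cong[of "carrier G" k h] eq by blast
  moreover have "k \<in> hom G H"
    using eq hom by (intro homI) (simp_all add: hom_in_carrier hom_mult)
  ultimately show ?thesis by (simp add: iso_def)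
qed

lemma acyclic_zdata_up_set: "finite (topspace X) \<Longrightarrow> x \<in> topspace X \<Longrightarrow> acyclic_data X (zdata (up_set X x))"
  unfolding acyclic_data_def by (intro allI exact_at_zdata_cone) (simp_all add: up_set_def)

text \<open>The criterion for projectives with the whole space as subspace: there
  \<open>up_set X x\<close> has the least element \<open>x\<close>.\<close>

lemma acyclic_proj_res:
  assumes inf: "infinite (UNIV :: 'g set)" and fin: "finite (topspace X)" and F: "abelian_data X (F :: ('a, 'g) ab_data)"
  shows "acyclic_data X (res_seq F (proj_res X F) (Suc n))"
  by (rule acyclic_projective[OF inf fin subspace_of_refl projective_proj_res[OF inf fin F] acyclic_zdata_up_set[OF fin]])

lemma homology_trivial_iff:
  assumes inf: "infinite (UNIV :: 'g set)" and fin: "finite (topspace X)" and F: "abelian_data X (F :: ('a, 'g) ab_data)"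
  shows "(\<forall>i > 0. trivial_group (homology i X F)) \<longleftrightarrow> acyclic_data X F"
proof -
  note ex = exact_seq_proj_res[OF inf fin F]
  show ?thesis
  proof
    assume triv: "\<forall>i > 0. trivial_group (homology i X F)"
    have "acyclic_data X (res_seq F (proj_res X F) 0)"
    proof (rule acyclic_of_trivial_homology[OF fin ex acyclic_proj_res[OF inf fin F]])
      fix i :: nat assume "i > 0"
      then show "trivial_group (chain_homology (ccx X (res_seq F (proj_res X F))) (ccd X (res_seq F (proj_res X F)) (res_maps (proj_res X F))) i)"
        using triv unfolding homology_ccx by blast
    qed
    then show "acyclic_data X F" by simp
  next
    assume acyc: "acyclic_data X F"
    have "acyclic_data X (res_seq F (proj_res X F) n)" for n
      using acyc acyclic_proj_res[OF inf fin F] by (cases n) simp_all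
    then show "\<forall>i > 0. trivial_group (homology i X F)"
      unfolding homology_ccx by (intro allI impI trivial_homology_of_acyclic[OF fin ex])
  qed
qed

lemma homology_0_colim:
  assumes inf: "infinite (UNIV :: 'g set)" and fin: "finite (topspace X)" and F: "abelian_data X (F :: ('a, 'g) ab_data)"
  shows "homology 0 X F \<cong> colim X F"
  using homology_0_iso[OF fin exact_seq_proj_res[OF inf fin F]] by (simp add: homology_ccx)

lemma group_homology:
  assumes inf: "infinite (UNIV :: 'g set)" and fin: "finite (topspace X)" and F: "abelian_data X (F :: ('a, 'g) ab_data)"
  shows "group (homology i X F)"
  using comm_group_chain_homology[OF chain_complex_ccx[OF fin exact_seq_proj_res[OF inf fin F]]]
  unfolding homology_ccx by (rule comm_group.axioms(2))

lemma group_colim: "finite (topspace X) \<Longrightarrow> abelian_data X F \<Longrightarrow> group (colim X F)"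
  using comm_group_colim by (rule comm_group.axioms(2))

text \<open>Constant coefficients live in the type \<open>int\<close>, which is infinite, so the
  chosen resolutions exist; homology in degree 0 is the colimit.\<close>

lemma homologically_trivial_iff:
  assumes fin: "finite (topspace X)"
  shows "homologically_trivial X \<longleftrightarrow> acyclic_data X (zdata UNIV) \<and> colim X (zdata UNIV) \<cong> integer_group"
proof -
  note hyps = infinite_UNIV_int fin abelian_zdata_UNIV
  have "homology 0 X (zdata UNIV) \<cong> integer_group \<longleftrightarrow> colim X (zdata UNIV) \<cong> integer_group"
    using homology_0_colim[OF hyps] group.iso_sym[OF group_homology[OF hyps] homology_0_colim[OF hyps]]
    by (blast intro: iso_trans)
  then show ?thesis
    unfolding homologically_trivial_def zdata_const[symmetric] homology_trivial_iff[OF hyps] by blast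
qed

text \<open>Moves the condition from an open part of a fibre to the whole fibre, where
  \<open>U\<close> becomes the support of the coefficients.\<close>

lemma homologically_trivial_subtopology_iff:
  assumes fin: "finite (topspace S)" and U: "upclosed S U"
  shows "homologically_trivial (subtopology S U) \<longleftrightarrow> acyclic_data S (zdata U) \<and> colim S (zdata U) \<cong> integer_group"
proof -
  have finU: "finite (topspace (subtopology S U))" using fin by (simp add: topspace_subtopology)
  note i = colim_subtopology_iso[OF fin U]
  have "colim (subtopology S U) (zdata UNIV) \<cong> integer_group \<longleftrightarrow> colim S (zdata U) \<cong> integer_group"
    using i group.iso_sym[OF group_colim[OF finU abelian_zdata_UNIV] i] by (blast intro: iso_trans)
  then show ?thesis
    unfolding homologically_trivial_iff[OF finU] acyclic_data_def exact_at_subtopology[OF fin U] by blast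
qed

subsection \<open>Finite spaces and base change\<close>

lemma spec_le_openin:
  assumes "openin X V" "p \<in> V" "spec_le X p q"
  shows "q \<in> V"
  using assms unfolding spec_le_iff by (auto simp: in_closure_of)

text \<open>The complement of an up-set is the union of the closures of its points, and this union
  is finite.\<close>

lemma openin_finite_iff:
  assumes fin: "finite (topspace X)"
  shows "openin X V \<longleftrightarrow> V \<subseteq> topspace X \<and> (\<forall>p \<in> V. \<forall>q. spec_le X p q \<longrightarrow> q \<in> V)"
proof
  assume "openin X V"
  then show "V \<subseteq> topspace X \<and> (\<forall>p \<in> V. \<forall>q. spec_le X p q \<longrightarrow> q \<in> V)"
    using openin_subset spec_le_openin[of X V] by blast
next
  assume V: "V \<subseteq> topspace X \<and> (\<forall>p \<in> V. \<forall>q. spec_le X p q \<longrightarrow> q \<in> V)"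
  have "topspace X - V = (\<Union>q\<in>topspace X - V. X closure_of {q})"
  proof (intro equalityI subsetI)
    fix q assume "q \<in> topspace X - V"
    then show "q \<in> (\<Union>q\<in>topspace X - V. X closure_of {q})"
      using spec_le_refl[of q X] unfolding spec_le_iff by blast
  next
    fix p assume "p \<in> (\<Union>q\<in>topspace X - V. X closure_of {q})"
    then obtain q where q: "q \<in> topspace X" "q \<notin> V" "p \<in> X closure_of {q}" by blast
    then have "spec_le X p q" using closure_of_subset_topspace[of X "{q}"] unfolding spec_le_iff by blast
    then show "p \<in> topspace X - V" using V q(2) spec_le_topspace(1)[of X p q] by blast
  qed
  moreover have "closedin X (\<Union>q\<in>topspace X - V. X closure_of {q})"
    by (rule closedin_Union) (use fin in auto)
  ultimately have "closedin X (topspace X - V)" by simp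
  then show "openin X V" using V openin_closedin_eq by metis
qed

lemma spec_le_continuous:
  assumes f: "continuous_map X Y f" and pq: "spec_le X p q"
  shows "spec_le Y (f p) (f q)"
proof -
  have "f p \<in> Y closure_of (f ` {q})"
    using continuous_map_image_closure_subset[OF f, of "{q}"] pq unfolding spec_le_iff by blast
  moreover have "f p \<in> topspace Y" "f q \<in> topspace Y"
    using continuous_map_image_subset_topspace[OF f] spec_le_topspace[OF pq] by blast+
  ultimately show ?thesis unfolding spec_le_iff by simp
qed

text \<open>Forwards, \<open>up_set X x\<close> is open, so its image is an open set containing
  \<open>f x\<close>. Backwards, lifting makes the image of an open set an up-set.\<close>

lemma open_map_finite_iff:
  assumes finX: "finite (topspace X)" and finY: "finite (topspace Y)" and f: "continuous_map X Y f"
  shows "open_map X Y f \<longleftrightarrow> (\<forall>x \<in> topspace X. \<forall>y \<in> up_set Y (f x). \<exists>z \<in> up_set X x. f z = y)"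
proof
  assume op: "open_map X Y f"
  show "\<forall>x \<in> topspace X. \<forall>y \<in> up_set Y (f x). \<exists>z \<in> up_set X x. f z = y"
  proof (intro ballI)
    fix x y assume x: "x \<in> topspace X" and y: "y \<in> up_set Y (f x)"
    have "openin X (up_set X x)"
      unfolding openin_finite_iff[OF finX]
    proof (intro conjI subsetI ballI allI impI)
      fix p assume "p \<in> up_set X x"
      then show "p \<in> topspace X" by (simp add: up_set_def spec_le_topspace(2)[of X x p])
    next
      fix p q assume "p \<in> up_set X x" "spec_le X p q"
      then show "q \<in> up_set X x" using spec_le_trans[of X x p q] by (simp add: up_set_def)
    qed
    then have 1: "openin Y (f ` up_set X x)" using op by (simp add: open_map_def)
    have "x \<in> up_set X x" using spec_le_refl[OF x] by (simp add: up_set_def)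
    then have 2: "f x \<in> f ` up_set X x" by (rule imageI)
    have "spec_le Y (f x) y" using y by (simp add: up_set_def)
    from spec_le_openin[OF 1 2 this] have "y \<in> f ` up_set X x" .
    then show "\<exists>z \<in> up_set X x. f z = y" by blast
  qed
next
  assume lift: "\<forall>x \<in> topspace X. \<forall>y \<in> up_set Y (f x). \<exists>z \<in> up_set X x. f z = y"
  show "open_map X Y f"
    unfolding open_map_def
  proof (intro allI impI)
    fix V assume V: "openin X V"
    show "openin Y (f ` V)"
      unfolding openin_finite_iff[OF finY]
    proof (intro conjI ballI allI impI)
      show "f ` V \<subseteq> topspace Y" using continuous_map_image_subset_topspace[OF f] openin_subset[OF V] by blast
      fix p q assume "p \<in> f ` V" "spec_le Y p q"
      then obtain x where x: "x \<in> V" "p = f x" "q \<in> up_set Y (f x)" by (auto simp: up_set_def)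
      then obtain z where z: "z \<in> up_set X x" "f z = q" using lift openin_subset[OF V] by blast
      have "spec_le X x z" using z(1) by (simp add: up_set_def)
      from spec_le_openin[OF V x(1) this] have "z \<in> V" .
      then show "q \<in> f ` V" using z(2) by blast
    qed
  qed
qed

lemma preimage_up_set:
  "preimage_space (subtopology X (up_set X x)) f B = subtopology (preimage_space X f B) (up_set X x)"
  unfolding subtopology_subtopology by (rule arg_cong[of _ _ "subtopology X"]) auto

section \<open>The fibre over a point and the preimage of its closure\<close>

locale map_point =
  fixes X :: "'a topology" and Y :: "'b topology" and f :: "'a \<Rightarrow> 'b" and y :: 'b
  assumes finX: "finite (topspace X)" and f: "continuous_map X Y f" and y: "y \<in> topspace Y"
begin

abbreviation "fibre \<equiv> preimage_space X f {y}"
abbreviation "lower \<equiv> preimage_space X f (down_set Y y)"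

lemma topspaces: "topspace fibre = {x \<in> topspace X. f x = y}" "topspace lower = {x \<in> topspace X. spec_le Y (f x) y}"
  by (auto simp: topspace_subtopology down_set_def)

lemma sub: "subspace_of fibre lower" "subspace_of lower X" "subspace_of fibre X"
  using spec_le_refl[OF y] by (auto simp: subspace_of_def topspaces spec_le_subtopology down_set_def)

lemma fin: "finite (topspace fibre)" "finite (topspace lower)"
  unfolding topspaces using finX by simp_all

lemma upclosed: "upclosed fibre (up_set X x)" "upclosed lower (up_set X x)"
  by (rule upclosed_up_set[OF sub(3)], rule upclosed_up_set[OF sub(2)])

lemma lower_cone: "x \<in> topspace lower \<Longrightarrow> q \<in> topspace lower \<Longrightarrow> q \<in> up_set X x \<longleftrightarrow> spec_le lower x q"
  unfolding topspaces by (simp add: up_set_def spec_le_subtopology down_set_def)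

text \<open>If \<open>up_set X x\<close> contains a point whose image is below \<open>y\<close>,
  monotonicity puts \<open>f x\<close> below \<open>y\<close> as well. A nonempty support on
  \<open>lower\<close> thus contains its own least point \<open>x\<close>.\<close>

lemma lower_meet:
  assumes "topspace lower \<inter> up_set X x \<noteq> {}"
  shows "x \<in> topspace lower" "y \<in> up_set Y (f x)"
proof -
  obtain z where z: "spec_le Y (f z) y" "spec_le X x z" using assms unfolding topspaces up_set_def by blast
  from spec_le_trans[OF spec_le_continuous[OF f z(2)] z(1)] have "spec_le Y (f x) y" .
  then show "x \<in> topspace lower" "y \<in> up_set Y (f x)"
    unfolding topspaces up_set_def using spec_le_topspace(1)[OF z(2)] by blast+
qed

lemma lower_up_set: "acyclic_data lower (zdata (up_set X x))" "sum_exact lower (up_set X x)"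
proof -
  have "acyclic_data lower (zdata (up_set X x)) \<and> sum_exact lower (up_set X x)"
  proof (cases "topspace lower \<inter> up_set X x = {}")
    case True
    then show ?thesis
      using exact_at_zdata_empty[OF upclosed(2)] sum_exact_empty[OF fin(2) upclosed(2)] by (simp add: acyclic_data_def)
  next
    case False
    from lower_meet(1)[OF this] have x: "x \<in> topspace lower" .
    then have xx: "x \<in> up_set X x" unfolding topspaces up_set_def using spec_le_refl[of x X] by blast
    have "acyclic_data lower (zdata (up_set X x))"
      unfolding acyclic_data_def by (rule allI, rule exact_at_zdata_cone[OF fin(2) x], rule lower_cone[OF x])
    moreover have "sum_exact lower (up_set X x)"
    proof (rule sum_exact_cone[OF fin(2) upclosed(2) x _ xx])
      fix q assume "q \<in> topspace lower" "q \<in> up_set X x"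
      then show "spec_le lower x q" using lower_cone[OF x, of q] by blast
    qed
    ultimately show ?thesis by blast
  qed
  then show "acyclic_data lower (zdata (up_set X x))" "sum_exact lower (up_set X x)" by blast+
qed

lemma colim_lower:
  assumes "y \<in> up_set Y (f x)" and x: "x \<in> topspace X"
  shows "integer_group \<cong> colim lower (zdata (up_set X x))"
proof (rule colim_zdata_iso[OF fin(2) upclosed(2) lower_up_set(2)])
  show "x \<in> topspace lower" unfolding topspaces using assms by (simp add: up_set_def)
  show "x \<in> up_set X x" using spec_le_refl[OF x] by (simp add: up_set_def)
qed

context
  fixes F :: "('a, 'g) ab_data"
  assumes inf: "infinite (UNIV :: 'g set)" and F: "abelian_data X F"
begin

abbreviation "KX \<equiv> res_seq F (proj_res X F)"
abbreviation "dX \<equiv> res_maps (proj_res X F)"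

lemma exact_KX: "exact_seq X KX dX" "exact_seq fibre KX dX" "exact_seq lower KX dX"
  using exact_seq_proj_res[OF inf finX F] exact_seq_subspace sub(2,3) by blast+

lemma acyclic_KX: "acyclic_data lower (KX (Suc n))"
  by (rule acyclic_projective[OF inf finX sub(2) projective_proj_res[OF inf finX F] lower_up_set(1)])

text \<open>Over \<open>lower\<close> the resolution chosen on \<open>X\<close> is still exact with
  acyclic terms, so its colimits can be used as they are.\<close>

lemma derived_stalk_trivial:
  assumes "acyclic_data lower F" "i > 0"
  shows "trivial_group (stalk (derived_shriek i X Y f F) y)"
proof -
  have "acyclic_data lower (KX n)" for n
    using assms(1) acyclic_KX by (cases n) simp_all
  from trivial_homology_of_acyclic[OF fin(2) exact_KX(3) this assms(2)]
  show ?thesis unfolding derived_shriek_stalk .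
qed

lemma derived_stalk_0: "stalk (derived_shriek 0 X Y f F) y \<cong> colim lower F"
  using homology_0_iso[OF fin(2) exact_KX(3)] by (simp add: derived_shriek_stalk)

lemma group_derived_stalk: "group (stalk (derived_shriek i X Y f F) y)"
  using comm_group_chain_homology[OF chain_complex_ccx[OF fin(2) exact_KX(3)]]
  unfolding derived_shriek_stalk by (rule comm_group.axioms(2))

text \<open>On the fibre, the composite of the two chosen comparisons is a map from the resolution
  chosen there to the restriction of the one chosen on \<open>X\<close>. The hypothesis
  \<open>acyc\<close> makes the latter acyclic, and the other two compare its colimits over
  \<open>fibre\<close> and \<open>lower\<close>.\<close>

lemma base_change_map_iso:
  assumes acyc: "\<And>x. x \<in> topspace X \<Longrightarrow> acyclic_data fibre (zdata (up_set X x))"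
    and exS: "\<And>x. x \<in> topspace X \<Longrightarrow> sum_exact fibre (up_set X x)"
    and meet: "\<And>x. x \<in> topspace X \<Longrightarrow> topspace lower \<inter> up_set X x \<noteq> {} \<Longrightarrow> topspace fibre \<inter> up_set X x \<noteq> {}"
  shows "base_change_map i X Y f F y \<in> iso (homology i fibre F) (stalk (derived_shriek i X Y f F) y)"
proof -
  interpret space_pair X fibre lower
    by (rule space_pair.intro[OF finX sub(1,2) exS lower_up_set(2) meet])
  note FS = abelian_data_subspace[OF F sub(3)] and FT = abelian_data_subspace[OF F sub(2)]
  let ?RS = "proj_res fibre F" and ?RT = "proj_res lower F" and ?RX = "proj_res X F"
  let ?\<phi> = "SOME \<phi>. comparison_map fibre ?RS ?RT \<phi>" and ?\<theta> = "SOME \<theta>. comparison_map lower ?RT ?RX \<theta>"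
  note eS = exact_seq_proj_res[OF inf fin(1) FS] and eT = exact_seq_proj_res[OF inf fin(2) FT]
  note eTS = exact_seq_subspace[OF eT sub(1)]
  have \<phi>: "resolution_map fibre (res_seq F ?RS) (res_seq F ?RT) (res_maps ?RS) (res_maps ?RT) (comparison_seq ?\<phi>)"
    by (rule resolution_map_comparison[OF fin(1) eS eTS
        comparison_map_some[OF fin(1) eS eTS projective_proj_res[OF inf fin(1) FS]]])
  have \<theta>: "resolution_map lower (res_seq F ?RT) KX (res_maps ?RT) dX (comparison_seq ?\<theta>)"
    by (rule resolution_map_comparison[OF fin(2) eT exact_KX(3)
        comparison_map_some[OF fin(2) eT exact_KX(3) projective_proj_res[OF inf fin(2) FT]]])
  note comp = chain_homology_map_comparison_comp[OF fin sub(1) \<phi> \<theta>]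
  have acyc': "acyclic_data fibre (KX (Suc n))" for n
    by (rule acyclic_projective[OF inf finX sub(3) projective_proj_res[OF inf finX F] acyc])
  note iso = base_change_iso[OF inf resolution_map_comp[OF sub(1) \<phi> \<theta>] exact_KX(1) projective_proj_res[OF inf finX F]
      acyclic_proj_res[OF inf fin(1) FS] acyc', where i = i]
  show ?thesis
    unfolding derived_shriek_stalk homology_ccx
  proof (rule iso_cong[OF iso])
    show "group (chain_homology (ccx fibre (res_seq F ?RS)) (ccd fibre (res_seq F ?RS) (res_maps ?RS)) i)"
      using group_homology[OF inf fin(1) FS] unfolding homology_ccx .
    fix z assume z: "z \<in> carrier (chain_homology (ccx fibre (res_seq F ?RS)) (ccd fibre (res_seq F ?RS) (res_maps ?RS)) i)"
    show "base_change_map i X Y f F y z =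
      chain_homology_map (ccx lower KX) (ccd lower KX dX)
        (\<lambda>n. colim_map fibre (res_seq F ?RS (Suc n)) lower (KX (Suc n))
          (\<lambda>p a. comparison_seq ?\<theta> (Suc n) p (comparison_seq ?\<phi> (Suc n) p a))) i z"
      unfolding base_change_map_def derived_shriek_stalk_map_def homology_incl_map_def Let_def o_apply
        resolution_homology_map_ccx[where F = F] by (rule comp[OF z])
  qed
qed

end

end

theorem theorem3p2p9:
  fixes X :: "'a topology" and Y :: "'b topology" and f :: "'a \<Rightarrow> 'b"
  assumes "finite (topspace X)" and "finite (topspace Y)"
    and "continuous_map X Y f"
    and "infinite (UNIV :: 'g set)"
  shows "h_open X Y f \<longleftrightarrow>
    (\<forall>F :: ('a, 'g) ab_data. abelian_data X F \<longrightarrow>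
       (\<forall>y \<in> topspace Y. \<forall>i. base_change_map i X Y f F y
          \<in> iso (homology i (preimage_space X f {y}) F) (stalk (derived_shriek i X Y f F) y)))"
proof
  assume ho: "h_open X Y f"
  show "\<forall>F :: ('a, 'g) ab_data. abelian_data X F \<longrightarrow>
       (\<forall>y \<in> topspace Y. \<forall>i. base_change_map i X Y f F y
          \<in> iso (homology i (preimage_space X f {y}) F) (stalk (derived_shriek i X Y f F) y))"
  proof (intro allI impI ballI)
    fix F :: "('a, 'g) ab_data" and y i
    assume F: "abelian_data X F" and y: "y \<in> topspace Y"
    interpret map_point X Y f y by (rule map_point.intro[OF assms(1,3) y])
    have triv: "acyclic_data fibre (zdata (up_set X x))" "sum_exact fibre (up_set X x)" "topspace fibre \<inter> up_set X x \<noteq> {}"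
      if "x \<in> topspace X" "y \<in> up_set Y (f x)" for x
    proof -
      have "homologically_trivial (subtopology fibre (up_set X x))"
        using ho that unfolding h_open_def preimage_up_set by blast
      then have "acyclic_data fibre (zdata (up_set X x))" and c: "colim fibre (zdata (up_set X x)) \<cong> integer_group"
        unfolding homologically_trivial_subtopology_iff[OF fin(1) upclosed(1)] by blast+
      with sum_exact_of_iso[OF fin(1) upclosed(1) c]
      show "acyclic_data fibre (zdata (up_set X x))" "sum_exact fibre (up_set X x)" "topspace fibre \<inter> up_set X x \<noteq> {}"
        by blast+
    qed
    \<comment> \<open>If \<open>y\<close> is not above \<open>f x\<close>, nothing of
      \<open>up_set X x\<close> lies over \<open>y\<close>, and the conditions on \<open>x\<close>
      become trivial.\<close>
    have empty: "topspace fibre \<inter> up_set X x = {}" if "y \<notin> up_set Y (f x)" for x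
      using lower_meet(2)[of x] that subspace_ofD(1)[OF sub(1)] by blast
    show "base_change_map i X Y f F y \<in> iso (homology i fibre F) (stalk (derived_shriek i X Y f F) y)"
    proof (rule base_change_map_iso[OF assms(4) F])
      fix x assume x: "x \<in> topspace X"
      show "acyclic_data fibre (zdata (up_set X x))"
        using triv(1)[OF x] exact_at_zdata_empty[OF upclosed(1) empty] unfolding acyclic_data_def by blast
      show "sum_exact fibre (up_set X x)"
        using triv(2)[OF x] sum_exact_empty[OF fin(1) upclosed(1) empty] by blast
      show "topspace fibre \<inter> up_set X x \<noteq> {}" if "topspace lower \<inter> up_set X x \<noteq> {}"
        by (rule triv(3)[OF x lower_meet(2)[OF that]])
    qed
  qed
next
  assume bc: "\<forall>F :: ('a, 'g) ab_data. abelian_data X F \<longrightarrow>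
       (\<forall>y \<in> topspace Y. \<forall>i. base_change_map i X Y f F y
          \<in> iso (homology i (preimage_space X f {y}) F) (stalk (derived_shriek i X Y f F) y))"
  \<comment> \<open>An infinite type contains a copy of the natural numbers, hence of the integers;
    this lets the integers on \<open>up_set X x\<close> be realised inside
    \<open>'g\<close>.\<close>
  obtain g :: "nat \<Rightarrow> 'g" where g: "inj g" using infinite_countable_subset[OF assms(4)] by blast
  define e :: "int \<Rightarrow> 'g" where "e = g \<circ> to_nat"
  have e: "inj_on e UNIV" unfolding e_def by (rule inj_compose[OF g inj_to_nat])
  have fibres: "homologically_trivial (preimage_space (subtopology X (up_set X x)) f {y}) \<and> (\<exists>z \<in> up_set X x. f z = y)"
    if x: "x \<in> topspace X" and xy: "y \<in> up_set Y (f x)" for x y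
  proof -
    have y: "y \<in> topspace Y" using xy spec_le_topspace(2)[of Y "f x" y] by (simp add: up_set_def)
    interpret map_point X Y f y by (rule map_point.intro[OF assms(1,3) y])
    let ?Z = "zdata (up_set X x) :: ('a, int) ab_data"
    define F :: "('a, 'g) ab_data" where "F = tdata e UNIV ?Z"
    have Z: "abelian_data X ?Z" by (rule abelian_zdata[OF upclosed_up_set[OF subspace_of_refl]])
    have F: "abelian_data X F" unfolding F_def by (rule abelian_tdata[OF Z e subset_UNIV])
    have i: "(\<lambda>p. inv_into UNIV e) \<in> data_hom X F ?Z" and r: "(\<lambda>p. e) \<in> data_hom X ?Z F"
      unfolding F_def by (rule tdata_inv_hom[OF Z e subset_UNIV], rule tdata_hom[OF Z e subset_UNIV])
    have ri: "e (inv_into UNIV e a) = a" if "a \<in> carrier (stalk F p)" for p a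
      using that by (auto simp: F_def e)
    have ir: "inv_into UNIV e (e k) = k" for k using e by simp
    note iS = data_hom_subspace[OF i sub(3)] and rS = data_hom_subspace[OF r sub(3)]
    note iT = data_hom_subspace[OF i sub(2)] and rT = data_hom_subspace[OF r sub(2)]
    note FS = abelian_data_subspace[OF F sub(3)] and FT = abelian_data_subspace[OF F sub(2)]
    note ZS = abelian_data_subspace[OF Z sub(3)] and ZT = abelian_data_subspace[OF Z sub(2)]
    have cS: "colim fibre ?Z \<cong> colim fibre F"
      by (rule colim_iso_of_data_iso[OF fin(1) ZS FS rS iS]) (simp_all add: ir ri)
    have cT: "colim lower ?Z \<cong> colim lower F"
      by (rule colim_iso_of_data_iso[OF fin(2) ZT FT rT iT]) (simp_all add: ir ri)
    have aT: "acyclic_data lower F"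
      unfolding acyclic_data_def
    proof
      fix n
      show "exact_at lower F n"
        by (rule exact_at_retract[OF fin(2) FT ZT iT rT]) (use lower_up_set(1) in \<open>simp_all add: ri acyclic_data_def\<close>)
    qed
    \<comment> \<open>From here on the base change map enters through the existence of an
      isomorphism.\<close>
    have h: "homology n fibre F \<cong> stalk (derived_shriek n X Y f F) y" for n
      using bc F y unfolding is_iso_def by blast
    have "trivial_group (homology n fibre F)" if "n > 0" for n
      using isomorphic_group_triviality[OF h group_homology[OF assms(4) fin(1) FS] group_derived_stalk[OF assms(4) F]]
        derived_stalk_trivial[OF assms(4) F aT that] by blast
    then have aS: "acyclic_data fibre F"
      using homology_trivial_iff[OF assms(4) fin(1) FS] by blast
    have "acyclic_data fibre ?Z"
      unfolding acyclic_data_def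
    proof
      fix n
      show "exact_at fibre ?Z n"
        by (rule exact_at_retract[OF fin(1) ZS FS rS iS]) (use aS in \<open>simp_all add: ir acyclic_data_def\<close>)
    qed
    \<comment> \<open>The chain runs through homology of degree 0 on the fibre and the stalk of the
      derived functor to the colimit over \<open>lower\<close>, where the support has the least
      point \<open>x\<close> and the colimit is infinite cyclic.\<close>
    moreover have c: "colim fibre ?Z \<cong> integer_group"
    proof -
      note cS
      also have "colim fibre F \<cong> homology 0 fibre F"
        by (rule group.iso_sym[OF group_homology[OF assms(4) fin(1) FS] homology_0_colim[OF assms(4) fin(1) FS]])
      also note h[of 0]
      also note derived_stalk_0[OF assms(4) F]
      also have "colim lower F \<cong> colim lower ?Z" by (rule group.iso_sym[OF group_colim[OF fin(2) ZT] cT])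
      also have "colim lower ?Z \<cong> integer_group"
        by (rule group.iso_sym[OF _ colim_lower[OF xy x]]) (rule comm_group.axioms(2)[OF abelian_integer_group])
      finally show ?thesis .
    qed
    ultimately have "homologically_trivial (subtopology fibre (up_set X x))"
      unfolding homologically_trivial_subtopology_iff[OF fin(1) upclosed(1)] by blast
    \<comment> \<open>A nonzero colimit means that \<open>up_set X x\<close> meets the fibre, and
      this is the lifting condition for openness.\<close>
    moreover have "\<exists>z \<in> up_set X x. f z = y"
      using sum_exact_of_iso(2)[OF fin(1) upclosed(1) c] unfolding topspaces by blast
    ultimately show ?thesis unfolding preimage_up_set by blast
  qed
  then show "h_open X Y f"
    unfolding h_open_def open_map_finite_iff[OF assms(1-3)] by blast
qed

end
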